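(* Let $R=k[x_1,x_2,x_3,x_4]$, let $t\ge 2$, and let $\mathfrak a=(F)\subset R$ with $F$ a general form of degree $2$. Let $A$ be a general graded Gorenstein Artinian algebra of embedding dimension $4$ and socle degree $2t+1$ that is relatively compressed with respect to $\mathfrak a$. Then $A$ has a minimal graded free $R$-resolution of the form $$0\to R(-2t-5)\to R(-t-4)^{2t+3}\oplus R(-2t-3)\to R(-t-2)^{2t+3}\oplus R(-t-3)^{2t+3}\to R(-t-1)^{2t+3}\oplus R(-2)\to R\to A\to 0.$$
   Context: $k$ is an infinite field and $R$ is standard graded. A graded Artinian algebra $A=R/I$ is Gorenstein of socle degree $s$ if $\operatorname{Soc}(A)\cong k(-s)$. Such an algebra with $\mathfrak a\subset I$ is relatively compressed with respect to $\mathfrak a$ if it has maximal length among all Gorenstein Artinian quotients of $R/\mathfrak a$ of socle degree $s$. A general form of degree $d$ is one in a suitable nonempty Zariski open subset of $R_d$. A general Gorenstein algebra relatively compressed with respect to $\mathfrak a$ is one in a suitable nonempty Zariski open subset of the natural parameter space of Gorenstein Artinian quotients of $R/\mathfrak a$ of socle degree $s$, i.e. the projective space of hyperplanes of $(R/\mathfrak a)_s$ (a hyperplane $H$ corresponds to the largest homogeneous ideal $I\supset\mathfrak a$ with $I_s/\mathfrak a_s= H$ and $I_{j}=R_{j}$ for $j>s$). *)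

theory Defs
  imports
    "HOL-Library.Poly_Mapping"
    "HOL-Library.Numeral_Type"
    "HOL-Library.Extended_Nat"
    "Jordan_Normal_Form.Matrix"
begin

section \<open>Polynomials\<close>

text \<open>Polynomials over \<open>'k\<close> in indeterminates indexed by \<open>'i\<close>, as finitely supported
  coefficient functions on monomials (exponent vectors). The ring \<open>k[x\<^sub>1,x\<^sub>2,x\<^sub>3,x\<^sub>4]\<close> is
  \<open>(4, 'k) mpoly\<close>, with the four-element index type \<open>4\<close>.\<close>

type_synonym 'i monom = "'i \<Rightarrow>\<^sub>0 nat"
type_synonym ('i, 'k) mpoly = "('i \<Rightarrow>\<^sub>0 nat) \<Rightarrow>\<^sub>0 'k"

definition mdeg :: "'i monom \<Rightarrow> nat"
  where "mdeg m = (\<Sum>i\<in>Poly_Mapping.keys m. Poly_Mapping.lookup m i)"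

definition forms :: "nat \<Rightarrow> ('i, 'k::zero) mpoly set"
  where "forms d = {p. \<forall>m\<in>Poly_Mapping.keys p. mdeg m = d}"

definition cmul :: "'k::comm_ring_1 \<Rightarrow> ('i, 'k) mpoly \<Rightarrow> ('i, 'k) mpoly"
  where "cmul c p = Poly_Mapping.single 0 c * p"

lemma vector_space_cmul: "Vector_Spaces.vector_space (cmul :: 'k::field \<Rightarrow> ('i, 'k) mpoly \<Rightarrow> _)"
  by unfold_locales
    (simp_all add: cmul_def algebra_simps single_add mult_single flip: mult.assoc)

abbreviation k_subspace :: "('i, 'k::field) mpoly set \<Rightarrow> bool"
  where "k_subspace \<equiv> Modules.module.subspace cmul"

abbreviation k_dim :: "('i, 'k::field) mpoly set \<Rightarrow> nat"
  where "k_dim \<equiv> Vector_Spaces.vector_space.dim cmul"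

definition eval_mpoly :: "('i \<Rightarrow> 'k) \<Rightarrow> ('i, 'k::comm_ring_1) mpoly \<Rightarrow> 'k"
  where "eval_mpoly x p = (\<Sum>m\<in>Poly_Mapping.keys p.
    Poly_Mapping.lookup p m * (\<Prod>i\<in>Poly_Mapping.keys m. x i ^ Poly_Mapping.lookup m i))"


section \<open>Ideals and graded quotient algebras\<close>

text \<open>An ideal is a submodule of the ring, regarded as a module over itself. Throughout, the
  algebra \<open>A = R/I\<close> is represented by the ideal \<open>I\<close>; ideals of \<open>A\<close> are ideals of \<open>R\<close>
  containing \<open>I\<close>.\<close>

abbreviation is_ideal :: "('i, 'k::field) mpoly set \<Rightarrow> bool"
  where "is_ideal \<equiv> Modules.module.subspace (*)"

abbreviation ideal_of :: "('i, 'k::field) mpoly set \<Rightarrow> ('i, 'k) mpoly set"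
  where "ideal_of \<equiv> Modules.module.span (*)"

lemma module_mult: "Modules.module ((*) :: ('i, 'k::field) mpoly \<Rightarrow> _)"
  by unfold_locales (simp_all add: algebra_simps)

definition hom_component :: "nat \<Rightarrow> ('i, 'k::zero) mpoly \<Rightarrow> ('i, 'k) mpoly"
  where "hom_component d p = Poly_Mapping.mapp (\<lambda>m c. if mdeg m = d then c else 0) p"

lemma lookup_hom_component:
  "Poly_Mapping.lookup (hom_component d p) m =
    (if mdeg m = d then Poly_Mapping.lookup p m else 0)"
  by (simp add: hom_component_def mapp.rep_eq in_keys_iff)

definition homogeneous_ideal :: "('i, 'k::field) mpoly set \<Rightarrow> bool"
  where "homogeneous_ideal I \<longleftrightarrow> is_ideal I \<and> (\<forall>f\<in>I. \<forall>d. hom_component d f \<in> I)"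

definition irrelevant_ideal :: "('i, 'k::zero) mpoly set"
  where "irrelevant_ideal = {f. Poly_Mapping.lookup f 0 = 0}"

definition artinian_quotient :: "('i, 'k::field) mpoly set \<Rightarrow> bool"
  where "artinian_quotient I \<longleftrightarrow>
    \<not> (\<exists>J :: nat \<Rightarrow> ('i, 'k) mpoly set.
        \<forall>n. is_ideal (J n) \<and> I \<subseteq> J n \<and> J (Suc n) \<subset> J n)"

text \<open>The length of \<open>R/I\<close> as an \<open>R\<close>-module: the supremum of the lengths of strict chains of
  submodules.\<close>

definition quotient_length :: "('i, 'k::field) mpoly set \<Rightarrow> enat"
  where "quotient_length I =
    Sup {enat n |n. \<exists>J :: nat \<Rightarrow> ('i, 'k) mpoly set.
      (\<forall>i\<le>n. is_ideal (J i) \<and> I \<subseteq> J i) \<and> (\<forall>i<n. J i \<subset> J (Suc i))}"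

definition hilbert_function :: "('i, 'k::field) mpoly set \<Rightarrow> nat \<Rightarrow> nat"
  where "hilbert_function I j = k_dim (forms j :: ('i, 'k) mpoly set) - k_dim (I \<inter> forms j)"

text \<open>As \<open>A\<close> is standard graded, its maximal homogeneous ideal modulo the square of that
  ideal is the degree one component of \<open>A\<close>.\<close>

definition embedding_dim :: "('i, 'k::field) mpoly set \<Rightarrow> nat"
  where "embedding_dim I = hilbert_function I 1"

text \<open>The preimage in \<open>R\<close> of the socle \<open>0 :\<^sub>A \<mm>\<close> of \<open>A = R/I\<close>.\<close>

definition socle :: "('i, 'k::field) mpoly set \<Rightarrow> ('i, 'k) mpoly set"
  where "socle I = {f. \<forall>g\<in>irrelevant_ideal. g * f \<in> I}"

text \<open>The socle of \<open>R/I\<close> is isomorphic to \<open>k(-s)\<close> iff it is spanned over \<open>k\<close> by the nonzero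
  residue class of a form of degree \<open>s\<close>.\<close>

definition gorenstein :: "nat \<Rightarrow> ('i, 'k::field) mpoly set \<Rightarrow> bool"
  where "gorenstein s I \<longleftrightarrow> homogeneous_ideal I \<and> artinian_quotient I \<and>
    (\<exists>g. g \<in> forms s \<and> g \<notin> I \<and> socle I = {f + cmul c g |f c. f \<in> I})"

definition relatively_compressed ::
    "('i, 'k::field) mpoly set \<Rightarrow> nat \<Rightarrow> ('i, 'k) mpoly set \<Rightarrow> bool"
  where "relatively_compressed \<aa> s I \<longleftrightarrow> gorenstein s I \<and> \<aa> \<subseteq> I \<and>
    (\<forall>J. gorenstein s J \<and> \<aa> \<subseteq> J \<longrightarrow> quotient_length J \<le> quotient_length I)"


section \<open>Zariski open sets and general members\<close>

text \<open>Forms of degree \<open>d\<close> are points of an affine space with their coefficients as coordinates.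
  Polynomial functions in these coordinates are polynomials whose indeterminates are indexed by
  monomials. A set is Zariski open iff it is the complement of the common zero set of a set \<open>S\<close>
  of such polynomials.\<close>

definition zariski_open_forms :: "nat \<Rightarrow> ('i, 'k::field) mpoly set \<Rightarrow> bool"
  where "zariski_open_forms d U \<longleftrightarrow>
    (\<exists>S :: ('i monom, 'k) mpoly set.
      U = {F \<in> forms d. \<exists>P\<in>S. eval_mpoly (Poly_Mapping.lookup F) P \<noteq> 0})"

definition general_form :: "nat \<Rightarrow> (('i, 'k::field) mpoly \<Rightarrow> bool) \<Rightarrow> bool"
  where "general_form d Q \<longleftrightarrow>
    (\<exists>U. zariski_open_forms d U \<and> U \<noteq> {} \<and> (\<forall>F\<in>U. Q F))"

text \<open>Hyperplanes of \<open>(R/\<aa>)\<^sub>s\<close>, given by their preimages in \<open>R\<^sub>s\<close>.\<close>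

definition hyperplanes :: "('i, 'k::field) mpoly set \<Rightarrow> nat \<Rightarrow> ('i, 'k) mpoly set set"
  where "hyperplanes \<aa> s = {H. k_subspace H \<and> \<aa> \<inter> forms s \<subseteq> H \<and> H \<subseteq> forms s \<and>
    k_dim H + 1 = k_dim (forms s :: ('i, 'k) mpoly set)}"

text \<open>The functional on \<open>R\<^sub>s\<close> sending each monomial \<open>m\<close> to \<open>c m\<close> has kernel \<open>H\<close>. For a
  hyperplane \<open>H\<close>, such a \<open>c\<close> exists and is unique up to a nonzero scalar; these are the
  homogeneous coordinates of \<open>H\<close>, which identify \<open>hyperplanes \<aa> s\<close> with a linear subspace of
  the projective space of hyperplanes of \<open>R\<^sub>s\<close>.\<close>

definition hyperplane_coords ::
    "nat \<Rightarrow> ('i, 'k::field) mpoly set \<Rightarrow> ('i monom \<Rightarrow> 'k) \<Rightarrow> bool"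
  where "hyperplane_coords s H c \<longleftrightarrow> (\<forall>m. mdeg m \<noteq> s \<longrightarrow> c m = 0) \<and>
    H = {p \<in> forms s.
      (\<Sum>m\<in>Poly_Mapping.keys p. Poly_Mapping.lookup p m * c m) = 0}"

definition zariski_open_hyperplanes ::
    "('i, 'k::field) mpoly set \<Rightarrow> nat \<Rightarrow> ('i, 'k) mpoly set set \<Rightarrow> bool"
  where "zariski_open_hyperplanes \<aa> s V \<longleftrightarrow>
    (\<exists>S :: ('i monom, 'k) mpoly set. (\<forall>P\<in>S. \<exists>e. P \<in> forms e) \<and>
      V = {H \<in> hyperplanes \<aa> s. \<exists>c. hyperplane_coords s H c \<and> (\<exists>P\<in>S. eval_mpoly c P \<noteq> 0)})"

definition hyperplane_ideal ::
    "('i, 'k::field) mpoly set \<Rightarrow> nat \<Rightarrow> ('i, 'k) mpoly set \<Rightarrow> ('i, 'k) mpoly set"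
  where "hyperplane_ideal \<aa> s H =
    (GREATEST I. homogeneous_ideal I \<and> \<aa> \<subseteq> I \<and> I \<inter> forms s = H \<and> (\<forall>j>s. forms j \<subseteq> I))"

definition general_gorenstein_quotient ::
    "('i, 'k::field) mpoly set \<Rightarrow> nat \<Rightarrow> (('i, 'k) mpoly set \<Rightarrow> bool) \<Rightarrow> bool"
  where "general_gorenstein_quotient \<aa> s Q \<longleftrightarrow>
    (\<exists>V. zariski_open_hyperplanes \<aa> s V \<and> V \<noteq> {} \<and> (\<forall>H\<in>V. Q (hyperplane_ideal \<aa> s H)))"


section \<open>Minimal graded free resolutions\<close>

text \<open>A list \<open>[d\<^sub>1,\<dots>,d\<^sub>n]\<close> stands for the graded free module \<open>R(-d\<^sub>1) \<oplus> \<dots> \<oplus> R(-d\<^sub>n)\<close>, with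
  underlying module \<open>carrier_vec n\<close>. A degree-preserving \<open>R\<close>-linear map from the module of \<open>es\<close>
  to that of \<open>ds\<close> is a matrix whose \<open>(i,j)\<close> entry is a form of degree \<open>e\<^sub>j - d\<^sub>i\<close>, and hence
  zero if this is negative.\<close>

definition graded_map :: "nat list \<Rightarrow> nat list \<Rightarrow> ('i, 'k::field) mpoly mat \<Rightarrow> bool"
  where "graded_map ds es M \<longleftrightarrow> M \<in> carrier_mat (length ds) (length es) \<and>
    (\<forall>i<length ds. \<forall>j<length es. \<forall>m\<in>Poly_Mapping.keys (M $$ (i, j)). mdeg m + ds ! i = es ! j)"

definition map_image :: "('i, 'k::field) mpoly mat \<Rightarrow> ('i, 'k) mpoly vec set"
  where "map_image M = (\<lambda>v. M *\<^sub>v v) ` carrier_vec (dim_col M)"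

definition map_kernel :: "('i, 'k::field) mpoly mat \<Rightarrow> ('i, 'k) mpoly vec set"
  where "map_kernel M = {v \<in> carrier_vec (dim_col M). M *\<^sub>v v = 0\<^sub>v (dim_row M)}"

text \<open>A minimal graded free resolution
  \<open>0 \<rightarrow> F\<^sub>n \<rightarrow> \<dots> \<rightarrow> F\<^sub>1 \<rightarrow> R \<rightarrow> R/I \<rightarrow> 0\<close>, where \<open>Ds = [F\<^sub>1,\<dots>,F\<^sub>n]\<close> and \<open>\<phi> p\<close> is the map from
  \<open>F\<^sub>p\<close> to \<open>F\<^sub>p\<^sub>-\<^sub>1\<close>. The conditions are exactness at \<open>R\<close>, at \<open>F\<^sub>p\<close> for \<open>0 < p < n\<close>, and at \<open>F\<^sub>n\<close>,
  and minimality: the image of each map lies in \<open>\<mm> F\<^sub>p\<^sub>-\<^sub>1\<close>.\<close>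

definition has_minimal_resolution :: "('i, 'k::field) mpoly set \<Rightarrow> nat list list \<Rightarrow> bool"
  where "has_minimal_resolution I Ds \<longleftrightarrow> Ds \<noteq> [] \<and>
    (let n = length Ds; F = [0] # Ds in
      \<exists>\<phi> :: nat \<Rightarrow> ('i, 'k) mpoly mat.
        (\<forall>p\<in>{1..n}. graded_map (F ! (p - 1)) (F ! p) (\<phi> p)) \<and>
        map_image (\<phi> 1) = {v \<in> carrier_vec 1. v $ 0 \<in> I} \<and>
        (\<forall>p\<in>{1..<n}. map_kernel (\<phi> p) = map_image (\<phi> (p + 1))) \<and>
        map_kernel (\<phi> n) = {0\<^sub>v (length (F ! n))} \<and>
        (\<forall>p\<in>{1..n}. \<forall>v\<in>map_image (\<phi> p). \<forall>i<length (F ! (p - 1)). v $ i \<in> irrelevant_ideal))"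

end

theory Submission
  imports Defs "Jordan_Normal_Form.Determinant" "HOL-Library.Function_Algebras"
begin

text \<open>
  A Gorenstein ideal \<open>I\<close> of socle degree \<open>s = 2 * t + 1\<close> is the annihilator of a functional \<open>c\<close> on the
  forms of degree \<open>s\<close>, where polynomials act on functionals by contraction (Macaulay duality,
  \<open>gorenstein_is_annihilator\<close>); it contains \<open>F\<close> iff \<open>F\<close> kills \<open>c\<close>, and the ideal of a hyperplane is
  the annihilator of its coordinates. So the proof is about one functional \<open>c\<close> killed by a quadric \<open>F\<close>.

  Two conditions on \<open>c\<close> are used: no form of degree \<open>t\<close> outside of \<open>(F)\<close> kills \<open>c\<close>, and there are no
  linear second syzygies between the forms of degree \<open>t + 1\<close> that kill \<open>c\<close>, modulo \<open>F\<close>. Each of them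
  says that a linear system, whose coefficients depend linearly on \<open>c\<close>, has only the solutions it
  must have. So it is the nonvanishing of a minor, and it is open (\<open>conditions_open\<close>). It remains to
  exhibit one functional (\<open>example_functional\<close>): a sum, over sufficiently many points \<open>v\<close> of the plane, of
  the functionals that send \<open>p + x\<^sub>0 q\<close>, with \<open>p\<close> and \<open>q\<close> free of \<open>x\<^sub>0\<close>, to \<open>q v\<close>. Up to a scalar, this
  is the difference of the evaluations at the two points of the quadric above \<open>v\<close>, but it is defined
  over every field.

  By the first condition and the symmetry of the Hilbert function, the ideal is as small as possible in
  every degree. As the length is a sum of dimensions, the quotient is relatively compressed. The
  dimensions also show that there are \<open>n = 2 * t + 3\<close> generators \<open>g\<close> of degree \<open>t + 1\<close> besides \<open>F\<close>.

  For the resolution, the second condition gives more: every functional that is killed by \<open>F\<close>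
  and by the forms of degree \<open>t + 1\<close> in the ideal is a contraction of \<open>c\<close>, if its degree is at least \<open>t + 1\<close>.
  So these forms and \<open>F\<close> generate the part of the ideal in these degrees (\<open>annihilated_functional\<close>,
  \<open>\<phi>1_onto\<close>). The relations between the \<open>g\<close> modulo \<open>F\<close> are generated by \<open>n\<close> linear ones. The main step is
  \<open>syz_step\<close>: a functional that kills the relations of lower degree factors through the generators after
  each differentiation, and the partial factors can be integrated because the Koszul complex of the
  variables is exact modulo \<open>F\<close> in the relevant place (\<open>koszul_cohomology_2\<close>). The Koszul relations
  with \<open>F\<close> and one further relation \<open>w\<close>, of degree \<open>2 * t + 3\<close>, then give the next map; its image is the
  whole kernel by a count of dimensions, in which the exactness at the left end enters. There, exactness
  is the fact that a general quadric is prime (\<open>prime\<close>) and does not divide \<open>w\<close>. All entries of the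
  matrices have positive degree, so the resolution is minimal.
\<close>

section \<open>Linear algebra in finite-dimensional subspaces\<close>

definition (in Vector_Spaces.vector_space) fin_dim :: "'b set \<Rightarrow> bool"
  where "fin_dim S \<longleftrightarrow> (\<exists>B. finite B \<and> S \<subseteq> span B)"

lemma (in Vector_Spaces.vector_space) fin_dim_mono: "fin_dim T \<Longrightarrow> S \<subseteq> T \<Longrightarrow> fin_dim S"
  unfolding fin_dim_def by blast

lemma (in Vector_Spaces.vector_space) finite_basis:
  assumes "subspace S" "fin_dim S" "A \<subseteq> S" "independent A"
  obtains C where "A \<subseteq> C" "C \<subseteq> S" "independent C" "finite C" "span C = S" "dim S = card C"
proof -
  obtain B where B: "finite B" "S \<subseteq> span B" using assms(2) unfolding fin_dim_def by blast
  obtain C where C: "A \<subseteq> C" "C \<subseteq> S" "independent C" "S \<subseteq> span C"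
    using maximal_independent_subset_extend[OF assms(3,4)] by blast
  then have "finite C" "span C = S" "dim S = card C"
    using independent_span_bound[OF B(1), of C] assms(1) B(2) span_minimal[of C S]
      basis_card_eq_dim[of C S] by auto
  then show ?thesis using that C by blast
qed

lemma (in Vector_Spaces.vector_space) dim_mono_fin:
  assumes "subspace T" "fin_dim T" "subspace S" "S \<subseteq> T"
  shows "dim S \<le> dim T" and "dim S = dim T \<Longrightarrow> S = T"
proof -
  obtain A where A: "A \<subseteq> S" "independent A" "finite A" "span A = S" "dim S = card A"
    by (rule finite_basis[of S "{}"]) (use assms independent_empty fin_dim_mono in auto)
  obtain C where C: "A \<subseteq> C" "C \<subseteq> T" "independent C" "finite C" "span C = T" "dim T = card C"
    by (rule finite_basis[of T A]) (use assms A fin_dim_mono in auto)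
  show "dim S \<le> dim T" using A C by (simp add: card_mono)
  show "S = T" if "dim S = dim T"
    using that A C card_subset_eq[of C A] by auto
qed

text \<open>A basis of a complement of \<open>S0\<close> in \<open>S\<close>, in a form that avoids naming the complement.\<close>

lemma (in Vector_Spaces.vector_space) basis_modulo:
  assumes "subspace S" "fin_dim S" "subspace S0" "S0 \<subseteq> S"
  obtains b :: "nat \<Rightarrow> 'b" and n where "dim S = dim S0 + n" "\<And>i. i < n \<Longrightarrow> b i \<in> S"
    "\<And>x. x \<in> S \<Longrightarrow> \<exists>u. x - (\<Sum>i<n. scale (u i) (b i)) \<in> S0"
    "\<And>u i. (\<Sum>i<n. scale (u i) (b i)) \<in> S0 \<Longrightarrow> i < n \<Longrightarrow> u i = 0"
proof -
  obtain A where A: "A \<subseteq> S0" "independent A" "finite A" "span A = S0" "dim S0 = card A"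
    by (rule finite_basis[of S0 "{}"]) (use assms independent_empty fin_dim_mono in auto)
  obtain C where C: "A \<subseteq> C" "C \<subseteq> S" "independent C" "finite C" "span C = S" "dim S = card C"
    by (rule finite_basis[of S A]) (use assms A fin_dim_mono in auto)
  define D where "D = C - A"
  have D: "finite D" "card C = card A + card D"
    using C A by (auto simp: D_def card_Diff_subset card_mono)
  obtain b where b: "bij_betw b {..<card D} D"
    using ex_bij_betw_nat_finite[OF D(1)] atLeast0LessThan by metis
  have reidx: "(\<Sum>i<card D. scale (u i) (b i)) = (\<Sum>d\<in>D. scale (u (inv_into {..<card D} b d)) d)" for u
    using b by (subst sum.reindex_bij_betw[OF b, symmetric])
      (auto intro!: sum.cong simp: bij_betw_def)
  show ?thesis
  proof
    show "dim S = dim S0 + card D" using A C D by simp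
    show "b i \<in> S" if "i < card D" for i
      using b that C D_def by (auto simp: bij_betw_def)
    show "\<exists>u. x - (\<Sum>i<card D. scale (u i) (b i)) \<in> S0" if "x \<in> S" for x
    proof -
      have "x \<in> span (A \<union> D)" using that C by (simp add: D_def Un_absorb1)
      then obtain y z where yz: "x = y + z" "y \<in> span A" "z \<in> span D" by (auto simp: span_Un)
      then obtain w where w: "z = (\<Sum>d\<in>D. scale (w d) d)" using span_finite[OF D(1)] by auto
      have "z = (\<Sum>i<card D. scale (w (b i)) (b i))"
        unfolding w by (rule sum.reindex_bij_betw[OF b, symmetric])
      then show ?thesis using yz A by (intro exI[of _ "\<lambda>i. w (b i)"]) auto
    qed
    show "u i = 0" if z: "(\<Sum>i<card D. scale (u i) (b i)) \<in> S0" and i: "i < card D" for u i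
    proof -
      define w where "w d = u (inv_into {..<card D} b d)" for d
      obtain a where a: "(\<Sum>d\<in>D. scale (w d) d) = (\<Sum>d\<in>A. scale (a d) d)"
        using z A span_finite[OF A(3)] unfolding reidx w_def by auto
      have "(\<Sum>d\<in>C. scale (if d \<in> A then - a d else w d) d) = 0"
      proof -
        have "C = A \<union> D" "A \<inter> D = {}" using C by (auto simp: D_def)
        then have "(\<Sum>d\<in>C. scale (if d \<in> A then - a d else w d) d) =
            (\<Sum>d\<in>A. scale (- a d) d) + (\<Sum>d\<in>D. scale (w d) d)"
          using A D by (simp add: sum.union_disjoint) (intro sum.cong, auto)
        then show ?thesis using a by (simp add: sum_negf)
      qed
      moreover have "b i \<in> C" using b i D_def by (auto simp: bij_betw_def)
      ultimately have "(if b i \<in> A then - a (b i) else w (b i)) = 0"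
        by (rule independentD[OF C(3,4) subset_refl])
      moreover have "b i \<notin> A" using b i D_def by (auto simp: bij_betw_def)
      ultimately have "w (b i) = 0" by simp
      then show ?thesis using b i by (simp add: w_def bij_betw_def inv_into_f_f)
    qed
  qed
qed

lemma (in Vector_Spaces.vector_space) exists_linear_with_kernel:
  assumes "subspace S"
  obtains \<pi> where "Vector_Spaces.linear scale scale \<pi>" "\<And>x. \<pi> x = 0 \<longleftrightarrow> x \<in> S"
proof -
  interpret p: vector_space_pair scale scale by unfold_locales
  obtain A where A: "A \<subseteq> S" "independent A" "S \<subseteq> span A" using maximal_independent_subset by blast
  obtain C where C: "A \<subseteq> C" "independent C" "UNIV \<subseteq> span C"
    by (rule maximal_independent_subset_extend[OF subset_UNIV A(2)])
  obtain \<pi> where \<pi>: "Vector_Spaces.linear scale scale \<pi>" "\<forall>x\<in>C. \<pi> x = (if x \<in> A then 0 else x)"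
    using p.linear_independent_extend[OF C(2), of "\<lambda>x. if x \<in> A then 0 else x"] by blast
  interpret l: Vector_Spaces.linear scale scale \<pi> by fact
  have 0: "\<pi> x = 0" if "x \<in> span A" for x
    by (rule p.linear_eq_0_on_span[OF \<pi>(1) _ that]) (use \<pi>(2) C in auto)
  have 1: "\<pi> x = x" if "x \<in> span (C - A)" for x
    using p.linear_eq_on[OF \<pi>(1) linear_id that] \<pi>(2) by auto
  have "\<pi> x = 0 \<longleftrightarrow> x \<in> S" for x
  proof
    assume "x \<in> S" then show "\<pi> x = 0" using 0 A by auto
  next
    assume x: "\<pi> x = 0"
    have "x \<in> span (A \<union> (C - A))" using C by (auto simp: Un_absorb1)
    then obtain y z where yz: "x = y + z" "y \<in> span A" "z \<in> span (C - A)" unfolding span_Un by blast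
    then have "z = 0" using x 0[of y] 1[of z] by (simp add: l.add)
    then show "x \<in> S" using yz A span_minimal[OF A(1) assms] by auto
  qed
  then show ?thesis using that \<pi> by blast
qed

lemma field_vector_space: "Vector_Spaces.vector_space ((*) :: 'k::field \<Rightarrow> 'k \<Rightarrow> 'k)"
  by unfold_locales (simp_all add: algebra_simps)

lemma (in Vector_Spaces.vector_space) separating_functional:
  assumes "subspace S" "z \<notin> S"
  obtains h where "Vector_Spaces.linear scale (*) h" "\<And>x. x \<in> S \<Longrightarrow> h x = 0" "h z = 1"
proof -
  interpret k: Vector_Spaces.vector_space "(*) :: 'a \<Rightarrow> 'a \<Rightarrow> 'a" by (rule field_vector_space)
  interpret p: vector_space_pair scale "(*) :: 'a \<Rightarrow> 'a \<Rightarrow> 'a" by unfold_locales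
  obtain A where A: "A \<subseteq> S" "independent A" "S \<subseteq> span A" using maximal_independent_subset by blast
  have z: "z \<notin> span A" using assms span_minimal[OF A(1)] by auto
  then have i: "independent (insert z A)" using A by (simp add: independent_insertI)
  then obtain h where l: "Vector_Spaces.linear scale (*) h" "\<forall>x\<in>insert z A. h x = (if x = z then 1 else 0)"
    using p.linear_independent_extend[OF i, of "\<lambda>x. if x = z then 1 else 0"] by blast
  have "h x = 0" if "x \<in> S" for x
    by (rule p.linear_eq_0_on_span[OF l(1), of A]) (use l(2) A that z span_base in auto)
  then show ?thesis using that l by auto
qed

text \<open>A functional that vanishes where \<open>f\<close> takes values in \<open>S\<close> factors through \<open>f\<close> modulo \<open>S\<close>.\<close>

lemma (in vector_space_pair) functional_factors:
  assumes f: "Vector_Spaces.linear s1 s2 f" and V: "vs1.subspace V" and S: "vs2.subspace S"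
    and l: "Vector_Spaces.linear s1 (*) h" and ker: "\<And>v. v \<in> V \<Longrightarrow> f v \<in> S \<Longrightarrow> h v = 0"
  obtains \<mu> where "Vector_Spaces.linear s2 (*) \<mu>" "\<And>p. p \<in> S \<Longrightarrow> \<mu> p = 0" "\<And>v. v \<in> V \<Longrightarrow> \<mu> (f v) = h v"
proof -
  interpret k: Vector_Spaces.vector_space "(*) :: 'a \<Rightarrow> 'a \<Rightarrow> 'a" by (rule field_vector_space)
  obtain \<pi> where \<pi>: "Vector_Spaces.linear s2 s2 \<pi>" "\<And>x. \<pi> x = 0 \<longleftrightarrow> x \<in> S"
    using vs2.exists_linear_with_kernel[OF S] by blast
  interpret l: Vector_Spaces.linear s1 "(*)" h by fact
  have pf: "Vector_Spaces.linear s1 s2 (\<lambda>v. \<pi> (f v))"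
    using Vector_Spaces.linear_compose[OF f \<pi>(1)] by (simp add: o_def)
  interpret pf: Vector_Spaces.linear s1 s2 "\<lambda>v. \<pi> (f v)" by fact
  obtain g where g: "range g \<subseteq> V" "Vector_Spaces.linear s2 s1 g" "\<forall>v\<in>(\<lambda>v. \<pi> (f v)) ` V. \<pi> (f (g v)) = v"
    using linear_exists_right_inverse_on[OF pf V] by blast
  show ?thesis
  proof
    show "Vector_Spaces.linear s2 (*) (\<lambda>p. h (g (\<pi> p)))"
      using Vector_Spaces.linear_compose[OF Vector_Spaces.linear_compose[OF \<pi>(1) g(2)] l] by (simp add: o_def)
    show "h (g (\<pi> p)) = 0" if "p \<in> S" for p
    proof -
      have "\<pi> p = 0" using \<pi> that by simp
      moreover have "g 0 = 0" using g(2) module_hom.zero unfolding Vector_Spaces.linear_def by blast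
      ultimately show ?thesis by simp
    qed
    show "h (g (\<pi> (f v))) = h v" if v: "v \<in> V" for v
    proof -
      let ?w = "g (\<pi> (f v))"
      have w: "?w \<in> V" using g by auto
      have "\<pi> (f ?w) = \<pi> (f v)" using g v by auto
      then have "\<pi> (f (?w - v)) = 0" by (simp add: pf.diff)
      then have "f (?w - v) \<in> S" using \<pi> by simp
      then have "h (?w - v) = 0" using ker w v V vs1.subspace_diff by blast
      then show ?thesis by (simp add: l.diff)
    qed
  qed
qed

lemma (in vector_space_pair) dim_image_kernel:
  assumes lf: "Vector_Spaces.linear s1 s2 f" and S: "vs1.subspace S" and B: "vs1.fin_dim S"
  shows "vs1.dim S = vs2.dim (f ` S) + vs1.dim {x \<in> S. f x = 0}"
proof -
  interpret f: Vector_Spaces.linear s1 s2 f by fact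
  interpret p: vector_space_pair s1 s1 by unfold_locales
  let ?N = "{x \<in> S. f x = 0}"
  have N: "vs1.subspace ?N"
    using S by (auto simp: vs1.subspace_def f.add f.scale)
  obtain A where A: "A \<subseteq> ?N" "vs1.independent A" "finite A" "vs1.span A = ?N" "vs1.dim ?N = card A"
    by (rule vs1.finite_basis[of ?N "{}"]) (use N B vs1.fin_dim_mono[of S] vs1.independent_empty in auto)
  obtain C where C: "A \<subseteq> C" "C \<subseteq> S" "vs1.independent C" "finite C" "vs1.span C = S" "vs1.dim S = card C"
    by (rule vs1.finite_basis[of S A]) (use S B A in auto)
  obtain \<pi> where \<pi>: "Vector_Spaces.linear s1 s1 \<pi>" "\<forall>x\<in>C. \<pi> x = (if x \<in> A then 0 else x)"
    using p.linear_independent_extend[OF C(3), of "\<lambda>x. if x \<in> A then 0 else x"] by blast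
  have 0: "\<pi> x = 0" if "x \<in> vs1.span A" for x
    by (rule p.linear_eq_0_on_span[OF \<pi>(1) _ that]) (use \<pi>(2) C in auto)
  have 1: "\<pi> x = x" if "x \<in> vs1.span (C - A)" for x
    using p.linear_eq_on[OF \<pi>(1) vs1.linear_id that] \<pi>(2) by auto
  have inj: "inj_on f (vs1.span (C - A))"
    unfolding linear_inj_on_iff_eq_0[OF lf vs1.subspace_span]
  proof (intro ballI impI)
    fix x assume x: "x \<in> vs1.span (C - A)" "f x = 0"
    then have "x \<in> S" using C vs1.span_mono[of "C - A" C] by auto
    then show "x = 0" using 0[of x] 1[of x] x A by auto
  qed
  have im: "f ` S = vs2.span (f ` (C - A))"
  proof -
    have "f ` S = vs2.span (f ` C)" using f.span_image[of C] C by simp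
    also have "f ` C \<subseteq> insert 0 (f ` (C - A))" using A by auto
    then have "vs2.span (f ` C) \<subseteq> vs2.span (f ` (C - A))"
      by (metis vs2.span_insert_0 vs2.span_mono)
    ultimately show ?thesis using vs2.span_mono[of "f ` (C - A)" "f ` C"] by auto
  qed
  have ind: "vs2.independent (f ` (C - A))"
    by (rule linear_independent_injective_image[OF lf _ inj])
      (use C vs1.independent_mono in blast)
  have "vs2.dim (f ` S) = card (f ` (C - A))"
    unfolding im by (rule vs2.dim_span_eq_card_independent[OF ind])
  also have "\<dots> = card (C - A)"
    using inj by (intro card_image) (meson inj_on_subset vs1.span_superset)
  also have "card C = card (C - A) + card A"
    using A C by (metis card_Diff_subset card_mono le_add_diff_inverse2)
  ultimately show ?thesis using A C by simp
qed

lemma (in vector_space_pair) dim_image_inj: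
  assumes lf: "Vector_Spaces.linear s1 s2 f" and S: "vs1.subspace S" and B: "vs1.fin_dim S"
    and inj: "\<And>x. x \<in> S \<Longrightarrow> f x = 0 \<Longrightarrow> x = 0"
  shows "vs2.dim (f ` S) = vs1.dim S"
proof -
  interpret f: Vector_Spaces.linear s1 s2 f by fact
  have "{x \<in> S. f x = 0} = {0}" using inj S by (auto simp: vs1.subspace_0)
  moreover have "vs1.dim {0} = 0" by (metis card.empty vs1.dim_le_card' vs1.dim_span vs1.span_empty finite.emptyI le_zero_eq)
  ultimately show ?thesis using dim_image_kernel[OF lf S B] by simp
qed

lemma (in vector_space_pair) fin_dim_image:
  assumes lf: "Vector_Spaces.linear s1 s2 f" and B: "vs1.fin_dim S"
  shows "vs2.fin_dim (f ` S)"
proof -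
  interpret f: Vector_Spaces.linear s1 s2 f by fact
  obtain B where "finite B" "S \<subseteq> vs1.span B" using B by (auto simp: vs1.fin_dim_def)
  then show ?thesis unfolding vs2.fin_dim_def
    by (intro exI[of _ "f ` B"]) (use f.span_image[of B] in auto)
qed

text \<open>Both sides of a bilinear pairing lose the same dimension: the rank of a matrix is the rank
  of its transpose.\<close>

lemma dim_pairing_le:
  fixes s1 :: "'k::field \<Rightarrow> 'v::ab_group_add \<Rightarrow> 'v" and s2 :: "'k \<Rightarrow> 'w::ab_group_add \<Rightarrow> 'w"
  assumes "Vector_Spaces.vector_space s1" "Vector_Spaces.vector_space s2"
    and V: "module.subspace s1 V" "vector_space.fin_dim s1 V"
    and W: "module.subspace s2 W" "vector_space.fin_dim s2 W"
    and \<beta>: "\<And>w. Vector_Spaces.linear s1 (*) (\<lambda>v. \<beta> v w)" "\<And>v. Vector_Spaces.linear s2 (*) (\<lambda>w. \<beta> v w)"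
  shows "Vector_Spaces.vector_space.dim s1 V + Vector_Spaces.vector_space.dim s2 {w \<in> W. \<forall>v\<in>V. \<beta> v w = 0}
    \<le> Vector_Spaces.vector_space.dim s2 W + Vector_Spaces.vector_space.dim s1 {v \<in> V. \<forall>w\<in>W. \<beta> v w = 0}"
proof -
  interpret v: Vector_Spaces.vector_space s1 by fact
  interpret w: Vector_Spaces.vector_space s2 by fact
  interpret k: Vector_Spaces.vector_space "\<lambda>c f. (\<lambda>i. c * f i) :: nat \<Rightarrow> 'k"
    by unfold_locales (auto simp: algebra_simps)
  interpret p: vector_space_pair s1 "\<lambda>c f. (\<lambda>i. c * f i) :: nat \<Rightarrow> 'k" by unfold_locales
  let ?W0 = "{w \<in> W. \<forall>v\<in>V. \<beta> v w = 0}"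
  note b1 = module_hom.add[OF \<beta>(1)[unfolded Vector_Spaces.linear_iff_module_hom]]
    module_hom.scale[OF \<beta>(1)[unfolded Vector_Spaces.linear_iff_module_hom]]
  note b2 = module_hom.add[OF \<beta>(2)[unfolded Vector_Spaces.linear_iff_module_hom]]
    module_hom.scale[OF \<beta>(2)[unfolded Vector_Spaces.linear_iff_module_hom]]
    module_hom.zero[OF \<beta>(2)[unfolded Vector_Spaces.linear_iff_module_hom]]
    module_hom.sum[OF \<beta>(2)[unfolded Vector_Spaces.linear_iff_module_hom]]
  have W0: "w.subspace ?W0" using W by (auto simp: w.subspace_def b2)
  obtain b and n :: nat where n: "w.dim W = w.dim ?W0 + n" and b: "\<And>i. i < n \<Longrightarrow> b i \<in> W"
    "\<And>x. x \<in> W \<Longrightarrow> \<exists>u. x - (\<Sum>i<n. s2 (u i) (b i)) \<in> ?W0"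
    by (rule w.basis_modulo[OF W W0]) blast+
  define f where "f v = (\<lambda>i. if i < n then \<beta> v (b i) else 0)" for v
  have lf: "Vector_Spaces.linear s1 (\<lambda>c f. (\<lambda>i. c * f i)) f"
    by unfold_locales (auto simp: f_def b1)
  have ker: "{v \<in> V. f v = 0} = {v \<in> V. \<forall>w\<in>W. \<beta> v w = 0}"
  proof (intro Collect_cong conj_cong refl iffI ballI)
    fix v w assume v: "v \<in> V" "f v = 0" and w: "w \<in> W"
    have z: "\<beta> v (b i) = 0" if "i < n" for i using fun_cong[OF v(2), of i] that by (simp add: f_def)
    obtain u where "w - (\<Sum>i<n. s2 (u i) (b i)) \<in> ?W0" using b(2)[OF w] by blast
    then have "\<beta> v (w - (\<Sum>i<n. s2 (u i) (b i))) = 0" using v by blast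
    then have "\<beta> v w = \<beta> v (\<Sum>i<n. s2 (u i) (b i))"
      using b2(1)[of v "w - (\<Sum>i<n. s2 (u i) (b i))" "\<Sum>i<n. s2 (u i) (b i)"] by simp
    also have "\<dots> = 0" using z by (simp add: b2)
    finally show "\<beta> v w = 0" .
  next
    fix v assume "v \<in> V" "\<forall>w\<in>W. \<beta> v w = 0"
    then show "f v = 0" using b(1) by (auto simp: f_def)
  qed
  define e where "e i = (\<lambda>j. if j = i then 1 else 0 :: 'k)" for i :: nat
  have "f ` V \<subseteq> k.span (e ` {..<n})"
  proof clarify
    fix v
    have "f v = (\<Sum>i<n. (\<lambda>j. f v i * e i j))"
    proof
      fix j
      have "(\<Sum>i<n. (\<lambda>j. f v i * e i j)) j = (\<Sum>i<n. if i = j then f v i else 0)"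
        by (induction n) (auto simp: e_def)
      then show "f v j = (\<Sum>i<n. (\<lambda>j. f v i * e i j)) j" by (simp add: f_def)
    qed
    then show "f v \<in> k.span (e ` {..<n})"
      using k.span_sum[of "{..<n}" "\<lambda>i. (\<lambda>j. f v i * e i j)" "e ` {..<n}"]
        k.span_scale[OF k.span_base] by auto
  qed
  then have "k.dim (f ` V) \<le> card (e ` {..<n})" by (intro k.dim_le_card) auto
  also have "\<dots> \<le> n" using card_image_le[of "{..<n}" e] by simp
  finally show ?thesis using p.dim_image_kernel[OF lf V] n ker by simp
qed

declare single_numeral [simp del] single_one [simp del] One_nat_def [simp del]

section \<open>Graded pieces of the polynomial ring\<close>

definition var :: "'i \<Rightarrow> ('i, 'k::zero_neq_one) mpoly"
  where "var i = Poly_Mapping.single (Poly_Mapping.single i 1) 1"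

lemma mpoly_induct [case_names single add]:
  fixes p :: "'a \<Rightarrow>\<^sub>0 'b::comm_monoid_add"
  assumes "\<And>m a. P (Poly_Mapping.single m a)" "\<And>p q. P p \<Longrightarrow> P q \<Longrightarrow> P (p + q)"
  shows "P p"
proof (induction p rule: update_induct)
  case const
  then show ?case using assms(1)[of undefined 0] by simp
next
  case (update f a b)
  have "Poly_Mapping.update a b f = f + Poly_Mapping.single a b"
    using update(1) by (intro poly_mapping_eqI)
      (auto simp: lookup_update lookup_add lookup_single when_def in_keys_iff)
  then show ?case using assms update by metis
qed

lemma mdeg_superset:
  assumes "finite S" "Poly_Mapping.keys m \<subseteq> S"
  shows "mdeg m = (\<Sum>i\<in>S. Poly_Mapping.lookup m i)"
  unfolding mdeg_def using assms by (intro sum.mono_neutral_left) (auto simp: in_keys_iff)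

lemma mdeg_zero [simp]: "mdeg 0 = 0"
  by (simp add: mdeg_def)

lemma mdeg_add [simp]: "mdeg (m + m') = mdeg m + mdeg m'"
proof -
  let ?S = "Poly_Mapping.keys m \<union> Poly_Mapping.keys m'"
  have "Poly_Mapping.keys (m + m') \<subseteq> ?S" by (rule keys_add)
  then show ?thesis
    by (subst (1 2 3) mdeg_superset[of ?S]) (auto simp: lookup_add sum.distrib)
qed

lemma mdeg_single [simp]: "mdeg (Poly_Mapping.single i n) = n"
  by (simp add: mdeg_def)

lemma mdeg_eq_0_iff: "mdeg m = 0 \<longleftrightarrow> m = 0"
proof
  assume "mdeg m = 0"
  then have "\<forall>i\<in>Poly_Mapping.keys m. Poly_Mapping.lookup m i = 0" by (simp add: mdeg_def)
  then show "m = 0" by (intro poly_mapping_eqI) (auto simp: in_keys_iff)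
qed simp

lemma monom_factor:
  fixes m :: "'i monom"
  assumes "Poly_Mapping.lookup m i > 0"
  obtains m' where "m = Poly_Mapping.single i 1 + m'"
proof
  show "m = Poly_Mapping.single i 1 + (m - Poly_Mapping.single i 1)"
    using assms by (intro poly_mapping_eqI) (auto simp: lookup_add lookup_minus lookup_single when_def)
qed

lemma monom_factor_pos:
  fixes m :: "'i monom"
  assumes "mdeg m > 0"
  obtains i m' where "m = Poly_Mapping.single i 1 + m'"
  by (metis assms gr0I mdeg_eq_0_iff monom_factor poly_mapping_eqI lookup_zero)

lemma in_forms_iff: "p \<in> forms d \<longleftrightarrow> (\<forall>m. Poly_Mapping.lookup p m \<noteq> 0 \<longrightarrow> mdeg m = d)"
  by (auto simp: forms_def in_keys_iff)

text \<open>Graded pieces are indexed by integers, so that the pieces of shifted modules need no case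
  distinctions: the pieces in negative degree vanish.\<close>

definition gforms :: "int \<Rightarrow> ('i, 'k::zero) mpoly set"
  where "gforms j = {p. \<forall>m. Poly_Mapping.lookup p m \<noteq> 0 \<longrightarrow> int (mdeg m) = j}"

lemma gforms_nat [simp]: "gforms (int d) = forms d"
  by (auto simp: gforms_def in_forms_iff)

lemma gforms_eq: "0 \<le> j \<Longrightarrow> gforms j = forms (nat j)"
  by (metis gforms_nat int_nat_eq)

lemma gforms_neg: "j < 0 \<Longrightarrow> gforms j = {0}"
  by (auto simp: gforms_def intro!: poly_mapping_eqI)

lemma gforms_0 [simp]: "0 \<in> gforms j"
  and gforms_add: "p \<in> gforms j \<Longrightarrow> q \<in> gforms j \<Longrightarrow> p + q \<in> gforms j"
  for p q :: "('i, 'k::comm_ring_1) mpoly"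
  by (auto simp: gforms_def lookup_add) (metis add.right_neutral)

lemma gforms_uminus: "p \<in> gforms j \<Longrightarrow> - p \<in> gforms j"
  and gforms_diff: "p \<in> gforms j \<Longrightarrow> q \<in> gforms j \<Longrightarrow> p - q \<in> gforms j"
  for p q :: "('i, 'k::comm_ring_1) mpoly"
  by (auto simp: gforms_def lookup_minus) (metis diff_self)

lemma gforms_sum: "(\<And>x. x \<in> A \<Longrightarrow> f x \<in> gforms j) \<Longrightarrow> sum f A \<in> gforms j"
  for f :: "_ \<Rightarrow> ('i, 'k::comm_ring_1) mpoly"
  by (induction A rule: infinite_finite_induct) (auto intro: gforms_add)

lemma gforms_mult:
  fixes p q :: "('i, 'k::comm_ring_1) mpoly"
  assumes "p \<in> gforms a" "q \<in> gforms b"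
  shows "p * q \<in> gforms (a + b)"
  unfolding gforms_def
proof (intro CollectI allI impI)
  fix m assume "Poly_Mapping.lookup (p * q) m \<noteq> 0"
  then have "m \<in> Poly_Mapping.keys (p * q)" by (simp add: in_keys_iff)
  then obtain m1 m2 where "m = m1 + m2" "m1 \<in> Poly_Mapping.keys p" "m2 \<in> Poly_Mapping.keys q"
    using keys_mult by blast
  then show "int (mdeg m) = a + b"
    using assms by (auto simp: gforms_def in_keys_iff)
qed

lemma gforms_mult':
  fixes p q :: "('i, 'k::comm_ring_1) mpoly"
  shows "p \<in> gforms a \<Longrightarrow> q \<in> gforms b \<Longrightarrow> a + b = c \<Longrightarrow> p * q \<in> gforms c"
  using gforms_mult by blast

lemma forms_0 [simp]: "0 \<in> forms d"
  and forms_add: "p \<in> forms d \<Longrightarrow> q \<in> forms d \<Longrightarrow> p + q \<in> forms d"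
  and forms_diff: "p \<in> forms d \<Longrightarrow> q \<in> forms d \<Longrightarrow> p - q \<in> forms d"
  and forms_uminus: "p \<in> forms d \<Longrightarrow> - p \<in> forms d"
  for p q :: "('i, 'k::comm_ring_1) mpoly"
  using gforms_add[of p "int d" q] gforms_diff[of p "int d" q] gforms_uminus[of p "int d"]
    gforms_0[of "int d"] by simp_all

lemma forms_sum: "(\<And>x. x \<in> A \<Longrightarrow> f x \<in> forms d) \<Longrightarrow> sum f A \<in> forms d"
  for f :: "_ \<Rightarrow> ('i, 'k::comm_ring_1) mpoly"
  using gforms_sum[of A f "int d"] by simp

lemma forms_mult: "p \<in> forms a \<Longrightarrow> q \<in> forms b \<Longrightarrow> p * q \<in> forms (a + b)"
  for p q :: "('i, 'k::comm_ring_1) mpoly"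
  using gforms_mult[of p "int a" q "int b"] by (metis gforms_nat of_nat_add)

lemma single_in_forms [simp]: "mdeg m = d \<Longrightarrow> Poly_Mapping.single m a \<in> forms d"
  by (auto simp: in_forms_iff lookup_single when_def split: if_splits)

lemma var_in_forms [simp]: "var i \<in> forms 1"
  by (simp add: var_def)

lemma lookup_cmul [simp]: "Poly_Mapping.lookup (cmul c p) m = c * Poly_Mapping.lookup p m"
  unfolding cmul_def using mult_map_scale_conv_mult[of c p, symmetric]
  by (simp add: map.rep_eq when_def)

lemma cmul_in_forms: "p \<in> forms d \<Longrightarrow> cmul c p \<in> forms d"
  and cmul_in_gforms: "p \<in> gforms j \<Longrightarrow> cmul c p \<in> gforms j"
  by (auto simp: in_forms_iff gforms_def) (metis mult_zero_right)+

lemma cmul_simps: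
  "cmul c (p + q) = cmul c p + cmul c q" "cmul (a + b) p = cmul a p + cmul b p"
  "cmul a (cmul b p) = cmul (a * b) p" "cmul 1 p = p" "cmul 0 p = 0" "cmul c 0 = 0"
  "cmul c (p - q) = cmul c p - cmul c q" "cmul (- c) p = - cmul c p"
  "cmul c (Poly_Mapping.single m a) = Poly_Mapping.single m (c * a)"
  by (rule poly_mapping_eqI, simp add: lookup_add lookup_minus algebra_simps)+
    (auto intro!: poly_mapping_eqI simp: lookup_single when_def)

lemma cmul_mult: "cmul c p * q = cmul c (p * q)" "p * cmul c q = cmul c (p * q)"
  by (simp_all add: cmul_def ac_simps)

lemma cmul_sum: "cmul c (sum f A) = (\<Sum>x\<in>A. cmul c (f x))"
  by (induction A rule: infinite_finite_induct) (auto simp: cmul_simps)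

interpretation V: Vector_Spaces.vector_space "cmul :: 'k::field \<Rightarrow> ('i, 'k) mpoly \<Rightarrow> _"
  by (rule vector_space_cmul)

interpretation I: Modules.module "(*) :: ('i, 'k::field) mpoly \<Rightarrow> ('i, 'k) mpoly \<Rightarrow> _"
  by (rule module_mult)

lemma subspace_forms [simp]: "V.subspace (forms d)"
  by (auto simp: V.subspace_def forms_add cmul_in_forms)

lemma subspace_gforms [simp]: "V.subspace (gforms j)"
  by (auto simp: V.subspace_def gforms_add cmul_in_gforms)

lemma ideal_k_subspace: "is_ideal J \<Longrightarrow> V.subspace J"
  by (auto simp: V.subspace_def I.subspace_def cmul_def)

lemma ideal_of_singleton: "ideal_of {F} = range (\<lambda>h. h * F)"
  by (rule I.span_singleton)

lemma in_ideal_of_iff: "p \<in> ideal_of {F} \<longleftrightarrow> F dvd p"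
  by (auto simp: ideal_of_singleton dvd_def mult.commute)

lemma hom_component_add: "hom_component d (p + q) = hom_component d p + hom_component d q"
  for p q :: "('i, 'k::comm_ring_1) mpoly"
  by (rule poly_mapping_eqI) (auto simp: lookup_hom_component lookup_add)

lemma hom_component_diff: "hom_component d (p - q) = hom_component d p - hom_component d q"
  for p q :: "('i, 'k::comm_ring_1) mpoly"
  by (rule poly_mapping_eqI) (auto simp: lookup_hom_component lookup_minus)

lemma hom_component_cmul: "hom_component d (cmul c p) = cmul c (hom_component d p)"
  by (rule poly_mapping_eqI) (auto simp: lookup_hom_component)

lemma hom_component_0 [simp]: "hom_component d 0 = 0"
  by (rule poly_mapping_eqI) (auto simp: lookup_hom_component)

lemma hom_component_sum: "hom_component d (sum f A) = (\<Sum>x\<in>A. hom_component d (f x))"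
  for f :: "_ \<Rightarrow> ('i, 'k::comm_ring_1) mpoly"
  by (induction A rule: infinite_finite_induct) (auto simp: hom_component_add)

lemma hom_component_in_forms [simp]: "hom_component d p \<in> forms d"
  by (auto simp: in_forms_iff lookup_hom_component)

lemma hom_component_forms: "p \<in> forms d \<Longrightarrow> hom_component e p = (if e = d then p else 0)"
  by (intro poly_mapping_eqI) (auto simp: in_forms_iff lookup_hom_component)

lemma mpoly_eq_sum_hom_components:
  obtains N where "\<And>n. n \<ge> N \<Longrightarrow> p = (\<Sum>d<n. hom_component d p)"
    "\<And>d. d \<ge> N \<Longrightarrow> hom_component d p = 0"
proof -
  define N where "N = Suc (Max (insert 0 (mdeg ` Poly_Mapping.keys p)))"
  have N: "mdeg m < N" if "Poly_Mapping.lookup p m \<noteq> 0" for m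
    unfolding N_def using that by (intro le_imp_less_Suc Max_ge) (auto simp: in_keys_iff)
  show ?thesis
  proof
    show "p = (\<Sum>d<n. hom_component d p)" if "n \<ge> N" for n
    proof (rule poly_mapping_eqI)
      fix m
      show "Poly_Mapping.lookup p m = Poly_Mapping.lookup (\<Sum>d<n. hom_component d p) m"
        using N[of m] that by (cases "Poly_Mapping.lookup p m = 0")
          (auto simp: lookup_sum lookup_hom_component sum.delta')
    qed
    show "hom_component d p = 0" if "d \<ge> N" for d
      using that N by (intro poly_mapping_eqI) (force simp: lookup_hom_component)
  qed
qed

lemma hom_component_mult:
  fixes p q :: "('i, 'k::comm_ring_1) mpoly"
  assumes "p \<in> forms a"
  shows "hom_component (a + b) (p * q) = p * hom_component b q"
    and "d < a \<Longrightarrow> hom_component d (p * q) = 0"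
proof -
  obtain N where N: "\<And>n. n \<ge> N \<Longrightarrow> q = (\<Sum>d<n. hom_component d q)"
    "\<And>d. d \<ge> N \<Longrightarrow> hom_component d q = 0"
    by (rule mpoly_eq_sum_hom_components[of q]) blast
  have *: "hom_component e (p * hom_component d q) = (if e = a + d then p * hom_component d q else 0)" for d e
    by (rule hom_component_forms) (intro forms_mult assms hom_component_in_forms)
  have **: "hom_component e (p * q) = (\<Sum>d<Suc (N + b). hom_component e (p * hom_component d q))" for e
    by (subst N(1)[of "Suc (N + b)"]) (simp_all only: sum_distrib_left hom_component_sum)
  show "hom_component (a + b) (p * q) = p * hom_component b q"
    unfolding ** * by simp
  show "d < a \<Longrightarrow> hom_component d (p * q) = 0"
    unfolding ** * by (intro sum.neutral) auto
qed

definition hcomp :: "int \<Rightarrow> ('i, 'k::zero) mpoly \<Rightarrow> ('i, 'k) mpoly"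
  where "hcomp j p = (if j < 0 then 0 else hom_component (nat j) p)"

lemma hcomp_in_gforms [simp]: "hcomp j p \<in> gforms j"
  by (auto simp: hcomp_def gforms_eq gforms_neg)

lemma hcomp_nat [simp]: "hcomp (int d) p = hom_component d p"
  by (simp add: hcomp_def)

lemma hcomp_sum: "hcomp j (sum f A) = (\<Sum>x\<in>A. hcomp j (f x))"
  for f :: "_ \<Rightarrow> ('i, 'k::comm_ring_1) mpoly"
  by (simp add: hcomp_def hom_component_sum)

lemma hcomp_mult:
  fixes p q :: "('i, 'k::comm_ring_1) mpoly"
  assumes "p \<in> gforms a"
  shows "hcomp j (p * q) = p * hcomp (j - a) q"
proof (cases "a < 0")
  case True
  then show ?thesis using assms by (simp add: gforms_neg hcomp_def)
next
  case False
  then have p: "p \<in> forms (nat a)" using assms by (simp add: gforms_eq)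
  show ?thesis
  proof (cases "j < a")
    case True
    then show ?thesis using hom_component_mult(2)[OF p, of "nat j" q] False by (auto simp: hcomp_def)
  next
    case ja: False
    then have "nat j = nat a + nat (j - a)" using False by simp
    then show ?thesis using hom_component_mult(1)[OF p, of "nat (j - a)" q] ja False
      by (auto simp: hcomp_def)
  qed
qed

lemma dvd_hom_component:
  fixes F :: "('i, 'k::comm_ring_1) mpoly"
  assumes "F \<in> forms a" "F dvd p"
  shows "F dvd hom_component d p"
proof -
  obtain h where "p = F * h" using assms by (auto simp: dvd_def)
  then show ?thesis using hom_component_mult[OF assms(1)]
    by (cases "d < a") (auto simp: le_iff_add not_less)
qed

lemma dvd_formE:
  fixes F :: "('i, 'k::comm_ring_1) mpoly"
  assumes "F \<in> gforms a" "F dvd p" "p \<in> gforms j"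
  obtains h where "p = F * h" "h \<in> gforms (j - a)"
proof -
  obtain h where h: "p = F * h" using assms by (auto simp: dvd_def)
  have "p = hcomp j p" using assms(3)
    by (cases "j < 0") (auto simp: gforms_neg gforms_eq hcomp_def hom_component_forms)
  also have "\<dots> = F * hcomp (j - a) h" unfolding h by (rule hcomp_mult) fact
  finally show ?thesis using that by simp
qed

subsection \<open>The dimension of the space of forms\<close>

lemma single_lincomb:
  fixes p :: "('i, 'k::field) mpoly"
  assumes "finite M" "Poly_Mapping.keys p \<subseteq> M"
  shows "p = (\<Sum>m\<in>M. cmul (Poly_Mapping.lookup p m) (Poly_Mapping.single m 1))"
  using assms by (intro poly_mapping_eqI)
    (auto simp: lookup_sum lookup_single when_def in_keys_iff if_distrib sum.If_cases cong: if_cong)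

lemma forms_basis:
  fixes d :: nat
  assumes "finite {m :: 'i monom. mdeg m = d}"
  defines "B \<equiv> (\<lambda>m. Poly_Mapping.single m (1 :: 'k::field)) ` {m :: 'i monom. mdeg m = d}"
  shows "finite B" "V.span B = forms d" "k_dim (forms d :: ('i, 'k) mpoly set) = card {m :: 'i monom. mdeg m = d}"
proof -
  let ?M = "{m :: 'i monom. mdeg m = d}"
  show fin: "finite B" using assms by simp
  show span: "V.span B = forms d"
  proof
    show "V.span B \<subseteq> forms d" by (rule V.span_minimal) (auto simp: B_def)
    show "forms d \<subseteq> V.span B"
    proof
      fix p :: "('i, 'k) mpoly" assume "p \<in> forms d"
      then have "Poly_Mapping.keys p \<subseteq> ?M" by (auto simp: forms_def)
      from single_lincomb[OF assms(1) this] show "p \<in> V.span B"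
        by (metis (no_types, lifting) B_def V.span_base V.span_scale V.span_sum imageI)
    qed
  qed
  have inj: "inj_on (\<lambda>m. Poly_Mapping.single m (1::'k)) ?M"
    by (auto intro!: inj_onI) (metis lookup_single_eq lookup_single_not_eq zero_neq_one)
  have "V.independent B"
    unfolding V.independent_explicit_finite_subsets
  proof (intro allI impI ballI)
    fix A u v assume A: "A \<subseteq> B" "finite A" "(\<Sum>v\<in>A. cmul (u v) v) = 0" "v \<in> A"
    then obtain m where m: "v = Poly_Mapping.single m 1" by (auto simp: B_def)
    have "Poly_Mapping.lookup (\<Sum>v\<in>A. cmul (u v) v) m = (\<Sum>w\<in>A. if w = v then u v else 0)"
      unfolding lookup_sum
    proof (intro sum.cong refl)
      fix w assume "w \<in> A"
      then obtain m' where "w = Poly_Mapping.single m' 1" using A(1) by (auto simp: B_def)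
      then show "Poly_Mapping.lookup (cmul (u w) w) m = (if w = v then u v else 0)"
        by (cases "m' = m")
          (auto simp: m lookup_single_not_eq, metis lookup_single_eq lookup_single_not_eq zero_neq_one)
    qed
    then show "u v = 0" using A by simp
  qed
  then show "k_dim (forms d :: ('i, 'k) mpoly set) = card ?M"
    unfolding span[symmetric] V.dim_span_eq_card_independent[OF \<open>V.independent B\<close>]
    by (simp add: B_def card_image[OF inj])
qed

lemma UNIV_4: "(UNIV :: 4 set) = {0, 1, 2, 3}"
proof -
  have "card {0, 1, 2, 3 :: 4} = card (UNIV :: 4 set)" by simp
  then show ?thesis by (metis card_subset_eq finite subset_UNIV)
qed

lemma exhaust_4': "x = 0 \<or> x = 1 \<or> x = 2 \<or> x = (3::4)"
  using UNIV_4 by blast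

lemma sum_4: "(\<Sum>x\<in>UNIV. f x) = f 0 + f 1 + f 2 + f (3::4)"
  unfolding UNIV_4 by (simp add: add.assoc)

lemma card_monoms_4:
  "card {m :: 4 monom. mdeg m = d} = (d + 3) choose 3" "finite {m :: 4 monom. mdeg m = d}"
proof -
  let ?L = "{l :: nat list. length l = 4 \<and> sum_list l = d}"
  define g where "g m = map (Poly_Mapping.lookup m) [0, 1, 2, 3 :: 4]" for m :: "4 monom"
  define h where "h l = Abs_poly_mapping (\<lambda>i::4. if i = 0 then l ! 0 else if i = 1 then l ! 1
    else if i = 2 then l ! 2 else l ! 3)" for l :: "nat list"
  have bij: "bij_betw g {m. mdeg m = d} ?L"
  proof (rule bij_betwI[of _ _ _ h])
    show "g \<in> {m. mdeg m = d} \<rightarrow> ?L"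
      by (auto simp: g_def mdeg_superset[of UNIV] sum_4)
    show "h \<in> ?L \<rightarrow> {m. mdeg m = d}"
      by (auto simp: h_def mdeg_superset[of UNIV] sum_4 length_Suc_conv numeral_eq_Suc)
    show "h (g m) = m" for m
      by (rule poly_mapping_eqI) (use exhaust_4' in \<open>auto simp: h_def g_def\<close>)
    show "g (h l) = l" if "l \<in> ?L" for l
      using that by (auto simp: h_def g_def length_Suc_conv numeral_eq_Suc)
  qed
  have "card ?L = (d + 3) choose 3"
  proof -
    have "card ?L = (d + 3) choose d" using card_length_sum_list[of 4 d] by (simp add: add.commute)
    then show ?thesis using binomial_symmetric[of d "d + 3"] by (simp add: add.commute)
  qed
  then show card: "card {m :: 4 monom. mdeg m = d} = (d + 3) choose 3"
    using bij_betw_same_card[OF bij] by simp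
  show "finite {m :: 4 monom. mdeg m = d}" by (rule card_ge_0_finite) (simp add: card)
qed

section \<open>The dual module: functionals on polynomials\<close>

text \<open>A functional on the polynomial ring is a function on monomials. It need not have finite
  support, so the functionals form an injective module.\<close>

definition pair :: "('i, 'k::comm_ring_1) mpoly \<Rightarrow> ('i monom \<Rightarrow> 'k) \<Rightarrow> 'k"
  where "pair p c = (\<Sum>m\<in>Poly_Mapping.keys p. Poly_Mapping.lookup p m * c m)"

definition act :: "('i, 'k::comm_ring_1) mpoly \<Rightarrow> ('i monom \<Rightarrow> 'k) \<Rightarrow> 'i monom \<Rightarrow> 'k"
  where "act p c = (\<lambda>m. pair p (\<lambda>q. c (q + m)))"

lemma pair_superset:
  "finite S \<Longrightarrow> Poly_Mapping.keys p \<subseteq> S \<Longrightarrow> pair p c = (\<Sum>m\<in>S. Poly_Mapping.lookup p m * c m)"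
  unfolding pair_def by (intro sum.mono_neutral_left) (auto simp: in_keys_iff)

lemma pair_0 [simp]: "pair 0 c = 0"
  by (simp add: pair_def)

lemma pair_single [simp]: "pair (Poly_Mapping.single m a) c = a * c m"
  by (subst pair_superset[of "{m}"]) auto

lemma pair_add: "pair (p + q) c = pair p c + pair q c"
proof -
  let ?S = "Poly_Mapping.keys p \<union> Poly_Mapping.keys q"
  show ?thesis using keys_add[of p q]
    by (subst (1 2 3) pair_superset[of ?S]) (auto simp: lookup_add sum.distrib algebra_simps)
qed

lemma pair_cmul: "pair (cmul a p) c = a * pair p c"
  by (induction p rule: mpoly_induct) (auto simp: cmul_simps pair_add algebra_simps)

lemma pair_uminus: "pair (- p) c = - pair p c"
  using pair_cmul[of "-1" p c] by (simp add: cmul_simps)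

lemma pair_diff: "pair (p - q) c = pair p c - pair q c"
  using pair_add[of p "- q" c] by (simp add: pair_uminus)

lemma pair_sum: "pair (sum f A) c = (\<Sum>x\<in>A. pair (f x) c)"
  by (induction A rule: infinite_finite_induct) (auto simp: pair_add)

lemma pair_fun:
  "pair p (c + d) = pair p c + pair p d" "pair p (c - d) = pair p c - pair p d"
  "pair p 0 = 0" "pair p (\<lambda>m. a * c m) = a * pair p c"
  by (simp_all add: pair_def sum.distrib sum_subtractf sum_distrib_left algebra_simps)

lemma pair_single_shift: "pair (Poly_Mapping.single m a * p) c = a * pair p (\<lambda>q. c (m + q))"
  by (induction p rule: mpoly_induct) (auto simp: mult_single distrib_left pair_add algebra_simps)

lemma pair_mult: "pair (p * q) c = pair q (act p c)"
proof (induction p rule: mpoly_induct)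
  case (single m a)
  then show ?case by (simp add: pair_single_shift act_def pair_fun add.commute)
next
  case (add p p')
  have "act (p + p') c = act p c + act p' c" by (rule ext) (simp add: act_def pair_add)
  then show ?case by (simp only: distrib_right pair_add pair_fun add)
qed

lemma act_add: "act (p + q) c = act p c + act q c"
  and act_diff: "act (p - q) c = act p c - act q c"
  and act_0 [simp]: "act 0 c = 0"
  and act_cmul: "act (cmul a p) c = (\<lambda>m. a * act p c m)"
  and act_fun: "act p (c + d) = act p c + act p d" "act p (c - d) = act p c - act p d" "act p 0 = 0"
  by (rule ext, simp add: act_def pair_add pair_diff pair_cmul pair_fun[unfolded plus_fun_def fun_diff_def zero_fun_def])+

lemma act_sum: "act (sum f A) c = (\<Sum>x\<in>A. act (f x) c)"
  by (induction A rule: infinite_finite_induct) (auto simp: act_add)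

lemma act_sum_fun: "act p (\<Sum>x\<in>A. c x) = (\<Sum>x\<in>A. act p (c x))"
proof (induction A rule: infinite_finite_induct)
  case (infinite A)
  then show ?case by (simp only: sum.infinite act_fun not_False_eq_True)
next
  case empty
  show ?case by (simp only: sum.empty act_fun)
next
  case (insert x F)
  then show ?case by (simp only: sum.insert act_fun not_False_eq_True)
qed

lemma sum_fun_apply: "(\<Sum>x\<in>A. f x) y = (\<Sum>x\<in>A. f x y)"
  by (induction A rule: infinite_finite_induct) auto

lemma pair_eq_act: "pair p c = act p c 0"
  by (simp add: act_def)

lemma act_apply: "act p c m = pair (p * Poly_Mapping.single m 1) c"
  by (simp add: mult.commute[of p] pair_single_shift act_def add.commute)

lemma act_mult: "act (p * q) c = act p (act q c)"
  by (rule ext) (simp add: act_apply[of "p * q"] act_apply[of p] pair_mult[symmetric] mult.assoc mult.left_commute)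

lemma act_commute: "act p (act q c) = act q (act p c)"
  by (metis act_mult mult.commute)

lemma act_single: "act (Poly_Mapping.single m a) c = (\<lambda>q. a * c (m + q))"
  by (rule ext) (simp add: act_def)

lemma act_var: "act (var i) c = (\<lambda>q. c (Poly_Mapping.single i 1 + q))"
  by (simp add: var_def act_single)

lemma linear_pair: "Vector_Spaces.linear cmul (*) (\<lambda>p. pair p (c :: 'i monom \<Rightarrow> 'k::field))"
  by unfold_locales (simp_all add: pair_add pair_cmul cmul_simps algebra_simps)

lemma functional_eq_pair:
  fixes h :: "('i, 'k::field) mpoly \<Rightarrow> 'k"
  assumes "Vector_Spaces.linear cmul (*) h"
  shows "h p = pair p (\<lambda>m. h (Poly_Mapping.single m 1))"
proof (induction p rule: mpoly_induct)
  case (single m a)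
  have "Poly_Mapping.single m a = cmul a (Poly_Mapping.single m 1)" by (simp add: cmul_simps)
  then show ?case using module_hom.scale[OF assms[unfolded Vector_Spaces.linear_iff_module_hom]]
    by (metis mult.right_neutral pair_single cmul_simps(9))
next
  case (add p q)
  then show ?case using module_hom.add[OF assms[unfolded Vector_Spaces.linear_iff_module_hom]]
    by (simp add: pair_add)
qed

definition dual :: "nat \<Rightarrow> ('i monom \<Rightarrow> 'k::comm_ring_1) set"
  where "dual d = {c. \<forall>m. mdeg m \<noteq> d \<longrightarrow> c m = 0}"

definition trunc :: "nat \<Rightarrow> ('i monom \<Rightarrow> 'k::comm_ring_1) \<Rightarrow> 'i monom \<Rightarrow> 'k"
  where "trunc d c = (\<lambda>m. if mdeg m = d then c m else 0)"

lemma trunc_dual [simp]: "trunc d c \<in> dual d"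
  by (simp add: trunc_def dual_def)

lemma trunc_id: "c \<in> dual d \<Longrightarrow> trunc d c = c"
  by (auto simp: trunc_def dual_def)

lemma trunc_0: "trunc d 0 = 0"
  by (rule ext) (simp add: trunc_def)

lemma dual_closed: "0 \<in> dual d" "c \<in> dual d \<Longrightarrow> c' \<in> dual d \<Longrightarrow> c + c' \<in> dual d"
  "c \<in> dual d \<Longrightarrow> c' \<in> dual d \<Longrightarrow> c - c' \<in> dual d"
  by (auto simp: dual_def)

lemma pair_trunc: "p \<in> forms d \<Longrightarrow> pair p (trunc d c) = pair p c"
  by (auto simp: pair_def trunc_def forms_def intro!: sum.cong)

lemma act_trunc:
  assumes "p \<in> forms a"
  shows "act p (trunc (a + b) c) = trunc b (act p c)"
  using assms by (auto simp: act_def pair_def trunc_def forms_def fun_eq_iff intro!: sum.cong sum.neutral)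

lemma act_dual: "p \<in> forms a \<Longrightarrow> c \<in> dual (a + b) \<Longrightarrow> act p c \<in> dual b"
  by (metis act_trunc trunc_dual trunc_id)

lemma act_dual_0:
  assumes "p \<in> forms a" "c \<in> dual b" "b < a"
  shows "act p c = 0"
  using assms by (auto simp: act_def pair_def dual_def forms_def fun_eq_iff intro!: sum.neutral)

lemma pair_hom_component: "c \<in> dual d \<Longrightarrow> pair p c = pair (hom_component d p) c"
proof -
  assume c: "c \<in> dual d"
  have "pair p c = (\<Sum>m\<in>Poly_Mapping.keys p. Poly_Mapping.lookup (hom_component d p) m * c m)"
    unfolding pair_def using c by (intro sum.cong) (auto simp: lookup_hom_component dual_def)
  also have "\<dots> = pair (hom_component d p) c"
    by (rule pair_superset[symmetric]) (auto simp: in_keys_iff lookup_hom_component split: if_splits)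
  finally show ?thesis .
qed

lemma act_eq_0_iff_pair:
  assumes "p \<in> forms a" "c \<in> dual (a + b)"
  shows "act p c = 0 \<longleftrightarrow> (\<forall>q\<in>forms b. pair (q * p) c = 0)"
proof
  assume "act p c = 0"
  then show "\<forall>q\<in>forms b. pair (q * p) c = 0"
    by (metis mult.commute pair_fun(3) pair_mult)
next
  assume r: "\<forall>q\<in>forms b. pair (q * p) c = 0"
  have "act p c m = 0" for m
  proof (cases "mdeg m = b")
    case True
    then show ?thesis using r[rule_format, of "Poly_Mapping.single m 1"] by (simp add: act_apply mult.commute)
  next
    case False
    then show ?thesis using act_dual[OF assms] by (simp add: dual_def)
  qed
  then show "act p c = 0" by (simp add: fun_eq_iff)
qed

lemma dual_eq_0:
  assumes "c \<in> dual d" "\<And>p. p \<in> forms d \<Longrightarrow> pair p c = 0"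
  shows "c = 0"
proof
  fix m show "c m = 0 m"
    using assms(2)[of "Poly_Mapping.single m 1"] assms(1) by (cases "mdeg m = d") (auto simp: dual_def)
qed

lemma dual_eq_0_vars:
  assumes "c \<in> dual d" "d > 0" "\<And>i. act (var i) c = 0"
  shows "c = 0"
proof
  fix m
  show "c m = 0 m"
  proof (cases "mdeg m = d")
    case True
    then obtain i m' where "m = Poly_Mapping.single i 1 + m'" using assms(2) monom_factor_pos by metis
    then show ?thesis using fun_cong[OF assms(3)[of i], of m'] by (simp add: act_var)
  qed (use assms(1) in \<open>auto simp: dual_def\<close>)
qed

text \<open>A compatible family of partial shifts integrates: the functionals have no first Koszul
  cohomology.\<close>

lemma dual_integrate:
  fixes \<psi> :: "'i \<Rightarrow> 'i monom \<Rightarrow> 'k::comm_ring_1"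
  assumes "\<And>i j. act (var i) (\<psi> j) = act (var j) (\<psi> i)"
  obtains \<Psi> where "\<And>i. act (var i) \<Psi> = \<psi> i"
proof
  let ?e = "\<lambda>i. Poly_Mapping.single i 1 :: 'i monom"
  define \<Psi> where "\<Psi> m = (if m = 0 then 0 else
    (case (SOME (i, m'). m = ?e i + m') of (i, m') \<Rightarrow> \<psi> i m'))" for m
  show "act (var i) \<Psi> = \<psi> i" for i
  proof
    fix m
    define P where "P = (\<lambda>(j, m'). ?e i + m = ?e j + m')"
    obtain j m' where jm: "(SOME x. P x) = (j, m')" by (cases "SOME x. P x")
    have "P (i, m)" by (simp add: P_def)
    then have "P (j, m')" using someI[of P] jm by metis
    then have eq: "?e i + m = ?e j + m'" by (simp add: P_def)
    have nz: "?e i + m \<noteq> 0"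
      by (metis add_is_0 lookup_add lookup_single_eq lookup_zero zero_neq_one)
    have "\<psi> j m' = \<psi> i m"
    proof (cases "i = j")
      case True
      then show ?thesis using eq by simp
    next
      case False
      have "Poly_Mapping.lookup m j > 0"
        using arg_cong[OF eq, of "\<lambda>x. Poly_Mapping.lookup x j"] False
        by (simp add: lookup_add lookup_single_not_eq)
      then obtain n where n: "m = ?e j + n" by (rule monom_factor)
      then have "?e j + m' = ?e j + (?e i + n)" using eq by (simp add: ac_simps)
      then have n': "m' = ?e i + n" by (rule add_left_imp_eq)
      show ?thesis using fun_cong[OF assms[of i j], of n] by (simp add: act_var n n')
    qed
    then show "act (var i) \<Psi> m = \<psi> i m"
      using nz jm by (simp add: act_var \<Psi>_def P_def)
  qed
qed

section \<open>Graded free modules\<close>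

definition tscale :: "'k::field \<Rightarrow> ('j \<Rightarrow> ('i, 'k) mpoly) \<Rightarrow> 'j \<Rightarrow> ('i, 'k) mpoly"
  where "tscale c v = (\<lambda>i. cmul c (v i))"

lemma tscale_apply [simp]: "tscale c v i = cmul c (v i)"
  by (simp add: tscale_def)

interpretation W: Vector_Spaces.vector_space "tscale :: 'k::field \<Rightarrow> ('j \<Rightarrow> ('i, 'k) mpoly) \<Rightarrow> _"
  by unfold_locales (simp_all add: fun_eq_iff cmul_simps)

interpretation VW: vector_space_pair "cmul :: 'k::field \<Rightarrow> ('i, 'k) mpoly \<Rightarrow> _" "tscale :: 'k \<Rightarrow> ('j \<Rightarrow> ('i, 'k) mpoly) \<Rightarrow> _"
  by unfold_locales
interpretation WV: vector_space_pair "tscale :: 'k::field \<Rightarrow> ('j \<Rightarrow> ('i, 'k) mpoly) \<Rightarrow> _" "cmul :: 'k \<Rightarrow> ('i, 'k) mpoly \<Rightarrow> _"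
  by unfold_locales
interpretation VV: vector_space_pair "cmul :: 'k::field \<Rightarrow> ('i, 'k) mpoly \<Rightarrow> _" "cmul :: 'k \<Rightarrow> ('i, 'k) mpoly \<Rightarrow> _"
  by unfold_locales
interpretation WW: vector_space_pair "tscale :: 'k::field \<Rightarrow> ('j \<Rightarrow> ('i, 'k) mpoly) \<Rightarrow> _" "tscale :: 'k \<Rightarrow> ('l \<Rightarrow> ('i, 'k) mpoly) \<Rightarrow> _"
  by unfold_locales

text \<open>The piece of degree \<open>d\<close> of the graded free module with generators in degrees \<open>ds\<close>.\<close>

definition free_piece :: "nat list \<Rightarrow> int \<Rightarrow> (nat \<Rightarrow> ('i, 'k::comm_ring_1) mpoly) set"
  where "free_piece ds d = {v. (\<forall>i<length ds. v i \<in> gforms (d - int (ds ! i))) \<and>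
    (\<forall>i\<ge>length ds. v i = 0)}"

lemma free_pieceI:
  "(\<And>i. i < length ds \<Longrightarrow> v i \<in> gforms (d - int (ds ! i))) \<Longrightarrow> (\<And>i. i \<ge> length ds \<Longrightarrow> v i = 0)
    \<Longrightarrow> v \<in> free_piece ds d"
  by (simp add: free_piece_def)

lemma free_pieceD:
  "v \<in> free_piece ds d \<Longrightarrow> i < length ds \<Longrightarrow> v i \<in> gforms (d - int (ds ! i))"
  "v \<in> free_piece ds d \<Longrightarrow> i \<ge> length ds \<Longrightarrow> v i = 0"
  by (simp_all add: free_piece_def)

definition unit :: "'j \<Rightarrow> ('i, 'k::comm_ring_1) mpoly \<Rightarrow> 'j \<Rightarrow> ('i, 'k) mpoly"
  where "unit i p = (\<lambda>j. if j = i then p else 0)"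

lemma linear_unit: "Vector_Spaces.linear cmul tscale (unit i :: ('i, 'k::field) mpoly \<Rightarrow> _)"
  by unfold_locales (auto simp: unit_def fun_eq_iff cmul_simps)

lemma linear_component: "Vector_Spaces.linear tscale cmul (\<lambda>v. v i :: ('i, 'k::field) mpoly)"
  by unfold_locales (auto simp: cmul_simps)

lemma sum_unit: "(\<And>i. i \<ge> n \<Longrightarrow> v i = 0) \<Longrightarrow> v = (\<Sum>i<n. unit i (v i))"
  for v :: "nat \<Rightarrow> ('i, 'k::comm_ring_1) mpoly"
  by (rule ext) (auto simp: sum_fun_apply unit_def)

lemma subspace_free_piece [simp]: "W.subspace (free_piece ds d)"
  by (auto simp: W.subspace_def free_piece_def gforms_add cmul_in_gforms cmul_simps)

definition rk :: "int \<Rightarrow> nat"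
  where "rk j = (if j < 0 then 0 else (nat j + 3) choose 3)"

lemma fin_dim_gforms [simp]: "V.fin_dim (gforms j :: (4, 'k::field) mpoly set)"
proof (cases "j < 0")
  case True
  then show ?thesis by (auto simp: gforms_neg V.fin_dim_def intro: exI[of _ "{}"])
next
  case False
  then show ?thesis using forms_basis(1,2)[OF card_monoms_4(2), of "nat j", where 'k='k]
    unfolding V.fin_dim_def by (metis gforms_eq not_less subset_refl)
qed

lemma fin_dim_forms [simp]: "V.fin_dim (forms j :: (4, 'k::field) mpoly set)"
  using fin_dim_gforms[of "int j"] by simp

lemma dim_gforms: "k_dim (gforms j :: (4, 'k::field) mpoly set) = rk j"
proof (cases "j < 0")
  case True
  then show ?thesis using V.dim_le_card[of "{0}" "{}"] by (simp add: gforms_neg rk_def)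
next
  case False
  then show ?thesis using forms_basis(3)[OF card_monoms_4(2), of "nat j"]
    by (simp add: gforms_eq card_monoms_4 rk_def)
qed

lemma dim_forms: "k_dim (forms j :: (4, 'k::field) mpoly set) = rk (int j)"
  using dim_gforms[of "int j"] by simp

lemma fin_dim_free_piece [simp]: "W.fin_dim (free_piece ds d :: (nat \<Rightarrow> (4, 'k::field) mpoly) set)"
proof -
  have "\<exists>B. finite B \<and> gforms (d - int (ds ! i)) \<subseteq> V.span (B :: (4, 'k) mpoly set)" for i
    using fin_dim_gforms unfolding V.fin_dim_def by blast
  then obtain B where B: "\<And>i. finite (B i)" "\<And>i. gforms (d - int (ds ! i)) \<subseteq> V.span (B i :: (4, 'k) mpoly set)"
    by metis
  let ?C = "\<Union>i<length ds. unit i ` B i"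
  have "free_piece ds d \<subseteq> W.span ?C"
  proof
    fix v :: "nat \<Rightarrow> (4, 'k) mpoly" assume v: "v \<in> free_piece ds d"
    have "unit i (v i) \<in> W.span ?C" if i: "i < length ds" for i
    proof -
      have "v i \<in> V.span (B i)" using v i B by (auto simp: free_piece_def)
      then have "unit i (v i) \<in> W.span (unit i ` B i)"
        using module_hom.span_image[OF linear_unit[unfolded Vector_Spaces.linear_iff_module_hom], of i "B i"] by blast
      then show ?thesis using W.span_mono[of "unit i ` B i" ?C] i by blast
    qed
    then have "(\<Sum>i<length ds. unit i (v i)) \<in> W.span ?C" by (intro W.span_sum) auto
    then show "v \<in> W.span ?C" using sum_unit[of "length ds" v] v by (simp add: free_piece_def)
  qed
  moreover have "finite ?C" using B(1) by simp
  ultimately show ?thesis unfolding W.fin_dim_def by (intro exI[of _ ?C] conjI)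
qed

lemma dim_free_piece:
  "W.dim (free_piece ds d :: (nat \<Rightarrow> (4, 'k::field) mpoly) set) = (\<Sum>x\<leftarrow>ds. rk (d - int x))"
proof (induction ds rule: rev_induct)
  case Nil
  have "free_piece [] d = {0 :: nat \<Rightarrow> (4, 'k) mpoly}" by (auto simp: free_piece_def)
  moreover have "W.dim {0 :: nat \<Rightarrow> (4, 'k) mpoly} \<le> card ({} :: (nat \<Rightarrow> (4, 'k) mpoly) set)"
    by (rule W.dim_le_card) (simp_all only: W.span_empty subset_refl finite.emptyI)
  ultimately show ?case by (simp only: list.map sum_list.Nil card.empty le_zero_eq)
next
  case (snoc a ds)
  let ?n = "length ds" let ?S = "free_piece (ds @ [a]) d :: (nat \<Rightarrow> (4, 'k) mpoly) set"
  have "W.dim ?S = k_dim ((\<lambda>v. v ?n) ` ?S) + W.dim {v \<in> ?S. v ?n = 0}"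
    by (rule WV.dim_image_kernel[OF linear_component]) auto
  also have "(\<lambda>v. v ?n) ` ?S = gforms (d - int a)"
  proof (intro equalityI subsetI)
    fix p assume "p \<in> (\<lambda>v. v ?n) ` ?S"
    then obtain v where v: "v \<in> ?S" "p = v ?n" by blast
    then show "p \<in> gforms (d - int a)" using free_pieceD(1)[OF v(1), of ?n] by simp
  next
    fix p :: "(4, 'k) mpoly" assume p: "p \<in> gforms (d - int a)"
    have "unit ?n p \<in> ?S" by (rule free_pieceI) (use p in \<open>auto simp: unit_def nth_append\<close>)
    then show "p \<in> (\<lambda>v. v ?n) ` ?S"
      by (intro image_eqI[of _ _ "unit ?n p"]) (simp_all add: unit_def)
  qed
  also have "{v \<in> ?S. v ?n = 0} = free_piece ds d"
  proof (intro equalityI subsetI CollectI conjI)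
    fix v assume v: "v \<in> {v \<in> ?S. v ?n = 0}"
    show "v \<in> free_piece ds d"
    proof (rule free_pieceI)
      show "v i \<in> gforms (d - int (ds ! i))" if "i < ?n" for i
        using free_pieceD(1)[of v "ds @ [a]" d i] v that by (simp add: nth_append)
      show "v i = 0" if "i \<ge> ?n" for i
        using free_pieceD(2)[of v "ds @ [a]" d i] v that by (cases "i = ?n") simp_all
    qed
  next
    fix v :: "nat \<Rightarrow> (4, 'k) mpoly" assume v: "v \<in> free_piece ds d"
    show "v \<in> ?S"
    proof (rule free_pieceI)
      show "v i \<in> gforms (d - int ((ds @ [a]) ! i))" if "i < length (ds @ [a])" for i
        using free_pieceD[OF v, of i] that by (cases "i < ?n") (simp_all add: nth_append)
      show "v i = 0" if "i \<ge> length (ds @ [a])" for i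
        using free_pieceD(2)[OF v, of i] that by simp
    qed
    show "v ?n = 0" using free_pieceD(2)[OF v, of ?n] by simp
  qed
  finally show ?case using snoc by (simp add: dim_gforms)
qed

section \<open>Koszul relations modulo a quadric\<close>

lemma koszul_identities:
  fixes x0 :: "'r::comm_ring_1"
  shows "x1 * (c23 - x2 * b3 + x3 * b2) - (x2 * (c13 - x1 * b3) - x3 * (c12 - x1 * b2))
      = x1 * c23 - x2 * c13 + x3 * c12"
    "x2 * (r1 + f * h1) - x1 * (r2 + f * h2) = (x2 * r1 - x1 * r2) + f * (x2 * h1 - x1 * h2)"
    "x1 * (a0 - x0 * e) = (x1 * a0 - x0 * a1) + x0 * (a1 - x1 * e)"
    "x1 * (r23 + f * h23) - x2 * (r13 + f * h13) + x3 * (r12 + f * h12)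
      = (x1 * r23 - x2 * r13 + x3 * r12) + f * (x1 * h23 - x2 * h13 + x3 * h12)"
    "c21 - (x1 * b2 - x2 * b1) = (c12 + c21) - (c12 - (x2 * b1 - x1 * b2))"
    "x2 * (c01 + x0 * a1) - x1 * (c02 + x0 * a2) = (x0 * c12 - x1 * c02 + x2 * c01)
        - x0 * (c12 - (x2 * a1 - x1 * a2))"
    "c01 - (x1 * e - x0 * a1) = (c01 + x0 * a1) - x1 * e"
  by (simp_all add: algebra_simps)

definition divided_by_var :: "'i \<Rightarrow> ('i, 'k::comm_ring_1) mpoly \<Rightarrow> ('i, 'k) mpoly"
  where "divided_by_var i p = Poly_Mapping.map_key (\<lambda>m. Poly_Mapping.single i 1 + m) p"

lemma lookup_divided_by_var [simp]:
  "Poly_Mapping.lookup (divided_by_var i p) m = Poly_Mapping.lookup p (Poly_Mapping.single i 1 + m)"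
  unfolding divided_by_var_def by (subst map_key.rep_eq) (auto simp: inj_def)

lemma lookup_single_mult:
  "Poly_Mapping.lookup (Poly_Mapping.single m a * p) (m + q) = a * Poly_Mapping.lookup p q"
  for m :: "'i monom" and a :: "'k::comm_ring_1"
proof (induction p rule: mpoly_induct)
  case (single n b)
  then show ?case by (auto simp: mult_single lookup_single when_def)
next
  case (add p p')
  then show ?case by (simp add: distrib_left lookup_add)
qed

lemma lookup_var_mult [simp]:
  "Poly_Mapping.lookup (var i * p) (Poly_Mapping.single i 1 + m) = Poly_Mapping.lookup p m"
  for p :: "('i, 'k::comm_ring_1) mpoly"
  by (simp add: var_def lookup_single_mult)

lemma var_neq_0 [simp]: "(var i :: ('i, 'k::comm_ring_1) mpoly) \<noteq> 0"
proof
  assume "(var i :: ('i, 'k) mpoly) = 0"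
  then have "Poly_Mapping.lookup (var i :: ('i, 'k) mpoly) (Poly_Mapping.single i 1) = 0" by simp
  then show False by (simp add: var_def)
qed

definition free_of_var :: "'i \<Rightarrow> ('i, 'k::comm_ring_1) mpoly \<Rightarrow> bool"
  where "free_of_var i p \<longleftrightarrow> (\<forall>m. Poly_Mapping.lookup p m \<noteq> 0 \<longrightarrow> Poly_Mapping.lookup m i = 0)"

lemma var_division:
  fixes p :: "('i, 'k::comm_ring_1) mpoly"
  shows "free_of_var i (p - var i * divided_by_var i p)"
  unfolding free_of_var_def
proof (intro allI impI, rule ccontr)
  fix m assume "Poly_Mapping.lookup (p - var i * divided_by_var i p) m \<noteq> 0" "Poly_Mapping.lookup m i \<noteq> 0"
  moreover from this(2) obtain m' where "m = Poly_Mapping.single i 1 + m'"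
    using monom_factor[of m i] by auto
  ultimately show False by (simp add: lookup_minus)
qed

lemma free_of_var_var_mult:
  fixes p :: "('i, 'k::comm_ring_1) mpoly"
  assumes "free_of_var i (var i * p)"
  shows "p = 0"
proof (rule poly_mapping_eqI)
  fix m :: "'i monom"
  have "Poly_Mapping.lookup (Poly_Mapping.single i 1 + m) i > 0" by (simp add: lookup_add)
  then have "Poly_Mapping.lookup (var i * p) (Poly_Mapping.single i 1 + m) = 0"
    using assms unfolding free_of_var_def by (metis less_irrefl)
  then show "Poly_Mapping.lookup p m = Poly_Mapping.lookup 0 m" by simp
qed

lemma free_of_var_diff: "free_of_var i p \<Longrightarrow> free_of_var i q \<Longrightarrow> free_of_var i (p - q)"
  unfolding free_of_var_def lookup_minus by (metis diff_zero)

lemma free_of_var_mult: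
  fixes p :: "('i, 'k::comm_ring_1) mpoly"
  assumes "free_of_var i p" "free_of_var i q"
  shows "free_of_var i (p * q)"
  unfolding free_of_var_def
proof (intro allI impI)
  fix m assume "Poly_Mapping.lookup (p * q) m \<noteq> 0"
  then have "m \<in> Poly_Mapping.keys (p * q)" by (simp add: in_keys_iff)
  then obtain a b where "m = a + b" "a \<in> Poly_Mapping.keys p" "b \<in> Poly_Mapping.keys q"
    using keys_mult by blast
  then show "Poly_Mapping.lookup m i = 0"
    using assms by (simp add: free_of_var_def in_keys_iff lookup_add)
qed

lemma free_of_var_var: "j \<noteq> i \<Longrightarrow> free_of_var i (var j)"
  by (auto simp: free_of_var_def var_def lookup_single when_def split: if_splits)

text \<open>Two variables form a regular sequence.\<close>

lemma var_syzygy: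
  fixes p q :: "('i::linorder, 'k::field) mpoly"
  assumes "i \<noteq> j" "var i * p = var j * q"
  obtains e where "p = var j * e" "q = var i * e"
proof -
  let ?e = "divided_by_var j p"
  let ?r = "p - var j * ?e"
  have "var i * ?r = var j * (q - var i * ?e)"
    using assms(2) by (simp add: right_diff_distrib mult.left_commute)
  moreover have "free_of_var j (var i * ?r)"
    using assms(1) by (intro free_of_var_mult var_division free_of_var_var)
  ultimately have "q - var i * ?e = 0" "var i * ?r = 0"
    using free_of_var_var_mult[of j "q - var i * ?e"] by auto
  then show ?thesis using that[of ?e] by simp
qed

lemma koszul_1:
  fixes a1 a2 a3 :: "(4, 'k::field) mpoly"
  assumes "var 2 * a1 = var 1 * a2" "var 3 * a1 = var 1 * a3"
  obtains e where "a1 = var 1 * e" "a2 = var 2 * e" "a3 = var 3 * e"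
proof -
  obtain e where e: "a1 = var 1 * e" "a2 = var 2 * e"
    using var_syzygy[of 2 1 a1 a2] assms(1) by auto
  then have "var 1 * a3 = var 1 * (var 3 * e)" using assms(2) by (simp add: mult.left_commute)
  then have "a3 = var 3 * e" by simp
  then show ?thesis using that e by blast
qed

lemma koszul_2:
  fixes c12 c13 c23 :: "(4, 'k::field) mpoly"
  assumes "var 1 * c23 - var 2 * c13 + var 3 * c12 = 0"
  obtains a1 a2 a3 where "c12 = var 2 * a1 - var 1 * a2" "c13 = var 3 * a1 - var 1 * a3"
    "c23 = var 3 * a2 - var 2 * a3"
proof -
  define b2 where "b2 = divided_by_var 1 c12"
  define b3 where "b3 = divided_by_var 1 c13"
  define r2 where "r2 = c12 - var 1 * b2"
  define r3 where "r3 = c13 - var 1 * b3"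
  have fr: "free_of_var 1 r2" "free_of_var 1 r3"
    unfolding r2_def r3_def b2_def b3_def by (rule var_division)+
  have "var 1 * (c23 - var 2 * b3 + var 3 * b2) - (var 2 * r3 - var 3 * r2)
      = var 1 * c23 - var 2 * c13 + var 3 * c12"
    unfolding r2_def r3_def by (rule koszul_identities(1))
  then have eq: "var 1 * (c23 - var 2 * b3 + var 3 * b2) = var 2 * r3 - var 3 * r2"
    using assms by simp
  moreover have "free_of_var 1 (var 2 * r3 - var 3 * r2)"
    using fr by (intro free_of_var_diff free_of_var_mult free_of_var_var) auto
  ultimately have z: "c23 - var 2 * b3 + var 3 * b2 = 0"
    using free_of_var_var_mult[of 1 "c23 - var 2 * b3 + var 3 * b2"] by simp
  then have "var 2 * r3 = var 3 * r2"
    using eq by simp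
  then obtain e where e: "r3 = var 3 * e" "r2 = var 2 * e" using var_syzygy[of 2 3 r3 r2] by auto
  show ?thesis
  proof (rule that[of e "- b2" "- b3"])
    show "c12 = var 2 * e - var 1 * - b2" using e(2) by (simp add: r2_def algebra_simps)
    show "c13 = var 3 * e - var 1 * - b3" using e(1) by (simp add: r3_def algebra_simps)
    show "c23 = var 3 * - b2 - var 2 * - b3" using z by (simp add: algebra_simps eq_neg_iff_add_eq_0)
  qed
qed

text \<open>Division by a quadric that is monic up to a unit in the variable \<open>0\<close>: residue classes have
  unique representatives of degree at most one in this variable.\<close>

definition deg0_le :: "nat \<Rightarrow> (4, 'k::comm_ring_1) mpoly \<Rightarrow> bool"
  where "deg0_le n p \<longleftrightarrow> (\<forall>m. Poly_Mapping.lookup p m \<noteq> 0 \<longrightarrow> Poly_Mapping.lookup m 0 \<le> n)"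

lemma deg0_le_add: "deg0_le n p \<Longrightarrow> deg0_le n q \<Longrightarrow> deg0_le n (p + q)"
  unfolding deg0_le_def lookup_add by (metis add.right_neutral)

lemma deg0_le_diff: "deg0_le n p \<Longrightarrow> deg0_le n q \<Longrightarrow> deg0_le n (p - q)"
  unfolding deg0_le_def lookup_minus by (metis diff_zero)

lemma deg0_le_cmul: "deg0_le n p \<Longrightarrow> deg0_le n (cmul a p)"
  unfolding deg0_le_def by (metis lookup_cmul mult_zero_right)

lemma deg0_le_mono: "deg0_le n p \<Longrightarrow> n \<le> n' \<Longrightarrow> deg0_le n' p"
  unfolding deg0_le_def using le_trans by blast

lemma deg0_le_mult:
  assumes "deg0_le a p" "deg0_le b q"
  shows "deg0_le (a + b) (p * q)"
  unfolding deg0_le_def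
proof (intro allI impI)
  fix m assume "Poly_Mapping.lookup (p * q) m \<noteq> 0"
  then have "m \<in> Poly_Mapping.keys (p * q)" by (simp add: in_keys_iff)
  then obtain m1 m2 where "m = m1 + m2" "m1 \<in> Poly_Mapping.keys p" "m2 \<in> Poly_Mapping.keys q"
    using keys_mult by blast
  then show "Poly_Mapping.lookup m 0 \<le> a + b"
    using assms by (simp add: deg0_le_def in_keys_iff lookup_add add_mono)
qed

lemma deg0_le_var_mult: "i \<noteq> 0 \<Longrightarrow> deg0_le n p \<Longrightarrow> deg0_le n (var i * p)"
  using deg0_le_mult[of 0 "var i" n p] by (auto simp: deg0_le_def var_def lookup_single when_def split: if_splits)

lemma deg0_le_hom_component: "deg0_le n p \<Longrightarrow> deg0_le n (hom_component d p)"
  by (auto simp: deg0_le_def lookup_hom_component)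

locale quadric =
  fixes F :: "(4, 'k::field) mpoly"
  assumes F2: "F \<in> forms 2" and lead: "Poly_Mapping.lookup F (Poly_Mapping.single 0 2) \<noteq> 0"
begin

definition "F\<^sub>0\<^sub>0 = Poly_Mapping.lookup F (Poly_Mapping.single 0 2)"

definition "F_rest = F - Poly_Mapping.single (Poly_Mapping.single 0 2) F\<^sub>0\<^sub>0"

lemma F_eq: "F = Poly_Mapping.single (Poly_Mapping.single 0 2) F\<^sub>0\<^sub>0 + F_rest"
  by (simp add: F_rest_def)

lemma F00: "F\<^sub>0\<^sub>0 \<noteq> 0"
  using lead by (simp add: F\<^sub>0\<^sub>0_def)

lemma F_neq_0: "F \<noteq> 0"
  using lead by auto

lemma deg0_le_F_rest: "deg0_le 1 F_rest"
  unfolding deg0_le_def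
proof (intro allI impI, rule ccontr)
  fix m assume m: "Poly_Mapping.lookup F_rest m \<noteq> 0" "\<not> Poly_Mapping.lookup m 0 \<le> 1"
  have ne: "m \<noteq> Poly_Mapping.single 0 2" using m by (auto simp: F_rest_def lookup_minus F\<^sub>0\<^sub>0_def)
  then have "Poly_Mapping.lookup F m \<noteq> 0" using m by (auto simp: F_rest_def lookup_minus lookup_single when_def)
  then have "mdeg m = 2" using F2 by (auto simp: in_forms_iff)
  then have "Poly_Mapping.lookup m 0 + Poly_Mapping.lookup m 1 + Poly_Mapping.lookup m 2 + Poly_Mapping.lookup m 3 = 2"
    using mdeg_superset[of UNIV m] sum_4[of "Poly_Mapping.lookup m"] by simp
  then have "Poly_Mapping.lookup m 0 = 2" "Poly_Mapping.lookup m 1 = 0" "Poly_Mapping.lookup m 2 = 0" "Poly_Mapping.lookup m 3 = 0"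
    using m(2) by auto
  then have "Poly_Mapping.lookup m i = Poly_Mapping.lookup (Poly_Mapping.single 0 2) i" for i
    using exhaust_4'[of i] by (auto simp: lookup_single when_def)
  then show False using ne poly_mapping_eqI by blast
qed

lemma division_exists:
  obtains r h where "p = r + F * h" "deg0_le 1 r"
proof -
  have "\<exists>r h. p = r + F * h \<and> deg0_le 1 r" if "deg0_le n p" for n p
    using that
  proof (induction n arbitrary: p)
    case 0
    then show ?case by (intro exI[of _ p] exI[of _ 0]) (auto intro: deg0_le_mono)
  next
    case (Suc n)
    show ?case
    proof (cases "n = 0")
      case True
      then show ?thesis using Suc.prems by (intro exI[of _ p] exI[of _ 0]) (auto simp: One_nat_def)
    next
      case False
      define q where "q = divided_by_var 0 (divided_by_var 0 p)"
      let ?x2 = "Poly_Mapping.single (Poly_Mapping.single 0 2) 1 :: (4, 'k) mpoly"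
      have e2: "Poly_Mapping.single 0 2 = Poly_Mapping.single (0::4) 1 + Poly_Mapping.single 0 (1::nat)"
        by (simp add: single_add[symmetric])
      have lq: "Poly_Mapping.lookup q m = Poly_Mapping.lookup p (Poly_Mapping.single 0 2 + m)" for m
        by (simp add: q_def e2 ac_simps)
      have q: "deg0_le (n - 1) q"
        unfolding deg0_le_def
      proof (intro allI impI)
        fix m assume "Poly_Mapping.lookup q m \<noteq> 0"
        then have "Poly_Mapping.lookup (Poly_Mapping.single 0 2 + m) 0 \<le> Suc n"
          using Suc.prems unfolding lq deg0_le_def by blast
        then show "Poly_Mapping.lookup m 0 \<le> n - 1" by (simp add: lookup_add)
      qed
      have low: "deg0_le 1 (p - ?x2 * q)"
        unfolding deg0_le_def
      proof (intro allI impI, rule ccontr)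
        fix m assume m: "Poly_Mapping.lookup (p - ?x2 * q) m \<noteq> 0" "\<not> Poly_Mapping.lookup m 0 \<le> 1"
        have "m = Poly_Mapping.single 0 2 + (m - Poly_Mapping.single 0 2)"
          using m(2) by (intro poly_mapping_eqI) (auto simp: lookup_add lookup_minus lookup_single when_def)
        then obtain m' where m': "m = Poly_Mapping.single 0 2 + m'" by blast
        show False using m(1) unfolding m' by (simp add: lookup_minus lookup_single_mult lq)
      qed
      have "deg0_le n (cmul (1 / F\<^sub>0\<^sub>0) (F_rest * q))"
        using deg0_le_mult[OF deg0_le_F_rest q] False by (intro deg0_le_cmul) simp
      then have "deg0_le n ((p - ?x2 * q) - cmul (1 / F\<^sub>0\<^sub>0) (F_rest * q))"
        using deg0_le_diff[OF deg0_le_mono[OF low]] False by simp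
      from Suc.IH[OF this] obtain r h where rh:
        "(p - ?x2 * q) - cmul (1 / F\<^sub>0\<^sub>0) (F_rest * q) = r + F * h" "deg0_le 1 r" by blast
      have "F * cmul (1 / F\<^sub>0\<^sub>0) q = ?x2 * q + cmul (1 / F\<^sub>0\<^sub>0) (F_rest * q)"
      proof -
        have "cmul (1 / F\<^sub>0\<^sub>0) F = ?x2 + cmul (1 / F\<^sub>0\<^sub>0) F_rest"
          by (subst F_eq) (simp add: cmul_simps F00)
        then have "cmul (1 / F\<^sub>0\<^sub>0) F * q = ?x2 * q + cmul (1 / F\<^sub>0\<^sub>0) F_rest * q"
          by (simp add: distrib_right)
        then show ?thesis by (simp add: cmul_mult)
      qed
      then have "p = r + F * (h + cmul (1 / F\<^sub>0\<^sub>0) q)"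
        using rh(1) by (simp add: distrib_left algebra_simps)
      then show ?thesis using rh(2) by blast
    qed
  qed
  moreover obtain n where "deg0_le n p"
  proof
    show "deg0_le (Max ((\<lambda>m. Poly_Mapping.lookup m 0) ` Poly_Mapping.keys p)) p"
      unfolding deg0_le_def by (auto simp: in_keys_iff intro!: Max_ge)
  qed
  ultimately show ?thesis using that by blast
qed

lemma division_unique:
  assumes "deg0_le 1 p" "F dvd p"
  shows "p = 0"
proof (rule ccontr)
  assume "p \<noteq> 0"
  obtain h where h: "p = F * h" using assms by (auto simp: dvd_def)
  then have "h \<noteq> 0" using \<open>p \<noteq> 0\<close> by auto
  define n where "n = Max ((\<lambda>m. Poly_Mapping.lookup m 0) ` Poly_Mapping.keys h)"
  have "n \<in> (\<lambda>m. Poly_Mapping.lookup m 0) ` Poly_Mapping.keys h"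
    unfolding n_def using \<open>h \<noteq> 0\<close> by (intro Max_in) auto
  then obtain m where m: "Poly_Mapping.lookup h m \<noteq> 0" "Poly_Mapping.lookup m 0 = n"
    by (auto simp: in_keys_iff)
  have "deg0_le n h" unfolding deg0_le_def n_def by (auto simp: in_keys_iff intro!: Max_ge)
  then have "deg0_le (1 + n) (F_rest * h)" by (rule deg0_le_mult[OF deg0_le_F_rest])
  then have 0: "Poly_Mapping.lookup (F_rest * h) (Poly_Mapping.single 0 2 + m) = 0"
    using m spec[of _ "Poly_Mapping.single 0 2 + m"] unfolding deg0_le_def
    by (metis (no_types, lifting) add_le_cancel_right lookup_add lookup_single_eq numeral_le_one_iff semiring_norm(69))
  have "p = Poly_Mapping.single (Poly_Mapping.single 0 2) F\<^sub>0\<^sub>0 * h + F_rest * h"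
    unfolding h by (subst F_eq) (simp add: distrib_right)
  then have "Poly_Mapping.lookup p (Poly_Mapping.single 0 2 + m) = F\<^sub>0\<^sub>0 * Poly_Mapping.lookup h m"
    by (simp add: lookup_add lookup_single_mult 0)
  then have "Poly_Mapping.lookup p (Poly_Mapping.single 0 2 + m) \<noteq> 0" using m F00 by simp
  then have "Poly_Mapping.lookup (Poly_Mapping.single 0 2 + m) 0 \<le> 1" using assms(1) unfolding deg0_le_def by blast
  then show False by (simp add: lookup_add)
qed

lemma dvd_var_mult:
  assumes "i \<noteq> 0" "F dvd var i * p"
  shows "F dvd p"
proof -
  obtain r h where r: "p = r + F * h" "deg0_le 1 r" by (rule division_exists)
  have "F dvd var i * r" using assms(2) unfolding r(1) distrib_left
    by (simp add: mult.left_commute dvd_add_left_iff)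
  then have "var i * r = 0" using r(2) assms(1) by (intro division_unique deg0_le_var_mult)
  then show ?thesis using r by simp
qed

lemma koszul_1_mod:
  assumes "\<And>i j. i \<noteq> 0 \<Longrightarrow> j \<noteq> 0 \<Longrightarrow> F dvd var j * a i - var i * a j"
  obtains e where "\<And>i. i \<noteq> 0 \<Longrightarrow> F dvd a i - var i * e"
proof -
  have "\<exists>r h. a i = r + F * h \<and> deg0_le 1 r" for i using division_exists[of "a i"] by blast
  then obtain r h where r: "\<And>i. a i = r i + F * h i" "\<And>i. deg0_le 1 (r i)" by metis
  have eq: "var j * r i = var i * r j" if "i \<noteq> 0" "j \<noteq> 0" for i j
  proof -
    have "var j * a i - var i * a j = (var j * r i - var i * r j) + F * (var j * h i - var i * h j)"
      unfolding r(1) by (rule koszul_identities(2))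
    then have "F dvd var j * r i - var i * r j"
      using assms[OF that] by (metis dvd_add_left_iff dvd_triv_left)
    then have "var j * r i - var i * r j = 0"
      using that r(2) by (intro division_unique deg0_le_diff deg0_le_var_mult)
    then show ?thesis by simp
  qed
  obtain e where e: "r 1 = var 1 * e" "r 2 = var 2 * e" "r 3 = var 3 * e"
    using koszul_1[of "r 1" "r 2" "r 3"] eq[of 1 2] eq[of 1 3] by auto
  have "a i - var i * e = F * h i" if "i \<noteq> 0" for i
    using exhaust_4'[of i] that e r(1)[of i] by auto
  then show ?thesis using that[of e] by auto
qed

text \<open>The residue class ring of a quadric in four variables has depth three, so its Koszul
  cohomology vanishes in degrees one and two.\<close>

lemma koszul_cohomology_1:
  assumes "\<And>i j. F dvd var j * a i - var i * a j"
  obtains e where "\<And>i. F dvd a i - var i * e"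
proof -
  obtain e where e: "\<And>i. i \<noteq> 0 \<Longrightarrow> F dvd a i - var i * e"
    using koszul_1_mod[of a] assms by metis
  have "var 1 * (a 0 - var 0 * e) = (var 1 * a 0 - var 0 * a 1) + var 0 * (a 1 - var 1 * e)"
    by (rule koszul_identities(3))
  then have "F dvd var 1 * (a 0 - var 0 * e)"
    using assms[of 1 0] e[of 1] by (metis dvd_add dvd_mult zero_neq_one)
  then have "F dvd a 0 - var 0 * e" by (rule dvd_var_mult[rotated]) simp
  then show ?thesis using that[of e] e by metis
qed

lemma koszul_cohomology_2:
  assumes alt: "\<And>i j. F dvd c i j + c j i" "\<And>i. F dvd c i i"
    and cocycle: "\<And>i j l. F dvd var i * c j l - var j * c i l + var l * c i j"
  obtains a where "\<And>i j. F dvd c i j - (var j * a i - var i * a j)"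
proof -
  have "\<exists>r h. c i j = r + F * h \<and> deg0_le 1 r" for i j using division_exists[of "c i j"] by blast
  then obtain r h where r: "\<And>i j. c i j = r i j + F * h i j" "\<And>i j. deg0_le 1 (r i j)" by metis
  have "var 1 * c 2 3 - var 2 * c 1 3 + var 3 * c 1 2 = (var 1 * r 2 3 - var 2 * r 1 3 + var 3 * r 1 2)
      + F * (var 1 * h 2 3 - var 2 * h 1 3 + var 3 * h 1 2)"
    unfolding r(1) by (rule koszul_identities(4))
  then have "F dvd var 1 * r 2 3 - var 2 * r 1 3 + var 3 * r 1 2"
    using cocycle[of 1 2 3] by (metis dvd_add_left_iff dvd_triv_left)
  then have "var 1 * r 2 3 - var 2 * r 1 3 + var 3 * r 1 2 = 0"
    using r(2) by (intro division_unique deg0_le_add deg0_le_diff deg0_le_var_mult) auto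
  then obtain a1 a2 a3 where a: "r 1 2 = var 2 * a1 - var 1 * a2" "r 1 3 = var 3 * a1 - var 1 * a3"
    "r 2 3 = var 3 * a2 - var 2 * a3" by (rule koszul_2)
  define a' where "a' i = (if i = 1 then a1 else if i = 2 then a2 else a3)" for i :: 4
  have c': "F dvd c i j - (var j * a' i - var i * a' j)" if "i = 1 \<and> j = 2 \<or> i = 1 \<and> j = 3 \<or> i = 2 \<and> j = 3" for i j
    using that r(1)[of i j] a by (auto simp: a'_def)
  have csym: "F dvd c j i - (var i * b j - var j * b i)" if "F dvd c i j - (var j * b i - var i * b j)" for b i j
  proof -
    have "c j i - (var i * b j - var j * b i) = (c i j + c j i) - (c i j - (var j * b i - var i * b j))"
      by (rule koszul_identities(5))
    then show ?thesis using alt(1)[of i j] that by (metis dvd_diff)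
  qed
  have refl: "F dvd c i i - (var i * b i - var i * b i)" for b i using alt(2)[of i] by simp
  have c'': "F dvd c i j - (var j * a' i - var i * a' j)" if "i \<noteq> 0" "j \<noteq> 0" for i j
    
  proof -
    have p: "F dvd c 1 2 - (var 2 * a' 1 - var 1 * a' 2)" "F dvd c 1 3 - (var 3 * a' 1 - var 1 * a' 3)"
      "F dvd c 2 3 - (var 3 * a' 2 - var 2 * a' 3)" by (rule c', simp)+
    show ?thesis
      using that exhaust_4'[of i] exhaust_4'[of j] p csym[OF p(1)] csym[OF p(2)] csym[OF p(3)] refl[of i a'] by auto
  qed
  define d where "d i = c 0 i + var 0 * a' i" for i
  have "F dvd var j * d i - var i * d j" if "i \<noteq> 0" "j \<noteq> 0" for i j
  proof -
    have "var j * d i - var i * d j = (var 0 * c i j - var i * c 0 j + var j * c 0 i)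
        - var 0 * (c i j - (var j * a' i - var i * a' j))"
      unfolding d_def by (rule koszul_identities(6))
    then show ?thesis using cocycle[of 0 i j] c''[OF that] by (metis dvd_diff dvd_mult)
  qed
  then obtain e where e: "\<And>i. i \<noteq> 0 \<Longrightarrow> F dvd d i - var i * e" using koszul_1_mod[of d] by metis
  define b where "b i = (if i = 0 then e else a' i)" for i
  have b0: "F dvd c 0 i - (var i * b 0 - var 0 * b i)" if "i \<noteq> 0" for i
    using e[OF that] that by (simp add: b_def d_def koszul_identities(7))
  show ?thesis
  proof (rule that[of b])
    fix i j
    show "F dvd c i j - (var j * b i - var i * b j)"
    proof (cases "i = 0 \<or> j = 0")
      case True
      then show ?thesis using b0[of j] csym[OF b0[of i]] refl[of i b] by (cases "i = j") auto
    next
      case False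
      then show ?thesis using c''[of i j] by (simp add: b_def)
    qed
  qed
qed

end

section \<open>Evaluation, minors and open conditions\<close>

definition mev :: "('i \<Rightarrow> 'a::comm_ring_1) \<Rightarrow> 'i monom \<Rightarrow> 'a"
  where "mev x m = (\<Prod>i\<in>Poly_Mapping.keys m. x i ^ Poly_Mapping.lookup m i)"

lemma mev_superset:
  "finite S \<Longrightarrow> Poly_Mapping.keys m \<subseteq> S \<Longrightarrow> mev x m = (\<Prod>i\<in>S. x i ^ Poly_Mapping.lookup m i)"
  unfolding mev_def by (intro prod.mono_neutral_left) (auto simp: in_keys_iff)

lemma mev_0 [simp]: "mev x 0 = 1"
  by (simp add: mev_def)

lemma mev_single [simp]: "mev x (Poly_Mapping.single i n) = x i ^ n"
  by (subst mev_superset[of "{i}"]) auto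

lemma mev_add: "mev x (m + m') = mev x m * mev x m'"
proof -
  let ?S = "Poly_Mapping.keys m \<union> Poly_Mapping.keys m'"
  show ?thesis using keys_add[of m m']
    by (subst (1 2 3) mev_superset[of ?S]) (auto simp: lookup_add power_add prod.distrib)
qed

text \<open>Evaluation along a homomorphism of the coefficients.\<close>

definition subst :: "('k::comm_ring_1 \<Rightarrow> 'a::comm_ring_1) \<Rightarrow> ('i \<Rightarrow> 'a) \<Rightarrow> ('i, 'k) mpoly \<Rightarrow> 'a"
  where "subst h x p = (\<Sum>m\<in>Poly_Mapping.keys p. h (Poly_Mapping.lookup p m) * mev x m)"

context comm_ring_hom
begin

lemma subst_superset:
  "finite S \<Longrightarrow> Poly_Mapping.keys p \<subseteq> S \<Longrightarrow> subst hom x p = (\<Sum>m\<in>S. hom (Poly_Mapping.lookup p m) * mev x m)"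
  unfolding subst_def by (intro sum.mono_neutral_left) (auto simp: in_keys_iff hom_zero)

lemma subst_single: "subst hom x (Poly_Mapping.single m a) = hom a * mev x m"
  by (subst subst_superset[of "{m}"]) auto

lemma subst_add: "subst hom x (p + q) = subst hom x p + subst hom x q"
proof -
  let ?S = "Poly_Mapping.keys p \<union> Poly_Mapping.keys q"
  show ?thesis using keys_add[of p q]
    by (subst (1 2 3) subst_superset[of ?S]) (auto simp: lookup_add hom_add sum.distrib distrib_right)
qed

lemma subst_mult: "subst hom x (p * q) = subst hom x p * subst hom x q"
proof (induction p rule: mpoly_induct)
  case (single m a)
  show ?case
  proof (induction q rule: mpoly_induct)
    case (single n b)
    then show ?case by (simp add: mult_single subst_single hom_mult mev_add ac_simps)
  next
    case (add p q)
    then show ?case by (simp only: distrib_left subst_add)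
  qed
next
  case (add p p')
  then show ?case by (simp only: distrib_right subst_add)
qed

lemma comm_ring_hom_subst: "comm_ring_hom (subst hom x)"
proof
  show "subst hom x 0 = 0" by (simp add: subst_def)
  show "subst hom x 1 = 1"
    using subst_single[of x 0 1] by (simp add: single_one)
qed (rule subst_add subst_mult)+

end

lemma comm_ring_hom_id: "comm_ring_hom (\<lambda>c :: 'k::comm_ring_1. c)"
  by unfold_locales auto

lemma comm_ring_hom_const: "comm_ring_hom (\<lambda>c :: 'k::comm_ring_1. [:c:])"
  by unfold_locales (auto simp: one_pCons)

lemma eval_mpoly_eq_subst: "eval_mpoly x = subst (\<lambda>c. c) x"
  by (rule ext) (simp add: eval_mpoly_def subst_def mev_def)

interpretation ev: comm_ring_hom "eval_mpoly x :: ('i, 'k::comm_ring_1) mpoly \<Rightarrow> 'k"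
  unfolding eval_mpoly_eq_subst by (rule comm_ring_hom.comm_ring_hom_subst[OF comm_ring_hom_id])

lemma eval_single: "eval_mpoly x (Poly_Mapping.single m a) = a * mev x m"
  unfolding eval_mpoly_eq_subst by (rule comm_ring_hom.subst_single[OF comm_ring_hom_id])

lemma eval_var [simp]: "eval_mpoly x (var i) = x i"
  by (simp add: var_def eval_single)

lemma eval_cmul [simp]: "eval_mpoly x (cmul c p) = c * eval_mpoly x p"
  by (simp add: cmul_def ev.hom_mult eval_single)

lemma prod_4: "(\<Prod>x\<in>UNIV. f x) = f 0 * f 1 * f 2 * f (3::4)"
  unfolding UNIV_4 by (simp add: mult.assoc)

text \<open>Kronecker substitution reduces the next lemma to one variable: for large \<open>N\<close>, the monomials
  of \<open>p\<close> have distinct images under \<open>x\<^sub>i \<mapsto> T^(N^i)\<close>.\<close>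

lemma nonvanishing_point:
  fixes p :: "(4, 'k::field) mpoly"
  assumes "infinite (UNIV :: 'k set)" "p \<noteq> 0"
  obtains x where "eval_mpoly x p \<noteq> 0"
proof -
  define N where "N = Suc (Max (mdeg ` Poly_Mapping.keys p))"
  have N: "Poly_Mapping.lookup m i < N" if "m \<in> Poly_Mapping.keys p" for m and i :: 4
  proof -
    have "Poly_Mapping.lookup m i \<le> mdeg m"
      using mdeg_superset[of UNIV m] member_le_sum[of i UNIV "Poly_Mapping.lookup m"] by simp
    also have "\<dots> \<le> Max (mdeg ` Poly_Mapping.keys p)" using that by (intro Max_ge) auto
    finally show ?thesis by (simp add: N_def)
  qed
  define \<phi> where "\<phi> m = Poly_Mapping.lookup m 0 + N * (Poly_Mapping.lookup m 1 + N * (Poly_Mapping.lookup m 2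
    + N * Poly_Mapping.lookup m 3))" for m :: "4 monom"
  have digits: "a = a' \<and> b = b'" if "a + N * b = a' + N * b'" "a < N" "a' < N" for a b a' b' :: nat
    using arg_cong[OF that(1), of "\<lambda>x. x mod N"] arg_cong[OF that(1), of "\<lambda>x. x div N"] that(2,3) by simp
  have inj: "m = m'" if "\<phi> m = \<phi> m'" "m \<in> Poly_Mapping.keys p" "m' \<in> Poly_Mapping.keys p" for m m'
  proof -
    have a: "Poly_Mapping.lookup m 0 = Poly_Mapping.lookup m' 0"
      "Poly_Mapping.lookup m 1 + N * (Poly_Mapping.lookup m 2 + N * Poly_Mapping.lookup m 3)
        = Poly_Mapping.lookup m' 1 + N * (Poly_Mapping.lookup m' 2 + N * Poly_Mapping.lookup m' 3)"
      using digits[OF that(1)[unfolded \<phi>_def] N[OF that(2)] N[OF that(3)]] by auto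
    have b: "Poly_Mapping.lookup m 1 = Poly_Mapping.lookup m' 1"
      "Poly_Mapping.lookup m 2 + N * Poly_Mapping.lookup m 3
        = Poly_Mapping.lookup m' 2 + N * Poly_Mapping.lookup m' 3"
      using digits[OF a(2) N[OF that(2)] N[OF that(3)]] by auto
    have c: "Poly_Mapping.lookup m 2 = Poly_Mapping.lookup m' 2" "Poly_Mapping.lookup m 3 = Poly_Mapping.lookup m' 3"
      using digits[OF b(2) N[OF that(2)] N[OF that(3)]] by auto
    show ?thesis
    proof (rule poly_mapping_eqI)
      fix i show "Poly_Mapping.lookup m i = Poly_Mapping.lookup m' i"
        using exhaust_4'[of i] a(1) b(1) c by auto
    qed
  qed
  define q where "q = (\<Sum>m\<in>Poly_Mapping.keys p. Polynomial.monom (Poly_Mapping.lookup p m) (\<phi> m))"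
  obtain m where m: "m \<in> Poly_Mapping.keys p" using assms(2) keys_eq_empty by fastforce
  have "coeff q (\<phi> m) = (\<Sum>m'\<in>Poly_Mapping.keys p. if m' = m then Poly_Mapping.lookup p m else 0)"
    unfolding q_def coeff_sum using inj m by (intro sum.cong) auto
  then have "coeff q (\<phi> m) \<noteq> 0" using m by (simp add: in_keys_iff)
  then have "q \<noteq> 0" by auto
  then obtain \<tau> where \<tau>: "poly q \<tau> \<noteq> 0"
    using ex_new_if_finite[OF assms(1) poly_roots_finite] by auto
  define x where "x i = (if i = 0 then \<tau> else if i = 1 then \<tau> ^ N else if i = 2 then \<tau> ^ (N * N) else \<tau> ^ (N * N * N))" for i :: 4
  have "mev x m = \<tau> ^ \<phi> m" for m
  proof -
    have "mev x m = x 0 ^ Poly_Mapping.lookup m 0 * (x 1 ^ Poly_Mapping.lookup m 1 *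
      (x 2 ^ Poly_Mapping.lookup m 2 * x 3 ^ Poly_Mapping.lookup m 3))"
      by (subst mev_superset[of UNIV]) (simp_all add: prod_4 mult.assoc)
    also have "\<dots> = \<tau> ^ \<phi> m"
      by (simp add: x_def \<phi>_def power_mult[symmetric] power_add[symmetric] algebra_simps)
    finally show ?thesis .
  qed
  then have "eval_mpoly x p = poly q \<tau>"
    unfolding eval_mpoly_eq_subst subst_def q_def poly_sum by (simp add: poly_monom)
  then show ?thesis using that \<tau> by metis
qed

text \<open>Linearly independent functions take independent values at suitable points, chosen one after the other
  by expansion along the last row.\<close>

lemma exists_nonzero_minor:
  fixes v :: "nat \<Rightarrow> 'x \<Rightarrow> 'k::field"
  assumes "\<And>u i. (\<And>x. (\<Sum>l<N. u l * v l x) = 0) \<Longrightarrow> i < N \<Longrightarrow> u i = 0"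
  shows "\<exists>x. det (mat N N (\<lambda>(j, l). v l (x j))) \<noteq> 0"
  using assms
proof (induction N)
  case 0
  then show ?case by simp
next
  case (Suc N)
  have "\<exists>x. det (mat N N (\<lambda>(j, l). v l (x j))) \<noteq> 0"
  proof (rule Suc.IH)
    fix u i assume u: "\<And>x. (\<Sum>l<N. u l * v l x) = 0" and i: "i < N"
    have "(\<Sum>l<Suc N. (u(N := 0)) l * v l x) = 0" for x
      using u[of x] by (simp add: sum.lessThan_Suc)
    from Suc.prems[of "u(N := 0)" i, OF this] i show "u i = 0" by simp
  qed
  then obtain x where x: "det (mat N N (\<lambda>(j, l). v l (x j))) \<noteq> 0" by blast
  define A where "A y = mat (Suc N) (Suc N) (\<lambda>(j, l). v l (if j < N then x j else y))" for y
  define C where "C l = cofactor (A undefined) N l" for l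
  have cof: "cofactor (A y) N l = C l" if "l < Suc N" for y l
  proof -
    have "mat_delete (A y) N l = mat_delete (A undefined) N l"
      using that by (intro eq_matI) (auto simp: mat_delete_def A_def)
    then show ?thesis by (simp add: C_def cofactor_def)
  qed
  have "mat_delete (A undefined) N N = mat N N (\<lambda>(j, l). v l (x j))"
    by (intro eq_matI) (auto simp: mat_delete_def A_def)
  then have "C N \<noteq> 0" using x by (simp add: C_def cofactor_def)
  have det: "det (A y) = (\<Sum>l<Suc N. C l * v l y)" for y
  proof -
    have "det (A y) = (\<Sum>l<Suc N. A y $$ (N, l) * cofactor (A y) N l)"
      by (rule laplace_expansion_row) (auto simp: A_def)
    also have "\<dots> = (\<Sum>l<Suc N. C l * v l y)"
      by (intro sum.cong refl) (auto simp: cof, simp add: A_def)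
    finally show ?thesis .
  qed
  have "\<exists>y. det (A y) \<noteq> 0"
  proof (rule ccontr)
    assume "\<not> ?thesis"
    then have "\<And>y. (\<Sum>l<Suc N. C l * v l y) = 0" using det by simp
    from Suc.prems[of C N, OF this] \<open>C N \<noteq> 0\<close> show False by simp
  qed
  then obtain y where "det (A y) \<noteq> 0" by blast
  then show ?case unfolding A_def by (intro exI[of _ "\<lambda>j. if j < N then x j else y"])
qed

lemma det_nonzero_kernel:
  fixes f :: "nat \<Rightarrow> nat \<Rightarrow> 'k::field"
  assumes "det (mat N N (\<lambda>(j, l). f j l)) \<noteq> 0" "\<And>j. j < N \<Longrightarrow> (\<Sum>l<N. f j l * u l) = 0" "i < N"
  shows "u i = 0"
proof -
  let ?A = "mat N N (\<lambda>(j, l). f j l)"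
  have "?A *\<^sub>v vec N u = 0\<^sub>v N"
    using assms(2) by (intro eq_vecI) (auto simp: scalar_prod_def atLeast0LessThan)
  then have "vec N u = 0\<^sub>v N"
    using assms(1) mat_carrier[of N N "\<lambda>(j, l). f j l"] det_0_iff_vec_prod_zero_field[of ?A N] vec_carrier[of N u] by blast
  then have "vec N u $ i = 0\<^sub>v N $ i" by simp
  then show ?thesis using assms(3) by simp
qed

lemma one_in_forms [simp]: "(1 :: ('i, 'k::comm_ring_1) mpoly) \<in> forms 0"
  by (metis single_one single_in_forms mdeg_zero)

lemma det_in_forms:
  fixes A :: "('i, 'k::comm_ring_1) mpoly mat"
  assumes "A \<in> carrier_mat n n" "\<And>i j. i < n \<Longrightarrow> j < n \<Longrightarrow> A $$ (i, j) \<in> forms 1"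
  shows "det A \<in> forms n"
proof -
  have pr: "(\<Prod>i = 0..<k. f i) \<in> forms k" if "\<And>i. i < k \<Longrightarrow> f i \<in> forms 1" for f :: "nat \<Rightarrow> ('i, 'k) mpoly" and k
    using that
  proof (induction k)
    case 0
    then show ?case by simp
  next
    case (Suc k)
    then show ?case using forms_mult[of "\<Prod>i = 0..<k. f i" k "f k" 1]
      by (metis Suc_eq_plus1 lessI less_SucI prod.atLeast0_lessThan_Suc)
  qed
  have "signof p * (\<Prod>i = 0..<n. A $$ (i, p i)) \<in> forms (0 + n)" if "p permutes {0..<n}" for p
  proof (rule forms_mult)
    show "(signof p :: ('i, 'k) mpoly) \<in> forms 0"
      by (auto simp: sign_def forms_uminus)
    show "(\<Prod>i = 0..<n. A $$ (i, p i)) \<in> forms n"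
      using that assms(2) permutes_in_image[OF that] by (intro pr) auto
  qed
  then show ?thesis unfolding det_def'[OF assms(1)] by (intro forms_sum) auto
qed

text \<open>Conditions of the form "a tuple of polynomials in a given space that is killed by \<open>c\<close> is
  trivial" are open in \<open>c\<close>: they are implied by the nonvanishing of a minor of a matrix whose
  entries are linear in \<open>c\<close>.\<close>

lemma open_condition:
  fixes Z Z0 :: "('j \<Rightarrow> (4, 'k::field) mpoly) set"
  assumes Z: "W.subspace Z" "W.fin_dim Z" "W.subspace Z0" "Z0 \<subseteq> Z"
    and c0: "\<And>v. v \<in> Z \<Longrightarrow> (\<And>j. act (v j) c0 = 0) \<Longrightarrow> v \<in> Z0"
  obtains P e where "P \<in> forms e" "eval_mpoly c0 P \<noteq> 0"
    "\<And>c v. eval_mpoly c P \<noteq> 0 \<Longrightarrow> (\<And>v j. v \<in> Z0 \<Longrightarrow> act (v j) c = 0) \<Longrightarrow> v \<in> Z \<Longrightarrow>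
      (\<And>j. act (v j) c = 0) \<Longrightarrow> v \<in> Z0"
proof -
  obtain b and n :: nat where b: "\<And>x. x \<in> Z \<Longrightarrow> \<exists>u. x - (\<Sum>i<n. tscale (u i) (b i)) \<in> Z0"
    "\<And>i. i < n \<Longrightarrow> b i \<in> Z"
    "\<And>u i. (\<Sum>i<n. tscale (u i) (b i)) \<in> Z0 \<Longrightarrow> i < n \<Longrightarrow> u i = 0"
    by (rule W.basis_modulo[OF Z]) blast
  have lin: "act ((\<Sum>i<n. tscale (u i) (b i)) j) c m = (\<Sum>i<n. u i * act (b i j) c m)" for u j c m
    by (simp add: sum_fun_apply act_sum act_cmul)
  have "\<exists>x. det (mat n n (\<lambda>(k, l). (\<lambda>(j, m). act (b l j) c0 m) (x k))) \<noteq> 0"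
  proof (rule exists_nonzero_minor)
    fix u i assume u: "\<And>x. (\<Sum>l<n. u l * (\<lambda>(j, m). act (b l j) c0 m) x) = 0" and i: "i < n"
    have "act ((\<Sum>i<n. tscale (u i) (b i)) j) c0 = 0" for j
      using u[of "(j, _)"] by (intro ext) (simp add: lin)
    moreover have "(\<Sum>i<n. tscale (u i) (b i)) \<in> Z"
      using b(2) Z(1) by (intro W.subspace_sum W.subspace_scale) auto
    ultimately show "u i = 0" using b(3)[OF c0 i] by simp
  qed
  then obtain x where x: "det (mat n n (\<lambda>(k, l). (\<lambda>(j, m). act (b l j) c0 m) (x k))) \<noteq> 0" by blast
  define L where "L = (\<lambda>(k, l). (\<lambda>(j, m). \<Sum>q\<in>Poly_Mapping.keys (b l j).
    Poly_Mapping.single (Poly_Mapping.single (q + m) 1) (Poly_Mapping.lookup (b l j) q)) (x k) :: (4 monom, 'k) mpoly)"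
  define P where "P = det (mat n n L)"
  have evL: "eval_mpoly c (L (k, l)) = (\<lambda>(j, m). act (b l j) c m) (x k)" for c k l
    by (simp add: L_def split_beta ev.hom_sum eval_single act_def pair_def)
  have evP: "eval_mpoly c P = det (mat n n (\<lambda>(k, l). (\<lambda>(j, m). act (b l j) c m) (x k)))" for c
  proof -
    have "eval_mpoly c P = det (map_mat (eval_mpoly c) (mat n n L))" by (simp add: P_def)
    also have "map_mat (eval_mpoly c) (mat n n L) = mat n n (\<lambda>(k, l). (\<lambda>(j, m). act (b l j) c m) (x k))"
      by (intro eq_matI) (auto simp: evL)
    finally show ?thesis .
  qed
  show ?thesis
  proof
    show "P \<in> forms n" unfolding P_def
      by (rule det_in_forms) (auto simp: L_def split_beta intro!: forms_sum)
    show "eval_mpoly c0 P \<noteq> 0" using x by (simp add: evP)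
    fix c v
    assume c: "eval_mpoly c P \<noteq> 0" "\<And>v j. v \<in> Z0 \<Longrightarrow> act (v j) c = 0" and v: "v \<in> Z" "\<And>j. act (v j) c = 0"
    obtain u where u: "v - (\<Sum>i<n. tscale (u i) (b i)) \<in> Z0" using b(1)[OF v(1)] by blast
    have z: "(\<Sum>l<n. u l * act (b l j) c m) = 0" for j m
    proof -
      have "act (v j - (\<Sum>i<n. tscale (u i) (b i)) j) c m = 0"
        using fun_cong[OF c(2)[OF u, of j], of m] by simp
      then show ?thesis using fun_cong[OF v(2)[of j], of m]
        by (simp add: act_diff lin[symmetric])
    qed
    have "u i = 0" if "i < n" for i
    proof (rule det_nonzero_kernel[OF _ _ that])
      show "det (mat n n (\<lambda>(k, l). (\<lambda>(j, m). act (b l j) c m) (x k))) \<noteq> 0" using c(1) by (simp add: evP)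
      show "(\<Sum>l<n. (\<lambda>(j, m). act (b l j) c m) (x k) * u l) = 0" for k
        using z by (simp add: split_beta mult.commute)
    qed
    then have "(\<Sum>i<n. tscale (u i) (b i)) = 0" by (intro sum.neutral) auto
    then show "v \<in> Z0" using u by simp
  qed
qed

section \<open>Irreducibility of a general quadric\<close>

lemma add_single_eq_iff:
  "Poly_Mapping.single i (1::nat) + Poly_Mapping.single j 1 = Poly_Mapping.single k 1 + Poly_Mapping.single l 1
    \<longleftrightarrow> (i = k \<and> j = l) \<or> (i = l \<and> j = k)"
proof
  assume eq: "Poly_Mapping.single i (1::nat) + Poly_Mapping.single j 1 = Poly_Mapping.single k 1 + Poly_Mapping.single l 1"
  have inj: "a = b" if "Poly_Mapping.single a (1::nat) = Poly_Mapping.single b 1" for a b :: 'a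
    using arg_cong[OF that, of "\<lambda>m. Poly_Mapping.lookup m a"] by (auto simp: lookup_single when_def split: if_splits)
  have "i = k \<or> i = l"
    using arg_cong[OF eq, of "\<lambda>m. Poly_Mapping.lookup m i"]
    by (auto simp: lookup_add lookup_single when_def split: if_splits)
  then show "(i = k \<and> j = l) \<or> (i = l \<and> j = k)"
  proof
    assume "i = k"
    then have "Poly_Mapping.single j (1::nat) = Poly_Mapping.single l 1" using eq by simp
    then show ?thesis using inj \<open>i = k\<close> by blast
  next
    assume "i = l"
    then have "Poly_Mapping.single j (1::nat) = Poly_Mapping.single k 1" using eq by (simp add: add.commute)
    then show ?thesis using inj \<open>i = l\<close> by blast
  qed
qed (auto simp: add.commute)

definition quad_coeff :: "('i, 'k::zero) mpoly \<Rightarrow> 'i \<Rightarrow> 'i \<Rightarrow> 'k"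
  where "quad_coeff F i j = Poly_Mapping.lookup F (Poly_Mapping.single i 1 + Poly_Mapping.single j 1)"

lemma var_mult_var: "cmul c (var i * var j) = Poly_Mapping.single (Poly_Mapping.single i 1 + Poly_Mapping.single j 1) c"
  by (simp add: var_def mult_single cmul_simps)

definition pairs4 :: "(4 \<times> 4) set"
  where "pairs4 = {(0,0), (0,1), (0,2), (0,3), (1,1), (1,2), (1,3), (2,2), (2,3), (3,3)}"

lemma pairs4_antisym: "(i, j) \<in> pairs4 \<Longrightarrow> (j, i) \<in> pairs4 \<Longrightarrow> i = j"
  using exhaust_4'[of i] exhaust_4'[of j] by (elim disjE) (simp_all add: pairs4_def)

lemma pairs4_total: "(i, j) \<in> pairs4 \<or> (j, i) \<in> pairs4"
  using exhaust_4'[of i] exhaust_4'[of j] by (elim disjE) (simp_all add: pairs4_def)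

lemma quadratic_form_expansion:
  fixes F :: "(4, 'k::comm_ring_1) mpoly"
  assumes "F \<in> forms 2"
  shows "F = (\<Sum>(i, j)\<in>pairs4. cmul (quad_coeff F i j) (var i * var j))"
proof (rule poly_mapping_eqI)
  fix m :: "4 monom"
  let ?e = "\<lambda>i::4. Poly_Mapping.single i (1::nat)"
  show "Poly_Mapping.lookup F m = Poly_Mapping.lookup (\<Sum>(i, j)\<in>pairs4. cmul (quad_coeff F i j) (var i * var j)) m"
  proof (cases "mdeg m = 2")
    case False
    have 0: "Poly_Mapping.lookup p m = 0" if "p \<in> forms 2" for p :: "(4, 'k) mpoly"
      using that False by (auto simp: in_forms_iff)
    have "(\<Sum>(i, j)\<in>pairs4. cmul (quad_coeff F i j) (var i * var j)) \<in> forms 2"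
      unfolding var_mult_var by (intro forms_sum) auto
    then show ?thesis using 0 assms by simp
  next
    case True
    then obtain i m' where m: "m = ?e i + m'" using monom_factor_pos[of m] by auto
    then have "mdeg m' > 0" using True by simp
    then obtain j m'' where m': "m' = ?e j + m''" by (rule monom_factor_pos)
    then have "m'' = 0" using True m by (simp add: mdeg_eq_0_iff)
    then have "m = ?e i + ?e j" using m m' by simp
    then obtain i j where ij: "m = ?e i + ?e j" "(i, j) \<in> pairs4"
      using pairs4_total[of i j] by (metis add.commute)
    have "Poly_Mapping.lookup (\<Sum>(i, j)\<in>pairs4. cmul (quad_coeff F i j) (var i * var j)) m
        = (\<Sum>p\<in>pairs4. if p = (i, j) then quad_coeff F i j else 0)"
      unfolding lookup_sum
    proof (intro sum.cong refl)
      fix p assume p: "p \<in> pairs4"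
      obtain k l where kl: "p = (k, l)" by (cases p)
      have "(?e k + ?e l = m) \<longleftrightarrow> p = (i, j)"
        using ij p pairs4_antisym[of i j] unfolding kl ij(1) add_single_eq_iff by auto
      then show "Poly_Mapping.lookup (case p of (i, j) \<Rightarrow> cmul (quad_coeff F i j) (var i * var j)) m
          = (if p = (i, j) then quad_coeff F i j else 0)"
        by (auto simp: kl var_mult_var lookup_single when_def)
    qed
    also have "\<dots> = quad_coeff F i j" using ij(2) by (simp add: pairs4_def)
    finally show ?thesis by (simp add: ij(1) quad_coeff_def)
  qed
qed

lemma poly_bezout:
  fixes p q :: "'k::field poly"
  shows "\<exists>d u v p' q'. p = d * p' \<and> q = d * q' \<and> d = u * p + v * q"
proof (induction "if q = 0 then 0 else Suc (degree q)" arbitrary: p q rule: less_induct)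
  case less
  show ?case
  proof (cases "q = 0")
    case True
    then show ?thesis
      by (intro exI[of _ p] exI[of _ 1] exI[of _ 0] exI[of _ 1] exI[of _ 0]) auto
  next
    case False
    have "(if p mod q = 0 then 0 else Suc (degree (p mod q))) < (if q = 0 then 0 else Suc (degree q))"
      using False degree_mod_less[OF False, of p] by auto
    from less[OF this] obtain d u v q' r' where d: "q = d * q'" "p mod q = d * r'" "d = u * q + v * (p mod q)"
      by blast
    have p: "p = q * (p div q) + p mod q" by simp
    have "p = d * (q' * (p div q) + r')"
      by (subst p, subst d(1), subst d(2)) (simp add: algebra_simps)
    moreover have "d = v * p + (u - v * (p div q)) * q"
    proof -
      have "v * p + (u - v * (p div q)) * q = u * q + v * (p - q * (p div q))"
        by (simp add: algebra_simps)
      then show ?thesis using d(3) by (simp only: minus_mult_div_eq_mod)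
    qed
    ultimately show ?thesis using d(1) by blast
  qed
qed

lemma square_identity:
  fixes a :: "'r::comm_ring_1"
  shows "a * ((u * p + v * q) * (u * p + v * q)) = u * u * (a * p * p) + q * (a * (2 * u * p * v + v * v * q))"
  by (simp add: algebra_simps)

text \<open>A binary quadratic polynomial that has a zero over \<open>k(T)\<close>, and whose coefficients have the
  degrees of a dehomogenized ternary quadratic form, has a root in \<open>k[T]\<close> of degree at most one.
  Then the form is a product of linear forms, and its discriminant vanishes.\<close>

lemma quadratic_discriminant_zero:
  fixes p q :: "'k::field poly"
  assumes A: "A \<noteq> 0" and q: "q \<noteq> 0"
    and eq: "[:A:] * p * p - [:l0, l1:] * p * q + [:q0, q1, q2:] * q * q = 0"
  shows "4 * A * q2 * q0 + q1 * l0 * l1 - A * q1 * q1 - q2 * l0 * l0 - q0 * l1 * l1 = 0"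
proof -
  obtain d u v p' q' where d: "p = d * p'" "q = d * q'" "d = u * p + v * q"
    using poly_bezout[of p q] by blast
  have d0: "d \<noteq> 0" using q d(2) by auto
  have "d * 1 = d * (u * p' + v * q')" by (subst d(3), subst d(1), subst d(2)) (simp add: algebra_simps)
  then have bz: "1 = u * p' + v * q'" using d0 by (metis mult_left_cancel)
  let ?L = "[:l0, l1:]" let ?Q = "[:q0, q1, q2:]"
  have "d * d * ([:A:] * p' * p' - ?L * p' * q' + ?Q * q' * q') = 0"
    using eq unfolding d(1,2) by (simp add: algebra_simps)
  then have e: "[:A:] * p' * p' - ?L * p' * q' + ?Q * q' * q' = 0" using d0 by simp
  define s where "s = ?L * p' - ?Q * q'"
  have s: "[:A:] * p' * p' = q' * s" using e by (simp add: s_def algebra_simps)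
  define w where "w = u * u * s + [:A:] * (2 * u * p' * v + v * v * q')"
  have "[:A:] * 1 = [:A:] * ((u * p' + v * q') * (u * p' + v * q'))"
    by (simp only: bz[symmetric] mult_1_right)
  also have "\<dots> = u * u * ([:A:] * p' * p') + q' * ([:A:] * (2 * u * p' * v + v * v * q'))"
    by (rule square_identity)
  also have "\<dots> = q' * w"
    unfolding s w_def by (simp only: distrib_left mult.left_commute[of "u * u"])
  finally have w: "[:A:] = q' * w" by (simp only: mult_1_right)
  have nz: "q' \<noteq> 0" "w \<noteq> 0" using w A by auto
  have "degree (q' * w) = 0" by (simp only: w[symmetric] degree_pCons_0)
  then have "degree q' = 0" using degree_mult_eq[OF nz] by simp
  then obtain z where z: "q' = [:z:]" using degree_eq_zeroE by blast
  have z0: "z \<noteq> 0" using w A z by auto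
  define T where "T = smult (inverse z) p'"
  have p': "p' = smult z T" using z0 by (simp add: T_def)
  have "smult (z * z) ([:A:] * T * T - ?L * T + ?Q) = 0"
    using e unfolding z p' by (simp add: algebra_simps smult_add_right smult_diff_right)
  then have T: "[:A:] * T * T - ?L * T + ?Q = 0" using z0 by simp
  have "degree T \<le> 1"
  proof (rule ccontr)
    assume deg: "\<not> degree T \<le> 1"
    have "[:A:] * T * T = ?L * T - ?Q" using T by (simp add: algebra_simps)
    moreover have "degree ([:A:] * T * T) = 2 * degree T"
      using deg A by (simp add: degree_mult_eq) (metis degree_0 degree_mult_eq mult_2 zero_le)
    moreover have "degree (?L * T - ?Q) \<le> max (1 + degree T) 2"
    proof (intro degree_diff_le_max[THEN order_trans] max.mono)
      have "degree ?L \<le> 1" by (simp add: degree_pCons_eq_if)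
      then show "degree (?L * T) \<le> 1 + degree T" using degree_mult_le[of ?L T] by simp
      show "degree ?Q \<le> 2" by (simp add: degree_pCons_eq_if)
    qed
    ultimately show False using deg by simp
  qed
  then obtain \<beta> \<alpha> where "T = [:\<beta>, \<alpha>:]"
    by (metis One_nat_def degree_eq_zeroE degree_pCons_eq le_0_eq le_Suc_eq pCons_0_0 pCons_cases degree_pCons_eq_if old.nat.inject)
  with T have e: "A * \<beta> * \<beta> - l0 * \<beta> + q0 = 0" "2 * A * \<alpha> * \<beta> - l0 * \<alpha> - l1 * \<beta> + q1 = 0"
    "A * \<alpha> * \<alpha> - l1 * \<alpha> + q2 = 0"
    by (auto simp: algebra_simps)
  have "q0 = l0 * \<beta> - A * \<beta> * \<beta>" using e(1) by (simp add: algebra_simps)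
  moreover have "q1 = l0 * \<alpha> + l1 * \<beta> - 2 * A * \<alpha> * \<beta>" using e(2) by (simp add: algebra_simps)
  moreover have "q2 = l1 * \<alpha> - A * \<alpha> * \<alpha>" using e(3) by (simp add: algebra_simps)
  moreover have "4 * A * (l1 * \<alpha> - A * \<alpha> * \<alpha>) * (l0 * \<beta> - A * \<beta> * \<beta>)
    + (l0 * \<alpha> + l1 * \<beta> - 2 * A * \<alpha> * \<beta>) * l0 * l1
    - A * (l0 * \<alpha> + l1 * \<beta> - 2 * A * \<alpha> * \<beta>) * (l0 * \<alpha> + l1 * \<beta> - 2 * A * \<alpha> * \<beta>)
    - (l1 * \<alpha> - A * \<alpha> * \<alpha>) * l0 * l0 - (l0 * \<beta> - A * \<beta> * \<beta>) * l1 * l1 = 0"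
    by (simp add: algebra_simps)
  ultimately show ?thesis by (simp only:)
qed

lemma norm_zero_identities:
  fixes a :: "'r::comm_ring_1"
  assumes "a * f0 * g0 = q * f1 * g1" "a * (f0 * g1 + f1 * g0) = l * f1 * g1"
  shows "(a * f0 * f0 - l * f0 * f1 + q * f1 * f1) * g1 = 0"
    "a * ((a * f0 * f0 - l * f0 * f1 + q * f1 * f1) * g0) = 0"
proof -
  have "(a * f0 * f0 - l * f0 * f1 + q * f1 * f1) * g1 = a * f0 * f0 * g1 - f0 * (l * f1 * g1) + f1 * (q * f1 * g1)"
    by (simp add: algebra_simps)
  also have "\<dots> = 0" unfolding assms[symmetric] by (simp add: algebra_simps)
  finally show "(a * f0 * f0 - l * f0 * f1 + q * f1 * f1) * g1 = 0" .
  have "a * ((a * f0 * f0 - l * f0 * f1 + q * f1 * f1) * g0)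
      = a * (f0 * (a * f0 * g0) - l * f0 * f1 * g0 + q * f1 * f1 * g0)"
    by (simp add: algebra_simps)
  also have "\<dots> = a * (f0 * (q * f1 * g1) - l * f0 * f1 * g0 + q * f1 * f1 * g0)"
    by (simp only: assms(1))
  also have "\<dots> = q * f1 * (a * (f0 * g1 + f1 * g0)) - l * f1 * (a * f0 * g0)"
    by (simp add: algebra_simps)
  also have "\<dots> = q * f1 * (l * f1 * g1) - l * f1 * (q * f1 * g1)"
    by (simp only: assms)
  also have "\<dots> = 0" by (simp add: ac_simps)
  finally show "a * ((a * f0 * f0 - l * f0 * f1 + q * f1 * f1) * g0) = 0" .
qed

lemma product_identity:
  fixes a :: "'r::comm_ring_1"
  shows "a * ((f0 + x * f1 + (a * x * x + x * l + q) * h) * (g0 + x * g1 + (a * x * x + x * l + q) * h'))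
    = (a * f0 * g0 - q * f1 * g1) + x * (a * (f0 * g1 + f1 * g0) - l * f1 * g1)
      + (a * x * x + x * l + q) * (f1 * g1 + a * ((f0 + x * f1) * h' + h * (g0 + x * g1) + (a * x * x + x * l + q) * h * h'))"
  by (simp add: algebra_simps)

definition conic_discriminant :: "(4, 'k::comm_ring_1) mpoly \<Rightarrow> 'k"
  where "conic_discriminant F = (let f = quad_coeff F in
    4 * f 0 0 * f 1 1 * f 2 2 + f 1 2 * f 0 2 * f 0 1 - f 0 0 * f 1 2 * f 1 2
    - f 1 1 * f 0 2 * f 0 2 - f 2 2 * f 0 1 * f 0 1)"

context quadric
begin

abbreviation "f \<equiv> quad_coeff F"

definition lin :: "(4, 'k) mpoly" where "lin = cmul (f 0 1) (var 1) + cmul (f 0 2) (var 2) + cmul (f 0 3) (var 3)"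

definition quad :: "(4, 'k) mpoly" where "quad = cmul (f 1 1) (var 1 * var 1) + cmul (f 1 2) (var 1 * var 2) + cmul (f 1 3) (var 1 * var 3)
  + cmul (f 2 2) (var 2 * var 2) + cmul (f 2 3) (var 2 * var 3) + cmul (f 3 3) (var 3 * var 3)"

abbreviation "lc \<equiv> Poly_Mapping.single 0 F\<^sub>0\<^sub>0 :: (4, 'k) mpoly"

lemma f00: "f 0 0 = F\<^sub>0\<^sub>0"
  by (simp add: quad_coeff_def F\<^sub>0\<^sub>0_def single_add[symmetric])

lemma F_expansion: "F = lc * var 0 * var 0 + var 0 * lin + quad"
proof -
  have "F = cmul (f 0 0) (var 0 * var 0) + (cmul (f 0 1) (var 0 * var 1) + cmul (f 0 2) (var 0 * var 2)
      + cmul (f 0 3) (var 0 * var 3)) + quad"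
    by (subst quadratic_form_expansion[OF F2]) (simp add: pairs4_def quad_def add.assoc)
  also have "\<dots> = lc * var 0 * var 0 + var 0 * lin + quad"
    by (simp only: f00 lin_def distrib_left cmul_mult cmul_def[of "F\<^sub>0\<^sub>0"] mult.assoc)
  finally show ?thesis .
qed

lemma free_of_var_cmul: "free_of_var i p \<Longrightarrow> free_of_var i (cmul c p)"
  unfolding free_of_var_def by (metis lookup_cmul mult_zero_right)

lemma free_of_var_add: "free_of_var i p \<Longrightarrow> free_of_var i q \<Longrightarrow> free_of_var i (p + q)"
  unfolding free_of_var_def lookup_add by (metis add_0)

lemma free_lin_quad: "free_of_var 0 lin" "free_of_var 0 quad"
  unfolding lin_def quad_def
  by (simp_all add: free_of_var_add free_of_var_cmul free_of_var_mult free_of_var_var)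

lemma free_lc: "free_of_var 0 lc"
  by (auto simp: free_of_var_def lookup_single when_def)

lemma split_std:
  assumes "deg0_le 1 r"
  shows "r = (r - var 0 * divided_by_var 0 r) + var 0 * divided_by_var 0 r"
    "free_of_var 0 (r - var 0 * divided_by_var 0 r)" "free_of_var 0 (divided_by_var 0 r)"
proof -
  show "free_of_var 0 (divided_by_var 0 r)"
    unfolding free_of_var_def
  proof (intro allI impI)
    fix m assume "Poly_Mapping.lookup (divided_by_var 0 r) m \<noteq> 0"
    then have "Poly_Mapping.lookup (Poly_Mapping.single 0 1 + m) 0 \<le> 1"
      using assms unfolding deg0_le_def by simp
    then show "Poly_Mapping.lookup m 0 = 0" by (simp add: lookup_add)
  qed
qed (simp_all add: var_division)

lemma std_combine: "free_of_var 0 p \<Longrightarrow> free_of_var 0 q \<Longrightarrow> deg0_le 1 (p + var 0 * q)"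
proof -
  assume p: "free_of_var 0 p" and q: "free_of_var 0 q"
  have "deg0_le (1 + 0) (var 0 * q)"
    using q by (intro deg0_le_mult) (auto simp: deg0_le_def free_of_var_def var_def lookup_single when_def split: if_splits)
  then show ?thesis using p by (intro deg0_le_add) (auto simp: deg0_le_def free_of_var_def)
qed

lemma std_eq_0:
  assumes "free_of_var 0 p" "free_of_var 0 q" "F dvd p + var 0 * q"
  shows "p = 0" "q = 0"
proof -
  have z: "p + var 0 * q = 0" using assms by (intro division_unique std_combine)
  then have "var 0 * q = - p" by (simp add: eq_neg_iff_add_eq_0 add.commute)
  moreover have "free_of_var 0 (- p)" using assms(1) by (simp add: free_of_var_def)
  ultimately show "q = 0" using free_of_var_var_mult by metis
  then show "p = 0" using z by simp
qed

text \<open>On the affine line \<open>x + T e\<^sub>1\<close> through a general point the equation becomes one over \<open>k[T]\<close>, and the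
  discriminant obstructs its solution.\<close>

lemma norm_form_anisotropic:
  assumes inf: "infinite (UNIV :: 'k set)" and disc: "conic_discriminant F \<noteq> 0"
    and eq: "lc * f0 * f0 - lin * f0 * f1 + quad * f1 * f1 = 0"
  shows "f1 = 0"
proof (rule ccontr)
  assume "f1 \<noteq> 0"
  define q1 :: "(4, 'k) mpoly" where "q1 = cmul (2 * f 1 1) (var 1) + cmul (f 1 2) (var 2) + cmul (f 1 3) (var 3)"
  define D :: "(4, 'k) mpoly" where "D = cmul (4 * F\<^sub>0\<^sub>0 * f 1 1) quad + cmul (f 0 1) (q1 * lin) - cmul F\<^sub>0\<^sub>0 (q1 * q1)
    - cmul (f 1 1) (lin * lin) - cmul (f 0 1 * f 0 1) quad"
  define x where "x i = (if i = 2 then 1 else 0 :: 'k)" for i :: 4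
  have x: "eval_mpoly x lin = f 0 2" "eval_mpoly x quad = f 2 2" "eval_mpoly x q1 = f 1 2"
    by (simp_all add: q1_def lin_def quad_def ev.hom_add ev.hom_mult x_def)
  have "eval_mpoly x D = 4 * F\<^sub>0\<^sub>0 * f 1 1 * f 2 2 + f 0 1 * (f 1 2 * f 0 2) - F\<^sub>0\<^sub>0 * (f 1 2 * f 1 2)
      - f 1 1 * (f 0 2 * f 0 2) - f 0 1 * f 0 1 * f 2 2"
    by (simp only: D_def ev.hom_add ev.hom_mult ev.hom_minus eval_cmul x)
  then have "eval_mpoly x D = conic_discriminant F"
    by (simp add: conic_discriminant_def Let_def f00 algebra_simps)
  then have "D \<noteq> 0" using disc by auto
  then have "f1 * D \<noteq> 0" using \<open>f1 \<noteq> 0\<close> by simp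
  then obtain \<alpha> where \<alpha>: "eval_mpoly \<alpha> (f1 * D) \<noteq> 0" using nonvanishing_point[OF inf] by blast
  interpret c: comm_ring_hom "\<lambda>c :: 'k. [:c:]" by (rule comm_ring_hom_const)
  define X where "X i = [:\<alpha> i, if i = 1 then 1 else 0:]" for i :: 4
  interpret s: comm_ring_hom "subst (\<lambda>c :: 'k. [:c:]) X :: (4, 'k) mpoly \<Rightarrow> _"
    by (rule c.comm_ring_hom_subst)
  let ?s = "subst (\<lambda>c :: 'k. [:c:]) X :: (4, 'k) mpoly \<Rightarrow> 'k poly"
  have sv: "?s (var i) = X i" for i by (simp add: var_def c.subst_single)
  have sc: "?s (cmul c p) = [:c:] * ?s p" for c p
    by (simp add: cmul_def s.hom_mult c.subst_single)
  have slc: "?s lc = [:F\<^sub>0\<^sub>0:]" by (simp add: c.subst_single)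
  have at0: "poly (?s p) 0 = eval_mpoly \<alpha> p" for p
  proof (induction p rule: mpoly_induct)
    case (single m a)
    have "poly (mev X m) 0 = mev \<alpha> m"
      by (simp add: mev_def poly_prod X_def)
    then show ?case by (simp add: c.subst_single eval_single)
  next
    case (add p q)
    then show ?case by (simp add: s.hom_add ev.hom_add)
  qed
  have sl: "?s lin = [:eval_mpoly \<alpha> lin, f 0 1:]"
    by (simp add: lin_def s.hom_add ev.hom_add sc sv X_def)
  have sq: "?s quad = [:eval_mpoly \<alpha> quad, eval_mpoly \<alpha> q1, f 1 1:]"
    by (simp add: quad_def q1_def s.hom_add s.hom_mult ev.hom_add ev.hom_mult sc sv X_def algebra_simps)
  have "?s f1 \<noteq> 0" using at0[of f1] \<alpha> by (auto simp: ev.hom_mult)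
  moreover have "?s (lc * f0 * f0 - lin * f0 * f1 + quad * f1 * f1) = 0" unfolding eq by simp
  then have "[:F\<^sub>0\<^sub>0:] * ?s f0 * ?s f0 - [:eval_mpoly \<alpha> lin, f 0 1:] * ?s f0 * ?s f1
      + [:eval_mpoly \<alpha> quad, eval_mpoly \<alpha> q1, f 1 1:] * ?s f1 * ?s f1 = 0"
    by (simp only: s.hom_add s.hom_minus s.hom_mult slc sl sq)
  ultimately have "4 * F\<^sub>0\<^sub>0 * f 1 1 * eval_mpoly \<alpha> quad + eval_mpoly \<alpha> q1 * eval_mpoly \<alpha> lin * f 0 1
      - F\<^sub>0\<^sub>0 * eval_mpoly \<alpha> q1 * eval_mpoly \<alpha> q1 - f 1 1 * eval_mpoly \<alpha> lin * eval_mpoly \<alpha> lin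
      - eval_mpoly \<alpha> quad * f 0 1 * f 0 1 = 0"
    by (intro quadratic_discriminant_zero[OF F00])
  then have "eval_mpoly \<alpha> D = 0"
    by (simp add: D_def ev.hom_add ev.hom_minus ev.hom_mult algebra_simps)
  then show False using \<alpha> by (simp add: ev.hom_mult)
qed

text \<open>Residue classes are written as \<open>f0 + x\<^sub>0 f1\<close>. If a product of two nonzero classes vanishes, then so does
  the norm of one of them to the polynomials without \<open>x\<^sub>0\<close>, and the norm form has no nontrivial zeros.\<close>

lemma prime:
  assumes inf: "infinite (UNIV :: 'k set)" and disc: "conic_discriminant F \<noteq> 0"
    and dvd: "F dvd p * q"
  shows "F dvd p \<or> F dvd q"
proof -
  obtain r h where r: "p = r + F * h" "deg0_le 1 r" by (rule division_exists)
  obtain r' h' where r': "q = r' + F * h'" "deg0_le 1 r'" by (rule division_exists)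
  define f0 f1 g0 g1 where "f0 = r - var 0 * divided_by_var 0 r" and "f1 = divided_by_var 0 r"
    and "g0 = r' - var 0 * divided_by_var 0 r'" and "g1 = divided_by_var 0 r'"
  have fr: "free_of_var 0 f0" "free_of_var 0 f1" "free_of_var 0 g0" "free_of_var 0 g1"
    and rr: "r = f0 + var 0 * f1" "r' = g0 + var 0 * g1"
    using split_std[OF r(2)] split_std[OF r'(2)] unfolding f0_def f1_def g0_def g1_def by auto
  define P where "P = lc * f0 * g0 - quad * f1 * g1"
  define Q where "Q = lc * (f0 * g1 + f1 * g0) - lin * f1 * g1"
  have "lc * (p * q) = P + var 0 * Q
      + F * (f1 * g1 + lc * ((f0 + var 0 * f1) * h' + h * (g0 + var 0 * g1) + F * h * h'))"
    unfolding r(1) r'(1) rr P_def Q_def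
    using product_identity[of lc f0 "var 0" f1 lin quad h g0 g1 h'] F_expansion by simp
  moreover have "F dvd lc * (p * q)" by (rule dvd_mult[OF dvd])
  ultimately have "F dvd P + var 0 * Q" by (metis dvd_add_left_iff dvd_triv_left)
  moreover have "free_of_var 0 P" "free_of_var 0 Q"
    unfolding P_def Q_def using fr free_lin_quad free_lc
    by (simp_all add: free_of_var_diff free_of_var_mult free_of_var_add)
  ultimately have "P = 0" "Q = 0" using std_eq_0 by blast+
  then have n: "(lc * f0 * f0 - lin * f0 * f1 + quad * f1 * f1) * g1 = 0"
    "lc * ((lc * f0 * f0 - lin * f0 * f1 + quad * f1 * f1) * g0) = 0"
    using norm_zero_identities[of lc f0 g0 quad f1 g1 lin] by (auto simp: P_def Q_def)
  have lc0: "lc \<noteq> 0" using F00 by (metis lookup_single_eq lookup_zero)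
  show ?thesis
  proof (cases "lc * f0 * f0 - lin * f0 * f1 + quad * f1 * f1 = 0")
    case True
    then have "f1 = 0" by (rule norm_form_anisotropic[OF inf disc])
    then have "f0 = 0" using True lc0 by simp
    then show ?thesis using \<open>f1 = 0\<close> r(1) rr by simp
  next
    case False
    then have "g1 = 0" "g0 = 0" using n lc0 by auto
    then show ?thesis using r'(1) rr by simp
  qed
qed

end

section \<open>The open conditions\<close>

lemma fin_dim_tuples: "W.fin_dim {v :: 'j::finite \<Rightarrow> (4, 'k::field) mpoly. \<forall>j. v j \<in> forms d}"
proof -
  obtain B where B: "finite B" "forms d \<subseteq> V.span (B :: (4, 'k) mpoly set)"
    using fin_dim_forms[of d] unfolding V.fin_dim_def by blast
  let ?C = "\<Union>j\<in>(UNIV :: 'j set). unit j ` B"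
  have "v \<in> W.span ?C" if v: "\<forall>j. v j \<in> forms d" for v
  proof -
    have "unit j (v j) \<in> W.span ?C" for j
    proof -
      have "v j \<in> V.span B" using v B by auto
      then have "unit j (v j) \<in> W.span (unit j ` B)"
        using module_hom.span_image[OF linear_unit[unfolded Vector_Spaces.linear_iff_module_hom], of j B] by blast
      then show ?thesis using W.span_mono[of "unit j ` B" ?C] by blast
    qed
    then have "(\<Sum>j\<in>UNIV. unit j (v j)) \<in> W.span ?C" by (intro W.span_sum) auto
    moreover have "(\<Sum>j\<in>UNIV. unit j (v j)) = v"
      by (rule ext) (simp add: sum_fun_apply unit_def)
    ultimately show ?thesis by simp
  qed
  moreover have "finite ?C" using B(1) by simp
  ultimately show ?thesis unfolding W.fin_dim_def by (intro exI[of _ ?C]) auto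
qed

lemma dvd_remainder: "F dvd p \<Longrightarrow> p = q + F * h \<Longrightarrow> F dvd q"
  for F :: "'r::comm_ring_1"
  by (simp add: dvd_add_left_iff)

lemma dvd_cmul: "F dvd p \<Longrightarrow> F dvd cmul c p"
  unfolding cmul_def by (rule dvd_mult)

context quadric
begin

text \<open>The first condition says that the quotient is compressed. The second one says that it has no
  linear second syzygies modulo the quadric: \<open>v (Some (i, j))\<close> are the coefficients of
  \<open>x\<^sub>i x\<^sub>j\<close> in such a syzygy, and they cancel up to a multiple \<open>v None\<close> of the quadric.\<close>

definition compressed :: "nat \<Rightarrow> (4 monom \<Rightarrow> 'k) \<Rightarrow> bool"
  where "compressed t c \<longleftrightarrow> (\<forall>p\<in>forms t. act p c = 0 \<longrightarrow> F dvd p)"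

definition syzygy_tuples :: "nat \<Rightarrow> ((4 \<times> 4) option \<Rightarrow> (4, 'k) mpoly) set"
  where "syzygy_tuples t = {v. (\<forall>j. v j \<in> forms (t + 1)) \<and>
    (\<forall>i. F dvd (\<Sum>j\<in>UNIV. var j * v (Some (i, j)))) \<and>
    (\<forall>i. F dvd v (Some (i, i)) - cmul (f i i) (v None)) \<and>
    (\<forall>i j. i \<noteq> j \<longrightarrow> F dvd v (Some (i, j)) + v (Some (j, i)) - cmul (f i j) (v None))}"

definition no_second_syzygies :: "nat \<Rightarrow> (4 monom \<Rightarrow> 'k) \<Rightarrow> bool"
  where "no_second_syzygies t c \<longleftrightarrow>
    (\<forall>v\<in>syzygy_tuples t. (\<forall>j. act (v j) c = 0) \<longrightarrow> (\<forall>j. F dvd v j))"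

lemma act_dvd: "F dvd p \<Longrightarrow> act F c = 0 \<Longrightarrow> act p c = 0"
  by (auto simp: dvd_def mult.commute[of F] act_mult act_fun)

lemma syzygy_tuples_subspace: "W.subspace (syzygy_tuples t)"
proof (rule W.subspaceI)
  show "0 \<in> syzygy_tuples t" by (simp add: syzygy_tuples_def cmul_simps)
next
  fix v w assume v: "v \<in> syzygy_tuples t" and w: "w \<in> syzygy_tuples t"
  have 1: "(\<Sum>j\<in>UNIV. var j * (v + w) (Some (i, j)))
      = (\<Sum>j\<in>UNIV. var j * v (Some (i, j))) + (\<Sum>j\<in>UNIV. var j * w (Some (i, j)))" for i
    by (simp add: distrib_left sum.distrib)
  have 2: "(v + w) (Some (i, i)) - cmul (f i i) ((v + w) None)
      = (v (Some (i, i)) - cmul (f i i) (v None)) + (w (Some (i, i)) - cmul (f i i) (w None))" for i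
    by (simp add: cmul_simps)
  have 3: "(v + w) (Some (i, j)) + (v + w) (Some (j, i)) - cmul (f i j) ((v + w) None)
      = (v (Some (i, j)) + v (Some (j, i)) - cmul (f i j) (v None))
        + (w (Some (i, j)) + w (Some (j, i)) - cmul (f i j) (w None))" for i j
    by (simp add: cmul_simps)
  show "v + w \<in> syzygy_tuples t"
    using v w unfolding syzygy_tuples_def mem_Collect_eq 1 2 3 by (auto intro!: dvd_add forms_add)
next
  fix a v assume v: "v \<in> syzygy_tuples t"
  have 1: "(\<Sum>j\<in>UNIV. var j * tscale a v (Some (i, j))) = cmul a (\<Sum>j\<in>UNIV. var j * v (Some (i, j)))" for i
    by (simp add: cmul_mult cmul_sum)
  have 2: "tscale a v (Some (i, i)) - cmul (f i i) (tscale a v None) = cmul a (v (Some (i, i)) - cmul (f i i) (v None))" for i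
    by (simp add: cmul_simps mult.commute)
  have 3: "tscale a v (Some (i, j)) + tscale a v (Some (j, i)) - cmul (f i j) (tscale a v None)
      = cmul a (v (Some (i, j)) + v (Some (j, i)) - cmul (f i j) (v None))" for i j
    by (simp add: cmul_simps mult.commute)
  show "tscale a v \<in> syzygy_tuples t"
    using v unfolding syzygy_tuples_def mem_Collect_eq 1 2 3 by (auto intro!: dvd_cmul cmul_in_forms)
qed

lemma dvd_tuples_subspace: "W.subspace {v. \<forall>j. F dvd v j}"
  by (rule W.subspaceI) (auto intro: dvd_cmul)

text \<open>Both conditions are instances of the preceding criterion. The product of the two minors serves for both.\<close>

lemma conditions_open:
  assumes c0: "compressed t c0" "no_second_syzygies t c0"
  obtains P e where "P \<in> forms e" "eval_mpoly c0 P \<noteq> 0"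
    "\<And>c. eval_mpoly c P \<noteq> 0 \<Longrightarrow> act F c = 0 \<Longrightarrow> compressed t c \<and> no_second_syzygies t c"
proof -
  let ?D = "{v. \<forall>j. F dvd v j}"
  let ?Z1 = "{v :: unit \<Rightarrow> (4, 'k) mpoly. \<forall>j. v j \<in> forms t}"
  have s1: "W.subspace ?Z1" by (rule W.subspaceI) (auto intro: forms_add cmul_in_forms)
  obtain P1 e1 where P1: "P1 \<in> forms e1" "eval_mpoly c0 P1 \<noteq> 0"
    "\<And>c v. eval_mpoly c P1 \<noteq> 0 \<Longrightarrow> (\<And>v j. v \<in> ?Z1 \<inter> ?D \<Longrightarrow> act (v j) c = 0) \<Longrightarrow> v \<in> ?Z1 \<Longrightarrow>
      (\<And>j. act (v j) c = 0) \<Longrightarrow> v \<in> ?Z1 \<inter> ?D"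
  proof (rule open_condition[of ?Z1 "?Z1 \<inter> ?D" c0])
    show "W.subspace (?Z1 \<inter> ?D)" using s1 dvd_tuples_subspace by (rule W.subspace_inter)
    show "v \<in> ?Z1 \<inter> ?D" if "v \<in> ?Z1" "\<And>j. act (v j) c0 = 0" for v
      using that c0(1) by (auto simp: compressed_def)
    show "W.fin_dim ?Z1" by (rule fin_dim_tuples)
  qed (use s1 in auto)
  obtain P2 e2 where P2: "P2 \<in> forms e2" "eval_mpoly c0 P2 \<noteq> 0"
    "\<And>c v. eval_mpoly c P2 \<noteq> 0 \<Longrightarrow> (\<And>v j. v \<in> syzygy_tuples t \<inter> ?D \<Longrightarrow> act (v j) c = 0) \<Longrightarrow> v \<in> syzygy_tuples t \<Longrightarrow>
      (\<And>j. act (v j) c = 0) \<Longrightarrow> v \<in> syzygy_tuples t \<inter> ?D"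
  proof (rule open_condition[of "syzygy_tuples t" "syzygy_tuples t \<inter> ?D" c0])
    show "W.subspace (syzygy_tuples t \<inter> ?D)"
      using syzygy_tuples_subspace dvd_tuples_subspace by (rule W.subspace_inter)
    show "W.fin_dim (syzygy_tuples t)"
      by (rule W.fin_dim_mono[OF fin_dim_tuples[of "t + 1"]]) (auto simp: syzygy_tuples_def)
    show "v \<in> syzygy_tuples t \<inter> ?D" if "v \<in> syzygy_tuples t" "\<And>j. act (v j) c0 = 0" for v
      using that c0(2) by (auto simp: no_second_syzygies_def)
  qed (use syzygy_tuples_subspace in auto)
  show ?thesis
  proof
    show "P1 * P2 \<in> forms (e1 + e2)" using P1(1) P2(1) by (rule forms_mult)
    show "eval_mpoly c0 (P1 * P2) \<noteq> 0" using P1(2) P2(2) by (simp add: ev.hom_mult)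
    fix c assume c: "eval_mpoly c (P1 * P2) \<noteq> 0" "act F c = 0"
    then have e: "eval_mpoly c P1 \<noteq> 0" "eval_mpoly c P2 \<noteq> 0" by (auto simp: ev.hom_mult)
    have "F dvd p" if "p \<in> forms t" "act p c = 0" for p
    proof -
      have "(\<lambda>_. p) \<in> ?Z1 \<inter> ?D"
        by (rule P1(3)[OF e(1)]) (use that act_dvd[OF _ c(2)] in auto)
      then show ?thesis by simp
    qed
    moreover have "\<forall>j. F dvd v j" if "v \<in> syzygy_tuples t" "\<forall>j. act (v j) c = 0" for v
    proof -
      have "v \<in> syzygy_tuples t \<inter> ?D"
        by (rule P2(3)[OF e(2)]) (use that act_dvd[OF _ c(2)] in auto)
      then show ?thesis by simp
    qed
    ultimately show "compressed t c \<and> no_second_syzygies t c"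
      unfolding compressed_def no_second_syzygies_def by blast
  qed
qed

section \<open>A functional that satisfies the conditions\<close>

lemma division_forms:
  assumes "p \<in> forms d"
  obtains r h where "p = r + F * h" "deg0_le 1 r" "r \<in> forms d"
proof -
  obtain r h where r: "p = r + F * h" "deg0_le 1 r" by (rule division_exists)
  have "F dvd hom_component d (F * h)" by (rule dvd_hom_component[OF F2]) simp
  then obtain h' where h': "hom_component d (F * h) = F * h'" by (auto simp: dvd_def)
  have "p = hom_component d p" using assms by (simp add: hom_component_forms)
  also have "\<dots> = hom_component d r + F * h'" unfolding r(1) hom_component_add h' ..
  finally show ?thesis using that deg0_le_hom_component[OF r(2)] by simp
qed

lemma divided_by_var_forms: "p \<in> forms (d + 1) \<Longrightarrow> divided_by_var i p \<in> forms d"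
  unfolding in_forms_iff by fastforce

text \<open>Unisolvent points for the forms of degree \<open>t\<close> in three variables, on the affine chart of
  the first coordinate.\<close>

lemma unisolvent_points:
  assumes "infinite (UNIV :: 'k set)"
  obtains N and v :: "nat \<Rightarrow> 4 \<Rightarrow> 'k" where "\<And>j. v j 0 = 1"
    "\<And>p. p \<in> forms t \<Longrightarrow> free_of_var 0 p \<Longrightarrow>
      (\<And>m. mdeg m = t \<Longrightarrow> Poly_Mapping.lookup m 0 = 0 \<Longrightarrow> (\<Sum>j<N. eval_mpoly (v j) p * mev (v j) m) = 0) \<Longrightarrow> p = 0"
proof -
  let ?M = "{m :: 4 monom. mdeg m = t \<and> Poly_Mapping.lookup m 0 = 0}"
  have finM: "finite ?M" by (rule finite_subset[OF _ card_monoms_4(2)[of t]]) auto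
  define N where "N = card ?M"
  obtain \<mu> where \<mu>: "bij_betw \<mu> {..<N} ?M"
    using ex_bij_betw_nat_finite[OF finM] unfolding N_def atLeast0LessThan by blast
  have \<mu>M: "\<mu> l \<in> ?M" if "l < N" for l using \<mu> that by (auto simp: bij_betw_def)
  have chart: "mev (x(0 := 1)) m = mev x m" if "m \<in> ?M" for x :: "4 \<Rightarrow> 'k" and m
    unfolding mev_def using that by (intro prod.cong) (auto simp: in_keys_iff)
  have expand: "p = (\<Sum>l<N. Poly_Mapping.single (\<mu> l) (Poly_Mapping.lookup p (\<mu> l)))"
    if p: "Poly_Mapping.keys p \<subseteq> ?M" for p :: "(4, 'k) mpoly"
  proof -
    have "p = (\<Sum>m\<in>?M. Poly_Mapping.single m (Poly_Mapping.lookup p m))"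
      using single_lincomb[OF finM p] by (simp add: cmul_simps)
    also have "\<dots> = (\<Sum>l<N. Poly_Mapping.single (\<mu> l) (Poly_Mapping.lookup p (\<mu> l)))"
      by (rule sum.reindex_bij_betw[OF \<mu>, symmetric])
    finally show ?thesis .
  qed
  have "\<exists>x. det (mat N N (\<lambda>(j, l). (\<lambda>x. mev (x(0 := 1)) (\<mu> l)) (x j))) \<noteq> (0 :: 'k)"
  proof (rule exists_nonzero_minor)
    fix u i assume u: "\<And>x. (\<Sum>l<N. u l * mev (x(0 := 1)) (\<mu> l)) = (0 :: 'k)" and i: "i < N"
    define p where "p = (\<Sum>l<N. Poly_Mapping.single (\<mu> l) (u l))"
    have "eval_mpoly x p = 0" for x
    proof -
      have "eval_mpoly x p = (\<Sum>l<N. u l * mev (x(0 := 1)) (\<mu> l))"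
        unfolding p_def ev.hom_sum eval_single using \<mu>M by (intro sum.cong refl) (simp add: chart)
      then show ?thesis using u by simp
    qed
    then have "p = 0" using nonvanishing_point[OF assms] by metis
    moreover have "Poly_Mapping.lookup p (\<mu> i) = (\<Sum>l<N. if l = i then u i else 0)"
      unfolding p_def lookup_sum
      using \<mu> i by (intro sum.cong refl) (auto simp: lookup_single when_def bij_betw_def inj_on_def)
    ultimately show "u i = 0" using i by simp
  qed
  then obtain x where x: "det (mat N N (\<lambda>(j, l). mev ((x j)(0 := 1)) (\<mu> l))) \<noteq> (0 :: 'k)" by auto
  define v where "v j = (x j)(0 := 1)" for j
  let ?A = "mat N N (\<lambda>(j, l). mev (v j) (\<mu> l))"
  have dA: "det ?A \<noteq> 0" using x by (simp add: v_def)
  have "det (mat N N (\<lambda>(l, j). mev (v j) (\<mu> l))) = det ?A"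
  proof -
    have "mat N N (\<lambda>(l, j). mev (v j) (\<mu> l)) = transpose_mat ?A" by (intro eq_matI) auto
    then show ?thesis using det_transpose[of ?A N] by simp
  qed
  then have dT: "det (mat N N (\<lambda>(l, j). mev (v j) (\<mu> l))) \<noteq> 0" using dA by simp
  show ?thesis
  proof (rule that[of v N])
    show "v j 0 = 1" for j by (simp add: v_def)
    fix p assume p: "p \<in> forms t" "free_of_var 0 p"
      "\<And>m. mdeg m = t \<Longrightarrow> Poly_Mapping.lookup m 0 = 0 \<Longrightarrow> (\<Sum>j<N. eval_mpoly (v j) p * mev (v j) m) = 0"
    have ev0: "eval_mpoly (v j) p = 0" if "j < N" for j
    proof (rule det_nonzero_kernel[OF dT _ that])
      show "(\<Sum>j<N. mev (v j) (\<mu> l) * eval_mpoly (v j) p) = 0" if "l < N" for l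
        using p(3)[of "\<mu> l"] \<mu>M[OF that] by (simp add: mult.commute)
    qed
    have keys: "Poly_Mapping.keys p \<subseteq> ?M"
      using p(1,2) by (auto simp: forms_def free_of_var_def in_keys_iff)
    have "Poly_Mapping.lookup p (\<mu> l) = 0" if "l < N" for l
    proof (rule det_nonzero_kernel[OF dA _ that])
      show "(\<Sum>l<N. mev (v j) (\<mu> l) * Poly_Mapping.lookup p (\<mu> l)) = 0" if "j < N" for j
      proof -
        have "eval_mpoly (v j) p = (\<Sum>l<N. mev (v j) (\<mu> l) * Poly_Mapping.lookup p (\<mu> l))"
          by (subst expand[OF keys]) (simp add: ev.hom_sum eval_single mult.commute)
        then show ?thesis using ev0[OF that] by simp
      qed
    qed
    then show "p = 0" using expand[OF keys] by (simp add: single_zero)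
  qed
qed

text \<open>For a point \<open>v\<close> with \<open>v 0 = 1\<close>, the functional sends a residue class \<open>p + x\<^sub>0 q\<close>, with
  \<open>p\<close> and \<open>q\<close> free of \<open>x\<^sub>0\<close>, to the value of \<open>q\<close> at \<open>v\<close>. The recursion expresses the powers of
  \<open>x\<^sub>0\<close> modulo the quadric.\<close>

fun root_seq :: "(4 \<Rightarrow> 'k) \<Rightarrow> nat \<Rightarrow> 'k" where
  "root_seq v 0 = 0"
| "root_seq v (Suc 0) = 1"
| "root_seq v (Suc (Suc n)) = - (eval_mpoly v lin * root_seq v (Suc n) + eval_mpoly v quad * root_seq v n) / F\<^sub>0\<^sub>0"

definition point_fun :: "(4 \<Rightarrow> 'k) \<Rightarrow> 4 monom \<Rightarrow> 'k"
  where "point_fun v m = root_seq v (Poly_Mapping.lookup m 0) * mev v m"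

lemma act_free:
  assumes "free_of_var 0 p"
  shows "act p (point_fun v) = (\<lambda>m. eval_mpoly v p * point_fun v m)"
proof
  fix m
  have "Poly_Mapping.lookup p q * point_fun v (q + m) = Poly_Mapping.lookup p q * mev v q * point_fun v m"
    if "q \<in> Poly_Mapping.keys p" for q
    using that assms by (simp add: free_of_var_def in_keys_iff point_fun_def lookup_add mev_add)
  then show "act p (point_fun v) m = eval_mpoly v p * point_fun v m"
    unfolding act_def pair_def eval_mpoly_eq_subst subst_def sum_distrib_right by (intro sum.cong) auto
qed

lemma act_F_point_fun: "v 0 = 1 \<Longrightarrow> act F (point_fun v) = 0"
proof
  fix m :: "4 monom" assume v: "v 0 = 1"
  let ?n = "Poly_Mapping.lookup m 0"
  have l: "act lc c n = F\<^sub>0\<^sub>0 * c n" for c n by (simp add: act_single)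
  have "act F (point_fun v) m = F\<^sub>0\<^sub>0 * point_fun v (Poly_Mapping.single 0 1 + (Poly_Mapping.single 0 1 + m))
      + eval_mpoly v lin * point_fun v (Poly_Mapping.single 0 1 + m) + eval_mpoly v quad * point_fun v m"
    by (subst F_expansion) (simp add: act_add act_mult l act_var act_free free_lin_quad)
  also have "\<dots> = mev v m * (F\<^sub>0\<^sub>0 * root_seq v (Suc (Suc ?n)) + eval_mpoly v lin * root_seq v (Suc ?n)
      + eval_mpoly v quad * root_seq v ?n)"
    by (simp add: point_fun_def lookup_add mev_add v algebra_simps One_nat_def del: root_seq.simps(3))
  also have "\<dots> = 0" using F00 by (simp add: field_simps)
  finally show "act F (point_fun v) m = 0 m" by simp
qed

lemma free_of_var_cancel:
  fixes p :: "(4, 'k) mpoly"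
  assumes "free_of_var i (var j * p)"
  shows "free_of_var i p"
  unfolding free_of_var_def
proof (intro allI impI)
  fix m assume "Poly_Mapping.lookup p m \<noteq> 0"
  then have "Poly_Mapping.lookup (Poly_Mapping.single j 1 + m) i = 0"
    using assms unfolding free_of_var_def by (metis lookup_var_mult)
  then show "Poly_Mapping.lookup m i = 0" by (simp add: lookup_add)
qed

lemma forms_var_cancel:
  fixes p :: "(4, 'k) mpoly"
  assumes "var j * p \<in> forms (d + 1)"
  shows "p \<in> forms d"
  unfolding in_forms_iff
proof (intro allI impI)
  fix m assume "Poly_Mapping.lookup p m \<noteq> 0"
  then have "mdeg (Poly_Mapping.single j 1 + m) = d + 1"
    using assms unfolding in_forms_iff by (metis lookup_var_mult)
  then show "mdeg m = d" by simp
qed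

text \<open>On residue classes \<open>p\<close> free of \<open>x\<^sub>0\<close>, contracting \<open>c\<close> by \<open>p\<close> and evaluating at \<open>x\<^sub>0 m\<close> gives the sum
  of the products \<open>p v * m v\<close> over the points. As the points are unisolvent in degree \<open>t\<close>, only \<open>p = 0\<close> of
  degree \<open>t\<close> is killed. A killed class of degree \<open>t\<close> or \<open>t + 1\<close> is free of \<open>x\<^sub>0\<close>, which proves the first
  condition and turns the second one into a Koszul relation between three variables.\<close>

lemma example_functional:
  assumes inf: "infinite (UNIV :: 'k set)" and t: "t \<ge> 1"
  obtains c where "c \<in> dual (2 * t + 1)" "act F c = 0" "compressed t c" "no_second_syzygies t c"
proof -
  obtain N and v :: "nat \<Rightarrow> 4 \<Rightarrow> 'k" where v0: "\<And>j. v j 0 = 1"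
    and uni: "\<And>p. p \<in> forms t \<Longrightarrow> free_of_var 0 p \<Longrightarrow>
      (\<And>m. mdeg m = t \<Longrightarrow> Poly_Mapping.lookup m 0 = 0 \<Longrightarrow> (\<Sum>j<N. eval_mpoly (v j) p * mev (v j) m) = 0) \<Longrightarrow> p = 0"
    by (rule unisolvent_points[OF inf, of t]) blast
  define \<Lambda> where "\<Lambda> = (\<Sum>j<N. point_fun (v j))"
  define c where "c = trunc (2 * t + 1) \<Lambda>"
  have Fc: "act F c = 0"
  proof -
    have "act F \<Lambda> = 0" unfolding \<Lambda>_def act_sum_fun by (intro sum.neutral) (simp add: act_F_point_fun v0)
    moreover have "act F c = trunc (2 * t - 1) (act F \<Lambda>)"
    proof -
      have e: "2 + (2 * t - 1) = 2 * t + 1" using t by arith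
      show ?thesis unfolding c_def by (rule act_trunc[OF F2, of "2 * t - 1" \<Lambda>, unfolded e])
    qed
    ultimately show ?thesis by (auto simp: trunc_def)
  qed
  have deg: "act p c m = (\<Sum>j<N. act p (point_fun (v j)) m)" if "p \<in> forms d" "d + mdeg m = 2 * t + 1" for p d m
  proof -
    have "act p c = trunc (mdeg m) (act p \<Lambda>)"
      unfolding c_def using act_trunc[OF that(1), of "mdeg m" \<Lambda>] that(2) by simp
    then show ?thesis by (simp add: trunc_def \<Lambda>_def act_sum_fun sum_fun_apply)
  qed
  have free: "act p c (Poly_Mapping.single 0 1 + m) = (\<Sum>j<N. eval_mpoly (v j) p * mev (v j) m)"
    if "p \<in> forms d" "free_of_var 0 p" "d + mdeg m = 2 * t" "Poly_Mapping.lookup m 0 = 0" for p d m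
  proof -
    have "point_fun (v j) (Poly_Mapping.single 0 1 + m) = mev (v j) m" for j
      using that(4) v0[of j] by (simp add: point_fun_def lookup_add mev_add One_nat_def)
    then show ?thesis using that deg[of p d "Poly_Mapping.single 0 1 + m"] by (simp add: act_free)
  qed
  have std: "act p c m = (\<Sum>j<N. eval_mpoly (v j) (divided_by_var 0 p) * mev (v j) m)"
    if p: "p \<in> forms d" "deg0_le 1 p" "d + mdeg m = 2 * t + 1" "Poly_Mapping.lookup m 0 = 0" for p d m
  proof -
    let ?r = "p - var 0 * divided_by_var 0 p"
    have "act p (point_fun (v j)) m = eval_mpoly (v j) (divided_by_var 0 p) * mev (v j) m" for j
    proof -
      have "act p (point_fun (v j)) m = act ?r (point_fun (v j)) m + act (var 0) (act (divided_by_var 0 p) (point_fun (v j))) m"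
        by (subst split_std(1)[OF p(2)]) (simp only: act_add act_mult plus_fun_apply)
      also have "act ?r (point_fun (v j)) m = 0"
        using p(4) by (simp add: act_free split_std(2)[OF p(2)] point_fun_def)
      also have "act (var 0) (act (divided_by_var 0 p) (point_fun (v j))) m
          = eval_mpoly (v j) (divided_by_var 0 p) * point_fun (v j) (Poly_Mapping.single 0 1 + m)"
        by (simp only: act_var act_free[OF split_std(3)[OF p(2)]])
      also have "point_fun (v j) (Poly_Mapping.single 0 1 + m) = mev (v j) m"
        using p(4) v0[of j] by (simp add: point_fun_def lookup_add mev_add One_nat_def)
      finally show ?thesis by simp
    qed
    then show ?thesis using deg[OF p(1,3)] by simp
  qed
  \<comment> \<open>The values at monomials free of \<open>x\<^sub>0\<close> determine the coefficient of \<open>x\<^sub>0\<close>; in degree \<open>t\<close> a factor \<open>x\<^sub>1\<close> fills up its degree.\<close>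
  have no_x0: "free_of_var 0 p" if p: "p \<in> forms d" "deg0_le 1 p" "act p c = 0" "d = t \<or> d = t + 1" for p d
  proof -
    let ?q = "divided_by_var 0 p"
    have fq: "free_of_var 0 ?q" by (rule split_std(3)[OF p(2)])
    have "?q = 0"
      using p(4)
    proof
      assume d: "d = t + 1"
      show ?thesis
      proof (rule uni)
        show "?q \<in> forms t" using p(1) d by (simp add: divided_by_var_forms)
        fix m :: "4 monom" assume "mdeg m = t" "Poly_Mapping.lookup m 0 = 0"
        then show "(\<Sum>j<N. eval_mpoly (v j) ?q * mev (v j) m) = 0"
          using std[OF p(1,2), of m] p(3) d by simp
      qed (rule fq)
    next
      assume d: "d = t"
      have "var 1 * ?q = 0"
      proof (rule uni)
        have "?q \<in> forms (t - 1)" using p(1) d t divided_by_var_forms[of p "t - 1"] by simp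
        then show "var 1 * ?q \<in> forms t" using forms_mult[of "var 1" 1 ?q "t - 1"] t by simp
        show "free_of_var 0 (var 1 * ?q)" using fq by (intro free_of_var_mult free_of_var_var) auto
        fix m :: "4 monom" assume "mdeg m = t" "Poly_Mapping.lookup m 0 = 0"
        then have "(\<Sum>j<N. eval_mpoly (v j) ?q * mev (v j) (Poly_Mapping.single 1 1 + m)) = 0"
          using std[OF p(1,2), of "Poly_Mapping.single 1 1 + m"] p(3) d by (simp add: lookup_add lookup_single_not_eq)
        then show "(\<Sum>j<N. eval_mpoly (v j) (var 1 * ?q) * mev (v j) m) = 0"
          by (simp add: ev.hom_mult mev_add ac_simps)
      qed
      then show ?thesis by simp
    qed
    then show ?thesis using split_std(1,2)[OF p(2)] by simp
  qed
  have free_0: "p = 0" if p: "p \<in> forms t" "free_of_var 0 p" "act p c = 0" for p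
  proof (rule uni[OF p(1,2)])
    fix m :: "4 monom" assume "mdeg m = t" "Poly_Mapping.lookup m 0 = 0"
    then show "(\<Sum>j<N. eval_mpoly (v j) p * mev (v j) m) = 0"
      using free[OF p(1,2), of m] p(3) by simp
  qed
  have linear_0: "e = 0" if e: "e \<in> forms t" "free_of_var 0 e" "\<And>i. i \<noteq> 0 \<Longrightarrow> act (var i * e) c = 0" for e
  proof (rule uni[OF e(1,2)])
    fix m :: "4 monom" assume m: "mdeg m = t" "Poly_Mapping.lookup m 0 = 0"
    then obtain i m' where m': "m = Poly_Mapping.single i 1 + m'" using t monom_factor_pos[of m] by auto
    then have i: "i \<noteq> 0" and m0: "Poly_Mapping.lookup m' 0 = 0" using m(2) by (auto simp: lookup_add One_nat_def)
    have "(\<Sum>j<N. eval_mpoly (v j) (var i * e) * mev (v j) m') = act (var i * e) c (Poly_Mapping.single 0 1 + m')"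
    proof (rule free[symmetric])
      show "var i * e \<in> forms (1 + t)" using e(1) by (intro forms_mult) auto
      show "free_of_var 0 (var i * e)" using i e(2) by (intro free_of_var_mult free_of_var_var) auto
      show "1 + t + mdeg m' = 2 * t" using m(1) m' by simp
    qed (rule m0)
    then show "(\<Sum>j<N. eval_mpoly (v j) e * mev (v j) m) = 0"
      using e(3)[OF i] by (simp add: m' ev.hom_mult mev_add ac_simps)
  qed
  have mod: "act r c = 0" if "act p c = 0" "p = r + F * h" for p r h
    using that act_dvd[of "F * h" c] Fc by (simp add: act_add)
  have comp: "compressed t c"
    unfolding compressed_def
  proof (intro ballI impI)
    fix p assume p: "p \<in> forms t" "act p c = 0"
    obtain r h where r: "p = r + F * h" "deg0_le 1 r" "r \<in> forms t" by (rule division_forms[OF p(1)])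
    have rc: "act r c = 0" by (rule mod[OF p(2) r(1)])
    have "r = 0" using free_0[OF r(3) no_x0[OF r(3,2) rc] rc] by simp
    then show "F dvd p" using r(1) by simp
  qed
  have "no_second_syzygies t c"
    unfolding no_second_syzygies_def
  proof (intro ballI impI)
    fix w assume w: "w \<in> syzygy_tuples t" "\<forall>j. act (w j) c = 0"
    have wf: "w j \<in> forms (t + 1)" for j using w(1) by (simp add: syzygy_tuples_def)
    have "\<exists>r h. w j = r + F * h \<and> deg0_le 1 r \<and> r \<in> forms (t + 1)" for j
      using division_forms[OF wf[of j]] by metis
    then obtain r h where r: "\<And>j. w j = r j + F * h j" "\<And>j. deg0_le 1 (r j)" "\<And>j. r j \<in> forms (t + 1)"
      by metis
    have rc: "act (r j) c = 0" for j using mod[OF _ r(1)] w(2) by blast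
    have fr: "free_of_var 0 (r j)" for j by (rule no_x0[OF r(3,2) rc]) simp
    have Frw: "F dvd w j - r j" for j by (simp add: r(1))
    define k where "k i j = r (Some (i, j))" for i j
    have fk: "free_of_var 0 (k i j)" for i j by (simp add: k_def fr)
    \<comment> \<open>The representatives of such a tuple are free of \<open>x\<^sub>0\<close>, so its divisibility conditions become equations.\<close>
    have row: "k i 0 = 0" "var 1 * k i 1 + var 2 * k i 2 + var 3 * k i 3 = 0" for i
    proof -
      have eq: "(\<Sum>j\<in>UNIV. var j * w (Some (i, j))) = (\<Sum>j\<in>UNIV. var j * k i j) + F * (\<Sum>j\<in>UNIV. var j * h (Some (i, j)))"
        by (simp only: r(1) k_def distrib_left sum.distrib sum_distrib_left mult.left_commute)
      have "F dvd (\<Sum>j\<in>UNIV. var j * w (Some (i, j)))" using w(1) by (simp add: syzygy_tuples_def)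
      then have "F dvd (\<Sum>j\<in>UNIV. var j * k i j)" using eq by (rule dvd_remainder)
      then have dv: "F dvd (var 1 * k i 1 + var 2 * k i 2 + var 3 * k i 3) + var 0 * k i 0"
        unfolding sum_4 by (simp only: ac_simps)
      have fv: "free_of_var 0 (var 1 * k i 1 + var 2 * k i 2 + var 3 * k i 3)"
        by (simp add: free_of_var_add free_of_var_mult free_of_var_var fk)
      show "k i 0 = 0" by (rule std_eq_0(2)[OF fv fk dv])
      show "var 1 * k i 1 + var 2 * k i 2 + var 3 * k i 3 = 0" by (rule std_eq_0(1)[OF fv fk dv])
    qed
    have None: "F dvd w None"
    proof -
      have "F dvd w (Some (0, 0)) - cmul F\<^sub>0\<^sub>0 (w None)" using w(1) unfolding f00[symmetric] by (simp add: syzygy_tuples_def)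
      moreover have "F dvd w (Some (0, 0))" using Frw[of "Some (0, 0)"] row(1)[of 0] by (simp add: k_def)
      ultimately have "F dvd cmul F\<^sub>0\<^sub>0 (w None)" using dvd_diff[of F "w (Some (0, 0))" "w (Some (0, 0)) - cmul F\<^sub>0\<^sub>0 (w None)"] by simp
      then have "F dvd cmul (1 / F\<^sub>0\<^sub>0) (cmul F\<^sub>0\<^sub>0 (w None))" by (rule dvd_cmul)
      then show ?thesis using F00 by (simp add: cmul_simps)
    qed
    have small: "p = 0" if "F dvd p" "free_of_var 0 p" for p
      using std_eq_0(1)[of p 0] that by (simp add: free_of_var_def)
    have diag: "k i i = 0" for i
    proof (rule small[OF _ fk])
      have "F dvd w (Some (i, i)) - cmul (f i i) (w None)" using w(1) by (simp add: syzygy_tuples_def)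
      then have "F dvd w (Some (i, i))" using dvd_add[OF _ dvd_cmul[OF None, of "f i i"]] by fastforce
      then show "F dvd k i i" unfolding k_def by (rule dvd_remainder[OF _ r(1)])
    qed
    have anti: "k j i = - k i j" for i j
    proof (cases "i = j")
      case False
      have "k i j + k j i = 0"
      proof (rule small)
        have "F dvd w (Some (i, j)) + w (Some (j, i)) - cmul (f i j) (w None)"
          using w(1) False by (simp add: syzygy_tuples_def)
        then have "F dvd w (Some (i, j)) + w (Some (j, i))" using dvd_add[OF _ dvd_cmul[OF None, of "f i j"]] by fastforce
        moreover have "w (Some (i, j)) + w (Some (j, i)) = (k i j + k j i) + F * (h (Some (i, j)) + h (Some (j, i)))"
          by (simp only: r(1) k_def distrib_left ac_simps)
        ultimately show "F dvd k i j + k j i" by (rule dvd_remainder)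
      qed (intro free_of_var_add fk)
      then show ?thesis by (simp add: eq_neg_iff_add_eq_0 add.commute)
    qed (simp add: diag)
    have r1: "var 2 * k 1 2 + var 3 * k 1 3 = 0" using row(2)[of 1] diag[of 1] by simp
    have r2: "var 1 * k 1 2 = var 3 * k 2 3" using row(2)[of 2] diag[of 2] anti[of 2 1] by (simp add: eq_neg_iff_add_eq_0 neg_eq_iff_add_eq_0)
    have r3: "var 1 * k 1 3 + var 2 * k 2 3 = 0"
      
  proof -
      have "- (var 1 * k 1 3 + var 2 * k 2 3) = 0"
        using row(2)[of 3] unfolding diag[of 3] anti[of 3 1] anti[of 3 2] by simp
      then show ?thesis by (simp only: neg_equal_0_iff_equal)
    qed
    \<comment> \<open>What remains is an alternating matrix in three variables that kills them, so it is a multiple of the Koszul matrix.\<close>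
    obtain e where e: "k 2 3 = var 1 * e" "- k 1 3 = var 2 * e" "k 1 2 = var 3 * e"
    proof (rule koszul_1[of "k 2 3" "- k 1 3" "k 1 2"])
      show "var 2 * k 2 3 = var 1 * - k 1 3" using r3 by (simp add: eq_neg_iff_add_eq_0 add.commute)
      show "var 3 * k 2 3 = var 1 * k 1 2" using r2 by simp
    qed
    have kf: "k i j \<in> forms (t + 1)" for i j by (simp add: k_def r(3))
    have kc: "act (k i j) c = 0" for i j by (simp add: k_def rc)
    have "e = 0"
    proof (rule linear_0)
      show "e \<in> forms t" using kf[of 2 3] unfolding e(1) by (rule forms_var_cancel)
      show "free_of_var 0 e" using fk[of 2 3] unfolding e(1) by (rule free_of_var_cancel)
      fix i :: 4 assume "i \<noteq> 0"
      moreover have "act (var 1 * e) c = 0" "act (var 3 * e) c = 0" unfolding e[symmetric] by (rule kc)+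
      moreover have "act (var 2 * e) c = 0" unfolding e(2)[symmetric] anti[symmetric] by (rule kc)
      ultimately show "act (var i * e) c = 0" using exhaust_4'[of i] by auto
    qed
    then have z: "k 2 3 = 0" "k 1 3 = 0" "k 1 2 = 0" using e by auto
    have k0: "k i j = 0" for i j
      using exhaust_4'[of i] exhaust_4'[of j] z row(1) diag anti[of 0] anti[of 1 2] anti[of 1 3] anti[of 2 3]
      by (elim disjE) simp_all
    show "\<forall>j. F dvd w j"
    proof
      fix j show "F dvd w j"
      proof (cases j)
        case (Some p)
        then have "r j = 0" using k0[of "fst p" "snd p"] by (simp add: k_def)
        then show ?thesis using r(1)[of j] by simp
      qed (use None in simp)
    qed
  qed
  then show ?thesis using that[of c] Fc comp by (simp add: c_def)
qed

end

section \<open>The annihilator of a functional\<close>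

lemma trunc_act:
  fixes c :: "'i monom \<Rightarrow> 'k::field"
  assumes "c \<in> dual s"
  shows "trunc d (act p c) = (if d \<le> s then act (hom_component (s - d) p) c else 0)"
proof
  fix m
  let ?m = "Poly_Mapping.single m 1 :: ('i, 'k) mpoly"
  have *: "act q c m = pair (hom_component s (?m * q)) c" for q
    unfolding act_apply using pair_hom_component[OF assms] by (simp add: mult.commute)
  show "trunc d (act p c) m = (if d \<le> s then act (hom_component (s - d) p) c else 0) m"
  proof (cases "mdeg m = d")
    case True
    then have m: "?m \<in> forms d" by simp
    show ?thesis
    proof (cases "d \<le> s")
      case True
      then have "hom_component s (?m * p) = ?m * hom_component (s - d) p"
        using hom_component_mult(1)[OF m, of "s - d" p] by simp
      then show ?thesis using True \<open>mdeg m = d\<close> *[of p] by (simp add: trunc_def act_apply mult.commute)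
    next
      case False
      then show ?thesis using hom_component_mult(2)[OF m, of s p] \<open>mdeg m = d\<close> *[of p] by (simp add: trunc_def)
    qed
  next
    case False
    have "act (hom_component (s - d) p) c m = 0" if "d \<le> s"
    proof -
      have "act (hom_component (s - d) p) c \<in> dual d"
        by (rule act_dual[of _ "s - d"]) (use that assms in auto)
      then show ?thesis using False by (simp add: dual_def)
    qed
    then show ?thesis using False by (simp add: trunc_def)
  qed
qed

lemma act_var_dual: "\<psi> \<in> dual (Suc d) \<Longrightarrow> act (var i) \<psi> \<in> dual d"
  by (rule act_dual[OF var_in_forms]) (simp only: plus_1_eq_Suc)

lemma linear_act_component:
  fixes c :: "'i monom \<Rightarrow> 'k::field"
  assumes "finite M"
  shows "Vector_Spaces.linear cmul cmul (\<lambda>p. \<Sum>m\<in>M. Poly_Mapping.single m (act p c m))"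
proof unfold_locales
  fix p q :: "('i, 'k) mpoly"
  show "(\<Sum>m\<in>M. Poly_Mapping.single m (act (p + q) c m))
      = (\<Sum>m\<in>M. Poly_Mapping.single m (act p c m)) + (\<Sum>m\<in>M. Poly_Mapping.single m (act q c m))"
    by (simp only: act_add plus_fun_apply single_add sum.distrib)
next
  fix a and p :: "('i, 'k) mpoly"
  show "(\<Sum>m\<in>M. Poly_Mapping.single m (act (cmul a p) c m)) = cmul a (\<Sum>m\<in>M. Poly_Mapping.single m (act p c m))"
    by (simp add: act_cmul cmul_sum cmul_simps)
qed

text \<open>Finite-dimensional duality: a functional that kills the annihilator of \<open>c\<close> in degree \<open>d\<close> is
  a multiple of \<open>c\<close>.\<close>

lemma double_annihilator:
  fixes \<psi> c :: "4 monom \<Rightarrow> 'k::field"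
  assumes c: "c \<in> dual s" and \<psi>: "\<psi> \<in> dual d" and ds: "d \<le> s"
    and kill: "\<And>p. p \<in> forms d \<Longrightarrow> act p c = 0 \<Longrightarrow> pair p \<psi> = 0"
  obtains r where "\<psi> = act r c"
proof -
  define e where "e = s - d"
  let ?M = "{m :: 4 monom. mdeg m = e}"
  have fin: "finite ?M" by (rule card_monoms_4)
  define \<Phi> where "\<Phi> p = (\<Sum>m\<in>?M. Poly_Mapping.single m (act p c m))" for p
  have l\<Phi>: "Vector_Spaces.linear cmul cmul \<Phi>" unfolding \<Phi>_def by (rule linear_act_component[OF fin])
  have zero: "act p c = 0" if "p \<in> forms d" "\<Phi> p = 0" for p
  proof
    fix m
    have "act p c \<in> dual e" by (rule act_dual[OF that(1)]) (use c ds in \<open>simp add: e_def\<close>)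
    moreover have "Poly_Mapping.lookup (\<Phi> p) m = (if mdeg m = e then act p c m else 0)"
      using fin by (simp add: \<Phi>_def lookup_sum lookup_single when_def)
    ultimately show "act p c m = 0 m" using that(2) by (auto simp: dual_def split: if_splits)
  qed
  obtain \<mu> where \<mu>: "Vector_Spaces.linear cmul (*) \<mu>" "\<And>p. p \<in> forms d \<Longrightarrow> \<mu> (\<Phi> p) = pair p \<psi>"
  proof (rule VV.functional_factors[OF l\<Phi> subspace_forms[of d] V.subspace_single_0 linear_pair[of \<psi>]])
    show "pair p \<psi> = 0" if "p \<in> forms d" "\<Phi> p \<in> {0}" for p
      using kill[OF that(1)] zero[OF that(1)] that(2) by simp
  qed blast
  define h where "h m = \<mu> (Poly_Mapping.single m 1)" for m
  define r where "r = (\<Sum>m\<in>?M. Poly_Mapping.single m (h m))"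
  have r: "r \<in> forms e" unfolding r_def by (intro forms_sum) auto
  have "\<psi> - act r c = 0"
  proof (rule dual_eq_0)
    have "act r c \<in> dual d" by (rule act_dual[OF r]) (use c ds in \<open>simp add: e_def\<close>)
    then show "\<psi> - act r c \<in> dual d" using \<psi> dual_closed(3) by blast
    fix p :: "(4, 'k) mpoly" assume p: "p \<in> forms d"
    have "pair p \<psi> = pair (\<Phi> p) h" using \<mu>(2)[OF p] functional_eq_pair[OF \<mu>(1), of "\<Phi> p"]
      by (simp only: h_def[abs_def])
    also have "\<dots> = (\<Sum>m\<in>?M. act p c m * h m)" by (simp add: \<Phi>_def pair_sum)
    also have "\<dots> = pair r (act p c)" by (simp add: r_def pair_sum mult.commute)
    also have "\<dots> = pair p (act r c)" by (simp only: pair_mult[symmetric] mult.commute)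
    finally show "pair p (\<psi> - act r c) = 0" by (simp only: pair_fun) simp
  qed
  then show ?thesis using that[of r] by simp
qed

locale compressed_functional = quadric F for F :: "(4, 'k::field) mpoly" +
  fixes t :: nat and c :: "4 monom \<Rightarrow> 'k"
  assumes t1: "t \<ge> 1" and c_dual: "c \<in> dual (2 * t + 1)" and F_kills: "act F c = 0"
    and compressed: "compressed t c" and no_second_syzygies: "no_second_syzygies t c"
begin

text \<open>In lower degree \<open>p\<close> is multiplied by powers of \<open>x\<^sub>1\<close> until it has degree \<open>t\<close>. The variable can be
  cancelled afterwards, because it is a nonzerodivisor modulo the quadric.\<close>

lemma ann_low:
  assumes "p \<in> forms j" "j \<le> t" "act p c = 0"
  shows "F dvd p"
proof -
  have "F dvd p" if "p \<in> forms j" "j + k = t" "act p c = 0" for k p j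
    using that
  proof (induction k arbitrary: p j)
    case 0
    then have "j = t" by simp
    then show ?case using compressed 0(1,3) unfolding compressed_def by blast
  next
    case (Suc k)
    have "F dvd var 1 * p"
    proof (rule Suc.IH)
      show "var 1 * p \<in> forms (1 + j)" using Suc.prems(1) by (intro forms_mult) auto
      show "1 + j + k = t" using Suc.prems(2) by simp
      show "act (var 1 * p) c = 0" by (simp only: act_mult Suc.prems(3) act_fun)
    qed
    then show ?case by (rule dvd_var_mult[rotated]) simp
  qed
  from this[OF assms(1), of "t - j"] show ?thesis using assms by simp
qed

text \<open>The Koszul complex is self-dual: the coefficients of a Koszul cocycle in degree two, placed
  at the complementary pairs of indices, are the coefficients of a cycle. So the condition on
  second syzygies also controls relations between shifts of \<open>c\<close>.\<close>

definition complement_tuple :: "(4 \<Rightarrow> 4 \<Rightarrow> (4, 'k) mpoly) \<Rightarrow> (4 \<times> 4) option \<Rightarrow> (4, 'k) mpoly" where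
  "complement_tuple k = (\<lambda>None \<Rightarrow> 0 | Some (i, j) \<Rightarrow>
    if (i, j) = (0, 1) then k 2 3 else if (i, j) = (1, 0) then - k 2 3 else
    if (i, j) = (0, 2) then - k 1 3 else if (i, j) = (2, 0) then k 1 3 else
    if (i, j) = (0, 3) then k 1 2 else if (i, j) = (3, 0) then - k 1 2 else
    if (i, j) = (1, 2) then k 0 3 else if (i, j) = (2, 1) then - k 0 3 else
    if (i, j) = (1, 3) then - k 0 2 else if (i, j) = (3, 1) then k 0 2 else
    if (i, j) = (2, 3) then k 0 1 else if (i, j) = (3, 2) then - k 0 1 else 0)"

lemma cocycle_identity:
  fixes x1 :: "'r::comm_ring_1"
  shows "x1 * (x3 * a2 - x2 * a3) - x2 * (x3 * a1 - x1 * a3) + x3 * (x2 * a1 - x1 * a2) = 0"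
  by (simp add: algebra_simps)

lemma row_identities:
  fixes x0 :: "'r::comm_ring_1"
  shows "x1 * p - x2 * q + x3 * r = 0 \<Longrightarrow> x0 * 0 + x1 * p + x2 * (- q) + x3 * r = 0"
    "x0 * p - x2 * q + x3 * r = 0 \<Longrightarrow> x0 * (- p) + x1 * 0 + x2 * q + x3 * (- r) = 0"
    "x0 * p - x1 * q + x3 * r = 0 \<Longrightarrow> x0 * p + x1 * (- q) + x2 * 0 + x3 * r = 0"
    "x0 * p - x1 * q + x2 * r = 0 \<Longrightarrow> x0 * (- p) + x1 * q + x2 * (- r) + x3 * 0 = 0"
proof -
  have neg: "- a + b - d = 0" if "a - b + d = 0" for a b d :: 'r
  proof -
    have "- a + b - d = - (a - b + d)" by simp
    then show ?thesis using that by simp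
  qed
  show "x0 * p - x2 * q + x3 * r = 0 \<Longrightarrow> x0 * (- p) + x1 * 0 + x2 * q + x3 * (- r) = 0"
    using neg[of "x0 * p" "x2 * q" "x3 * r"] by simp
  show "x0 * p - x1 * q + x2 * r = 0 \<Longrightarrow> x0 * (- p) + x1 * q + x2 * (- r) + x3 * 0 = 0"
    using neg[of "x0 * p" "x1 * q" "x2 * r"] by simp
qed simp_all

lemma dvd_koszul_relations:
  assumes k: "\<And>i j. k i j = var j * a i - var i * a j"
    and forms: "\<And>i j. k i j \<in> forms (t + 1)" and kill: "\<And>i j. act (k i j) c = 0"
  shows "F dvd k i j"
proof -
  let ?v = "complement_tuple k"
  have cyc: "var i * k j l - var j * k i l + var l * k i j = 0" for i j l
    unfolding k by (rule cocycle_identity)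
  have fv: "?v x \<in> forms (t + 1)" and kv: "act (?v x) c = 0" for x
  proof -
    have um: "act (- p) c = 0" if "act p c = 0" for p
      using that act_diff[of 0 p c] by simp
    show "?v x \<in> forms (t + 1)" "act (?v x) c = 0"
      unfolding complement_tuple_def
      by (cases x; simp add: forms forms_uminus kill um split: prod.splits)+
  qed
  have "?v (Some (i, i)) = 0" for i
    using exhaust_4'[of i] by (elim disjE) (simp_all add: complement_tuple_def)
  moreover have "?v None = 0"
    "?v (Some (0, 1)) = k 2 3" "?v (Some (0, 2)) = - k 1 3" "?v (Some (0, 3)) = k 1 2"
    "?v (Some (1, 0)) = - k 2 3" "?v (Some (1, 2)) = k 0 3" "?v (Some (1, 3)) = - k 0 2"
    "?v (Some (2, 0)) = k 1 3" "?v (Some (2, 1)) = - k 0 3" "?v (Some (2, 3)) = k 0 1"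
    "?v (Some (3, 0)) = - k 1 2" "?v (Some (3, 1)) = k 0 2" "?v (Some (3, 2)) = - k 0 1"
    unfolding complement_tuple_def by simp_all
  ultimately have vals: "?v None = 0" "?v (Some (i, i)) = 0"
    "?v (Some (0, 1)) = k 2 3" "?v (Some (0, 2)) = - k 1 3" "?v (Some (0, 3)) = k 1 2"
    "?v (Some (1, 0)) = - k 2 3" "?v (Some (1, 2)) = k 0 3" "?v (Some (1, 3)) = - k 0 2"
    "?v (Some (2, 0)) = k 1 3" "?v (Some (2, 1)) = - k 0 3" "?v (Some (2, 3)) = k 0 1"
    "?v (Some (3, 0)) = - k 1 2" "?v (Some (3, 1)) = k 0 2" "?v (Some (3, 2)) = - k 0 1" for i
    by simp_all
  have rows: "(\<Sum>j\<in>UNIV. var j * ?v (Some (i, j))) = 0" for i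
    using exhaust_4'[of i] cyc[of 1 2 3] cyc[of 0 2 3] cyc[of 0 1 3] cyc[of 0 1 2]
    by (elim disjE) (simp_all only: sum_4 vals row_identities)
  have "?v \<in> syzygy_tuples t"
  proof -
    have sym: "?v (Some (i, j)) + ?v (Some (j, i)) = 0" for i j
      using exhaust_4'[of i] exhaust_4'[of j]
      by (elim disjE) (simp_all only: vals add.right_inverse add.left_inverse add_0)
    show ?thesis unfolding syzygy_tuples_def mem_Collect_eq rows sym vals(1,2)
      using fv by (simp add: cmul_simps)
  qed
  then have d: "F dvd ?v x" for x using no_second_syzygies kv unfolding no_second_syzygies_def by blast
  have p: "F dvd k 0 1" "F dvd k 0 2" "F dvd k 0 3" "F dvd k 1 2" "F dvd k 1 3" "F dvd k 2 3"
    using d[of "Some (2, 3)"] d[of "Some (3, 1)"] d[of "Some (1, 2)"] d[of "Some (0, 3)"] d[of "Some (2, 0)"] d[of "Some (0, 1)"]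
    by (simp_all only: vals)
  have anti: "k j i = - k i j" for i j unfolding k by simp
  have "k i i = 0" for i unfolding k by simp
  then show ?thesis using exhaust_4'[of i] exhaust_4'[of j] p
      anti[of 0 1] anti[of 0 2] anti[of 0 3] anti[of 1 2] anti[of 1 3] anti[of 2 3]
    by (elim disjE) simp_all
qed

definition "ann d = {p \<in> forms d. act p c = 0}"

text \<open>In degree \<open>t + 1\<close> this is duality. In higher degrees, the derivatives of \<open>\<psi>\<close> are contractions of \<open>c\<close> by
  forms \<open>a i\<close>, by induction. The forms \<open>x\<^sub>j a i - x\<^sub>i a j\<close> kill \<open>c\<close>, so they are multiples of the quadric: by
  the second condition if their degree is \<open>t + 1\<close>, and by the first one if it is lower. Hence \<open>a i = x\<^sub>i e\<close>
  modulo the quadric for one \<open>e\<close>, and \<open>\<psi>\<close> is the contraction by \<open>e\<close>.\<close>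

lemma annihilated_functional:
  assumes "d \<ge> t + 1" "\<psi> \<in> dual d" "act F \<psi> = 0" "\<And>g. g \<in> ann (t + 1) \<Longrightarrow> act g \<psi> = 0"
  shows "\<exists>r. \<psi> = act r c"
  using assms
proof (induction d arbitrary: \<psi> rule: dec_induct)
  case base
  have "pair p \<psi> = 0" if "p \<in> forms (t + 1)" "act p c = 0" for p
    using base(3)[of p] that by (simp add: ann_def pair_eq_act)
  then obtain r where "\<psi> = act r c"
    using double_annihilator[OF c_dual base(1)] by (metis add_le_mono1 le_add1 mult_2)
  then show ?case by blast
next
  case (step d)
  let ?s = "2 * t + 1"
  have ex: "\<exists>r. act (var i) \<psi> = act r c" for i
  proof (rule step.IH)
    show "act (var i) \<psi> \<in> dual d" by (rule act_var_dual[OF step.prems(1)])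
    show "act F (act (var i) \<psi>) = 0" by (simp only: act_commute[of F] step.prems(2) act_fun)
    show "act g (act (var i) \<psi>) = 0" if "g \<in> ann (t + 1)" for g
      by (simp only: act_commute[of g] step.prems(3)[OF that] act_fun)
  qed
  have hom: "act (var i) \<psi> = (if d \<le> ?s then act (hom_component (?s - d) r) c else 0)"
    if "act (var i) \<psi> = act r c" for i r
  proof -
    have "act (var i) \<psi> \<in> dual d" by (rule act_var_dual[OF step.prems(1)])
    then have "act (var i) \<psi> = trunc d (act r c)" using trunc_id that by metis
    then show ?thesis by (simp only: trunc_act[OF c_dual])
  qed
  show ?case
  proof (cases "d \<le> ?s")
    case False
    then have "act (var i) \<psi> = 0" for i using ex[of i] hom[of i] by auto
    then have "\<psi> = 0" using dual_eq_0_vars[OF step.prems(1)] by simp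
    then show ?thesis by (metis act_0)
  next
    case True
    have "\<exists>r. r \<in> forms (?s - d) \<and> act (var i) \<psi> = act r c" for i
    proof -
      obtain r where "act (var i) \<psi> = act r c" using ex[of i] by auto
      then have "act (var i) \<psi> = act (hom_component (?s - d) r) c" using hom[of i r] True by simp
      then show ?thesis using hom_component_in_forms by blast
    qed
    then obtain a where a: "\<And>i. a i \<in> forms (?s - d)" "\<And>i. act (var i) \<psi> = act (a i) c" by metis
    define k where "k i j = var j * a i - var i * a j" for i j
    have kf: "k i j \<in> forms (1 + (?s - d))" for i j
      unfolding k_def using a(1) by (intro forms_diff forms_mult) auto
    have kk: "act (k i j) c = 0" for i j
      unfolding k_def by (simp only: act_diff act_mult a(2)[symmetric] act_commute[of "var i" "var j"]) simp
    have "F dvd k i j" for i j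
    proof (cases "d = t + 1")
      case True
      then have eq: "1 + (?s - d) = t + 1" by simp
      have "k i j \<in> forms (t + 1)" for i j using kf[of i j] by (simp only: eq)
      then show ?thesis by (rule dvd_koszul_relations[OF k_def _ kk])
    next
      case False
      then show ?thesis using step.hyps True by (intro ann_low[OF kf _ kk]) auto
    qed
    then obtain e where e: "\<And>i. F dvd a i - var i * e"
      unfolding k_def using koszul_cohomology_1[of a] by blast
    have eq: "act (a i) c = act (var i) (act e c)" for i
      using act_dvd[OF e F_kills, of i] by (simp add: act_diff act_mult)
    define \<chi> where "\<chi> = trunc (Suc d) (act e c)"
    have z: "act (var i) (\<psi> - \<chi>) = 0" for i
    proof -
      have "act (var i) \<chi> = trunc d (act (var i) (act e c))"
        unfolding \<chi>_def using act_trunc[OF var_in_forms[of i], where b = d and c = "act e c"] by (simp only: plus_1_eq_Suc)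
      also have "\<dots> = trunc d (act (var i) \<psi>)" by (simp only: eq[symmetric] a(2))
      also have "\<dots> = act (var i) \<psi>"
        by (rule trunc_id[OF act_var_dual[OF step.prems(1)]])
      finally show ?thesis by (simp only: act_fun) simp
    qed
    have "\<chi> \<in> dual (Suc d)" by (simp only: \<chi>_def trunc_dual)
    from dual_eq_0_vars[OF dual_closed(3)[OF step.prems(1) this] _ z] have "\<psi> = \<chi>"
      by (simp only: zero_less_Suc right_minus_eq)
    then have \<psi>: "\<psi> = (if Suc d \<le> ?s then act (hom_component (?s - Suc d) e) c else 0)"
      unfolding \<chi>_def by (simp only: trunc_act[OF c_dual])
    show ?thesis
    proof (cases "Suc d \<le> ?s")
      case True
      then show ?thesis using \<psi> by (intro exI) (simp only: if_True)
    next
      case False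
      then show ?thesis using \<psi> by (intro exI[of _ 0]) (simp only: if_False act_0)
    qed
  qed
qed

end

section \<open>Hilbert functions\<close>

lemma rk_formula:
  assumes "j \<ge> -3"
  shows "6 * int (rk j) = (j + 1) * (j + 2) * (j + 3)"
proof (cases "j < 0")
  case True
  then have "j = -1 \<or> j = -2 \<or> j = -3" using assms by auto
  then show ?thesis by (auto simp: rk_def)
next
  case False
  have "6 * ((n + 3) choose 3) = (n + 1) * (n + 2) * (n + 3)" for n :: nat
  proof -
    have a: "(n + 3) * ((n + 2) choose 2) = ((n + 3) choose 3) * 3"
      using Suc_times_binomial_eq[of "n + 2" 2] by (simp add: eval_nat_numeral One_nat_def del: binomial_Suc_Suc)
    have b: "(n + 2) * (n + 1) = ((n + 2) choose 2) * 2"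
      using Suc_times_binomial_eq[of "n + 1" 1] by (simp add: eval_nat_numeral One_nat_def del: binomial_Suc_Suc)
    have "6 * ((n + 3) choose 3) = (((n + 3) choose 3) * 3) * 2" by simp
    also have "\<dots> = (n + 3) * (((n + 2) choose 2) * 2)" by (simp only: a[symmetric] mult.assoc)
    also have "\<dots> = (n + 1) * (n + 2) * (n + 3)" by (simp only: b[symmetric]) (simp only: ac_simps)
    finally show ?thesis .
  qed
  from arg_cong[OF this[of "nat j"], of int] show ?thesis using False
    by (simp add: rk_def algebra_simps)
qed

lemma rk_diff:
  assumes "j \<ge> -1"
  shows "int (rk j) - int (rk (j - 2)) = (j + 1) * (j + 1)"
  using rk_formula[of j] rk_formula[of "j - 2"] assms by (simp add: algebra_simps)

lemma rk_neg: "j < 0 \<Longrightarrow> rk j = 0"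
  by (simp add: rk_def)

lemma rk_values: "rk 0 = 1" "rk 1 = 4" "rk 2 = 10"
  by (simp_all add: rk_def numeral_eq_Suc)

lemma linear_mult: "Vector_Spaces.linear cmul cmul (\<lambda>p. q * p :: ('i, 'k::field) mpoly)"
  by unfold_locales (simp_all add: distrib_left cmul_mult)

lemma ann_subspace: "V.subspace {p \<in> gforms d. act p c = 0}"
  for c :: "'i monom \<Rightarrow> 'k::field"
proof (rule V.subspaceI)
  fix p q assume "p \<in> {p \<in> gforms d. act p c = 0}" "q \<in> {p \<in> gforms d. act p c = 0}"
  then show "p + q \<in> {p \<in> gforms d. act p c = 0}" by (simp add: gforms_add act_add)
next
  fix a p assume "p \<in> {p \<in> gforms d. act p c = 0}"
  moreover then have "act (cmul a p) c = 0" using act_cmul[of a p c] by (auto simp: fun_eq_iff)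
  ultimately show "cmul a p \<in> {p \<in> gforms d. act p c = 0}" by (simp add: cmul_in_gforms)
qed simp

lemma ann_dim_le:
  fixes c :: "4 monom \<Rightarrow> 'k::field"
  assumes c: "c \<in> dual (d + e)"
  shows "rk (int d) + k_dim {p \<in> forms e. act p c = 0} \<le> rk (int e) + k_dim {p \<in> forms d. act p c = 0}"
proof -
  have l: "Vector_Spaces.linear cmul (*) (\<lambda>v. pair (w * v) c)" for w
    using Vector_Spaces.linear_compose[OF linear_mult[of w] linear_pair[of c]] by (simp add: o_def)
  have e: "{w \<in> forms e. \<forall>v\<in>forms d. pair (v * w) c = 0} = {p \<in> forms e. act p c = 0}"
    using act_eq_0_iff_pair[of _ e c d] c by (auto simp: add.commute)
  have d: "{v \<in> forms d. \<forall>w\<in>forms e. pair (v * w) c = 0} = {p \<in> forms d. act p c = 0}"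
    using act_eq_0_iff_pair[of _ d c e] c by (auto simp: mult.commute)
  have "k_dim (forms d :: (4, 'k) mpoly set) + k_dim {w \<in> forms e. \<forall>v\<in>forms d. pair (v * w) c = 0}
    \<le> k_dim (forms e :: (4, 'k) mpoly set) + k_dim {v \<in> forms d. \<forall>w\<in>forms e. pair (v * w) c = 0}"
  proof (rule dim_pairing_le[OF vector_space_cmul vector_space_cmul subspace_forms fin_dim_forms subspace_forms fin_dim_forms])
    show "Vector_Spaces.linear cmul (*) (\<lambda>v. pair (v * w) c)" for w
      using l[of w] by (simp only: mult.commute[of w])
  qed (rule l)
  then show ?thesis unfolding e d dim_forms .
qed

text \<open>Macaulay duality in numbers: \<open>c\<close> pairs the forms of degree \<open>d\<close> with those of degree \<open>e\<close>, and the
  kernels of this pairing are the annihilated forms. So the Hilbert function of the quotient is symmetric.\<close>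

lemma ann_dim_symmetric:
  fixes c :: "4 monom \<Rightarrow> 'k::field"
  assumes "c \<in> dual (d + e)"
  shows "rk (int d) + k_dim {p \<in> forms e. act p c = 0} = rk (int e) + k_dim {p \<in> forms d. act p c = 0}"
  using ann_dim_le[OF assms] ann_dim_le[of c e d] assms by (simp add: add.commute)

context quadric
begin

lemma F_gforms: "F \<in> gforms 2"
  using F2 gforms_nat[of 2] by (metis of_nat_numeral)

lemma dim_multiples: "k_dim {p \<in> gforms j. F dvd p} = rk (j - 2)"
proof -
  have "{p \<in> gforms j. F dvd p} = (\<lambda>h. F * h) ` gforms (j - 2)"
  proof (intro equalityI subsetI)
    fix p assume "p \<in> {p \<in> gforms j. F dvd p}"
    then obtain h where "p = F * h" "h \<in> gforms (j - 2)" using dvd_formE[OF F_gforms] by blast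
    then show "p \<in> (\<lambda>h. F * h) ` gforms (j - 2)" by blast
  next
    fix p assume "p \<in> (\<lambda>h. F * h) ` gforms (j - 2)"
    then show "p \<in> {p \<in> gforms j. F dvd p}" using gforms_mult'[OF F_gforms, of _ "j - 2" j] by auto
  qed
  then show ?thesis using VV.dim_image_inj[OF linear_mult[of F] subspace_gforms fin_dim_gforms, of "j - 2"] F_neq_0
    by (simp add: dim_gforms)
qed

end

context compressed_functional
begin

lemma act_above: "p \<in> gforms d \<Longrightarrow> d > 2 * int t + 1 \<Longrightarrow> act p c = 0"
  using act_dual_0[of p "nat d" c "2 * t + 1"] c_dual by (simp add: gforms_eq)

lemma dim_ann_low:
  assumes "j \<le> t"
  shows "k_dim {p \<in> forms j. act p c = 0} = rk (int j - 2)"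
proof -
  have "{p \<in> forms j. act p c = 0} = {p \<in> gforms (int j). F dvd p}"
    using ann_low[OF _ assms] act_dvd[OF _ F_kills] by auto
  then show ?thesis by (simp only: dim_multiples)
qed

lemma dim_ann:
  assumes "e \<le> t + 1"
  shows "int (k_dim {p \<in> gforms (int (t + 1 + e)). act p c = 0})
    = int (rk (int (t + 1 + e))) - (int t - int e + 1) * (int t - int e + 1)"
proof (cases "e = t + 1")
  case True
  then have "{p \<in> gforms (int (t + 1 + e)). act p c = 0} = gforms (int (t + 1 + e))"
    using act_above[of _ "int (t + 1 + e)"] by auto
  then show ?thesis using True by (simp only: dim_gforms) simp
next
  case False
  then have e: "e \<le> t" using assms by simp
  have "(t + 1 + e) + (t - e) = 2 * t + 1" using e by simp
  then have "c \<in> dual ((t + 1 + e) + (t - e))" using c_dual by (simp only:)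
  from ann_dim_symmetric[OF this]
  have "rk (int (t + 1 + e)) + rk (int (t - e) - 2) = rk (int (t - e)) + k_dim {p \<in> forms (t + 1 + e). act p c = 0}"
    by (simp only: dim_ann_low diff_le_self)
  moreover have "int (rk (int (t - e))) - int (rk (int (t - e) - 2)) = (int t - int e + 1) * (int t - int e + 1)"
    using rk_diff[of "int (t - e)"] e by (simp add: of_nat_diff)
  ultimately show ?thesis unfolding gforms_nat by linarith
qed

lemma exists_generators:
  obtains g where "\<And>i. i < 2 * t + 3 \<Longrightarrow> g i \<in> ann (t + 1)"
    "\<And>p. p \<in> ann (t + 1) \<Longrightarrow> \<exists>u. F dvd p - (\<Sum>i<2 * t + 3. cmul (u i) (g i))"
    "\<And>u i. F dvd (\<Sum>i<2 * t + 3. cmul (u i) (g i)) \<Longrightarrow> i < 2 * t + 3 \<Longrightarrow> u i = 0"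
proof -
  let ?S = "{p \<in> gforms (int (t + 1)). act p c = 0}" and ?T = "{p \<in> gforms (int (t + 1)). F dvd p}"
  have S: "?S = ann (t + 1)" unfolding gforms_nat ann_def ..
  have S0: "V.subspace ?T"
    by (rule V.subspaceI) (auto intro: gforms_add cmul_in_gforms dvd_cmul)
  have sub: "?T \<subseteq> ?S" using act_dvd[OF _ F_kills] by auto
  have fin: "V.fin_dim ?S" by (rule V.fin_dim_mono[OF fin_dim_gforms]) auto
  obtain g and n :: nat where g: "k_dim ?S = k_dim ?T + n" "\<And>i. i < n \<Longrightarrow> g i \<in> ?S"
    "\<And>p. p \<in> ?S \<Longrightarrow> \<exists>u. p - (\<Sum>i<n. cmul (u i) (g i)) \<in> ?T"
    "\<And>u i. (\<Sum>i<n. cmul (u i) (g i)) \<in> ?T \<Longrightarrow> i < n \<Longrightarrow> u i = 0"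
    by (rule V.basis_modulo[OF ann_subspace fin S0 sub]) blast
  have "int (k_dim ?S) = int (rk (int (t + 1))) - (int t + 1) * (int t + 1)"
    using dim_ann[of 0] by simp
  moreover have "int (rk (int (t + 1))) - int (rk (int (t + 1) - 2)) = (int t + 2) * (int t + 2)"
    using rk_diff[of "int (t + 1)"] by (simp add: algebra_simps)
  moreover have "(int t + 2) * (int t + 2) - (int t + 1) * (int t + 1) = 2 * int t + 3"
    by (simp add: algebra_simps)
  ultimately have "int n = 2 * int t + 3" using g(1) dim_multiples[of "int (t + 1)"] by linarith
  then have n: "n = 2 * t + 3" by linarith
  have "(\<Sum>i<n. cmul (u i) (g i)) \<in> gforms (int (t + 1))" for u
    using g(2) by (intro gforms_sum cmul_in_gforms) auto
  then show ?thesis using that[of g] g(2-4) unfolding n S by blast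
qed

end

locale generators = compressed_functional F t c for F :: "(4, 'k::field) mpoly" and t c +
  fixes n :: nat and g :: "nat \<Rightarrow> (4, 'k) mpoly"
  assumes n: "n = 2 * t + 3"
    and g_ann: "\<And>i. i < n \<Longrightarrow> g i \<in> ann (t + 1)"
    and g_span: "\<And>p. p \<in> ann (t + 1) \<Longrightarrow> \<exists>u. F dvd p - (\<Sum>i<n. cmul (u i) (g i))"
    and g_indep: "\<And>u i. F dvd (\<Sum>i<n. cmul (u i) (g i)) \<Longrightarrow> i < n \<Longrightarrow> u i = 0"
begin

lemma g_gforms: "i < n \<Longrightarrow> g i \<in> gforms (int (t + 1))"
  using g_ann unfolding gforms_nat by (simp add: ann_def)

definition "degs1 = replicate n (t + 1) @ [2]"

lemma length_degs1 [simp]: "length degs1 = n + 1"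
  by (simp add: degs1_def)

lemma degs1_nth [simp]: "i < n \<Longrightarrow> degs1 ! i = t + 1" "degs1 ! n = 2"
  by (simp_all add: degs1_def nth_append)

definition \<phi>1 :: "(nat \<Rightarrow> (4, 'k) mpoly) \<Rightarrow> (4, 'k) mpoly"
  where "\<phi>1 v = (\<Sum>i<n. g i * v i) + F * v n"

lemma \<phi>1_linear: "\<phi>1 (v + w) = \<phi>1 v + \<phi>1 w" "\<phi>1 (tscale a v) = cmul a (\<phi>1 v)"
  by (simp_all only: \<phi>1_def plus_fun_apply tscale_apply distrib_left sum.distrib cmul_mult cmul_sum cmul_simps ac_simps)

lemma linear_\<phi>1: "Vector_Spaces.linear tscale cmul \<phi>1"
  by unfold_locales (rule \<phi>1_linear)+

lemma \<phi>1_killed: "act (\<phi>1 v) c = 0"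
proof -
  have "act (g i * v i) c = 0" if "i \<in> {..<n}" for i
    using g_ann[of i] that by (simp only: ann_def mem_Collect_eq lessThan_iff mult.commute[of "g i"] act_mult act_fun)
  then have "(\<Sum>i<n. act (g i * v i) c) = 0" by (intro sum.neutral) auto
  then show ?thesis
    by (simp only: \<phi>1_def act_add act_sum mult.commute[of F] act_mult F_kills act_fun add_0)
qed

lemma \<phi>1_hcomp: "hcomp d (\<phi>1 v) = \<phi>1 (\<lambda>i. if i < n then hcomp (d - int (t + 1)) (v i) else if i = n then hcomp (d - 2) (v n) else 0)"
proof -
  have a: "hcomp j (p + q) = hcomp j p + hcomp j q" for j and p q :: "(4, 'k) mpoly"
    by (simp add: hcomp_def hom_component_add)
  have "hcomp d (\<Sum>i<n. g i * v i) = (\<Sum>i<n. g i * hcomp (d - int (t + 1)) (v i))"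
    unfolding hcomp_sum by (intro sum.cong refl hcomp_mult g_gforms) simp
  then show ?thesis unfolding \<phi>1_def a by (simp add: hcomp_mult[OF F_gforms])
qed

lemma degs1_piece:
  "(\<lambda>i. if i < n then hcomp (d - int (t + 1)) (v i) else if i = n then hcomp (d - 2) (v n) else 0) \<in> free_piece degs1 d"
proof (rule free_pieceI)
  fix i assume "i < length degs1"
  then consider "i < n" | "i = n" by fastforce
  then show "(if i < n then hcomp (d - int (t + 1)) (v i) else if i = n then hcomp (d - 2) (v n) else 0)
      \<in> gforms (d - int (degs1 ! i))"
    by cases simp_all
qed simp

lemma \<phi>1_gforms: "v \<in> free_piece degs1 d \<Longrightarrow> \<phi>1 v \<in> gforms d"
  unfolding \<phi>1_def
proof (intro gforms_add gforms_sum)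
  assume v: "v \<in> free_piece degs1 d"
  show "g i * v i \<in> gforms d" if "i \<in> {..<n}" for i
    using gforms_mult'[OF g_gforms free_pieceD(1)[OF v], of i i d] that by simp
  show "F * v n \<in> gforms d"
    using gforms_mult'[OF F_gforms free_pieceD(1)[OF v], of n d] by simp
qed

lemma hcomp_id: "p \<in> gforms d \<Longrightarrow> hcomp d p = p"
  by (cases "d < 0") (auto simp: gforms_neg gforms_eq hcomp_def hom_component_forms)

lemma F_multiple: "q * F \<in> range \<phi>1"
proof (rule range_eqI)
  show "q * F = \<phi>1 (unit n q)" by (simp add: \<phi>1_def unit_def mult.commute)
qed

lemma g_multiple: "p \<in> ann (t + 1) \<Longrightarrow> q * p \<in> range \<phi>1"
proof -
  assume "p \<in> ann (t + 1)"
  then obtain u where "F dvd p - (\<Sum>i<n. cmul (u i) (g i))" using g_span by blast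
  then obtain h where h: "p - (\<Sum>i<n. cmul (u i) (g i)) = F * h" by (rule dvdE)
  have "p = (\<Sum>i<n. cmul (u i) (g i)) + F * h" using h by (simp add: diff_eq_eq add.commute)
  then have "q * p = (\<Sum>i<n. q * cmul (u i) (g i)) + q * (F * h)" by (simp only: distrib_left sum_distrib_left)
  also have "(\<Sum>i<n. q * cmul (u i) (g i)) = (\<Sum>i<n. g i * cmul (u i) q)"
    by (intro sum.cong refl) (simp only: cmul_mult mult.commute[of q])
  also have "q * (F * h) = F * (q * h)" by (rule mult.left_commute)
  also have "(\<Sum>i<n. g i * cmul (u i) q) + F * (q * h) = \<phi>1 (\<lambda>i. if i < n then cmul (u i) q else q * h)" by (simp add: \<phi>1_def)
  finally have "q * p = \<phi>1 (\<lambda>i. if i < n then cmul (u i) q else q * h)" .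
  then show ?thesis by (intro image_eqI[of _ _ "\<lambda>i. if i < n then cmul (u i) q else q * h"]) simp_all
qed

text \<open>The annihilator is generated by the quadric and its part of degree \<open>t + 1\<close>: a functional that
  kills these generators is a multiple of \<open>c\<close>.\<close>

lemma \<phi>1_onto:
  assumes "d \<ge> t + 1" "p \<in> forms d" "act p c = 0"
  obtains v where "v \<in> free_piece degs1 (int d)" "\<phi>1 v = p"
proof -
  have "\<exists>v. p = \<phi>1 v"
  proof (rule ccontr)
    assume no: "\<nexists>v. p = \<phi>1 v"
    have "V.subspace (range \<phi>1)"
      using module_hom.subspace_image[OF linear_\<phi>1[unfolded Vector_Spaces.linear_iff_module_hom] W.subspace_UNIV] .
    moreover have "p \<notin> range \<phi>1" using no by blast
    ultimately obtain h where h: "Vector_Spaces.linear cmul (*) h" "\<And>x. x \<in> range \<phi>1 \<Longrightarrow> h x = 0" "h p = 1"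
      using V.separating_functional by blast
    define \<psi> where "\<psi> = trunc d (\<lambda>m. h (Poly_Mapping.single m 1))"
    have \<psi>: "pair q \<psi> = h q" if "q \<in> forms d" for q
      unfolding \<psi>_def using functional_eq_pair[OF h(1), of q] pair_trunc[OF that] by simp
    have kill: "act q \<psi> = 0" if q: "q \<in> forms a" "a \<le> d" "\<And>q'. q' * q \<in> range \<phi>1" for q a
    proof -
      have "\<psi> \<in> dual (a + (d - a))" using q(2) by (simp add: \<psi>_def)
      moreover have "pair (q' * q) \<psi> = 0" if "q' \<in> forms (d - a)" for q'
      proof -
        have "q' * q \<in> forms d" using forms_mult[OF that q(1)] q(2) by simp
        then show ?thesis using \<psi> h(2) q(3) by simp
      qed
      ultimately show ?thesis using act_eq_0_iff_pair[OF q(1)] by blast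
    qed
    have "2 \<le> d" using assms(1) t1 by simp
    then have "act F \<psi> = 0" by (rule kill[OF F2 _ F_multiple])
    moreover have "act q \<psi> = 0" if "q \<in> ann (t + 1)" for q
      by (rule kill[OF _ assms(1) g_multiple[OF that]]) (use that in \<open>simp add: ann_def\<close>)
    ultimately obtain r where r: "\<psi> = act r c"
      using annihilated_functional[OF assms(1), of \<psi>] by (auto simp: \<psi>_def)
    have "pair p \<psi> = pair r (act p c)" unfolding r by (simp only: pair_mult[symmetric] mult.commute)
    then have "pair p \<psi> = 0" by (simp only: assms(3) pair_fun)
    then show False using \<psi>[OF assms(2)] h(3) by simp
  qed
  then obtain v where v: "p = \<phi>1 v" by blast
  have "p \<in> gforms (int d)" using assms(2) unfolding gforms_nat .
  then have "p = hcomp (int d) (\<phi>1 v)" using hcomp_id v by metis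
  then show ?thesis using that[OF degs1_piece[of "int d" v]] unfolding \<phi>1_hcomp by simp
qed

definition "ker1 d = {v \<in> free_piece degs1 d. \<phi>1 v = 0}"

lemma subspace_ker1: "W.subspace (ker1 d)"
proof (rule W.subspaceI)
  have "\<phi>1 0 = 0" using module_hom.zero[OF linear_\<phi>1[unfolded Vector_Spaces.linear_iff_module_hom]] .
  then show "0 \<in> ker1 d" unfolding ker1_def using W.subspace_0[OF subspace_free_piece] by blast
next
  fix v w assume "v \<in> ker1 d" "w \<in> ker1 d"
  then show "v + w \<in> ker1 d" unfolding ker1_def mem_Collect_eq \<phi>1_linear
    using W.subspace_add[OF subspace_free_piece, of v degs1 d w] by simp
next
  fix a v assume "v \<in> ker1 d"
  then show "tscale a v \<in> ker1 d" unfolding ker1_def mem_Collect_eq \<phi>1_linear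
    using W.subspace_scale[OF subspace_free_piece, of v degs1 d a] by (simp add: cmul_simps)
qed

lemma fin_dim_ker1: "W.fin_dim (ker1 d)"
  by (rule W.fin_dim_mono[OF fin_dim_free_piece[of degs1 d]]) (auto simp: ker1_def)

lemma dim_ker1:
  assumes "d \<ge> t + 1"
  shows "W.dim (ker1 (int d)) + k_dim {p \<in> gforms (int d). act p c = 0} = n * rk (int d - int (t + 1)) + rk (int d - 2)"
proof -
  have "\<phi>1 ` free_piece degs1 (int d) = {p \<in> gforms (int d). act p c = 0}"
  proof (intro equalityI subsetI)
    fix p assume "p \<in> {p \<in> gforms (int d). act p c = 0}"
    then have "p \<in> forms d" "act p c = 0" unfolding gforms_nat by auto
    then obtain v where "v \<in> free_piece degs1 (int d)" "\<phi>1 v = p" by (rule \<phi>1_onto[OF assms])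
    then show "p \<in> \<phi>1 ` free_piece degs1 (int d)" by blast
  next
    fix p assume "p \<in> \<phi>1 ` free_piece degs1 (int d)"
    then obtain v where "v \<in> free_piece degs1 (int d)" "p = \<phi>1 v" by blast
    then show "p \<in> {p \<in> gforms (int d). act p c = 0}" using \<phi>1_gforms[of v "int d"] \<phi>1_killed[of v] by blast
  qed
  then have "W.dim (free_piece degs1 (int d) :: (nat \<Rightarrow> (4, 'k) mpoly) set)
      = k_dim {p \<in> gforms (int d). act p c = 0} + W.dim (ker1 (int d))"
    using WV.dim_image_kernel[OF linear_\<phi>1 subspace_free_piece fin_dim_free_piece, of degs1 "int d"]
    by (simp add: ker1_def)
  moreover have "W.dim (free_piece degs1 (int d) :: (nat \<Rightarrow> (4, 'k) mpoly) set) = n * rk (int d - int (t + 1)) + rk (int d - 2)"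
    unfolding dim_free_piece by (simp add: degs1_def sum_list_replicate)
  ultimately show ?thesis by simp
qed

lemma exists_linear_syzygies:
  obtains b where "\<And>j. j < n \<Longrightarrow> b j \<in> ker1 (int (t + 2))"
    "\<And>v. v \<in> ker1 (int (t + 2)) \<Longrightarrow> \<exists>u. v = (\<Sum>j<n. tscale (u j) (b j))"
    "\<And>u j. (\<Sum>j<n. tscale (u j) (b j)) = 0 \<Longrightarrow> j < n \<Longrightarrow> u j = 0"
proof -
  have z: "W.subspace {0 :: nat \<Rightarrow> (4, 'k) mpoly}" "{0} \<subseteq> ker1 (int (t + 2))"
    using W.subspace_0[OF subspace_ker1] by (auto simp: W.subspace_single_0)
  obtain b and m :: nat where b: "W.dim (ker1 (int (t + 2))) = W.dim {0 :: nat \<Rightarrow> (4, 'k) mpoly} + m"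
    "\<And>j. j < m \<Longrightarrow> b j \<in> ker1 (int (t + 2))"
    "\<And>v. v \<in> ker1 (int (t + 2)) \<Longrightarrow> \<exists>u. v - (\<Sum>j<m. tscale (u j) (b j)) \<in> {0}"
    "\<And>u j. (\<Sum>j<m. tscale (u j) (b j)) \<in> {0} \<Longrightarrow> j < m \<Longrightarrow> u j = 0"
    by (rule W.basis_modulo[OF subspace_ker1 fin_dim_ker1 z]) blast
  have "W.dim {0 :: nat \<Rightarrow> (4, 'k) mpoly} \<le> card ({} :: (nat \<Rightarrow> (4, 'k) mpoly) set)"
    by (rule W.dim_le_card) (simp_all only: W.span_empty subset_refl finite.emptyI)
  then have m: "W.dim (ker1 (int (t + 2))) = m" using b(1) by (simp only: card.empty le_zero_eq add_0)
  have k: "int (k_dim {p \<in> gforms (int (t + 2)). act p c = 0}) = int (rk (int (t + 2))) - int t * int t"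
    using dim_ann[of 1] by (simp add: algebra_simps)
  have "m + k_dim {p \<in> gforms (int (t + 2)). act p c = 0} = n * 4 + rk (int t)"
    using dim_ker1[of "t + 2"] m by (simp add: rk_values)
  moreover have "int (rk (int (t + 2))) - int (rk (int t)) = (int t + 3) * (int t + 3)"
    using rk_diff[of "int (t + 2)"] by (simp add: algebra_simps)
  moreover have "(int t + 3) * (int t + 3) - int t * int t = 6 * int t + 9" by (simp add: algebra_simps)
  ultimately have "int m = 4 * int n - (6 * int t + 9)" using k by linarith
  then have "m = n" using n by linarith
  moreover have "v = (\<Sum>j<m. tscale (u j) (b j))" if "v - (\<Sum>j<m. tscale (u j) (b j)) \<in> {0}" for v u
    using that by (simp only: singleton_iff right_minus_eq)
  ultimately show ?thesis using that[of b] b(2-4) by blast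
qed

end

section \<open>The resolution\<close>

locale linear_syzygies = generators F t c n g for F :: "(4, 'k::field) mpoly" and t c n g +
  fixes b :: "nat \<Rightarrow> nat \<Rightarrow> (4, 'k) mpoly"
  assumes b_ker: "\<And>j. j < n \<Longrightarrow> b j \<in> ker1 (int (t + 2))"
    and b_span: "\<And>v. v \<in> ker1 (int (t + 2)) \<Longrightarrow> \<exists>u. v = (\<Sum>j<n. tscale (u j) (b j))"
    and b_indep: "\<And>u j. (\<Sum>j<n. tscale (u j) (b j)) = 0 \<Longrightarrow> j < n \<Longrightarrow> u j = 0"
begin

lemma b_gforms: "j < n \<Longrightarrow> i < n \<Longrightarrow> b j i \<in> forms 1" "j < n \<Longrightarrow> b j n \<in> forms t"
  "j < n \<Longrightarrow> i > n \<Longrightarrow> b j i = 0"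
proof -
  assume j: "j < n"
  then have v: "b j \<in> free_piece degs1 (int (t + 2))" using b_ker by (simp add: ker1_def)
  show "b j i \<in> forms 1" if "i < n"
  proof -
    have "b j i \<in> gforms (int (t + 2) - int (t + 1))" using free_pieceD(1)[OF v, of i] that by simp
    also have "int (t + 2) - int (t + 1) = int 1" by simp
    finally show ?thesis unfolding gforms_nat .
  qed
  have "b j n \<in> gforms (int (t + 2) - int 2)" using free_pieceD(1)[OF v, of n] by simp
  also have "int (t + 2) - int 2 = int t" by simp
  finally show "b j n \<in> forms t" unfolding gforms_nat .
  show "b j i = 0" if "i > n" using free_pieceD(2)[OF v, of i] that by simp
qed

lemma b_relation: "j < n \<Longrightarrow> (\<Sum>i<n. g i * b j i) + F * b j n = 0"
  using b_ker by (simp add: ker1_def \<phi>1_def)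

definition "degs2 = replicate n (t + 2) @ replicate n (t + 3)"

lemma length_degs2 [simp]: "length degs2 = n + n"
  by (simp add: degs2_def)

lemma degs2_nth [simp]: "i < n \<Longrightarrow> degs2 ! i = t + 2" "i < n \<Longrightarrow> degs2 ! (n + i) = t + 3"
  by (simp_all add: degs2_def nth_append)

definition \<phi>2 :: "(nat \<Rightarrow> (4, 'k) mpoly) \<Rightarrow> nat \<Rightarrow> (4, 'k) mpoly"
  where "\<phi>2 u i = (if i < n then (\<Sum>j<n. b j i * u j) + F * u (n + i)
    else if i = n then (\<Sum>j<n. b j n * u j) - (\<Sum>j<n. g j * u (n + j)) else 0)"

lemma linear_\<phi>2: "Vector_Spaces.linear tscale tscale \<phi>2"
proof unfold_locales
  fix u w
  show "\<phi>2 (u + w) = \<phi>2 u + \<phi>2 w"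
    by (rule ext) (simp only: \<phi>2_def plus_fun_apply distrib_left sum.distrib; simp)
next
  fix a u
  show "\<phi>2 (tscale a u) = tscale a (\<phi>2 u)"
    by (rule ext) (simp only: \<phi>2_def tscale_apply cmul_mult cmul_sum[symmetric] cmul_simps; simp add: cmul_simps)
qed

lemma rearrange:
  fixes f :: "'r::comm_ring_1"
  shows "(\<Sum>i<n. x i * ((\<Sum>j<n. y j i * u j) + f * w i)) + f * ((\<Sum>j<n. z j * u j) - (\<Sum>j<n. x j * w j))
    = (\<Sum>j<n. ((\<Sum>i<n. x i * y j i) + f * z j) * u j)"
proof -
  have "(\<Sum>i<n. x i * (\<Sum>j<n. y j i * u j)) = (\<Sum>j<n. (\<Sum>i<n. x i * y j i) * u j)"
    unfolding sum_distrib_left sum_distrib_right by (subst sum.swap) (simp add: mult.assoc)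
  moreover have "(\<Sum>i<n. x i * (f * w i)) = f * (\<Sum>j<n. x j * w j)"
    by (simp add: sum_distrib_left mult.left_commute)
  moreover have "(\<Sum>j<n. f * z j * u j) = f * (\<Sum>j<n. z j * u j)"
    by (simp add: sum_distrib_left mult.assoc)
  ultimately show ?thesis by (simp add: distrib_left distrib_right sum.distrib right_diff_distrib)
qed

lemma \<phi>1_\<phi>2: "\<phi>1 (\<phi>2 u) = 0"
proof -
  have "\<phi>1 (\<phi>2 u) = (\<Sum>i<n. g i * ((\<Sum>j<n. b j i * u j) + F * u (n + i)))
      + F * ((\<Sum>j<n. b j n * u j) - (\<Sum>j<n. g j * u (n + j)))"
    by (simp add: \<phi>1_def \<phi>2_def)
  also have "\<dots> = (\<Sum>j<n. ((\<Sum>i<n. g i * b j i) + F * b j n) * u j)" by (rule rearrange)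
  also have "\<dots> = 0" by (intro sum.neutral) (simp add: b_relation)
  finally show ?thesis .
qed

lemma \<phi>2_piece: "u \<in> free_piece degs2 d \<Longrightarrow> \<phi>2 u \<in> free_piece degs1 d"
proof (rule free_pieceI)
  fix i assume u: "u \<in> free_piece degs2 d" and "i < length degs1"
  then consider "i < n" | "i = n" by fastforce
  then show "\<phi>2 u i \<in> gforms (d - int (degs1 ! i))"
  proof cases
    case 1
    have "b j i * u j \<in> gforms (d - int (t + 1))" if "j < n" for j
      by (rule gforms_mult'[of _ "int 1" _ "d - int (t + 2)"])
        (use b_gforms(1)[OF that 1] free_pieceD(1)[OF u, of j] that in \<open>simp_all only: gforms_nat, simp_all\<close>)
    moreover have "F * u (n + i) \<in> gforms (d - int (t + 1))"
      by (rule gforms_mult'[OF F_gforms, of _ "d - int (t + 3)"]) (use free_pieceD(1)[OF u, of "n + i"] 1 in simp_all)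
    ultimately show ?thesis using 1 by (auto simp: \<phi>2_def intro!: gforms_add gforms_sum)
  next
    case 2
    have "b j n * u j \<in> gforms (d - 2)" if "j < n" for j
      by (rule gforms_mult'[of _ "int t" _ "d - int (t + 2)"])
        (use b_gforms(2)[OF that] free_pieceD(1)[OF u, of j] that in \<open>simp_all only: gforms_nat, simp_all\<close>)
    moreover have "g j * u (n + j) \<in> gforms (d - 2)" if "j < n" for j
      by (rule gforms_mult'[OF g_gforms[OF that], of _ "d - int (t + 3)"]) (use free_pieceD(1)[OF u, of "n + j"] that in simp_all)
    ultimately show ?thesis using 2 by (auto simp: \<phi>2_def intro!: gforms_diff gforms_sum)
  qed
qed (auto simp: \<phi>2_def)

definition "ker2 d = {u \<in> free_piece degs2 d. \<phi>2 u = 0}"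

text \<open>The tuples of polynomials that represent relations modulo the quadric between the generators
  \<open>g\<close>, and those that come from the linear syzygies.\<close>

definition "syz = {v. F dvd (\<Sum>i<n. g i * v i)}"

definition "syz' = {v. \<exists>u z. \<forall>i<n. v i = (\<Sum>j<n. b j i * u j) + F * z i}"

lemma syz'_subspace: "W.subspace syz'"
proof (rule W.subspaceI)
  show "0 \<in> syz'" unfolding syz'_def by (intro CollectI exI[of _ "\<lambda>_. 0"]) simp
next
  fix v w assume "v \<in> syz'" "w \<in> syz'"
  then obtain u z u' z' where "\<forall>i<n. v i = (\<Sum>j<n. b j i * u j) + F * z i" "\<forall>i<n. w i = (\<Sum>j<n. b j i * u' j) + F * z' i"
    unfolding syz'_def by blast
  then show "v + w \<in> syz'" unfolding syz'_def
    by (intro CollectI exI[of _ "\<lambda>j. u j + u' j"] exI[of _ "\<lambda>j. z j + z' j"]) (simp add: distrib_left sum.distrib)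
next
  fix a v assume "v \<in> syz'"
  then obtain u z where "\<forall>i<n. v i = (\<Sum>j<n. b j i * u j) + F * z i" unfolding syz'_def by blast
  then show "tscale a v \<in> syz'" unfolding syz'_def
    by (intro CollectI exI[of _ "\<lambda>j. cmul a (u j)"] exI[of _ "\<lambda>j. cmul a (z j)"])
      (simp add: cmul_simps cmul_mult cmul_sum)
qed

lemma lift_syz:
  assumes "v \<in> syz" "\<And>i. i < n \<Longrightarrow> v i \<in> gforms (d - int (t + 1))"
  obtains h where "(\<lambda>i. if i < n then v i else if i = n then h else 0) \<in> ker1 d"
proof -
  have "(\<Sum>i<n. g i * v i) \<in> gforms d"
  proof (intro gforms_sum)
    fix i assume "i \<in> {..<n}"
    then show "g i * v i \<in> gforms d" using gforms_mult'[OF g_gforms assms(2), of i i d] by simp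
  qed
  then obtain h where h: "(\<Sum>i<n. g i * v i) = F * h" "h \<in> gforms (d - 2)"
    using dvd_formE[OF F_gforms, of "\<Sum>i<n. g i * v i" d] assms(1) unfolding syz_def by blast
  let ?v = "\<lambda>i. if i < n then v i else if i = n then - h else 0"
  have "\<phi>1 ?v = 0" by (simp add: \<phi>1_def h(1))
  moreover have "?v \<in> free_piece degs1 d"
  proof (rule free_pieceI)
    fix i assume "i < length degs1"
    then consider "i < n" | "i = n" by fastforce
    then show "?v i \<in> gforms (d - int (degs1 ! i))"
      by cases (use assms(2) h(2) in \<open>simp_all add: gforms_uminus\<close>)
  qed simp
  ultimately show ?thesis using that[of "- h"] by (simp add: ker1_def)
qed

text \<open>The coefficients of the products of variables in such a relation, combined with the \<open>g\<close>, form a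
  tuple of the kind excluded by the second open condition.\<close>

lemma no_linear_kernel:
  assumes u: "\<And>j. j < n \<Longrightarrow> u j \<in> forms 1" and f: "\<And>i. i < n \<Longrightarrow> f' i \<in> forms 0"
    and eq: "\<And>i. i < n \<Longrightarrow> (\<Sum>j<n. b j i * u j) + F * f' i = 0" and j: "j < n"
  shows "u j = 0"
proof -
  let ?e = "\<lambda>i. Poly_Mapping.single i (1::nat) :: 4 monom"
  define U where "U j x = Poly_Mapping.lookup (u j) (?e x)" for j x
  define B where "B j i x = Poly_Mapping.lookup (b j i) (?e x)" for j i x
  define C where "C i = Poly_Mapping.lookup (f' i) 0" for i
  define \<kappa> where "\<kappa> = (\<Sum>i<n. cmul (- C i) (g i))"
  define k where "k x y = (\<Sum>i<n. cmul (\<Sum>j<n. U j x * B j i y) (g i))" for x y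
  define v where "v = (\<lambda>None \<Rightarrow> \<kappa> | Some (x, y) \<Rightarrow> k x y)"
  have lin: "p = (\<Sum>x\<in>UNIV. cmul (Poly_Mapping.lookup p (?e x)) (var x))" if "p \<in> forms 1" for p :: "(4, 'k) mpoly"
  proof (rule poly_mapping_eqI)
    fix m
    have l: "Poly_Mapping.lookup (\<Sum>x\<in>UNIV. cmul (Poly_Mapping.lookup p (?e x)) (var x)) m
        = (\<Sum>x\<in>UNIV. if ?e x = m then Poly_Mapping.lookup p m else 0)"
      unfolding lookup_sum by (intro sum.cong refl) (auto simp: var_def lookup_single when_def)
    show "Poly_Mapping.lookup p m = Poly_Mapping.lookup (\<Sum>x\<in>UNIV. cmul (Poly_Mapping.lookup p (?e x)) (var x)) m"
    proof (cases "mdeg m = 1")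
      case True
      then obtain x m' where m: "m = ?e x + m'" using monom_factor_pos[of m] by auto
      then have "m' = 0" using True by (simp add: mdeg_eq_0_iff)
      then have m: "m = ?e x" using m by simp
      have inj: "?e y = ?e x \<longleftrightarrow> y = x" for y
        using add_single_eq_iff[of y y x y] by (metis add_right_cancel)
      show ?thesis unfolding l unfolding m inj by simp
    next
      case False
      then have "?e x \<noteq> m" for x by auto
      then show ?thesis unfolding l using False that by (auto simp: in_forms_iff)
    qed
  qed
  have uu: "u j = (\<Sum>x\<in>UNIV. cmul (U j x) (var x))" if "j < n" for j
    unfolding U_def by (rule lin[OF u[OF that]])
  have bb: "b j i = (\<Sum>x\<in>UNIV. cmul (B j i x) (var x))" if "j < n" "i < n" for j i
    unfolding B_def by (rule lin[OF b_gforms(1)[OF that]])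
  have quad_rel: "(\<Sum>j<n. U j x * B j i y) + (if x = y then 0 else \<Sum>j<n. U j y * B j i x) = - C i * f x y"
    if i: "i < n" for i x y
  proof -
    have fC: "f' i = Poly_Mapping.single 0 (C i)"
    proof (rule poly_mapping_eqI)
      fix m show "Poly_Mapping.lookup (f' i) m = Poly_Mapping.lookup (Poly_Mapping.single 0 (C i)) m"
        using f[OF i] by (cases "m = 0") (auto simp: C_def in_forms_iff mdeg_eq_0_iff lookup_single_not_eq)
    qed
    have c: "Poly_Mapping.lookup (b j i * u j) (?e x + ?e y) = U j x * B j i y + (if x = y then 0 else U j y * B j i x)"
      if "j < n" for j
    proof -
      have bu: "b j i * u j = (\<Sum>z\<in>UNIV. \<Sum>w\<in>UNIV. cmul (B j i z * U j w) (var z * var w))"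
        unfolding uu[OF that] bb[OF that i] sum_product by (simp add: cmul_mult cmul_simps mult.commute)
      have "Poly_Mapping.lookup (b j i * u j) (?e x + ?e y)
          = (\<Sum>z\<in>UNIV. \<Sum>w\<in>UNIV. if (z = x \<and> w = y) \<or> (z = y \<and> w = x) then B j i z * U j w else 0)"
        unfolding bu var_mult_var lookup_sum
        by (simp only: lookup_single when_def add_single_eq_iff)
      also have "\<dots> = (\<Sum>z\<in>UNIV. (if z = x then B j i x * U j y else 0) + (if z = y \<and> x \<noteq> y then B j i y * U j x else 0))"
      proof (intro sum.cong refl)
        fix z
        show "(\<Sum>w\<in>UNIV. if (z = x \<and> w = y) \<or> (z = y \<and> w = x) then B j i z * U j w else 0)
          = (if z = x then B j i x * U j y else 0) + (if z = y \<and> x \<noteq> y then B j i y * U j x else 0)"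
          by (cases "z = x"; cases "z = y") (auto simp: sum.delta')
      qed
      also have "\<dots> = B j i x * U j y + (if x \<noteq> y then B j i y * U j x else 0)"
        by (simp add: sum.distrib)
      finally show ?thesis by (auto simp: ac_simps)
    qed
    have "Poly_Mapping.lookup ((\<Sum>j<n. b j i * u j) + F * f' i) (?e x + ?e y) = 0" using eq[OF i] by simp
    moreover have "Poly_Mapping.lookup (F * f' i) (?e x + ?e y) = C i * f x y"
      unfolding fC mult.commute[of F] using lookup_single_mult[of 0 "C i" F "?e x + ?e y"]
      by (simp add: quad_coeff_def)
    ultimately have "(\<Sum>j<n. U j x * B j i y + (if x = y then 0 else U j y * B j i x)) + C i * f x y = 0"
      by (simp only: lookup_add lookup_sum) (simp add: c)
    moreover have "(\<Sum>j<n. U j x * B j i y + (if x = y then 0 else U j y * B j i x))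
        = (\<Sum>j<n. U j x * B j i y) + (if x = y then 0 else \<Sum>j<n. U j y * B j i x)"
      by (cases "x = y") (simp_all add: sum.distrib)
    ultimately show ?thesis by (simp only: mult_minus_left eq_neg_iff_add_eq_0)
  qed
  have gf: "g i \<in> forms (t + 1)" "act (g i) c = 0" if "i < n" for i using g_ann[OF that] by (auto simp: ann_def)
  have comb: "(\<Sum>i<n. cmul (a i) (g i)) \<in> forms (t + 1)" "act (\<Sum>i<n. cmul (a i) (g i)) c = 0" for a
  proof -
    show "(\<Sum>i<n. cmul (a i) (g i)) \<in> forms (t + 1)" by (intro forms_sum cmul_in_forms gf) simp
    have "act (cmul (a i) (g i)) c = 0" if "i < n" for i
      unfolding act_cmul by (rule ext) (simp only: gf(2)[OF that] zero_fun_apply mult_zero_right)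
    then show "act (\<Sum>i<n. cmul (a i) (g i)) c = 0" unfolding act_sum by (intro sum.neutral) auto
  qed
  have vv: "v None = \<kappa>" "v (Some (x, y)) = k x y" for x y by (simp_all add: v_def)
  have kk: "\<kappa> \<in> forms (t + 1)" "act \<kappa> c = 0" "k x y \<in> forms (t + 1)" "act (k x y) c = 0" for x y
    unfolding \<kappa>_def k_def by (rule comb)+
  have vj: "v s \<in> forms (t + 1)" "act (v s) c = 0" for s
  proof -
    consider "s = None" | x y where "s = Some (x, y)" by (metis not_None_eq surj_pair)
    note s = this
    show "v s \<in> forms (t + 1)" using s by cases (simp_all only: vv kk)
    show "act (v s) c = 0" using s by cases (simp_all only: vv kk)
  qed
  have row: "F dvd (\<Sum>y\<in>UNIV. var y * k x y)" for x
  proof -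
    have "(\<Sum>y\<in>UNIV. var y * k x y) = (\<Sum>y\<in>UNIV. \<Sum>i<n. \<Sum>j<n. cmul (U j x) (g i * cmul (B j i y) (var y)))"
      unfolding k_def sum_distrib_left
      by (intro sum.cong refl) (simp add: cmul_mult cmul_simps mult.commute V.scale_sum_left sum_distrib_left)
    also have "\<dots> = (\<Sum>i<n. \<Sum>y\<in>UNIV. \<Sum>j<n. cmul (U j x) (g i * cmul (B j i y) (var y)))"
      by (rule sum.swap)
    also have "\<dots> = (\<Sum>i<n. \<Sum>j<n. \<Sum>y\<in>UNIV. cmul (U j x) (g i * cmul (B j i y) (var y)))"
      by (intro sum.cong refl sum.swap)
    also have "\<dots> = (\<Sum>i<n. \<Sum>j<n. cmul (U j x) (g i * b j i))"
      by (intro sum.cong refl) (simp add: bb cmul_sum[symmetric] sum_distrib_left[symmetric])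
    also have "\<dots> = (\<Sum>j<n. cmul (U j x) (\<Sum>i<n. g i * b j i))"
      by (subst sum.swap) (simp add: cmul_sum)
    also have "F dvd \<dots>"
    proof (rule dvd_sum, rule dvd_cmul)
      fix j assume "j \<in> {..<n}"
      then have "(\<Sum>i<n. g i * b j i) = F * (- b j n)" using b_relation[of j] by (simp add: eq_neg_iff_add_eq_0)
      then show "F dvd (\<Sum>i<n. g i * b j i)" by simp
    qed
    finally show ?thesis .
  qed
  have \<kappa>: "cmul a \<kappa> = (\<Sum>i<n. cmul (- C i * a) (g i))" for a
    unfolding \<kappa>_def cmul_sum by (intro sum.cong refl) (simp only: cmul_simps(3) mult.commute[of a])
  have diag: "k x x - cmul (f x x) \<kappa> = 0" for x
  proof -
    have "(\<Sum>j<n. U j x * B j i x) = - C i * f x x" if "i < n" for i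
      using quad_rel[OF that, of x x] by (simp only: if_True refl add_0_right)
    then have "k x x = cmul (f x x) \<kappa>" unfolding k_def \<kappa> by (intro sum.cong refl) (simp only: lessThan_iff)
    then show ?thesis by (simp only: diff_self)
  qed
  have offdiag: "k x y + k y x - cmul (f x y) \<kappa> = 0" if xy: "x \<noteq> y" for x y
  proof -
    have e: "(\<Sum>j<n. U j x * B j i y) + (\<Sum>j<n. U j y * B j i x) = - C i * f x y" if "i < n" for i
      using quad_rel[OF that, of x y] xy by (simp only: if_False)
    have "k x y + k y x = (\<Sum>i<n. cmul ((\<Sum>j<n. U j x * B j i y) + (\<Sum>j<n. U j y * B j i x)) (g i))"
      unfolding k_def by (simp only: cmul_simps(2) sum.distrib)
    also have "\<dots> = cmul (f x y) \<kappa>" unfolding \<kappa> using e by (intro sum.cong refl) (simp only: lessThan_iff)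
    finally show ?thesis by (simp only: diff_self)
  qed
  have "v \<in> syzygy_tuples t"
    unfolding syzygy_tuples_def mem_Collect_eq vv using vj(1) row diag offdiag by simp
  then have "\<forall>s. F dvd v s" using no_second_syzygies vj(2) unfolding no_second_syzygies_def by blast
  then have "F dvd k x y" for x y using vv(2) by metis
  then have z: "(\<Sum>j<n. U j x * B j i y) = 0" if "i < n" for i x y
    using g_indep[of "\<lambda>i. \<Sum>j<n. U j x * B j i y" i] that unfolding k_def by blast
  have "U j x = 0" for x
  proof (rule b_indep[OF _ j])
    define w where "w = (\<Sum>j<n. tscale (U j x) (b j))"
    have w: "w i = (\<Sum>j<n. cmul (U j x) (b j i))" for i by (simp add: w_def sum_fun_apply)
    have w0: "w i = 0" if "i < n" for i
    proof -
      have "w i = (\<Sum>j<n. \<Sum>y\<in>UNIV. cmul (U j x * B j i y) (var y))"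
        unfolding w using bb that by (intro sum.cong refl) (simp add: cmul_sum cmul_simps)
      also have "\<dots> = (\<Sum>y\<in>UNIV. cmul (\<Sum>j<n. U j x * B j i y) (var y))"
        by (subst sum.swap) (simp add: V.scale_sum_left)
      also have "\<dots> = 0" using z[OF that] by (simp add: cmul_simps)
      finally show ?thesis .
    qed
    have "w \<in> ker1 (int (t + 2))"
      unfolding w_def using b_ker by (intro W.subspace_sum[OF subspace_ker1] W.subspace_scale[OF subspace_ker1]) simp
    then have "\<phi>1 w = 0" "w \<in> free_piece degs1 (int (t + 2))" by (auto simp: ker1_def)
    moreover from this(1) have "F * w n = 0" using w0 by (simp add: \<phi>1_def)
    ultimately have wz: "w i = 0" for i
      using w0[of i] F_neq_0 free_pieceD(2)[of w degs1 "int (t + 2)" i] by (cases "i < n"; cases "i = n") auto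
    show "(\<Sum>j<n. tscale (U j x) (b j)) = 0" unfolding w_def[symmetric] by (rule ext) (simp only: wz zero_fun_apply)
  qed
  then show ?thesis using uu[OF j] by (simp add: cmul_simps)
qed

end

section \<open>Syzygies of the generators\<close>

lemma functional_pieces:
  fixes h :: "(nat \<Rightarrow> ('i, 'k::field) mpoly) \<Rightarrow> 'k"
  assumes h: "Vector_Spaces.linear tscale (*) h" and v: "\<And>i. i \<ge> n \<Longrightarrow> v i = 0"
  shows "h v = (\<Sum>i<n. pair (v i) (\<lambda>m. h (unit i (Poly_Mapping.single m 1))))"
proof -
  have l: "Vector_Spaces.linear cmul (*) (\<lambda>p. h (unit i p))" for i
    using Vector_Spaces.linear_compose[OF linear_unit h, of i] by (simp add: o_def)
  have "h v = h (\<Sum>i<n. unit i (v i))" using sum_unit[of n v, OF v] by (rule arg_cong)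
  also have "\<dots> = (\<Sum>i<n. h (unit i (v i)))"
    by (rule module_hom.sum[OF h[unfolded Vector_Spaces.linear_iff_module_hom]])
  also have "\<dots> = (\<Sum>i<n. pair (v i) (\<lambda>m. h (unit i (Poly_Mapping.single m 1))))"
    by (intro sum.cong refl functional_eq_pair[OF l])
  finally show ?thesis .
qed

lemma group_identities:
  fixes a :: "'a::ab_group_add"
  shows "a - b + (b - a) = 0" "(a - b) - (d - b) + (d - a) = 0" "(a - b) - (d - e) = 0 \<Longrightarrow> a - d = b - e"
  by (simp_all add: algebra_simps)

context linear_syzygies
begin

definition "tuples e = {v :: nat \<Rightarrow> (4, 'k) mpoly. (\<forall>i<n. v i \<in> forms e) \<and> (\<forall>i\<ge>n. v i = 0)}"

lemma tuplesD: "v \<in> tuples e \<Longrightarrow> i < n \<Longrightarrow> v i \<in> forms e" "v \<in> tuples e \<Longrightarrow> i \<ge> n \<Longrightarrow> v i = 0"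
  by (simp_all add: tuples_def)

lemma tuples_subspace: "W.subspace (tuples e)"
  by (rule W.subspaceI) (auto simp: tuples_def cmul_simps intro: forms_add cmul_in_forms)

lemma linear_g: "Vector_Spaces.linear tscale cmul (\<lambda>v. \<Sum>i<n. g i * v i)"
  by unfold_locales (simp_all only: plus_fun_apply tscale_apply distrib_left sum.distrib cmul_mult cmul_sum)

lemma multiples_subspace: "V.subspace {p. F dvd p}"
  by (rule V.subspaceI) (auto intro: dvd_cmul)

text \<open>In degrees well above \<open>t\<close> a functional on tuples that kills the relations generated in lower
  degree factors through the generators. After one differentiation it does so by induction; the
  differentiated factors differ by multiples of \<open>c\<close> that form a Koszul cocycle, and this cocycle
  is a coboundary. So the factors integrate.\<close>

lemma syz_step:
  assumes e: "e \<ge> 3" and IH: "\<And>v. v \<in> tuples (e - 1) \<Longrightarrow> v \<in> syz \<Longrightarrow> v \<in> syz'"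
    and v: "v \<in> tuples e" "v \<in> syz"
  shows "v \<in> syz'"
proof (rule ccontr)
  assume "v \<notin> syz'"
  then obtain h where h: "Vector_Spaces.linear tscale (*) h" "\<And>x. x \<in> syz' \<Longrightarrow> h x = 0" "h v = 1"
    using W.separating_functional[OF syz'_subspace] by blast
  define \<nu> where "\<nu> i = trunc e (\<lambda>m. h (unit i (Poly_Mapping.single m 1)))" for i
  have hv: "h w = (\<Sum>i<n. pair (w i) (\<nu> i))" if "w \<in> tuples e" for w
  proof -
    have "h w = (\<Sum>i<n. pair (w i) (\<lambda>m. h (unit i (Poly_Mapping.single m 1))))"
      by (rule functional_pieces[OF h(1)]) (rule tuplesD(2)[OF that])
    also have "\<dots> = (\<Sum>i<n. pair (w i) (\<nu> i))"
      unfolding \<nu>_def by (intro sum.cong refl) (simp add: pair_trunc[OF tuplesD(1)[OF that]])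
    finally show ?thesis .
  qed
  have e1: "e = Suc (e - 1)" using e by simp
  have \<nu>d: "\<nu> i \<in> dual e" for i by (simp add: \<nu>_def)
  have "\<exists>\<psi>. \<psi> \<in> dual (e + t) \<and> act F \<psi> = 0 \<and> (\<forall>i<n. act (var x) (\<nu> i) = act (g i) \<psi>)" for x
  proof -
    define h' where "h' w = (\<Sum>i<n. pair (w i) (act (var x) (\<nu> i)))" for w :: "nat \<Rightarrow> (4, 'k) mpoly"
    have lh': "Vector_Spaces.linear tscale (*) h'"
      unfolding h'_def by unfold_locales
        (simp_all only: plus_fun_apply tscale_apply pair_add pair_cmul sum.distrib sum_distrib_left algebra_simps mult_1_left mult_1_right)
    have kill: "h' w = 0" if w: "w \<in> tuples (e - 1)" "(\<Sum>i<n. g i * w i) \<in> {p. F dvd p}" for w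
    proof -
      have "w \<in> syz'" using IH[OF w(1)] w(2) by (simp add: syz_def)
      then obtain u z where uz: "\<forall>i<n. w i = (\<Sum>j<n. b j i * u j) + F * z i" unfolding syz'_def by blast
      have "var x * w i = (\<Sum>j<n. b j i * (var x * u j)) + F * (var x * z i)" if "i < n" for i
      proof -
        have "var x * w i = var x * ((\<Sum>j<n. b j i * u j) + F * z i)" using uz that by simp
        also have "\<dots> = (\<Sum>j<n. b j i * (var x * u j)) + F * (var x * z i)"
          by (simp only: distrib_left sum_distrib_left mult.left_commute[of "var x"])
        finally show ?thesis .
      qed
      then have "(\<lambda>i. var x * w i) \<in> syz'" unfolding syz'_def
        by (intro CollectI exI[of _ "\<lambda>j. var x * u j"] exI[of _ "\<lambda>j. var x * z j"] allI impI)
      moreover have "(\<lambda>i. var x * w i) \<in> tuples e"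
      proof -
        have "var x * w i \<in> forms e" if "i < n" for i
          using forms_mult[OF var_in_forms tuplesD(1)[OF w(1) that], of x] e1 by (metis plus_1_eq_Suc)
        then show ?thesis using tuplesD(2)[OF w(1)] by (simp add: tuples_def)
      qed
      ultimately have "(\<Sum>i<n. pair (var x * w i) (\<nu> i)) = 0" using hv h(2) by metis
      then show ?thesis by (simp only: h'_def pair_mult)
    qed
    obtain \<mu> where \<mu>: "Vector_Spaces.linear cmul (*) \<mu>" "\<And>p. p \<in> {p. F dvd p} \<Longrightarrow> \<mu> p = 0"
      "\<And>w. w \<in> tuples (e - 1) \<Longrightarrow> \<mu> (\<Sum>i<n. g i * w i) = h' w"
      by (rule WV.functional_factors[OF linear_g tuples_subspace[of "e - 1"] multiples_subspace lh' kill]) blast+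
    define \<psi> where "\<psi> = trunc (e + t) (\<lambda>m. \<mu> (Poly_Mapping.single m 1))"
    have p\<psi>: "pair p \<psi> = \<mu> p" if "p \<in> forms (e + t)" for p
      unfolding \<psi>_def pair_trunc[OF that] by (rule functional_eq_pair[OF \<mu>(1), symmetric])
    have "act F \<psi> = 0"
    proof -
      have "2 + (e + t - 2) = e + t" using e by simp
      then have d: "\<psi> \<in> dual (2 + (e + t - 2))" by (simp only: \<psi>_def trunc_dual)
      have "pair (q * F) \<psi> = 0" if "q \<in> forms (e + t - 2)" for q
      proof -
        have "e + t - 2 + 2 = e + t" using e by simp
        then have "q * F \<in> forms (e + t)" using forms_mult[OF that F2] by (simp only:)
        then show ?thesis using p\<psi> \<mu>(2)[of "q * F"] by simp
      qed
      then show ?thesis using act_eq_0_iff_pair[OF F2 d] by blast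
    qed
    moreover have "act (var x) (\<nu> i) = act (g i) \<psi>" if i: "i < n" for i
    proof -
      have gi: "g i \<in> forms (t + 1)" using g_ann[OF i] by (simp add: ann_def)
      have d1: "act (var x) (\<nu> i) \<in> dual (e - 1)" by (rule act_var_dual) (use \<nu>d[of i] e1 in metis)
      have "(t + 1) + (e - 1) = e + t" using e by simp
      then have "\<psi> \<in> dual ((t + 1) + (e - 1))" by (simp only: \<psi>_def trunc_dual)
      then have d2: "act (g i) \<psi> \<in> dual (e - 1)" by (rule act_dual[OF gi])
      have "act (var x) (\<nu> i) - act (g i) \<psi> = 0"
      proof (rule dual_eq_0[OF dual_closed(3)[OF d1 d2]])
        fix p :: "(4, 'k) mpoly" assume p: "p \<in> forms (e - 1)"
        have up: "unit i p \<in> tuples (e - 1)" using p i by (auto simp: tuples_def unit_def)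
        have pc: "(\<Sum>j<n. pair (unit i p j) (d j)) = pair p (d i)" for d :: "nat \<Rightarrow> 4 monom \<Rightarrow> 'k"
          using i by (subst sum.remove[of _ i]) (auto simp: unit_def intro!: sum.neutral)
        have gu: "(\<Sum>j<n. g j * unit i p j) = g i * p"
          using i by (subst sum.remove[of _ i]) (auto simp: unit_def intro!: sum.neutral)
        have "g i * p \<in> forms (e + t)" using forms_mult[OF gi p] e by (simp add: add.commute)
        then have "pair p (act (g i) \<psi>) = \<mu> (g i * p)" using p\<psi> pair_mult[of "g i" p \<psi>] by simp
        also have "\<dots> = h' (unit i p)" using \<mu>(3)[OF up] unfolding gu .
        also have "\<dots> = pair p (act (var x) (\<nu> i))" unfolding h'_def by (rule pc)
        finally show "pair p (act (var x) (\<nu> i) - act (g i) \<psi>) = 0" by (simp only: pair_fun) simp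
      qed
      then show ?thesis by simp
    qed
    ultimately show ?thesis by (intro exI[of _ \<psi>]) (simp add: \<psi>_def)
  qed
  then obtain \<psi> where \<psi>: "\<And>x. \<psi> x \<in> dual (e + t)" "\<And>x. act F (\<psi> x) = 0"
    "\<And>x i. i < n \<Longrightarrow> act (var x) (\<nu> i) = act (g i) (\<psi> x)" by metis
  define \<chi> where "\<chi> x y = act (var y) (\<psi> x) - act (var x) (\<psi> y)" for x y
  have "\<exists>r. \<chi> x y = act r c" for x y
  proof (rule annihilated_functional)
    show "t + 1 \<le> e + t - 1" using e by simp
    have "\<psi> z \<in> dual (Suc (e + t - 1))" for z using \<psi>(1)[of z] e by simp
    then show "\<chi> x y \<in> dual (e + t - 1)" unfolding \<chi>_def by (intro dual_closed(3) act_var_dual)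
    show "act F (\<chi> x y) = 0"
      by (simp only: \<chi>_def act_fun act_commute[of F] \<psi>(2)) simp
    have g0: "act (g i) (\<chi> x y) = 0" if "i < n" for i
      by (simp only: \<chi>_def act_fun act_commute[of "g i"] \<psi>(3)[OF that, symmetric] act_commute[of "var y" "var x"]) simp
    show "act p (\<chi> x y) = 0" if p: "p \<in> ann (t + 1)" for p
    proof -
      obtain u where "F dvd p - (\<Sum>i<n. cmul (u i) (g i))" using g_span[OF p] by blast
      from act_dvd[OF this \<open>act F (\<chi> x y) = 0\<close>] have "act p (\<chi> x y) = act (\<Sum>i<n. cmul (u i) (g i)) (\<chi> x y)"
        by (simp only: act_diff right_minus_eq)
      also have "\<dots> = (\<Sum>i<n. act (cmul (u i) (g i)) (\<chi> x y))" by (rule act_sum)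
      also have "\<dots> = 0"
        by (intro sum.neutral ballI ext) (simp only: act_cmul g0 lessThan_iff zero_fun_apply mult_zero_right)
      finally show ?thesis .
    qed
  qed
  then obtain k where k: "\<And>x y. \<chi> x y = act (k x y) c" by metis
  have \<chi>d: "\<chi> x y \<in> dual (e + t - 1)" for x y
  proof -
    have "\<psi> z \<in> dual (Suc (e + t - 1))" for z using \<psi>(1)[of z] e by simp
    then show ?thesis unfolding \<chi>_def by (intro dual_closed(3) act_var_dual)
  qed
  let ?r = "2 * t + 1 - (e + t - 1)"
  define K where "K x y = (if e + t - 1 \<le> 2 * t + 1 then hom_component ?r (k x y) else 0)" for x y
  have K: "act (K x y) c = \<chi> x y" for x y
  proof -
    have "\<chi> x y = trunc (e + t - 1) (\<chi> x y)" by (rule trunc_id[OF \<chi>d, symmetric])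
    also have "\<dots> = trunc (e + t - 1) (act (k x y) c)" by (simp only: k)
    also have "\<dots> = (if e + t - 1 \<le> 2 * t + 1 then act (hom_component ?r (k x y)) c else 0)" by (rule trunc_act[OF c_dual])
    also have "\<dots> = act (K x y) c"
      unfolding K_def by (cases "e + t - 1 \<le> 2 * t + 1") (simp_all only: if_True if_False act_0)
    finally show ?thesis by (rule sym)
  qed
  have Kf: "K x y \<in> forms ?r" for x y by (simp add: K_def)
  have r: "?r \<le> t" "1 + ?r \<le> t" using e t1 by arith+
  have alt: "F dvd K x y + K y x" for x y
    by (rule ann_low[OF forms_add[OF Kf Kf] r(1)]) (unfold act_add K \<chi>_def, rule group_identities(1))
  have alt': "F dvd K x x" for x
    by (rule ann_low[OF Kf r(1)]) (unfold K \<chi>_def, rule diff_self)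
  have cocycle: "F dvd var i * K j l - var j * K i l + var l * K i j" for i j l
  proof (rule ann_low[OF forms_add[OF forms_diff[OF forms_mult[OF var_in_forms Kf] forms_mult[OF var_in_forms Kf]]
        forms_mult[OF var_in_forms Kf]] r(2)])
    show "act (var i * K j l - var j * K i l + var l * K i j) c = 0"
      unfolding act_add act_diff act_mult K \<chi>_def act_fun act_commute[of "var l" "var i" "\<psi> j"]
        act_commute[of "var l" "var j" "\<psi> i"] act_commute[of "var j" "var i" "\<psi> l"]
      by (rule group_identities(2))
  qed
  obtain a where a: "\<And>i j. F dvd K i j - (var j * a i - var i * a j)"
    by (rule koszul_cohomology_2[of K, OF alt alt' cocycle]) blast
  define \<psi>' where "\<psi>' x = \<psi> x - act (a x) c" for x
  have compatible: "act (var i) (\<psi>' j) = act (var j) (\<psi>' i)" for i j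
  proof -
    have "act (K j i - (var i * a j - var j * a i)) c = 0" by (rule act_dvd[OF a F_kills])
    then have "\<chi> j i - (act (var i) (act (a j) c) - act (var j) (act (a i) c)) = 0" by (simp only: act_diff act_mult K)
    then show ?thesis unfolding \<chi>_def \<psi>'_def act_fun by (rule group_identities(3))
  qed
  obtain \<Psi>0 where \<Psi>0: "\<And>i. act (var i) \<Psi>0 = \<psi>' i" by (rule dual_integrate[of \<psi>', OF compatible]) blast
  define \<Psi> where "\<Psi> = trunc (1 + (e + t)) \<Psi>0"
  have v\<Psi>: "act (var x) \<Psi> = trunc (e + t) (\<psi>' x)" for x
    unfolding \<Psi>_def act_trunc[OF var_in_forms] by (simp only: \<Psi>0)
  have F\<psi>': "act F (\<psi>' i) = 0" for i
    by (simp only: \<psi>'_def act_fun \<psi>(2) act_commute[of F "a i"] F_kills diff_self)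
  have F\<Psi>: "act F \<Psi> = 0"
  proof (rule dual_eq_0_vars)
    have "1 + (e + t) = 2 + (e + t - 1)" using e by simp
    then have "\<Psi> \<in> dual (2 + (e + t - 1))" by (simp only: \<Psi>_def trunc_dual)
    then show "act F \<Psi> \<in> dual (e + t - 1)" by (rule act_dual[OF F2])
    show "0 < e + t - 1" using e by simp
    fix i
    have eq: "e + t = 2 + (e + t - 2)" using e by simp
    have "act (var i) (act F \<Psi>) = act F (trunc (e + t) (\<psi>' i))" by (simp only: act_commute[of "var i" F] v\<Psi>)
    also have "\<dots> = act F (trunc (2 + (e + t - 2)) (\<psi>' i))" by (rule arg_cong[OF eq, of "\<lambda>d. act F (trunc d (\<psi>' i))"])
    also have "\<dots> = trunc (e + t - 2) (act F (\<psi>' i))" by (rule act_trunc[OF F2])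
    also have "\<dots> = 0" by (simp only: F\<psi>' trunc_0)
    finally show "act (var i) (act F \<Psi>) = 0" .
  qed
  have gi: "g i \<in> forms (t + 1)" "act (g i) c = 0" if "i < n" for i
    using g_ann[OF that] unfolding ann_def by blast+
  have g\<psi>: "act (g i) (\<psi>' x) = act (var x) (\<nu> i)" if "i < n" for i x
    by (simp only: \<psi>'_def act_fun act_commute[of "g i" "a x"] gi(2)[OF that] diff_zero \<psi>(3)[OF that])
  have \<nu>\<Psi>: "\<nu> i = act (g i) \<Psi>" if i: "i < n" for i
  proof -
    have "1 + (e + t) = (t + 1) + e" by simp
    then have "\<Psi> \<in> dual ((t + 1) + e)" by (simp only: \<Psi>_def trunc_dual)
    then have d: "act (g i) \<Psi> \<in> dual e" by (rule act_dual[OF gi(1)[OF i]])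
    have "\<nu> i - act (g i) \<Psi> = 0"
    proof (rule dual_eq_0_vars[OF dual_closed(3)[OF \<nu>d d]])
      show "0 < e" using e by simp
      fix x
      have eq: "e + t = (t + 1) + (e - 1)" using e by simp
      have d': "act (var x) (\<nu> i) \<in> dual (e - 1)" by (rule act_var_dual) (use \<nu>d[of i] e1 in metis)
      have "act (var x) (act (g i) \<Psi>) = act (g i) (trunc (e + t) (\<psi>' x))" by (simp only: act_commute[of "var x" "g i"] v\<Psi>)
      also have "\<dots> = act (g i) (trunc ((t + 1) + (e - 1)) (\<psi>' x))"
        by (rule arg_cong[OF eq, of "\<lambda>d. act (g i) (trunc d (\<psi>' x))"])
      also have "\<dots> = trunc (e - 1) (act (g i) (\<psi>' x))" by (rule act_trunc[OF gi(1)[OF i]])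
      also have "\<dots> = trunc (e - 1) (act (var x) (\<nu> i))" by (simp only: g\<psi>[OF i])
      also have "\<dots> = act (var x) (\<nu> i)" by (rule trunc_id[OF d'])
      finally show "act (var x) (\<nu> i - act (g i) \<Psi>) = 0" by (simp only: act_fun diff_self)
    qed
    then show ?thesis by (rule eq_iff_diff_eq_0[THEN iffD2])
  qed
  have "h v = (\<Sum>i<n. pair (v i) (\<nu> i))" by (rule hv[OF v(1)])
  also have "\<dots> = (\<Sum>i<n. pair (v i) (act (g i) \<Psi>))" by (intro sum.cong refl arg_cong[where f = "pair _"] \<nu>\<Psi>) simp
  also have "\<dots> = pair (\<Sum>i<n. g i * v i) \<Psi>" unfolding pair_sum by (simp only: pair_mult)
  also have "\<dots> = act (\<Sum>i<n. g i * v i) \<Psi> 0" by (rule pair_eq_act)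
  also have "act (\<Sum>i<n. g i * v i) \<Psi> = 0" by (rule act_dvd[OF _ F\<Psi>]) (use v(2) in \<open>simp add: syz_def\<close>)
  finally show False using h(3) by (simp only: zero_fun_apply one_neq_zero)
qed

text \<open>The dimension of the relations between the generators. For \<open>e > t + 1\<close> the quotient vanishes in
  the degree under consideration, which accounts for the correction.\<close>

definition excess :: "nat \<Rightarrow> int"
  where "excess e = (if e \<le> t + 1 then 0 else (int e - int t - 1) * (int e - int t - 1))"

lemma int_count: "a + k = m * r + r' \<Longrightarrow> int a + int k = int m * int r + int r'"
  by (metis of_nat_add of_nat_mult)

lemma dim_ker1_formula:
  "int (W.dim (ker1 (int (t + 1 + e)))) = int n * int (rk (int e)) - int n * (2 * int e + 1) - excess e"
proof -
  define D where "D = int (t + 1 + e)"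
  have D: "D = int t + 1 + int e" by (simp add: D_def)
  have e1: "int (t + 1 + e) - int (t + 1) = int e" by simp
  have c1: "int (W.dim (ker1 D)) + int (k_dim {p \<in> gforms D. act p c = 0}) = int n * int (rk (int e)) + int (rk (D - 2))"
    by (rule int_count) (use dim_ker1[OF le_add1[of "t + 1" e]] in \<open>simp only: e1 D_def\<close>)
  have c2: "int (rk D) - int (rk (D - 2)) = (D + 1) * (D + 1)" by (rule rk_diff) (simp add: D)
  have nn: "int n = 2 * int t + 3" using n by simp
  show ?thesis
  proof (cases "e \<le> t + 1")
    case True
    have "int (k_dim {p \<in> gforms D. act p c = 0}) = int (rk D) - (int t - int e + 1) * (int t - int e + 1)"
      unfolding D_def by (rule dim_ann[OF True])
    moreover have "(D + 1) * (D + 1) - (int t - int e + 1) * (int t - int e + 1) = int n * (2 * int e + 1)"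
      unfolding D nn by (simp add: algebra_simps)
    moreover have "excess e = 0" using True by (simp add: excess_def)
    ultimately show ?thesis using c1 c2 unfolding D_def[symmetric] by linarith
  next
    case False
    then have "{p \<in> gforms D. act p c = 0} = gforms D" using act_above[of _ D] unfolding D by auto
    then have "int (k_dim {p \<in> gforms D. act p c = 0}) = int (rk D)" by (simp only: dim_gforms)
    moreover have "(D + 1) * (D + 1) = int n * (2 * int e + 1) + (int e - int t - 1) * (int e - int t - 1)"
      unfolding D nn by (simp add: algebra_simps)
    moreover have "excess e = (int e - int t - 1) * (int e - int t - 1)" using False by (simp add: excess_def)
    ultimately show ?thesis using c1 c2 unfolding D_def[symmetric] by linarith
  qed
qed

lemma dim_piece2: "W.dim (free_piece degs2 d :: (nat \<Rightarrow> (4, 'k) mpoly) set) = n * rk (d - int (t + 2)) + n * rk (d - int (t + 3))"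
  unfolding dim_free_piece by (simp add: degs2_def sum_list_replicate)

lemma \<phi>2_ker1: "\<phi>2 ` free_piece degs2 d \<subseteq> ker1 d"
  using \<phi>2_piece \<phi>1_\<phi>2 by (auto simp: ker1_def)

lemma \<phi>2_0: "\<phi>2 0 = 0"
  by (rule module_hom.zero[OF linear_\<phi>2[unfolded Vector_Spaces.linear_iff_module_hom]])

lemma \<phi>2_injective_low:
  assumes u: "u \<in> free_piece degs2 (int (t + 3))" and z: "\<phi>2 u = 0"
  shows "u = 0"
proof -
  have u1: "u j \<in> forms 1" if "j < n" for j
  proof -
    have "u j \<in> gforms (int (t + 3) - int (t + 2))" using free_pieceD(1)[OF u, of j] that by simp
    also have "int (t + 3) - int (t + 2) = int 1" by simp
    finally show ?thesis unfolding gforms_nat .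
  qed
  have u2: "u (n + i) \<in> forms 0" if "i < n" for i
  proof -
    have "u (n + i) \<in> gforms (int (t + 3) - int (t + 3))" using free_pieceD(1)[OF u, of "n + i"] that by simp
    also have "int (t + 3) - int (t + 3) = int 0" by simp
    finally show ?thesis unfolding gforms_nat .
  qed
  have row: "(\<Sum>j<n. b j i * u j) + F * u (n + i) = 0" if "i < n" for i
    using fun_cong[OF z, of i] that unfolding \<phi>2_def zero_fun_apply by (simp only: if_True)
  have z1: "u j = 0" if "j < n" for j
    by (rule no_linear_kernel[of u "\<lambda>i. u (n + i)", OF u1 u2 row that])
  have z2: "u (n + i) = 0" if "i < n" for i
  proof -
    have "(\<Sum>j<n. b j i * u j) = 0" by (intro sum.neutral ballI) (simp add: z1)
    then have "F * u (n + i) = 0" using row[OF that] by simp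
    then show ?thesis using F_neq_0 by simp
  qed
  show ?thesis
  proof
    fix k
    consider "k < n" | "k \<ge> n" "k < n + n" | "k \<ge> n + n" by linarith
    then show "u k = 0 k"
    proof cases
      case 2
      then show ?thesis using z2[of "k - n"] by simp
    qed (use z1[of k] free_pieceD(2)[OF u, of k] in simp_all)
  qed
qed

text \<open>Both sides have dimension \<open>5 * n\<close>, because the second map is injective in this degree.\<close>

lemma ker1_low: "ker1 (int (t + 3)) = \<phi>2 ` free_piece degs2 (int (t + 3))"
proof -
  have s: "W.subspace (\<phi>2 ` free_piece degs2 (int (t + 3)))"
    by (rule module_hom.subspace_image[OF linear_\<phi>2[unfolded Vector_Spaces.linear_iff_module_hom] subspace_free_piece])
  have "W.dim (\<phi>2 ` free_piece degs2 (int (t + 3))) = W.dim (free_piece degs2 (int (t + 3)) :: (nat \<Rightarrow> (4, 'k) mpoly) set)"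
    by (rule WW.dim_image_inj[OF linear_\<phi>2 subspace_free_piece fin_dim_free_piece \<phi>2_injective_low])
  also have "\<dots> = 5 * n"
  proof -
    have "int (t + 3) - int (t + 2) = 1" "int (t + 3) - int (t + 3) = 0" by simp_all
    then show ?thesis unfolding dim_piece2 by (simp only: rk_values)
  qed
  finally have d1: "W.dim (\<phi>2 ` free_piece degs2 (int (t + 3))) = 5 * n" .
  have t3: "t + 1 + 2 = t + 3" "int 2 = 2" "2 * (2::int) + 1 = 5" by simp_all
  have "int (W.dim (ker1 (int (t + 3)))) = int n * int (rk 2) - int n * 5 - excess 2"
    using dim_ker1_formula[of 2] unfolding t3 .
  moreover have "excess 2 = 0" using t1 by (simp add: excess_def)
  ultimately have "W.dim (ker1 (int (t + 3))) = 5 * n" unfolding rk_values by linarith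
  with d1 show ?thesis using W.dim_mono_fin(2)[OF subspace_ker1 fin_dim_ker1 s \<phi>2_ker1] by simp
qed

lemma syz_generated:
  assumes "v \<in> tuples e" "v \<in> syz"
  shows "v \<in> syz'"
  using assms
proof (induction e arbitrary: v rule: less_induct)
  case (less e)
  consider "e = 0" | "e = 1" | "e = 2" | "e \<ge> 3" by linarith
  then show ?case
  proof cases
    case 1
    define a where "a i = Poly_Mapping.lookup (v i) 0" for i
    have va: "v i = cmul (a i) 1" if "i < n" for i
    proof (rule poly_mapping_eqI)
      fix m
      have "v i \<in> forms 0" using tuplesD(1)[OF less.prems(1) that] 1 by simp
      then show "Poly_Mapping.lookup (v i) m = Poly_Mapping.lookup (cmul (a i) 1) m"
        by (cases "m = 0") (auto simp: a_def in_forms_iff mdeg_eq_0_iff lookup_one)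
    qed
    have "(\<Sum>i<n. g i * v i) = (\<Sum>i<n. cmul (a i) (g i))"
      by (intro sum.cong refl) (simp add: va cmul_mult)
    then have "a i = 0" if "i < n" for i
      using g_indep[of a i] less.prems(2) that unfolding syz_def by simp
    then have "v i = 0" if "i < n" for i using va that by (simp add: cmul_simps)
    then show ?thesis unfolding syz'_def by (intro CollectI exI[of _ "\<lambda>_. 0"]) simp
  next
    case 2
    have "v i \<in> gforms (int (t + 2) - int (t + 1))" if "i < n" for i
    proof -
      have "v i \<in> gforms (int 1)" using tuplesD(1)[OF less.prems(1) that] 2 unfolding gforms_nat by simp
      then show ?thesis by simp
    qed
    from lift_syz[OF less.prems(2) this] obtain h
      where "(\<lambda>i. if i < n then v i else if i = n then h else 0) \<in> ker1 (int (t + 2))" by blast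
    from b_span[OF this] obtain u
      where u: "(\<lambda>i. if i < n then v i else if i = n then h else 0) = (\<Sum>j<n. tscale (u j) (b j))" by blast
    have "v i = (\<Sum>j<n. b j i * cmul (u j) 1)" if "i < n" for i
      using fun_cong[OF u, of i] that by (simp add: sum_fun_apply cmul_mult)
    then show ?thesis unfolding syz'_def
      by (intro CollectI exI[of _ "\<lambda>j. cmul (u j) 1"] exI[of _ "\<lambda>_. 0"]) simp
  next
    case 3
    have "v i \<in> gforms (int (t + 3) - int (t + 1))" if "i < n" for i
    proof -
      have "v i \<in> gforms (int 2)" using tuplesD(1)[OF less.prems(1) that] 3 unfolding gforms_nat by simp
      then show ?thesis by simp
    qed
    from lift_syz[OF less.prems(2) this] obtain h
      where "(\<lambda>i. if i < n then v i else if i = n then h else 0) \<in> ker1 (int (t + 3))" by blast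
    then obtain u where u: "(\<lambda>i. if i < n then v i else if i = n then h else 0) = \<phi>2 u" unfolding ker1_low by blast
    have "v i = (\<Sum>j<n. b j i * u j) + F * u (n + i)" if "i < n" for i
      using fun_cong[OF u, of i] that by (simp add: \<phi>2_def)
    then show ?thesis unfolding syz'_def
      by (intro CollectI exI[of _ u] exI[of _ "\<lambda>i. u (n + i)"]) simp
  next
    case 4
    have "e - 1 < e" using 4 by simp
    from syz_step[OF 4 less.IH[OF this] less.prems] show ?thesis by blast
  qed
qed

text \<open>Relations modulo the quadric were treated above; the last coordinate of a relation is determined by the
  others, because the quadric is a nonzerodivisor.\<close>

lemma \<phi>2_onto:
  assumes v: "v \<in> ker1 d"
  obtains u where "u \<in> free_piece degs2 d" "v = \<phi>2 u"
proof (cases "d < int (t + 1)")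
  case True
  have p: "v \<in> free_piece degs1 d" "\<phi>1 v = 0" using v by (simp_all add: ker1_def)
  have z: "v i = 0" if "i < n" for i
    using free_pieceD(1)[OF p(1), of i] that True by (simp add: gforms_neg)
  have "F * v n = 0" using p(2) z by (simp add: \<phi>1_def)
  then have vn: "v n = 0" using F_neq_0 by simp
  have "v = 0"
  proof
    fix i
    consider "i < n" | "i = n" | "i > n" by linarith
    then show "v i = 0 i" by cases (use z vn free_pieceD(2)[OF p(1), of i] in simp_all)
  qed
  then have "v = \<phi>2 0" using \<phi>2_0 by (simp only:)
  then show ?thesis using that[of 0] W.subspace_0[OF subspace_free_piece] by blast
next
  case False
  define e where "e = nat (d - int (t + 1))"
  have d: "d - int (t + 1) = int e" using False by (simp add: e_def)
  have p: "v \<in> free_piece degs1 d" "\<phi>1 v = 0" using v by (simp_all add: ker1_def)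
  have vg: "v i \<in> gforms (d - int (t + 1))" if "i < n" for i using free_pieceD(1)[OF p(1), of i] that by simp
  let ?v = "\<lambda>i. if i < n then v i else 0"
  have vf: "v i \<in> forms e" if "i < n" for i using vg[OF that] unfolding d gforms_nat .
  then have tu: "?v \<in> tuples e" by (simp add: tuples_def)
  have "(\<Sum>i<n. g i * v i) = - (F * v n)" using p(2) unfolding \<phi>1_def by (simp add: eq_neg_iff_add_eq_0)
  then have "F dvd (\<Sum>i<n. g i * v i)" by simp
  then have "?v \<in> syz" by (simp add: syz_def)
  from syz_generated[OF tu this] obtain u z where uz: "\<And>i. i < n \<Longrightarrow> v i = (\<Sum>j<n. b j i * u j) + F * z i"
    unfolding syz'_def by auto
  define u' where "u' j = (if j < n then hcomp (d - int (t + 2)) (u j)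
    else if j < n + n then hcomp (d - int (t + 3)) (z (j - n)) else 0)" for j
  have u': "u' \<in> free_piece degs2 d"
  proof (rule free_pieceI)
    fix j assume "j < length degs2"
    then consider "j < n" | k where "k < n" "j = n + k"
      by (metis add_diff_inverse_nat add_less_cancel_left length_degs2)
    then show "u' j \<in> gforms (d - int (degs2 ! j))" by cases (simp_all add: u'_def)
  qed (simp add: u'_def)
  have eq: "v i = \<phi>2 u' i" if i: "i < n" for i
  proof -
    have a: "hcomp j (p + q) = hcomp j p + hcomp j q" for j and p q :: "(4, 'k) mpoly"
      by (simp add: hcomp_def hom_component_add)
    have "v i = hcomp (d - int (t + 1)) ((\<Sum>j<n. b j i * u j) + F * z i)"
      using hcomp_id[OF vg[OF i]] uz[OF i] by metis
    also have "\<dots> = (\<Sum>j<n. hcomp (d - int (t + 1)) (b j i * u j)) + hcomp (d - int (t + 1)) (F * z i)"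
      by (simp only: a hcomp_sum)
    also have "(\<Sum>j<n. hcomp (d - int (t + 1)) (b j i * u j)) = (\<Sum>j<n. b j i * u' j)"
    proof (intro sum.cong refl)
      fix j assume "j \<in> {..<n}"
      then have j: "j < n" by simp
      have "b j i \<in> gforms (int 1)" using b_gforms(1)[OF j i] unfolding gforms_nat .
      from hcomp_mult[OF this] have "hcomp (d - int (t + 1)) (b j i * u j) = b j i * hcomp (d - int (t + 1) - int 1) (u j)" .
      also have "d - int (t + 1) - int 1 = d - int (t + 2)" by simp
      finally show "hcomp (d - int (t + 1)) (b j i * u j) = b j i * u' j" using j by (simp add: u'_def)
    qed
    also have "hcomp (d - int (t + 1)) (F * z i) = F * hcomp (d - int (t + 1) - 2) (z i)" by (rule hcomp_mult[OF F_gforms])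
    also have "d - int (t + 1) - 2 = d - int (t + 3)" by simp
    also have "hcomp (d - int (t + 3)) (z i) = u' (n + i)" using i by (simp add: u'_def)
    finally show ?thesis using i by (simp add: \<phi>2_def)
  qed
  have "\<phi>1 (\<phi>2 u') = \<phi>1 v" using \<phi>1_\<phi>2 p(2) by simp
  moreover have "(\<Sum>i<n. g i * \<phi>2 u' i) = (\<Sum>i<n. g i * v i)" by (intro sum.cong refl) (simp add: eq)
  ultimately have "F * \<phi>2 u' n = F * v n" unfolding \<phi>1_def by simp
  then have eqn: "\<phi>2 u' n = v n" using F_neq_0 by simp
  have "v i = \<phi>2 u' i" for i
  proof -
    consider "i < n" | "i = n" | "i > n" by linarith
    then show ?thesis
    proof cases
      case 3
      then show ?thesis using free_pieceD(2)[OF p(1), of i] by (simp add: \<phi>2_def)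
    qed (use eq eqn in simp_all)
  qed
  then have "v = \<phi>2 u'" by (rule ext)
  then show ?thesis using that[OF u'] by blast
qed

end

section \<open>The end of the resolution\<close>

lemma count_identity:
  fixes N :: int
  assumes "r0 - r2 = (e + 1) * (e + 1)" "r1 - r3 = e * e"
  shows "N * r1 + N * r2 - (N * r0 - N * (2 * e + 1) - x) = N * r3 + x"
proof -
  have "r0 = r2 + (e + 1) * (e + 1)" "r1 = r3 + e * e" using assms by simp_all
  then show ?thesis by (simp add: algebra_simps)
qed

lemma int_count_converse:
  assumes "int a + int b = int m * int r + int s"
  shows "a + b = m * r + s"
  using assms by (metis of_nat_add of_nat_eq_iff of_nat_mult)

lemma mult_rows:
  fixes f :: "'r::comm_ring_1"
  shows "(\<Sum>j<n. y j * (u j * q)) + f * (r * q) = ((\<Sum>j<n. y j * u j) + f * r) * q"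
    and "(\<Sum>j<n. y j * (u j * q)) - (\<Sum>j<n. x j * (w j * q)) = ((\<Sum>j<n. y j * u j) - (\<Sum>j<n. x j * w j)) * q"
    and "(\<Sum>j<n. y j * (u j * q)) + r * (f * q) = ((\<Sum>j<n. y j * u j) + f * r) * q"
    and "f * - (r * q) + r * (f * q) = 0"
  by (simp_all add: sum_distrib_right distrib_right left_diff_distrib mult.assoc mult.left_commute)

context linear_syzygies
begin

lemma subspace_ker2: "W.subspace (ker2 d)"
proof -
  have "ker2 d = free_piece degs2 d \<inter> {u. \<phi>2 u = 0}" by (auto simp: ker2_def)
  moreover have "W.subspace {u. \<phi>2 u = 0}"
    by (rule module_hom.subspace_kernel[OF linear_\<phi>2[unfolded Vector_Spaces.linear_iff_module_hom]])
  ultimately show ?thesis using W.subspace_inter[OF subspace_free_piece] by simp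
qed

lemma fin_dim_ker2: "W.fin_dim (ker2 d)"
  by (rule W.fin_dim_mono[OF fin_dim_free_piece[of degs2 d]]) (auto simp: ker2_def)

lemma \<phi>2_image: "\<phi>2 ` free_piece degs2 d = ker1 d"
proof (rule antisym[OF \<phi>2_ker1])
  show "ker1 d \<subseteq> \<phi>2 ` free_piece degs2 d" by (rule subsetI) (erule \<phi>2_onto, blast)
qed

text \<open>The alternating sum of the dimensions in the resolution, as far as it concerns the kernel of the second map.\<close>

lemma dim_ker2:
  assumes d: "d = int (t + 1 + e)"
  shows "W.dim (ker2 d) + rk (d - int (2 * t + 5)) = n * rk (d - int (t + 4)) + rk (d - int (2 * t + 3))"
proof -
  have "W.dim (free_piece degs2 d :: (nat \<Rightarrow> (4, 'k) mpoly) set) = W.dim (ker1 d) + W.dim (ker2 d)"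
    using WW.dim_image_kernel[OF linear_\<phi>2 subspace_free_piece fin_dim_free_piece, of degs2 d]
    unfolding \<phi>2_image ker2_def .
  moreover have s: "d - int (t + 2) = int e - 1" "d - int (t + 3) = int e - 2" "d - int (t + 4) = int e - 3"
    "d - int (2 * t + 3) = int e - int t - 2" "d - int (2 * t + 5) = int e - int t - 2 - 2" unfolding d by simp_all
  ultimately have "W.dim (ker1 d) + W.dim (ker2 d) = n * rk (int e - 1) + n * rk (int e - 2)"
    unfolding dim_piece2 by (simp only: s)
  from int_count[OF this] have "int (W.dim (ker2 d)) = int n * int (rk (int e - 1)) + int n * int (rk (int e - 2))
      - int (W.dim (ker1 d))" by (simp only: of_nat_mult)
  also have "\<dots> = int n * int (rk (int e - 1)) + int n * int (rk (int e - 2))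
      - (int n * int (rk (int e)) - int n * (2 * int e + 1) - excess e)" unfolding d dim_ker1_formula ..
  also have "\<dots> = int n * int (rk (int e - 3)) + excess e"
  proof (rule count_identity)
    show "int (rk (int e)) - int (rk (int e - 2)) = (int e + 1) * (int e + 1)" by (rule rk_diff) simp
    show "int (rk (int e - 1)) - int (rk (int e - 3)) = int e * int e" using rk_diff[of "int e - 1"] by simp
  qed
  finally have k: "int (W.dim (ker2 d)) = int n * int (rk (int e - 3)) + excess e" .
  have x: "excess e = int (rk (int e - int t - 2)) - int (rk (int e - int t - 2 - 2))"
  proof (cases "e \<le> t + 1")
    case True
    then show ?thesis by (simp add: excess_def rk_neg)
  next
    case False
    then have "int e - int t - 2 \<ge> -1" by simp
    from rk_diff[OF this] show ?thesis using False by (simp add: excess_def)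
  qed
  show ?thesis unfolding s by (rule int_count_converse) (use k x in linarith)
qed

text \<open>The Koszul relations between the quadric and the linear syzygies.\<close>

definition \<tau> :: "(nat \<Rightarrow> (4, 'k) mpoly) \<Rightarrow> nat \<Rightarrow> (4, 'k) mpoly"
  where "\<tau> z i = (if i < n then F * z i else if i < n + n then - (\<Sum>j<n. b j (i - n) * z j) else 0)"

lemma linear_\<tau>: "Vector_Spaces.linear tscale tscale \<tau>"
proof unfold_locales
  fix u w
  show "\<tau> (u + w) = \<tau> u + \<tau> w"
    by (rule ext) (simp only: \<tau>_def plus_fun_apply distrib_left sum.distrib minus_add_distrib; simp)
next
  fix a u
  show "\<tau> (tscale a u) = tscale a (\<tau> u)"
    by (rule ext) (simp add: \<tau>_def cmul_mult cmul_sum cmul_simps V.scale_minus_right)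
qed

lemma koszul_rearrange:
  fixes f :: "'r::comm_ring_1"
  shows "(\<Sum>j<n. y j * (f * z j)) - (\<Sum>i<n. x i * - (\<Sum>j<n. a j i * z j))
    = (\<Sum>j<n. ((\<Sum>i<n. x i * a j i) + f * y j) * z j)"
proof -
  have "(\<Sum>i<n. x i * - (\<Sum>j<n. a j i * z j)) = - (\<Sum>j<n. (\<Sum>i<n. x i * a j i) * z j)"
    unfolding mult_minus_right sum_negf sum_distrib_left sum_distrib_right
    by (subst sum.swap) (simp add: mult.assoc)
  then show ?thesis by (simp add: distrib_right sum.distrib mult.assoc mult.left_commute)
qed

lemma \<phi>2_\<tau>: "\<phi>2 (\<tau> z) = 0"
proof
  fix i
  consider "i < n" | "i = n" | "i > n" by linarith
  then show "\<phi>2 (\<tau> z) i = 0 i"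
  proof cases
    case 1
    have "(\<Sum>j<n. b j i * (F * z j)) = F * (\<Sum>j<n. b j i * z j)" by (simp only: sum_distrib_left mult.left_commute[of F])
    then show ?thesis using 1 by (simp add: \<phi>2_def \<tau>_def)
  next
    case 2
    have "\<phi>2 (\<tau> z) n = (\<Sum>j<n. b j n * (F * z j)) - (\<Sum>i<n. g i * - (\<Sum>j<n. b j i * z j))"
      by (simp add: \<phi>2_def \<tau>_def)
    also have "\<dots> = (\<Sum>j<n. ((\<Sum>i<n. g i * b j i) + F * b j n) * z j)" by (rule koszul_rearrange)
    also have "\<dots> = 0" by (intro sum.neutral) (simp add: b_relation)
    finally show ?thesis using 2 by simp
  next
    case 3
    then show ?thesis by (simp add: \<phi>2_def)
  qed
qed

lemma \<tau>_piece:
  assumes z: "\<And>j. j < n \<Longrightarrow> z j \<in> gforms (d - int (t + 4))"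
  shows "\<tau> z \<in> free_piece degs2 d"
proof (rule free_pieceI)
  fix i assume "i < length degs2"
  then consider "i < n" | k where "k < n" "i = n + k"
    by (metis add_diff_inverse_nat add_less_cancel_left length_degs2)
  then show "\<tau> z i \<in> gforms (d - int (degs2 ! i))"
  proof cases
    case 1
    then show ?thesis using gforms_mult'[OF F_gforms z[OF 1], of "d - int (t + 2)"] by (simp add: \<tau>_def)
  next
    case 2
    have "b j k * z j \<in> gforms (d - int (t + 3))" if "j < n" for j
    proof (rule gforms_mult'[OF _ z[OF that]])
      show "b j k \<in> gforms (int 1)" using b_gforms(1)[OF that 2(1)] unfolding gforms_nat .
    qed simp
    then show ?thesis using 2 by (auto simp: \<tau>_def intro!: gforms_uminus gforms_sum)
  qed
qed (simp add: \<tau>_def)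

text \<open>By the count of dimensions, the relations of degree \<open>2 * t + 3\<close> have one dimension more than the Koszul
  relations, and a relation whose first \<open>n\<close> coordinates are divisible by the quadric is a Koszul relation.\<close>

lemma exists_extra_syzygy:
  obtains w i0 where "w \<in> ker2 (int (2 * t + 3))" "i0 < n" "\<not> F dvd w i0"
proof -
  let ?d = "int (2 * t + 3)" and ?P = "free_piece (replicate n (t + 4)) (int (2 * t + 3)) :: (nat \<Rightarrow> (4, 'k) mpoly) set"
  have zero: "z = 0" if z: "z \<in> ?P" "\<tau> z = 0" for z
  proof
    fix i
    show "z i = 0 i"
    proof (cases "i < n")
      case True
      have "F * z i = 0" using fun_cong[OF z(2), of i] True by (simp add: \<tau>_def)
      then show ?thesis using F_neq_0 by simp
    next
      case False
      then show ?thesis using free_pieceD(2)[OF z(1), of i] by simp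
    qed
  qed
  have s: "W.subspace (\<tau> ` ?P)"
    by (rule module_hom.subspace_image[OF linear_\<tau>[unfolded Vector_Spaces.linear_iff_module_hom] subspace_free_piece])
  have "W.dim (\<tau> ` ?P) = W.dim ?P"
    by (rule WW.dim_image_inj[OF linear_\<tau> subspace_free_piece fin_dim_free_piece zero])
  also have "\<dots> = n * rk (?d - int (t + 4))" unfolding dim_free_piece by (simp add: sum_list_replicate)
  finally have d1: "W.dim (\<tau> ` ?P) = n * rk (?d - int (t + 4))" .
  have "?d = int (t + 1 + (t + 2))" by simp
  from dim_ker2[OF this] have "W.dim (ker2 ?d) + rk (?d - int (2 * t + 5)) = n * rk (?d - int (t + 4)) + rk (?d - ?d)" .
  moreover have "rk (?d - int (2 * t + 5)) = 0" "rk (?d - ?d) = 1" by (simp_all add: rk_neg rk_values)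
  ultimately have "W.dim (ker2 ?d) = n * rk (?d - int (t + 4)) + 1" by linarith
  then have ne: "W.dim (\<tau> ` ?P) < W.dim (ker2 ?d)" using d1 by linarith
  have fin: "W.fin_dim (\<tau> ` ?P)" by (rule WW.fin_dim_image[OF linear_\<tau> fin_dim_free_piece])
  have "\<not> ker2 ?d \<subseteq> \<tau> ` ?P" using W.dim_mono_fin(1)[OF s fin subspace_ker2] ne by (meson not_less)
  then obtain w where w: "w \<in> ker2 ?d" "w \<notin> \<tau> ` ?P" by blast
  have wp: "w \<in> free_piece degs2 ?d" "\<phi>2 w = 0" using w(1) unfolding ker2_def by blast+
  have "\<exists>i<n. \<not> F dvd w i"
  proof (rule ccontr)
    assume "\<not> (\<exists>i<n. \<not> F dvd w i)"
    then have dv: "F dvd w i" if "i < n" for i using that by blast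
    have "\<exists>h. w i = F * h \<and> h \<in> gforms (?d - int (t + 4))" if i: "i < n" for i
    proof -
      have "w i \<in> gforms (?d - int (t + 2))" using free_pieceD(1)[OF wp(1), of i] i by simp
      from dvd_formE[OF F_gforms dv[OF i] this] obtain h where "w i = F * h" "h \<in> gforms (?d - int (t + 2) - 2)" by blast
      moreover have "?d - int (t + 2) - 2 = ?d - int (t + 4)" by simp
      ultimately show ?thesis by metis
    qed
    then obtain h where h: "\<And>i. i < n \<Longrightarrow> w i = F * h i" "\<And>i. i < n \<Longrightarrow> h i \<in> gforms (?d - int (t + 4))" by metis
    define z where "z i = (if i < n then h i else 0)" for i
    have zP: "z \<in> ?P" using h(2) by (intro free_pieceI) (simp_all add: z_def)
    have "w i = \<tau> z i" for i
    proof -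
      consider "i < n" | k where "k < n" "i = n + k" | "i \<ge> n + n"
        by (metis add_diff_inverse_nat add_less_cancel_left not_less)
      then show ?thesis
      proof cases
        case 1
        then show ?thesis using h(1) by (simp add: \<tau>_def z_def)
      next
        case 2
        have "(\<Sum>j<n. b j k * w j) + F * w (n + k) = 0"
          using fun_cong[OF wp(2), of k] 2(1) unfolding \<phi>2_def zero_fun_apply by (simp only: if_True)
        moreover have "(\<Sum>j<n. b j k * w j) = F * (\<Sum>j<n. b j k * z j)"
          unfolding sum_distrib_left by (intro sum.cong refl) (simp only: lessThan_iff h(1) z_def if_True mult.left_commute[of F])
        ultimately have "F * ((\<Sum>j<n. b j k * z j) + w (n + k)) = 0" by (simp only: distrib_left)
        then have "(\<Sum>j<n. b j k * z j) + w (n + k) = 0" using F_neq_0 by simp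
        then have "w (n + k) = - (\<Sum>j<n. b j k * z j)" by (simp only: eq_neg_iff_add_eq_0 add.commute)
        then show ?thesis using 2 by (simp add: \<tau>_def)
      next
        case 3
        then show ?thesis using free_pieceD(2)[OF wp(1), of i] by (simp add: \<tau>_def)
      qed
    qed
    then have "w = \<tau> z" by (rule ext)
    then show False using w(2) zP by blast
  qed
  then show ?thesis using that w(1) by blast
qed

end

locale resolution = linear_syzygies F t c n g b for F :: "(4, 'k::field) mpoly" and t c n g b +
  fixes w :: "nat \<Rightarrow> (4, 'k) mpoly" and i0 :: nat
  assumes F_prime: "\<And>p q. F dvd p * q \<Longrightarrow> F dvd p \<or> F dvd q"
    and w_ker: "w \<in> ker2 (int (2 * t + 3))" and i0: "i0 < n" "\<not> F dvd w i0"
begin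

lemma w_piece: "w \<in> free_piece degs2 (int (2 * t + 3))" and \<phi>2_w: "\<phi>2 w = 0"
  using w_ker unfolding ker2_def by blast+

definition "degs3 = replicate n (t + 4) @ [2 * t + 3]"

lemma length_degs3 [simp]: "length degs3 = n + 1"
  by (simp add: degs3_def)

lemma degs3_nth [simp]: "i < n \<Longrightarrow> degs3 ! i = t + 4" "degs3 ! n = 2 * t + 3"
  by (simp_all add: degs3_def nth_append)

definition \<phi>3 :: "(nat \<Rightarrow> (4, 'k) mpoly) \<Rightarrow> nat \<Rightarrow> (4, 'k) mpoly"
  where "\<phi>3 z = \<tau> z + (\<lambda>i. w i * z n)"

definition \<phi>4 :: "(4, 'k) mpoly \<Rightarrow> nat \<Rightarrow> (4, 'k) mpoly"
  where "\<phi>4 y i = (if i < n then - (w i * y) else if i = n then F * y else 0)"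

lemma linear_\<phi>3: "Vector_Spaces.linear tscale tscale \<phi>3"
proof unfold_locales
  fix u v
  have "\<tau> (u + v) = \<tau> u + \<tau> v" by (rule module_hom.add[OF linear_\<tau>[unfolded Vector_Spaces.linear_iff_module_hom]])
  then show "\<phi>3 (u + v) = \<phi>3 u + \<phi>3 v"
    by (intro ext) (simp only: \<phi>3_def plus_fun_apply distrib_left ac_simps)
next
  fix a u
  have "\<tau> (tscale a u) = tscale a (\<tau> u)" by (rule module_hom.scale[OF linear_\<tau>[unfolded Vector_Spaces.linear_iff_module_hom]])
  then show "\<phi>3 (tscale a u) = tscale a (\<phi>3 u)"
    by (intro ext) (simp only: \<phi>3_def plus_fun_apply tscale_apply cmul_mult cmul_simps)
qed

lemma linear_\<phi>4: "Vector_Spaces.linear cmul tscale \<phi>4"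
proof unfold_locales
  fix p q show "\<phi>4 (p + q) = \<phi>4 p + \<phi>4 q" by (rule ext) (simp add: \<phi>4_def distrib_left)
next
  fix a p show "\<phi>4 (cmul a p) = tscale a (\<phi>4 p)" by (rule ext) (simp add: \<phi>4_def cmul_mult V.scale_minus_right cmul_simps)
qed

lemma \<phi>2_mult: "\<phi>2 (\<lambda>i. u i * q) = (\<lambda>i. \<phi>2 u i * q)"
proof
  fix i
  consider "i < n" | "i = n" | "i > n" by linarith
  then show "\<phi>2 (\<lambda>i. u i * q) i = \<phi>2 u i * q"
  proof cases
    case 1
    then show ?thesis by (simp only: \<phi>2_def if_True mult_rows)
  next
    case 2
    show ?thesis unfolding 2 by (simp only: \<phi>2_def less_irrefl if_False if_True refl mult_rows)
  next
    case 3
    then show ?thesis by (simp add: \<phi>2_def)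
  qed
qed

lemma \<phi>2_\<phi>3: "\<phi>2 (\<phi>3 z) = 0"
proof -
  have "\<phi>2 (\<phi>3 z) = \<phi>2 (\<tau> z) + \<phi>2 (\<lambda>i. w i * z n)"
    unfolding \<phi>3_def by (rule module_hom.add[OF linear_\<phi>2[unfolded Vector_Spaces.linear_iff_module_hom]])
  also have "\<dots> = 0" unfolding \<phi>2_\<tau> \<phi>2_mult \<phi>2_w by (rule ext) simp
  finally show ?thesis .
qed

lemma \<phi>3_\<phi>4: "\<phi>3 (\<phi>4 y) = 0"
proof
  fix i
  consider "i < n" | k where "k < n" "i = n + k" | "i \<ge> n + n"
    by (metis add_diff_inverse_nat add_less_cancel_left not_less)
  then show "\<phi>3 (\<phi>4 y) i = 0 i"
  proof cases
    case 1
    have "\<phi>3 (\<phi>4 y) i = F * - (w i * y) + w i * (F * y)" using 1 by (simp add: \<phi>3_def \<phi>4_def \<tau>_def)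
    also have "\<dots> = 0" by (rule mult_rows(4))
    finally show ?thesis by simp
  next
    case 2
    have r: "(\<Sum>j<n. b j k * w j) + F * w (n + k) = 0"
      using fun_cong[OF \<phi>2_w, of k] 2(1) unfolding \<phi>2_def zero_fun_apply by (simp only: if_True)
    have "\<phi>3 (\<phi>4 y) i = (\<Sum>j<n. b j k * (w j * y)) + w (n + k) * (F * y)"
      using 2 by (simp add: \<phi>3_def \<phi>4_def \<tau>_def sum_negf)
    also have "\<dots> = ((\<Sum>j<n. b j k * w j) + F * w (n + k)) * y"
      by (rule mult_rows(3))
    finally show ?thesis using r by simp
  next
    case 3
    then show ?thesis using free_pieceD(2)[OF w_piece, of i] by (simp add: \<phi>3_def \<tau>_def)
  qed
qed

lemma \<phi>3_piece:
  assumes z: "z \<in> free_piece degs3 d"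
  shows "\<phi>3 z \<in> free_piece degs2 d"
  unfolding \<phi>3_def
proof (rule W.subspace_add[OF subspace_free_piece])
  show "\<tau> z \<in> free_piece degs2 d"
  proof (rule \<tau>_piece)
    fix j assume "j < n"
    then show "z j \<in> gforms (d - int (t + 4))" using free_pieceD(1)[OF z, of j] by simp
  qed
  have zn: "z n \<in> gforms (d - int (2 * t + 3))" using free_pieceD(1)[OF z, of n] by simp
  show "(\<lambda>i. w i * z n) \<in> free_piece degs2 d"
  proof (rule free_pieceI)
    fix i assume "i < length degs2"
    from gforms_mult'[OF free_pieceD(1)[OF w_piece this] zn, of "d - int (degs2 ! i)"]
    show "w i * z n \<in> gforms (d - int (degs2 ! i))" by simp
  next
    fix i assume "i \<ge> length degs2"
    then show "w i * z n = 0" using free_pieceD(2)[OF w_piece] by simp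
  qed
qed

lemma \<phi>4_piece:
  assumes "y \<in> gforms (d - int (2 * t + 5))"
  shows "\<phi>4 y \<in> free_piece degs3 d"
proof (rule free_pieceI)
  fix i assume "i < length degs3"
  then consider "i < n" | "i = n" by fastforce
  then show "\<phi>4 y i \<in> gforms (d - int (degs3 ! i))"
  proof cases
    case 1
    have "w i \<in> gforms (int (2 * t + 3) - int (t + 2))" using free_pieceD(1)[OF w_piece, of i] 1 by simp
    from gforms_mult'[OF this assms, of "d - int (t + 4)"] show ?thesis using 1 by (simp add: \<phi>4_def gforms_uminus)
  next
    case 2
    from gforms_mult'[OF F_gforms assms, of "d - int (2 * t + 3)"] show ?thesis using 2 by (simp add: \<phi>4_def)
  qed
qed (simp add: \<phi>4_def)

lemma \<phi>4_eq_0: "\<phi>4 y = 0 \<Longrightarrow> y = 0"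
proof -
  assume "\<phi>4 y = 0"
  from fun_cong[OF this, of n] have "F * y = 0" by (simp add: \<phi>4_def)
  then show ?thesis using F_neq_0 by simp
qed

text \<open>Primality of the quadric: it divides the last coordinate of an element of the kernel because it
  does not divide \<open>w i0\<close>.\<close>

lemma \<phi>3_kernel:
  assumes z: "z \<in> free_piece degs3 d" "\<phi>3 z = 0"
  obtains y where "y \<in> gforms (d - int (2 * t + 5))" "z = \<phi>4 y"
proof -
  have row: "F * z i + w i * z n = 0" if "i < n" for i
    using fun_cong[OF z(2), of i] that by (simp add: \<phi>3_def \<tau>_def)
  have "w i0 * z n = - (F * z i0)" using row[OF i0(1)] by (simp only: eq_neg_iff_add_eq_0 add.commute)
  then have "F dvd w i0 * z n" by simp
  then have "F dvd z n" using F_prime i0(2) by blast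
  moreover have "z n \<in> gforms (d - int (2 * t + 3))" using free_pieceD(1)[OF z(1), of n] by simp
  ultimately obtain y where y: "z n = F * y" "y \<in> gforms (d - int (2 * t + 3) - 2)" by (rule dvd_formE[OF F_gforms])
  have "z i = \<phi>4 y i" for i
  proof -
    consider "i < n" | "i = n" | "i > n" by linarith
    then show ?thesis
    proof cases
      case 1
      have "F * (z i + w i * y) = F * z i + w i * z n" unfolding y(1) by (simp only: distrib_left mult.left_commute[of F])
      then have "z i + w i * y = 0" using row[OF 1] F_neq_0 by simp
      then show ?thesis using 1 by (simp add: \<phi>4_def eq_neg_iff_add_eq_0)
    next
      case 2
      then show ?thesis using y(1) by (simp add: \<phi>4_def)
    next
      case 3
      then show ?thesis using free_pieceD(2)[OF z(1), of i] by (simp add: \<phi>4_def)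
    qed
  qed
  then have "z = \<phi>4 y" by (rule ext)
  moreover have "d - int (2 * t + 3) - 2 = d - int (2 * t + 5)" by simp
  ultimately show ?thesis using that[of y] y(2) by metis
qed

text \<open>The kernel of the third map is the image of the fourth one, so the dimension of its image is known. It
  agrees with that of the kernel of the second map in every degree.\<close>

lemma \<phi>3_onto:
  assumes v: "v \<in> ker2 d"
  obtains z where "z \<in> free_piece degs3 d" "v = \<phi>3 z"
proof (cases "d < int (t + 1)")
  case True
  have p: "v \<in> free_piece degs2 d" using v unfolding ker2_def by blast
  have "v i = 0" for i
  proof -
    consider "i < n" | k where "k < n" "i = n + k" | "i \<ge> n + n"
      by (metis add_diff_inverse_nat add_less_cancel_left not_less)
    then show ?thesis
      by cases (use free_pieceD[OF p, of i] True in \<open>simp_all add: gforms_neg\<close>)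
  qed
  then have "v = 0" by (intro ext) simp
  moreover have "\<phi>3 0 = 0" by (rule module_hom.zero[OF linear_\<phi>3[unfolded Vector_Spaces.linear_iff_module_hom]])
  ultimately have "v = \<phi>3 0" by (simp only:)
  then show ?thesis using that[of 0] W.subspace_0[OF subspace_free_piece] by blast
next
  case False
  define e where "e = nat (d - int (t + 1))"
  have d: "d = int (t + 1 + e)" using False by (simp add: e_def)
  let ?P = "free_piece degs3 d :: (nat \<Rightarrow> (4, 'k) mpoly) set"
  have s: "W.subspace (\<phi>3 ` ?P)"
    by (rule module_hom.subspace_image[OF linear_\<phi>3[unfolded Vector_Spaces.linear_iff_module_hom] subspace_free_piece])
  have sub: "\<phi>3 ` ?P \<subseteq> ker2 d" using \<phi>3_piece \<phi>2_\<phi>3 by (auto simp: ker2_def)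
  have k: "{z \<in> ?P. \<phi>3 z = 0} = \<phi>4 ` gforms (d - int (2 * t + 5))"
  proof (intro equalityI subsetI)
    fix z assume "z \<in> {z \<in> ?P. \<phi>3 z = 0}"
    then have "z \<in> ?P" "\<phi>3 z = 0" by blast+
    then show "z \<in> \<phi>4 ` gforms (d - int (2 * t + 5))" by (rule \<phi>3_kernel) blast
  next
    fix z assume "z \<in> \<phi>4 ` gforms (d - int (2 * t + 5))"
    then show "z \<in> {z \<in> ?P. \<phi>3 z = 0}" using \<phi>4_piece \<phi>3_\<phi>4 by blast
  qed
  have "W.dim (\<phi>4 ` gforms (d - int (2 * t + 5))) = rk (d - int (2 * t + 5))"
    using VW.dim_image_inj[OF linear_\<phi>4 subspace_gforms fin_dim_gforms \<phi>4_eq_0] unfolding dim_gforms .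
  moreover have "W.dim ?P = n * rk (d - int (t + 4)) + rk (d - int (2 * t + 3))"
    unfolding dim_free_piece by (simp add: degs3_def sum_list_replicate)
  ultimately have "W.dim (\<phi>3 ` ?P) = W.dim (ker2 d)"
    using WW.dim_image_kernel[OF linear_\<phi>3 subspace_free_piece fin_dim_free_piece, of degs3 d] dim_ker2[OF d]
    unfolding k by linarith
  then have "\<phi>3 ` ?P = ker2 d" by (rule W.dim_mono_fin(2)[OF subspace_ker2 fin_dim_ker2 s sub])
  then show ?thesis using that v by blast
qed

end

section \<open>Gorenstein quotients and their lengths\<close>

definition annihilator :: "('i monom \<Rightarrow> 'k::field) \<Rightarrow> ('i, 'k) mpoly set"
  where "annihilator c = {p. act p c = 0}"

lemma annihilator_ideal: "is_ideal (annihilator c)"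
proof (rule I.subspaceI)
  show "0 \<in> annihilator c" unfolding annihilator_def mem_Collect_eq by (rule act_0)
next
  fix p q assume "p \<in> annihilator c" "q \<in> annihilator c"
  then show "p + q \<in> annihilator c" unfolding annihilator_def mem_Collect_eq by (simp only: act_add add_0)
next
  fix p q assume "q \<in> annihilator c"
  then show "p * q \<in> annihilator c" unfolding annihilator_def mem_Collect_eq by (simp only: act_mult act_fun)
qed

lemma annihilator_homogeneous:
  assumes c: "c \<in> dual s"
  shows "homogeneous_ideal (annihilator c)"
  unfolding homogeneous_ideal_def
proof (intro conjI ballI allI)
  fix p d assume "p \<in> annihilator c"
  then have p: "act p c = 0" unfolding annihilator_def mem_Collect_eq .
  show "hom_component d p \<in> annihilator c" unfolding annihilator_def mem_Collect_eq
  proof (cases "d \<le> s")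
    case True
    then have "s - d \<le> s" "s - (s - d) = d" by simp_all
    with trunc_act[OF c, of "s - d" p] have "trunc (s - d) (act p c) = act (hom_component d p) c" by (simp only: if_True)
    then show "act (hom_component d p) c = 0" by (simp only: p trunc_0)
  next
    case False
    then show "act (hom_component d p) c = 0" using act_dual_0[OF hom_component_in_forms c] by (simp only: not_le)
  qed
qed (rule annihilator_ideal)

lemma annihilator_above: "c \<in> dual s \<Longrightarrow> j > s \<Longrightarrow> forms j \<subseteq> annihilator c"
  unfolding annihilator_def by (intro subsetI CollectI) (rule act_dual_0)

lemma annihilator_top:
  assumes c: "c \<in> dual s" and p: "p \<in> forms s"
  shows "p \<in> annihilator c \<longleftrightarrow> pair p c = 0"
proof
  assume "p \<in> annihilator c"
  then have "act p c = 0" unfolding annihilator_def mem_Collect_eq .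
  then show "pair p c = 0" unfolding pair_eq_act by (simp only: zero_fun_apply)
next
  assume z: "pair p c = 0"
  have d: "act p c \<in> dual 0" by (rule act_dual[OF p]) (use c in simp)
  have "act p c m = 0 m" for m
  proof (cases "m = 0")
    case True
    then show ?thesis using z unfolding pair_eq_act by simp
  next
    case False
    then show ?thesis using d by (simp add: dual_def mdeg_eq_0_iff)
  qed
  then show "p \<in> annihilator c" unfolding annihilator_def by (intro CollectI ext)
qed

lemma contained_in_annihilator:
  assumes J: "homogeneous_ideal J" and k: "\<And>p. p \<in> J \<Longrightarrow> p \<in> forms s \<Longrightarrow> pair p c = 0" and c: "c \<in> dual s"
  shows "J \<subseteq> annihilator c"
proof
  fix p assume p: "p \<in> J"
  have "act p c m = 0 m" for m
  proof -
    let ?q = "p * Poly_Mapping.single m 1"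
    have "?q \<in> J" using I.subspace_scale[OF _ p, of "Poly_Mapping.single m 1"] J
      unfolding homogeneous_ideal_def by (simp add: mult.commute)
    then have "hom_component s ?q \<in> J" using J unfolding homogeneous_ideal_def by blast
    then have "pair (hom_component s ?q) c = 0" by (rule k) simp
    then show ?thesis unfolding act_apply pair_hom_component[OF c, of ?q] by simp
  qed
  then show "p \<in> annihilator c" unfolding annihilator_def by (intro CollectI ext)
qed

lemma irrelevant_act:
  assumes q: "q \<in> irrelevant_ideal" and \<delta>: "\<delta> \<in> dual 0"
  shows "act q \<delta> = 0"
proof
  fix m
  have "Poly_Mapping.lookup q r * \<delta> (r + m) = 0" if "r \<in> Poly_Mapping.keys q" for r
  proof -
    have "r \<noteq> 0" using that q by (auto simp: irrelevant_ideal_def in_keys_iff)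
    then have "mdeg (r + m) \<noteq> 0" using mdeg_eq_0_iff[of r] by simp
    then show ?thesis using \<delta> by (simp add: dual_def)
  qed
  then show "act q \<delta> m = 0 m" unfolding act_def pair_def by simp
qed

lemma var_irrelevant: "var x \<in> irrelevant_ideal"
proof -
  have "Poly_Mapping.single x (1::nat) \<noteq> 0" by (metis mdeg_single mdeg_zero zero_neq_one)
  then show ?thesis by (simp add: irrelevant_ideal_def var_def lookup_single when_def)
qed

lemma sum_of_terms: "p = (\<Sum>m\<in>Poly_Mapping.keys p. Poly_Mapping.single m (Poly_Mapping.lookup p m))"
  by (rule poly_mapping_eqI) (simp add: lookup_sum lookup_single when_def in_keys_iff)

lemma term_factor:
  fixes a :: "'k::comm_ring_1"
  shows "Poly_Mapping.single (Poly_Mapping.single i 1 + m) a = Poly_Mapping.single m a * var i"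
  by (simp add: var_def mult_single add.commute)

lemma socle_vars:
  assumes J: "is_ideal J" and v: "\<And>x. var x * p \<in> J"
  shows "p \<in> socle J"
  unfolding socle_def
proof (intro CollectI ballI)
  fix q :: "('a, 'b) mpoly" assume q: "q \<in> irrelevant_ideal"
  have "Poly_Mapping.single m (Poly_Mapping.lookup q m) * p \<in> J" if "m \<in> Poly_Mapping.keys q" for m
  proof -
    have "m \<noteq> 0" using that q by (auto simp: irrelevant_ideal_def in_keys_iff)
    then have "mdeg m > 0" using mdeg_eq_0_iff[of m] by simp
    then obtain i m' where m: "m = Poly_Mapping.single i 1 + m'" by (rule monom_factor_pos)
    have "Poly_Mapping.single m' (Poly_Mapping.lookup q m) * (var i * p) \<in> J" by (rule I.subspace_scale[OF J v])
    then show ?thesis using term_factor[of i m' "Poly_Mapping.lookup q m"] m by (simp only: mult.assoc)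
  qed
  then have "(\<Sum>m\<in>Poly_Mapping.keys q. Poly_Mapping.single m (Poly_Mapping.lookup q m) * p) \<in> J"
    by (rule I.subspace_sum[OF J])
  then show "q * p \<in> J" unfolding sum_distrib_right[symmetric] sum_of_terms[symmetric] .
qed

subsection \<open>Truncated ideals\<close>

definition low :: "nat \<Rightarrow> ('i, 'k::zero) mpoly set"
  where "low n = {p. \<forall>d\<ge>n. hom_component d p = 0}"

definition low_part :: "nat \<Rightarrow> ('i, 'k::comm_ring_1) mpoly \<Rightarrow> ('i, 'k) mpoly"
  where "low_part n p = (\<Sum>d<n. hom_component d p)"

lemma sum_lessThan_add: "(\<Sum>d<n + m. f d) = (\<Sum>d<n. f d) + (\<Sum>d<m. f (n + d :: nat))"
  for f :: "nat \<Rightarrow> 'a::comm_monoid_add"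
  by (induction m) (simp_all add: add.assoc)

lemma hom_component_low_part: "hom_component d (low_part n p) = (if d < n then hom_component d p else 0)"
proof -
  have "hom_component d (low_part n p) = (\<Sum>e<n. if d = e then hom_component e p else 0)"
    unfolding low_part_def hom_component_sum by (intro sum.cong refl) (rule hom_component_forms[OF hom_component_in_forms])
  also have "\<dots> = (if d < n then hom_component d p else 0)" by simp
  finally show ?thesis .
qed

lemma low_part_low: "low_part n p \<in> low n"
  by (simp add: low_def hom_component_low_part)

lemma diff_low_part:
  fixes p :: "('i, 'k::field) mpoly"
  assumes J: "is_ideal J" and top: "\<And>j. j \<ge> n \<Longrightarrow> forms j \<subseteq> J"
  shows "p - low_part n p \<in> J"
proof -
  obtain N where N: "\<And>m. m \<ge> N \<Longrightarrow> p = (\<Sum>d<m. hom_component d p)" by (rule mpoly_eq_sum_hom_components) blast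
  have "p = low_part n p + (\<Sum>d<N. hom_component (n + d) p)"
    using N[of "n + N"] unfolding sum_lessThan_add low_part_def by simp
  then have "p - low_part n p = (\<Sum>d<N. hom_component (n + d) p)" by (simp add: diff_eq_eq add.commute)
  moreover have "(\<Sum>d<N. hom_component (n + d) p) \<in> J"
  proof (rule I.subspace_sum[OF J])
    fix d show "hom_component (n + d) p \<in> J" using top[of "n + d"] hom_component_in_forms[of "n + d" p] by auto
  qed
  ultimately show ?thesis by (simp only:)
qed

lemma low_eq: "p \<in> low n \<Longrightarrow> low_part n p = p"
  for p :: "('i, 'k::comm_ring_1) mpoly"
proof -
  assume p: "p \<in> low n"
  obtain N where N: "\<And>m. m \<ge> N \<Longrightarrow> p = (\<Sum>d<m. hom_component d p)" by (rule mpoly_eq_sum_hom_components) blast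
  have "(\<Sum>d<N. hom_component (n + d) p) = 0" using p by (simp add: low_def)
  then show ?thesis using N[of "n + N"] unfolding sum_lessThan_add low_part_def by simp
qed

lemma subspace_low: "V.subspace (low n)"
  by (rule V.subspaceI) (simp_all add: low_def hom_component_add hom_component_cmul cmul_simps)

lemma fin_dim_low: "V.fin_dim (low n :: (4, 'k::field) mpoly set)"
proof -
  have "\<exists>B. finite B \<and> forms d \<subseteq> V.span (B :: (4, 'k) mpoly set)" for d
    using fin_dim_forms[of d] unfolding V.fin_dim_def by blast
  then obtain B where B: "\<And>d. finite (B d)" "\<And>d. forms d \<subseteq> V.span (B d :: (4, 'k) mpoly set)" by metis
  let ?C = "\<Union>d<n. B d"
  have "low n \<subseteq> V.span ?C"
  proof
    fix p :: "(4, 'k) mpoly" assume p: "p \<in> low n"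
    have "low_part n p \<in> V.span ?C" unfolding low_part_def
    proof (rule V.span_sum)
      fix d assume "d \<in> {..<n}"
      then have "V.span (B d) \<subseteq> V.span ?C" by (intro V.span_mono) blast
      then show "hom_component d p \<in> V.span ?C" using B(2)[of d] hom_component_in_forms[of d p] by blast
    qed
    then show "p \<in> V.span ?C" unfolding low_eq[OF p] .
  qed
  then show ?thesis unfolding V.fin_dim_def using B(1) by (intro exI[of _ ?C]) simp
qed

text \<open>Ideals that contain all forms of degree at least \<open>n\<close> are compared by this number: it depends on the
  finite-dimensional part of the ideal only.\<close>

definition low_dim :: "nat \<Rightarrow> (4, 'k::field) mpoly set \<Rightarrow> nat"
  where "low_dim n J = k_dim (J \<inter> low n)"

lemma subspace_Int_low: "is_ideal J \<Longrightarrow> V.subspace (J \<inter> low n)"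
  by (rule V.subspace_inter[OF ideal_k_subspace subspace_low])

lemma fin_dim_Int_low: "V.fin_dim (J \<inter> low n :: (4, 'k::field) mpoly set)"
  by (rule V.fin_dim_mono[OF fin_dim_low]) blast

lemma low_dim_le:
  fixes J :: "(4, 'k::field) mpoly set"
  assumes "is_ideal J"
  shows "low_dim n J \<le> k_dim (low n :: (4, 'k) mpoly set)"
  unfolding low_dim_def
proof (rule V.dim_mono_fin(1))
  show "V.subspace (low n :: (4, 'k) mpoly set)" by (rule subspace_low)
  show "V.fin_dim (low n :: (4, 'k) mpoly set)" by (rule fin_dim_low)
  show "V.subspace (J \<inter> low n)" by (rule subspace_Int_low[OF assms])
qed blast

lemma low_dim_mono: "is_ideal J \<Longrightarrow> is_ideal J' \<Longrightarrow> J \<subseteq> J' \<Longrightarrow> low_dim n J \<le> low_dim n J'"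
  unfolding low_dim_def by (rule V.dim_mono_fin(1)[OF subspace_Int_low fin_dim_Int_low subspace_Int_low]) auto

lemma low_dim_strict:
  assumes J: "is_ideal J" and J': "is_ideal J'" and sub: "J \<subset> J'" and top: "\<And>j. j \<ge> n \<Longrightarrow> forms j \<subseteq> J"
  shows "low_dim n J < low_dim n J'"
proof (rule ccontr)
  assume nl: "\<not> low_dim n J < low_dim n J'"
  have sub1: "J \<subseteq> J'" by (rule psubset_imp_subset[OF sub])
  have same: "low_dim n J = low_dim n J'" using low_dim_mono[OF J J' sub1, of n] nl by linarith
  have eq: "J \<inter> low n = J' \<inter> low n"
  proof (rule V.dim_mono_fin(2)[OF subspace_Int_low[OF J'] fin_dim_Int_low subspace_Int_low[OF J]])
    show "J \<inter> low n \<subseteq> J' \<inter> low n" by (rule Int_mono[OF sub1 order_refl])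
    show "k_dim (J \<inter> low n) = k_dim (J' \<inter> low n)" by (rule same[unfolded low_dim_def])
  qed
  obtain p where p: "p \<in> J'" "p \<notin> J" using psubset_imp_ex_mem[OF sub] by (elim exE DiffE)
  have d: "p - low_part n p \<in> J" by (rule diff_low_part[OF J top])
  then have "p - low_part n p \<in> J'" by (rule subsetD[OF sub1])
  then have "p - (p - low_part n p) \<in> J'" by (rule I.subspace_diff[OF J' p(1)])
  then have "low_part n p \<in> J'" by simp
  then have "low_part n p \<in> J" using low_part_low[of n p] eq by blast
  then have "low_part n p + (p - low_part n p) \<in> J" using d by (rule I.subspace_add[OF J])
  then show False using p(2) by simp
qed

lemma artinian_of_top:
  fixes J :: "(4, 'k::field) mpoly set"
  assumes top: "\<And>j. j \<ge> n \<Longrightarrow> forms j \<subseteq> J"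
  shows "artinian_quotient J"
  unfolding artinian_quotient_def
proof
  assume "\<exists>K. \<forall>m. is_ideal (K m) \<and> J \<subseteq> K m \<and> K (Suc m) \<subset> K m"
  then obtain K where K0: "\<forall>m. is_ideal (K m) \<and> J \<subseteq> K m \<and> K (Suc m) \<subset> K m" by (rule exE)
  have K: "is_ideal (K m)" "J \<subseteq> K m" "K (Suc m) \<subset> K m" for m
    by (rule conjunct1[OF spec[OF K0]] conjunct1[OF conjunct2[OF spec[OF K0]]] conjunct2[OF conjunct2[OF spec[OF K0]]])+
  have "low_dim n (K m) + m \<le> low_dim n (K 0)" for m
  proof (induction m)
    case (Suc m)
    have "low_dim n (K (Suc m)) < low_dim n (K m)"
    proof (rule low_dim_strict[OF K(1) K(1) K(3)])
      fix j assume "j \<ge> n"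
      from top[OF this] show "forms j \<subseteq> K (Suc m)" using K(2)[of "Suc m"] by blast
    qed
    then show ?case using Suc by simp
  qed simp
  from this[of "Suc (low_dim n (K 0))"] show False by simp
qed

lemma quotient_length_le:
  fixes J :: "(4, 'k::field) mpoly set"
  assumes J: "is_ideal J" and top: "\<And>j. j \<ge> n \<Longrightarrow> forms j \<subseteq> J"
  shows "quotient_length J \<le> enat (k_dim (low n :: (4, 'k) mpoly set) - low_dim n J)"
  unfolding quotient_length_def
proof (rule Sup_least)
  fix x assume "x \<in> {enat m |m. \<exists>K :: nat \<Rightarrow> (4, 'k) mpoly set. (\<forall>i\<le>m. is_ideal (K i) \<and> J \<subseteq> K i) \<and> (\<forall>i<m. K i \<subset> K (Suc i))}"
  then obtain m and K :: "nat \<Rightarrow> (4, 'k) mpoly set" where x: "x = enat m"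
    and K0: "\<forall>i\<le>m. is_ideal (K i) \<and> J \<subseteq> K i" "\<forall>i<m. K i \<subset> K (Suc i)" by (elim CollectE exE conjE)
  have K: "\<And>i. i \<le> m \<Longrightarrow> is_ideal (K i)" "\<And>i. i \<le> m \<Longrightarrow> J \<subseteq> K i" "\<And>i. i < m \<Longrightarrow> K i \<subset> K (Suc i)"
    by (erule K0(1)[THEN spec, THEN mp, THEN conjunct1], erule K0(1)[THEN spec, THEN mp, THEN conjunct2],
      erule K0(2)[THEN spec, THEN mp])
  have "low_dim n J + i \<le> low_dim n (K i)" if "i \<le> m" for i
    using that
  proof (induction i)
    case 0
    then show ?case using low_dim_mono[OF J K(1) K(2), of 0] by simp
  next
    case (Suc i)
    have "low_dim n (K i) < low_dim n (K (Suc i))"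
    proof (rule low_dim_strict[OF K(1) K(1) K(3)])
      fix j assume "j \<ge> n"
      from top[OF this] show "forms j \<subseteq> K i" using K(2)[of i] Suc.prems by auto
    qed (use Suc.prems in auto)
    then show ?case using Suc by simp
  qed
  from this[of m] low_dim_le[OF K(1)[of m], of n] show "x \<le> enat (k_dim (low n :: (4, 'k) mpoly set) - low_dim n J)"
    unfolding x by simp
qed

text \<open>An element of largest possible initial degree outside of the ideal is multiplied into the ideal by the
  variables. Adding it gives the next term of a composition series.\<close>

lemma exists_socle_element:
  fixes J :: "(4, 'k::field) mpoly set"
  assumes J: "is_ideal J" and top: "\<And>j. j \<ge> n \<Longrightarrow> forms j \<subseteq> J" and less: "low_dim n J < k_dim (low n :: (4, 'k) mpoly set)"
  obtains p where "p \<in> low n" "p \<notin> J" "p \<in> socle J"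
proof -
  have "J \<inter> low n \<noteq> low n" using less unfolding low_dim_def by auto
  then obtain q where q: "q \<in> low n" "q \<notin> J" by blast
  let ?D = "{d. \<exists>p\<in>low n. p \<notin> J \<and> (\<forall>k<d. hom_component k p = 0)}"
  have D: "?D \<subseteq> {..<n}"
  proof
    fix d assume "d \<in> ?D"
    then obtain p where p: "p \<in> low n" "p \<notin> J" "\<And>k. k < d \<Longrightarrow> hom_component k p = 0" by blast
    have "d < n"
    proof (rule ccontr)
      assume "\<not> d < n"
      then have "low_part n p = 0" unfolding low_part_def by (intro sum.neutral) (simp add: p(3))
      then show False using low_eq[OF p(1)] p(2) I.subspace_0[OF J] by simp
    qed
    then show "d \<in> {..<n}" by simp
  qed
  then have fin: "finite ?D" by (rule finite_subset) simp
  have "0 \<in> ?D" using q by auto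
  then have "Max ?D \<in> ?D" using fin Max_in by blast
  then obtain p where p: "p \<in> low n" "p \<notin> J" "\<And>k. k < Max ?D \<Longrightarrow> hom_component k p = 0" by blast
  have "var x * p \<in> J" for x
  proof (rule ccontr)
    assume no: "var x * p \<notin> J"
    let ?q = "low_part n (var x * p)"
    have "?q \<notin> J"
    proof
      assume "?q \<in> J"
      then have "?q + (var x * p - ?q) \<in> J" by (rule I.subspace_add[OF J _ diff_low_part[OF J top]])
      then show False using no by simp
    qed
    moreover have "hom_component k ?q = 0" if "k < Suc (Max ?D)" for k
    proof -
      have "hom_component k (var x * p) = 0"
      proof (cases k)
        case 0
        then show ?thesis using hom_component_mult(2)[OF var_in_forms, of k x p] by simp
      next
        case (Suc k')
        then have "k = 1 + k'" by simp
        moreover have "hom_component k' p = 0" using p(3)[of k'] that Suc by simp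
        ultimately show ?thesis using hom_component_mult(1)[OF var_in_forms, of k' x p] by simp
      qed
      then show ?thesis by (simp add: hom_component_low_part)
    qed
    ultimately have "Suc (Max ?D) \<in> ?D" using low_part_low[of n "var x * p"] by blast
    then have "Suc (Max ?D) \<le> Max ?D" using fin by (rule Max_ge[rotated])
    then show False by simp
  qed
  then have "p \<in> socle J" by (rule socle_vars[OF J])
  then show ?thesis using that p(1,2) by blast
qed

lemma extend_by_socle:
  fixes J :: "(4, 'k::field) mpoly set"
  assumes J: "is_ideal J" and p: "p \<in> low n" "p \<in> socle J"
  defines "J' \<equiv> {f + cmul a p |f a. f \<in> J}"
  shows "is_ideal J'" "low_dim n J' \<le> low_dim n J + 1"
proof -
  have JV: "V.subspace J" by (rule ideal_k_subspace[OF J])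
  show "is_ideal J'"
  proof (rule I.subspaceI)
    show "0 \<in> J'" unfolding J'_def using I.subspace_0[OF J] by (intro CollectI exI[of _ 0]) (simp add: cmul_simps)
  next
    fix x y assume "x \<in> J'" "y \<in> J'"
    then obtain f a f' a' where "x = f + cmul a p" "f \<in> J" "y = f' + cmul a' p" "f' \<in> J" unfolding J'_def by blast
    then show "x + y \<in> J'" unfolding J'_def
      by (intro CollectI exI[of _ "f + f'"] exI[of _ "a + a'"]) (simp add: cmul_simps I.subspace_add[OF J])
  next
    fix q x :: "(4, 'k) mpoly" assume "x \<in> J'"
    then obtain f a where x: "x = f + cmul a p" "f \<in> J" unfolding J'_def by blast
    define q0 where "q0 = q - Poly_Mapping.single 0 (Poly_Mapping.lookup q 0)"
    have "q0 \<in> irrelevant_ideal" by (simp add: q0_def irrelevant_ideal_def lookup_minus)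
    then have "q0 * p \<in> J" using p(2) unfolding socle_def by blast
    then have s: "q * f + cmul a (q0 * p) \<in> J"
      by (intro I.subspace_add[OF J] I.subspace_scale[OF J x(2)] V.subspace_scale[OF JV])
    have q: "q * p = q0 * p + cmul (Poly_Mapping.lookup q 0) p" by (simp add: q0_def cmul_def left_diff_distrib)
    have "q * x = q * f + cmul a (q * p)" unfolding x(1) by (simp only: distrib_left cmul_mult)
    also have "\<dots> = (q * f + cmul a (q0 * p)) + cmul (a * Poly_Mapping.lookup q 0) p"
      unfolding q by (simp only: cmul_simps add.assoc)
    finally show "q * x \<in> J'" unfolding J'_def using s by blast
  qed
  then have sub: "V.subspace (J' \<inter> low n)" by (rule subspace_Int_low)
  obtain A where A: "A \<subseteq> J \<inter> low n" "finite A" "V.span A = J \<inter> low n" "k_dim (J \<inter> low n) = card A"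
    by (rule V.finite_basis[OF subspace_Int_low[OF J, of n] fin_dim_Int_low, of "{}"]) (auto simp: V.independent_empty)
  have "J' \<inter> low n \<subseteq> V.span (insert p A)"
  proof
    fix x assume x: "x \<in> J' \<inter> low n"
    then obtain f a where fa: "x = f + cmul a p" "f \<in> J" unfolding J'_def by blast
    have "x - cmul a p \<in> low n" using x p(1) by (intro V.subspace_diff[OF subspace_low] V.subspace_scale[OF subspace_low]) auto
    then have "f \<in> low n" using fa(1) by simp
    then have "f \<in> V.span A" using fa(2) A(3) by blast
    then have "f \<in> V.span (insert p A)" using V.span_mono[of A "insert p A"] by blast
    moreover have "cmul a p \<in> V.span (insert p A)" by (intro V.span_scale V.span_base) simp
    ultimately show "x \<in> V.span (insert p A)" unfolding fa(1) by (rule V.span_add)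
  qed
  then have "k_dim (J' \<inter> low n) \<le> card (insert p A)" by (rule V.dim_le_card) (simp add: A(2))
  also have "\<dots> \<le> card A + 1" by (simp add: card_insert_if A(2))
  finally show "low_dim n J' \<le> low_dim n J + 1" unfolding low_dim_def A(4) .
qed

lemma composition_series:
  fixes J :: "(4, 'k::field) mpoly set"
  assumes "is_ideal J" "\<And>j. j \<ge> n \<Longrightarrow> forms j \<subseteq> J" "low_dim n J + l = k_dim (low n :: (4, 'k) mpoly set)"
  shows "\<exists>K :: nat \<Rightarrow> (4, 'k) mpoly set. (\<forall>i\<le>l. is_ideal (K i) \<and> J \<subseteq> K i) \<and> (\<forall>i<l. K i \<subset> K (Suc i))"
  using assms
proof (induction l arbitrary: J)
  case 0
  then show ?case by (intro exI[of _ "\<lambda>_. J"]) simp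
next
  case (Suc l)
  have "low_dim n J < k_dim (low n :: (4, 'k) mpoly set)" using Suc.prems(3) by simp
  from exists_socle_element[OF Suc.prems(1,2) this] obtain p where p: "p \<in> low n" "p \<notin> J" "p \<in> socle J" by blast
  define J' where "J' = {f + cmul a p |f a. f \<in> J}"
  have J': "is_ideal J'" "low_dim n J' \<le> low_dim n J + 1"
    unfolding J'_def by (rule extend_by_socle[OF Suc.prems(1) p(1,3)])+
  have sub: "J \<subseteq> J'"
  proof
    fix f assume "f \<in> J"
    then show "f \<in> J'" unfolding J'_def by (intro CollectI exI[of _ f] exI[of _ 0]) (simp add: cmul_simps)
  qed
  have "p \<in> J'" unfolding J'_def using I.subspace_0[OF Suc.prems(1)]
    by (intro CollectI exI[of _ 0] exI[of _ 1]) (simp add: cmul_simps)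
  then have strict: "J \<subset> J'" using p(2) sub by blast
  have top: "forms j \<subseteq> J'" if "j \<ge> n" for j using Suc.prems(2)[OF that] sub by blast
  have "low_dim n J < low_dim n J'" by (rule low_dim_strict[OF Suc.prems(1) J'(1) strict Suc.prems(2)])
  then have eq: "low_dim n J' + l = k_dim (low n :: (4, 'k) mpoly set)" using J'(2) Suc.prems(3) by simp
  have "\<exists>K :: nat \<Rightarrow> (4, 'k) mpoly set. (\<forall>i\<le>l. is_ideal (K i) \<and> J' \<subseteq> K i) \<and> (\<forall>i<l. K i \<subset> K (Suc i))"
    by (rule Suc.IH[OF J'(1) _ eq]) (rule top)
  then obtain K :: "nat \<Rightarrow> (4, 'k) mpoly set"
    where K0: "\<forall>i\<le>l. is_ideal (K i) \<and> J' \<subseteq> K i" "\<forall>i<l. K i \<subset> K (Suc i)" by (elim exE conjE)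
  have K: "\<And>i. i \<le> l \<Longrightarrow> is_ideal (K i)" "\<And>i. i \<le> l \<Longrightarrow> J' \<subseteq> K i" "\<And>i. i < l \<Longrightarrow> K i \<subset> K (Suc i)"
    by (erule K0(1)[THEN spec, THEN mp, THEN conjunct1], erule K0(1)[THEN spec, THEN mp, THEN conjunct2],
      erule K0(2)[THEN spec, THEN mp])
  let ?K = "\<lambda>i. case i of 0 \<Rightarrow> J | Suc i \<Rightarrow> K i"
  have k1: "is_ideal (?K i) \<and> J \<subseteq> ?K i" if "i \<le> Suc l" for i
  proof (cases i)
    case 0
    then show ?thesis using Suc.prems(1) by simp
  next
    case (Suc i')
    then have "i' \<le> l" using that by simp
    from K(1)[OF this] order_trans[OF sub K(2)[OF this]] show ?thesis using Suc by simp
  qed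
  have k2: "?K i \<subset> ?K (Suc i)" if "i < Suc l" for i
  proof (cases i)
    case 0
    then show ?thesis using psubset_subset_trans[OF strict K(2)[OF le0]] by simp
  next
    case (Suc i')
    then show ?thesis using K(3)[of i'] that by simp
  qed
  have "\<forall>i\<le>Suc l. is_ideal (?K i) \<and> J \<subseteq> ?K i" by (intro allI impI) (rule k1)
  moreover have "\<forall>i<Suc l. ?K i \<subset> ?K (Suc i)" by (intro allI impI) (rule k2)
  ultimately show ?case by (rule exI[of _ ?K, OF conjI])
qed

lemma quotient_length_ge:
  fixes J :: "(4, 'k::field) mpoly set"
  assumes J: "is_ideal J" and top: "\<And>j. j \<ge> n \<Longrightarrow> forms j \<subseteq> J"
  shows "enat (k_dim (low n :: (4, 'k) mpoly set) - low_dim n J) \<le> quotient_length J"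
  unfolding quotient_length_def
proof (rule Sup_upper, rule CollectI, rule exI, rule conjI[OF refl])
  show "\<exists>K :: nat \<Rightarrow> (4, 'k) mpoly set. (\<forall>i\<le>k_dim (low n :: (4, 'k) mpoly set) - low_dim n J. is_ideal (K i) \<and> J \<subseteq> K i) \<and>
      (\<forall>i<k_dim (low n :: (4, 'k) mpoly set) - low_dim n J. K i \<subset> K (Suc i))"
    by (rule composition_series[OF J], erule top) (use low_dim_le[OF J, of n] in simp)
qed

text \<open>For a homogeneous ideal the low part splits into graded pieces, so that lengths can be compared degree
  by degree.\<close>

lemma low_dim_eq_sum:
  fixes J :: "(4, 'k::field) mpoly set"
  assumes J: "homogeneous_ideal J"
  shows "low_dim n J = (\<Sum>d<n. k_dim (J \<inter> forms d))"
proof (induction n)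
  case 0
  have "p = 0" if "p \<in> low 0" for p :: "(4, 'k) mpoly" using low_eq[OF that] by (simp add: low_part_def)
  then have "J \<inter> low 0 \<subseteq> {0}" by blast
  then have "J \<inter> low 0 \<subseteq> V.span {}" by (simp only: V.span_empty)
  then have "k_dim (J \<inter> low 0) \<le> card ({} :: (4, 'k) mpoly set)" by (rule V.dim_le_card) simp
  then show ?case by (simp add: low_dim_def)
next
  case (Suc n)
  have id: "is_ideal J" and hc: "\<And>f d. f \<in> J \<Longrightarrow> hom_component d f \<in> J" using J unfolding homogeneous_ideal_def by blast+
  have lin: "Vector_Spaces.linear cmul cmul (hom_component n :: (4, 'k) mpoly \<Rightarrow> _)"
    by unfold_locales (simp_all add: hom_component_add hom_component_cmul)
  have im: "hom_component n ` (J \<inter> low (Suc n)) = J \<inter> forms n"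
  proof (intro equalityI subsetI)
    fix p assume "p \<in> hom_component n ` (J \<inter> low (Suc n))"
    then show "p \<in> J \<inter> forms n" using hc by auto
  next
    fix p assume p: "p \<in> J \<inter> forms n"
    then have "p = hom_component n p" "p \<in> low (Suc n)" by (auto simp: hom_component_forms low_def)
    then show "p \<in> hom_component n ` (J \<inter> low (Suc n))" using p by blast
  qed
  have ker: "{p \<in> J \<inter> low (Suc n). hom_component n p = 0} = J \<inter> low n"
  proof -
    have "(\<forall>d\<ge>n. hom_component d p = 0) \<longleftrightarrow> (\<forall>d\<ge>Suc n. hom_component d p = 0) \<and> hom_component n p = 0" for p :: "(4, 'k) mpoly"
      by (metis Suc_leD le_antisym not_less_eq_eq order_refl)
    then show ?thesis unfolding low_def by blast
  qed
  show ?case using VV.dim_image_kernel[OF lin subspace_Int_low[OF id] fin_dim_Int_low, of "Suc n"] Suc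
    unfolding im ker low_dim_def by simp
qed

section \<open>Gorenstein ideals as annihilators\<close>

lemma nonzero_functional:
  assumes c: "c \<in> dual s" "c \<noteq> 0"
  obtains g where "g \<in> forms s" "pair g c = (1 :: 'k::field)"
proof -
  obtain m where m: "c m \<noteq> 0" using c(2) by (metis ext zero_fun_apply)
  then have "mdeg m = s" using c(1) by (auto simp: dual_def)
  then have "Poly_Mapping.single m (1 / c m) \<in> forms s" by simp
  moreover have "pair (Poly_Mapping.single m (1 / c m)) c = 1" using m by simp
  ultimately show ?thesis using that by blast
qed

lemma annihilator_gorenstein:
  fixes c :: "4 monom \<Rightarrow> 'k::field"
  assumes c: "c \<in> dual s" "c \<noteq> 0"
  shows "gorenstein s (annihilator c)"
proof -
  obtain g where g: "g \<in> forms s" "pair g c = 1" by (rule nonzero_functional[OF c])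
  have gd: "act g c \<in> dual 0" by (rule act_dual[OF g(1)]) (use c(1) in simp)
  have g0: "act g c 0 = 1" using g(2) by (simp only: pair_eq_act)
  have "socle (annihilator c) = {f + cmul a g |f a. f \<in> annihilator c}"
  proof (intro equalityI subsetI)
    fix p assume p: "p \<in> socle (annihilator c)"
    define a where "a = act p c 0"
    have "act (p - cmul a g) c m = 0 m" for m
    proof (cases "m = 0")
      case True
      then show ?thesis by (simp add: act_diff act_cmul a_def g0)
    next
      case False
      then have "mdeg m > 0" using mdeg_eq_0_iff[of m] by simp
      then obtain i m' where m: "m = Poly_Mapping.single i 1 + m'" by (rule monom_factor_pos)
      have "var i * p \<in> annihilator c" using p var_irrelevant[of i] unfolding socle_def by blast
      then have z: "act (var i) (act p c) = 0" unfolding annihilator_def mem_Collect_eq act_mult .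
      have "act p c m = act (var i) (act p c) m'" unfolding m act_var ..
      also have "\<dots> = 0" by (simp only: z zero_fun_apply)
      finally have "act p c m = 0" .
      moreover have "act g c m = 0" using gd False by (simp add: dual_def mdeg_eq_0_iff)
      ultimately show ?thesis by (simp add: act_diff act_cmul)
    qed
    then have "p - cmul a g \<in> annihilator c" unfolding annihilator_def by (intro CollectI ext)
    then show "p \<in> {f + cmul a g |f a. f \<in> annihilator c}"
      by (intro CollectI exI[of _ "p - cmul a g"] exI[of _ a]) simp
  next
    fix p assume "p \<in> {f + cmul a g |f a. f \<in> annihilator c}"
    then obtain f a where p: "p = f + cmul a g" "f \<in> annihilator c" by blast
    have f: "act f c = 0" using p(2) unfolding annihilator_def mem_Collect_eq .
    show "p \<in> socle (annihilator c)" unfolding socle_def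
    proof (intro CollectI ballI)
      fix q :: "(4, 'k) mpoly" assume "q \<in> irrelevant_ideal"
      then have q: "act q (act g c) = 0" by (rule irrelevant_act[OF _ gd])
      have "q * p = q * f + cmul a (q * g)" unfolding p(1) by (simp only: distrib_left cmul_mult)
      moreover have "q * f \<in> annihilator c" by (rule I.subspace_scale[OF annihilator_ideal p(2)])
      moreover have "q * g \<in> annihilator c" unfolding annihilator_def mem_Collect_eq act_mult by (rule q)
      ultimately show "q * p \<in> annihilator c"
        using I.subspace_add[OF annihilator_ideal] V.subspace_scale[OF ideal_k_subspace[OF annihilator_ideal]] by metis
    qed
  qed
  moreover have "g \<notin> annihilator c" using annihilator_top[OF c(1) g(1)] g(2) by simp
  moreover have "artinian_quotient (annihilator c)"
    by (rule artinian_of_top[of "Suc s"]) (rule annihilator_above[OF c(1)], simp)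
  ultimately show ?thesis unfolding gorenstein_def using annihilator_homogeneous[OF c(1)] g(1) by blast
qed

lemma hom_component_product:
  fixes p q :: "('i, 'k::comm_ring_1) mpoly"
  shows "\<exists>N. hom_component d (q * p)
    = (\<Sum>e<N. if e \<le> d then hom_component e q * hom_component (d - e) p else 0)"
proof -
  obtain N where N: "\<And>m. m \<ge> N \<Longrightarrow> q = (\<Sum>e<m. hom_component e q)" by (rule mpoly_eq_sum_hom_components) blast
  have "q * p = (\<Sum>e<N. hom_component e q * p)" using N[of N] unfolding sum_distrib_right[symmetric] by simp
  then have "hom_component d (q * p) = (\<Sum>e<N. hom_component d (hom_component e q * p))" by (simp only: hom_component_sum)
  also have "\<dots> = (\<Sum>e<N. if e \<le> d then hom_component e q * hom_component (d - e) p else 0)"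
  proof (intro sum.cong refl)
    fix e
    show "hom_component d (hom_component e q * p) = (if e \<le> d then hom_component e q * hom_component (d - e) p else 0)"
    proof (cases "e \<le> d")
      case True
      then have "d = e + (d - e)" by simp
      then show ?thesis using hom_component_mult(1)[OF hom_component_in_forms, of e "d - e" q p] True by simp
    next
      case False
      then show ?thesis using hom_component_mult(2)[OF hom_component_in_forms, of d e q p] by simp
    qed
  qed
  finally show ?thesis by blast
qed

lemma forms_Suc_in_ideal:
  fixes J :: "('i, 'k::field) mpoly set"
  assumes J: "is_ideal J" and k: "forms k \<subseteq> J"
  shows "forms (Suc k) \<subseteq> J"
proof
  fix p :: "('i, 'k) mpoly" assume p: "p \<in> forms (Suc k)"
  have "Poly_Mapping.single m (Poly_Mapping.lookup p m) \<in> J" if "m \<in> Poly_Mapping.keys p" for m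
  proof -
    have d: "mdeg m = Suc k" using that p by (simp add: forms_def)
    then have "mdeg m > 0" by simp
    then obtain i m' where m: "m = Poly_Mapping.single i 1 + m'" by (rule monom_factor_pos)
    then have "mdeg m' = k" using d by simp
    then have "Poly_Mapping.single m' (Poly_Mapping.lookup p m) \<in> forms k" by simp
    then have "Poly_Mapping.single m' (Poly_Mapping.lookup p m) \<in> J" using k by blast
    then have "var i * Poly_Mapping.single m' (Poly_Mapping.lookup p m) \<in> J" by (rule I.subspace_scale[OF J])
    then show ?thesis using term_factor[of i m' "Poly_Mapping.lookup p m"] m by (simp only: mult.commute)
  qed
  then have "(\<Sum>m\<in>Poly_Mapping.keys p. Poly_Mapping.single m (Poly_Mapping.lookup p m)) \<in> J" by (rule I.subspace_sum[OF J])
  then show "p \<in> J" unfolding sum_of_terms[symmetric] .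
qed

text \<open>The ideals generated by \<open>J\<close> and all forms of degree at least \<open>n\<close> form a descending chain. Where it
  becomes stationary, all forms of degree \<open>n\<close> lie in \<open>J\<close>.\<close>

lemma artinian_top:
  fixes J :: "('i, 'k::field) mpoly set"
  assumes J: "homogeneous_ideal J" and art: "artinian_quotient J"
  obtains n where "\<And>k. k \<ge> n \<Longrightarrow> forms k \<subseteq> J"
proof -
  have id: "is_ideal J" and hc: "\<And>f d. f \<in> J \<Longrightarrow> hom_component d f \<in> J" using J unfolding homogeneous_ideal_def by blast+
  define K where "K n = {p. \<forall>d<n. hom_component d p \<in> J}" for n
  have "is_ideal (K n)" for n
  proof (rule I.subspaceI)
    show "0 \<in> K n" using I.subspace_0[OF id] by (simp add: K_def)
  next
    fix p q assume "p \<in> K n" "q \<in> K n"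
    then show "p + q \<in> K n" using I.subspace_add[OF id] by (simp add: K_def hom_component_add)
  next
    fix q p assume p: "p \<in> K n"
    have "hom_component d (q * p) \<in> J" if "d < n" for d
    proof -
      obtain N where N: "hom_component d (q * p) = (\<Sum>e<N. if e \<le> d then hom_component e q * hom_component (d - e) p else 0)"
        using hom_component_product by blast
      have "(if e \<le> d then hom_component e q * hom_component (d - e) p else 0) \<in> J" for e
      proof (cases "e \<le> d")
        case True
        have "hom_component (d - e) p \<in> J" using p that by (simp add: K_def)
        then show ?thesis using True I.subspace_scale[OF id] by simp
      next
        case False
        then show ?thesis using I.subspace_0[OF id] by simp
      qed
      then show ?thesis unfolding N by (intro I.subspace_sum[OF id])
    qed
    then show "q * p \<in> K n" by (simp add: K_def)
  qed
  moreover have "J \<subseteq> K n" for n using hc by (auto simp: K_def)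
  ultimately have K: "is_ideal (K n)" "J \<subseteq> K n" for n by simp_all
  have "\<exists>n. \<not> K (Suc n) \<subset> K n"
  proof (rule ccontr)
    assume "\<nexists>n. \<not> K (Suc n) \<subset> K n"
    then have "K (Suc n) \<subset> K n" for n by (simp only: not_ex not_not)
    then have "\<forall>n. is_ideal (K n) \<and> J \<subseteq> K n \<and> K (Suc n) \<subset> K n" using K by (intro allI conjI)
    then have "\<exists>K. \<forall>n. is_ideal (K n) \<and> J \<subseteq> K n \<and> K (Suc n) \<subset> K n" by (rule exI[where x = K])
    with art show False unfolding artinian_quotient_def by (rule notE)
  qed
  then obtain n where n: "\<not> K (Suc n) \<subset> K n" by (rule exE)
  have "K (Suc n) \<subseteq> K n" by (auto simp: K_def)
  then have eq: "K (Suc n) = K n" using n by blast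
  have base: "forms n \<subseteq> J"
  proof
    fix p :: "('i, 'k) mpoly" assume p: "p \<in> forms n"
    have "hom_component d p \<in> J" if "d < n" for d
      using that I.subspace_0[OF id] by (simp add: hom_component_forms[OF p])
    then have "p \<in> K (Suc n)" unfolding eq by (simp add: K_def)
    then have "hom_component n p \<in> J" by (simp add: K_def)
    then show "p \<in> J" by (simp add: hom_component_forms[OF p])
  qed
  have "forms k \<subseteq> J" if "k \<ge> n" for k
    using that by (induction k rule: dec_induct) (auto simp: base intro: forms_Suc_in_ideal[OF id, THEN subsetD])
  then show ?thesis using that by blast
qed

text \<open>The functional is \<open>1\<close> on a generator of the socle and vanishes on the ideal. It detects the ideal: by
  descending induction on the degree, a form whose products with all variables lie in the ideal represents
  a socle element, so it lies in the ideal unless its degree is \<open>s\<close>.\<close>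

lemma gorenstein_is_annihilator:
  fixes J :: "('i, 'k::field) mpoly set"
  assumes gor: "gorenstein s J"
  obtains c where "c \<in> dual s" "J = annihilator c"
proof -
  obtain g where J: "homogeneous_ideal J" "artinian_quotient J" and g: "g \<in> forms s" "g \<notin> J"
    and soc: "socle J = {f + cmul a g |f a. f \<in> J}" using gor unfolding gorenstein_def by blast
  have id: "is_ideal J" and hc: "\<And>f d. f \<in> J \<Longrightarrow> hom_component d f \<in> J" using J(1) unfolding homogeneous_ideal_def by blast+
  have socle_form: "\<exists>a. p - cmul a g \<in> J" if "\<And>x. var x * p \<in> J" for p
  proof -
    have "p \<in> socle J" by (rule socle_vars[OF id that])
    then obtain f a where "p = f + cmul a g" "f \<in> J" unfolding soc by blast
    then have "p - cmul a g \<in> J" by simp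
    then show ?thesis by (rule exI[where x = a])
  qed
  have other: "p \<in> J" if p: "p \<in> forms d" "d \<noteq> s" "\<And>x. var x * p \<in> J" for p d
  proof -
    obtain a where "p - cmul a g \<in> J" using socle_form[OF p(3)] by blast
    then have "hom_component d (p - cmul a g) \<in> J" by (rule hc)
    moreover have "hom_component d (p - cmul a g) = p"
      unfolding hom_component_diff hom_component_cmul using hom_component_forms[OF p(1), of d] hom_component_forms[OF g(1), of d] p(2)
      by (simp add: cmul_simps)
    ultimately show ?thesis by simp
  qed
  obtain n where n: "\<And>k. k \<ge> n \<Longrightarrow> forms k \<subseteq> J" by (rule artinian_top[OF J]) blast
  have above: "forms k \<subseteq> J" if "k > s" for k
  proof -
    have "\<And>k. k > s \<Longrightarrow> k + l \<ge> n \<Longrightarrow> forms k \<subseteq> J" for l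
    proof (induction l)
      case 0
      then show ?case using n by simp
    next
      case (Suc l)
      have up: "forms (Suc k) \<subseteq> J" by (rule Suc.IH) (use Suc.prems in simp_all)
      show ?case
      proof
        fix p :: "('i, 'k) mpoly" assume p: "p \<in> forms k"
        have "var x * p \<in> forms (Suc k)" for x using forms_mult[OF var_in_forms p, of x] by (simp only: plus_1_eq_Suc)
        then have "var x * p \<in> J" for x using up by blast
        then show "p \<in> J" using other[OF p] Suc.prems(1) by blast
      qed
    qed
    from this[of k n] show ?thesis using that by simp
  qed
  obtain h where h: "Vector_Spaces.linear cmul (*) h" "\<And>x. x \<in> J \<Longrightarrow> h x = 0" "h g = 1"
    using V.separating_functional[OF ideal_k_subspace[OF id] g(2)] by blast
  define c where "c = trunc s (\<lambda>m. h (Poly_Mapping.single m 1))"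
  have c: "c \<in> dual s" by (simp add: c_def)
  have ph: "pair p c = h p" if "p \<in> forms s" for p
    unfolding c_def using functional_eq_pair[OF h(1), of p] pair_trunc[OF that] by simp
  have "J \<subseteq> annihilator c"
    by (rule contained_in_annihilator[OF J(1) _ c]) (simp add: ph h(2))
  moreover have "annihilator c \<subseteq> J"
  proof -
    have f: "p \<in> J" if "p \<in> forms d" "p \<in> annihilator c" "d + l = Suc s" for p d l
      using that
    proof (induction l arbitrary: p d)
      case 0
      then show ?case using above[of d] by auto
    next
      case (Suc l)
      have v: "var x * p \<in> J" for x
      proof (rule Suc.IH)
        show "var x * p \<in> forms (Suc d)" using forms_mult[OF var_in_forms Suc.prems(1), of x] by (simp only: plus_1_eq_Suc)
        show "var x * p \<in> annihilator c" by (rule I.subspace_scale[OF annihilator_ideal Suc.prems(2)])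
      qed (use Suc.prems in simp)
      show ?case
      proof (cases "d = s")
        case False
        then show ?thesis using other[OF Suc.prems(1) _ v] by blast
      next
        case True
        obtain a where a: "p - cmul a g \<in> J" using socle_form[OF v] by blast
        have "p - cmul a g \<in> forms s" using Suc.prems(1) g(1) True by (intro forms_diff cmul_in_forms) simp_all
        from ph[OF this] have "pair p c - a * pair g c = 0" using h(2)[OF a] by (simp add: pair_diff pair_cmul)
        moreover have "pair p c = 0" using annihilator_top[OF c, of p] Suc.prems(1,2) True by simp
        moreover have "pair g c = 1" using ph[OF g(1)] h(3) by simp
        ultimately have "a = 0" by simp
        then show ?thesis using a by (simp add: cmul_simps)
      qed
    qed
    show ?thesis
    proof
      fix p assume p: "p \<in> annihilator c"
      have "hom_component d p \<in> J" for d
      proof (cases "d \<le> s")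
        case True
        have "hom_component d p \<in> annihilator c" using annihilator_homogeneous[OF c] p unfolding homogeneous_ideal_def by blast
        then show ?thesis using f[OF hom_component_in_forms, of d p "Suc s - d"] True by simp
      next
        case False
        then show ?thesis using above[of d] hom_component_in_forms[of d p] by auto
      qed
      moreover obtain N where "\<And>m. m \<ge> N \<Longrightarrow> p = (\<Sum>d<m. hom_component d p)" by (rule mpoly_eq_sum_hom_components) blast
      ultimately show "p \<in> J" using I.subspace_sum[OF id, of "{..<N}" "\<lambda>d. hom_component d p"] by auto
    qed
  qed
  ultimately show ?thesis using that c by blast
qed

text \<open>Every homogeneous ideal whose part of degree \<open>s\<close> is the kernel of \<open>c\<close> lies in the annihilator: a
  contraction of \<open>c\<close> by an element of the ideal takes its values on that part.\<close>

lemma hyperplane_ideal_eq: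
  assumes c: "c \<in> dual s" and H: "H = {p \<in> forms s. pair p c = 0}" and sub: "\<aa> \<subseteq> annihilator c"
  shows "hyperplane_ideal \<aa> s H = annihilator c"
  unfolding hyperplane_ideal_def
proof (rule Greatest_equality)
  have "annihilator c \<inter> forms s = H" unfolding H using annihilator_top[OF c] by blast
  then show "homogeneous_ideal (annihilator c) \<and> \<aa> \<subseteq> annihilator c \<and> annihilator c \<inter> forms s = H \<and> (\<forall>j>s. forms j \<subseteq> annihilator c)"
    using annihilator_homogeneous[OF c] sub annihilator_above[OF c] by blast
next
  fix J assume J: "homogeneous_ideal J \<and> \<aa> \<subseteq> J \<and> J \<inter> forms s = H \<and> (\<forall>j>s. forms j \<subseteq> J)"
  show "J \<subseteq> annihilator c"
    by (rule contained_in_annihilator[OF _ _ c]) (use J H in blast)+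
qed

context compressed_functional
begin

lemma c_neq_0: "c \<noteq> 0"
proof
  assume c: "c = 0"
  have "{p \<in> forms 0. act p c = 0} = (forms 0 :: (4, 'k) mpoly set)" unfolding c by (simp only: act_fun) simp
  then show False using dim_ann_low[of 0] by (simp add: dim_forms rk_values rk_neg)
qed

lemma annihilator_Int_forms: "annihilator c' \<inter> forms d = {p \<in> forms d. act p c' = 0}"
  unfolding annihilator_def by blast

text \<open>Up to degree \<open>t\<close> the annihilator of \<open>c\<close> consists of the multiples of the quadric, which lie in every
  competitor. The other degrees follow by the symmetry of the Hilbert function.\<close>

lemma annihilator_minimal:
  assumes c': "c' \<in> dual (2 * t + 1)" "act F c' = 0"
  shows "k_dim (annihilator c \<inter> forms d) \<le> k_dim (annihilator c' \<inter> forms d)"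
proof -
  have sub: "V.subspace (annihilator c' \<inter> forms d)" for d
    by (rule V.subspace_inter[OF ideal_k_subspace[OF annihilator_ideal] subspace_forms])
  have sub0: "V.subspace (annihilator c \<inter> forms d)" for d
    by (rule V.subspace_inter[OF ideal_k_subspace[OF annihilator_ideal] subspace_forms])
  have fin: "V.fin_dim (annihilator c' \<inter> forms d)" for d by (rule V.fin_dim_mono[OF fin_dim_forms]) blast
  have low: "k_dim (annihilator c \<inter> forms d) \<le> k_dim (annihilator c' \<inter> forms d)" if "d \<le> t" for d
  proof (rule V.dim_mono_fin(1)[OF sub fin sub0])
    show "annihilator c \<inter> forms d \<subseteq> annihilator c' \<inter> forms d"
    proof
      fix p assume "p \<in> annihilator c \<inter> forms d"
      then have p: "p \<in> forms d" "act p c = 0" unfolding annihilator_def by blast+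
      from act_dvd[OF ann_low[OF p(1) that p(2)] c'(2)] show "p \<in> annihilator c' \<inter> forms d"
        using p(1) unfolding annihilator_def by blast
    qed
  qed
  consider "d \<le> t" | "t < d" "d \<le> 2 * t + 1" | "d > 2 * t + 1" by linarith
  then show ?thesis
  proof cases
    case 1
    then show ?thesis by (rule low)
  next
    case 2
    define e where "e = 2 * t + 1 - d"
    have e: "e \<le> t" "d + e = 2 * t + 1" using 2 by (simp_all add: e_def)
    have "c \<in> dual (d + e)" "c' \<in> dual (d + e)" using c_dual c'(1) unfolding e(2) .
    then show ?thesis using ann_dim_symmetric[of c d e] ann_dim_symmetric[of c' d e] low[OF e(1)]
      unfolding annihilator_Int_forms by linarith
  next
    case 3
    then show ?thesis using annihilator_above[OF c_dual, of d] annihilator_above[OF c'(1), of d] by (simp add: Int_absorb1)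
  qed
qed

lemma annihilator_relatively_compressed: "relatively_compressed (ideal_of {F}) (2 * t + 1) (annihilator c)"
  unfolding relatively_compressed_def
proof (intro conjI allI impI)
  show "gorenstein (2 * t + 1) (annihilator c)" by (rule annihilator_gorenstein[OF c_dual c_neq_0])
  show "ideal_of {F} \<subseteq> annihilator c"
  proof
    fix p assume "p \<in> ideal_of {F}"
    then have "F dvd p" unfolding in_ideal_of_iff .
    from act_dvd[OF this F_kills] show "p \<in> annihilator c" unfolding annihilator_def by blast
  qed
  fix J :: "(4, 'k) mpoly set" assume J: "gorenstein (2 * t + 1) J \<and> ideal_of {F} \<subseteq> J"
  then obtain c' where c': "c' \<in> dual (2 * t + 1)" "J = annihilator c'" using gorenstein_is_annihilator by blast
  have "F \<in> ideal_of {F}" unfolding in_ideal_of_iff by simp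
  then have F: "act F c' = 0" using J unfolding c'(2) annihilator_def by blast
  let ?n = "Suc (2 * t + 1)"
  have top: "forms j \<subseteq> annihilator c" "forms j \<subseteq> annihilator c'" if "j \<ge> ?n" for j
    using annihilator_above[OF c_dual, of j] annihilator_above[OF c'(1), of j] that by simp_all
  have "low_dim ?n (annihilator c) \<le> low_dim ?n (annihilator c')"
    unfolding low_dim_eq_sum[OF annihilator_homogeneous[OF c_dual]] low_dim_eq_sum[OF annihilator_homogeneous[OF c'(1)]]
    by (intro sum_mono annihilator_minimal[OF c'(1) F])
  then have "enat (k_dim (low ?n :: (4, 'k) mpoly set) - low_dim ?n (annihilator c'))
      \<le> enat (k_dim (low ?n :: (4, 'k) mpoly set) - low_dim ?n (annihilator c))" by (simp only: enat_ord_simps diff_le_mono2)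
  also have "\<dots> \<le> quotient_length (annihilator c)" by (rule quotient_length_ge[OF annihilator_ideal top(1)])
  finally have "enat (k_dim (low ?n :: (4, 'k) mpoly set) - low_dim ?n (annihilator c')) \<le> quotient_length (annihilator c)" .
  moreover have "quotient_length (annihilator c') \<le> enat (k_dim (low ?n :: (4, 'k) mpoly set) - low_dim ?n (annihilator c'))"
    by (rule quotient_length_le[OF annihilator_ideal top(2)])
  ultimately show "quotient_length J \<le> quotient_length (annihilator c)" unfolding c'(2) by (rule order_trans[rotated])
qed

lemma annihilator_embedding_dim: "embedding_dim (annihilator c) = 4"
proof -
  have "k_dim {p \<in> forms 1. act p c = 0} = 0" using dim_ann_low[of 1] t1 by (simp add: rk_neg)
  then show ?thesis unfolding embedding_dim_def hilbert_function_def annihilator_Int_forms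
    using dim_forms[of 1, where 'k = 'k] by (simp add: rk_values)
qed

end

section \<open>Matrices\<close>

definition entries_mat :: "nat list \<Rightarrow> nat list \<Rightarrow> (nat \<Rightarrow> nat \<Rightarrow> ('i, 'k::field) mpoly) \<Rightarrow> ('i, 'k) mpoly mat"
  where "entries_mat ds es E = mat (length ds) (length es) (\<lambda>(i, j). E i j)"

definition graded_entries :: "nat list \<Rightarrow> nat list \<Rightarrow> (nat \<Rightarrow> nat \<Rightarrow> ('i, 'k::field) mpoly) \<Rightarrow> bool"
  where "graded_entries ds es E \<longleftrightarrow> (\<forall>i<length ds. \<forall>j<length es.
    E i j \<in> gforms (int (es ! j) - int (ds ! i)) \<and> ds ! i < es ! j)"

lemma graded_entriesD:
  assumes "graded_entries ds es E" "i < length ds" "j < length es"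
  shows "E i j \<in> gforms (int (es ! j) - int (ds ! i))" "ds ! i < es ! j"
  using assms unfolding graded_entries_def by blast+

lemma entries_mat_mult:
  assumes "v \<in> carrier_vec (length es)"
  shows "entries_mat ds es E *\<^sub>v v = vec (length ds) (\<lambda>i. \<Sum>j<length es. E i j * v $ j)"
  using assms by (intro eq_vecI) (auto simp: entries_mat_def scalar_prod_def atLeast0LessThan intro!: sum.cong)

lemma entries_mat_graded:
  assumes "graded_entries ds es E"
  shows "graded_map ds es (entries_mat ds es E)"
  unfolding graded_map_def
proof (intro conjI allI impI ballI)
  fix i j m assume ij: "i < length ds" "j < length es" and m: "m \<in> Poly_Mapping.keys (entries_mat ds es E $$ (i, j))"
  have "Poly_Mapping.lookup (E i j) m \<noteq> 0" using m ij by (simp add: entries_mat_def in_keys_iff)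
  then have "int (mdeg m) = int (es ! j) - int (ds ! i)"
    using graded_entriesD(1)[OF assms ij] unfolding gforms_def by blast
  then show "mdeg m + ds ! i = es ! j" by linarith
qed (simp add: entries_mat_def)

lemma irrelevant_mult:
  fixes p q :: "('i, 'k::field) mpoly"
  assumes "p \<in> gforms d" "d > 0"
  shows "p * q \<in> irrelevant_ideal"
proof -
  have "p \<in> forms (nat d)" using assms gforms_eq[of d] by auto
  then have "hom_component 0 (p * q) = 0" by (rule hom_component_mult(2)) (use assms in simp)
  then have "Poly_Mapping.lookup (hom_component 0 (p * q)) 0 = 0" by simp
  then show ?thesis by (simp add: lookup_hom_component irrelevant_ideal_def)
qed

lemma irrelevant_sum: "(\<And>x. x \<in> A \<Longrightarrow> f x \<in> irrelevant_ideal) \<Longrightarrow> sum f A \<in> irrelevant_ideal"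
  for f :: "_ \<Rightarrow> ('i, 'k::field) mpoly"
  by (simp add: irrelevant_ideal_def lookup_sum)

lemma entries_mat_minimal:
  assumes E: "graded_entries ds es E" and v: "v \<in> map_image (entries_mat ds es E)" and i: "i < length ds"
  shows "v $ i \<in> irrelevant_ideal"
proof -
  have c: "dim_col (entries_mat ds es E) = length es" by (simp add: entries_mat_def)
  obtain u where u: "u \<in> carrier_vec (length es)" "v = entries_mat ds es E *\<^sub>v u"
    using v unfolding map_image_def c by (rule imageE)
  have "v $ i = (\<Sum>j<length es. E i j * u $ j)" unfolding u(2) entries_mat_mult[OF u(1)] using i by simp
  moreover have "(\<Sum>j<length es. E i j * u $ j) \<in> irrelevant_ideal"
  proof (rule irrelevant_sum)
    fix j assume that: "j \<in> {..<length es}"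
    show "E i j * u $ j \<in> irrelevant_ideal"
      by (rule irrelevant_mult[OF graded_entriesD(1)[OF E i]]) (use graded_entriesD(2)[OF E i, of j] that in simp_all)
  qed
  ultimately show ?thesis by (simp only:)
qed

text \<open>Exactness in each degree implies exactness: a vector in the kernel is the sum of its homogeneous
  components, and these lie in the kernel.\<close>

lemma exact_from_pieces:
  fixes E E' :: "nat \<Rightarrow> nat \<Rightarrow> ('i, 'k::field) mpoly"
  assumes E: "graded_entries ds es E"
    and exact: "\<And>d v. v \<in> free_piece es d \<Longrightarrow> (\<And>i. i < length ds \<Longrightarrow> (\<Sum>j<length es. E i j * v j) = 0) \<Longrightarrow>
      \<exists>u. \<forall>i<length es. v i = (\<Sum>j<m. E' i j * u j)"
    and v: "\<And>i. i < length ds \<Longrightarrow> (\<Sum>j<length es. E i j * v j) = 0"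
  shows "\<exists>u. \<forall>i<length es. v i = (\<Sum>j<m. E' i j * u j)"
proof -
  define vd where "vd d j = (if j < length es then hcomp (int d - int (es ! j)) (v j) else 0)" for d j
  have "\<exists>u. \<forall>i<length es. vd d i = (\<Sum>j<m. E' i j * u j)" for d
  proof (rule exact)
    show "vd d \<in> free_piece es (int d)" by (rule free_pieceI) (simp_all add: vd_def)
    fix i assume i: "i < length ds"
    have "(\<Sum>j<length es. E i j * vd d j) = (\<Sum>j<length es. hcomp (int d - int (ds ! i)) (E i j * v j))"
    proof (intro sum.cong refl)
      fix j assume "j \<in> {..<length es}"
      then have j: "j < length es" by simp
      have "hcomp (int d - int (ds ! i)) (E i j * v j)
          = E i j * hcomp (int d - int (ds ! i) - (int (es ! j) - int (ds ! i))) (v j)"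
        by (rule hcomp_mult[OF graded_entriesD(1)[OF E i j]])
      also have "int d - int (ds ! i) - (int (es ! j) - int (ds ! i)) = int d - int (es ! j)" by simp
      finally show "E i j * vd d j = hcomp (int d - int (ds ! i)) (E i j * v j)" using j by (simp add: vd_def)
    qed
    also have "\<dots> = hcomp (int d - int (ds ! i)) 0" unfolding hcomp_sum[symmetric] v[OF i] ..
    also have "\<dots> = 0" by (simp add: hcomp_def)
    finally show "(\<Sum>j<length es. E i j * vd d j) = 0" .
  qed
  then obtain u where u: "\<And>d i. i < length es \<Longrightarrow> vd d i = (\<Sum>j<m. E' i j * u d j)" by metis
  have "\<exists>N. \<forall>n\<ge>N. v i = (\<Sum>d<n. hom_component d (v i))" for i
    using mpoly_eq_sum_hom_components[of "v i"] by metis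
  then obtain N where N: "\<And>i n. n \<ge> N i \<Longrightarrow> v i = (\<Sum>d<n. hom_component d (v i))" by metis
  define M where "M = (\<Sum>i<length es. es ! i + N i)"
  have "v i = (\<Sum>j<m. E' i j * (\<Sum>d<M. u d j))" if i: "i < length es" for i
  proof -
    have "es ! i + N i \<le> M" unfolding M_def by (rule member_le_sum) (use i in auto)
    then obtain l where l: "M = es ! i + (N i + l)" by (metis add.assoc le_Suc_ex)
    have "(\<Sum>d<M. vd d i) = (\<Sum>d<es ! i. vd d i) + (\<Sum>d<N i + l. vd (es ! i + d) i)" unfolding l by (rule sum_lessThan_add)
    also have "(\<Sum>d<es ! i. vd d i) = 0" by (intro sum.neutral) (simp add: vd_def hcomp_def)
    also have "(\<Sum>d<N i + l. vd (es ! i + d) i) = (\<Sum>d<N i + l. hom_component d (v i))"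
      by (intro sum.cong refl) (simp add: vd_def i)
    also have "\<dots> = v i" using N[of i "N i + l"] by simp
    finally have "v i = (\<Sum>d<M. \<Sum>j<m. E' i j * u d j)" using u[OF i] by simp
    also have "\<dots> = (\<Sum>j<m. \<Sum>d<M. E' i j * u d j)" by (rule sum.swap)
    also have "\<dots> = (\<Sum>j<m. E' i j * (\<Sum>d<M. u d j))" by (simp only: sum_distrib_left)
    finally show ?thesis .
  qed
  then show ?thesis by (intro exI[of _ "\<lambda>j. \<Sum>d<M. u d j"] allI impI)
qed

lemma kernel_eq_image:
  fixes E E' :: "nat \<Rightarrow> nat \<Rightarrow> ('i, 'k::field) mpoly"
  assumes E: "graded_entries ds es E"
    and complex: "\<And>i u. i < length ds \<Longrightarrow> (\<Sum>j<length es. E i j * (\<Sum>k<length fs. E' j k * u k)) = 0"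
    and exact: "\<And>d v. v \<in> free_piece es d \<Longrightarrow> (\<And>i. i < length ds \<Longrightarrow> (\<Sum>j<length es. E i j * v j) = 0) \<Longrightarrow>
      \<exists>u. \<forall>i<length es. v i = (\<Sum>j<length fs. E' i j * u j)"
  shows "map_kernel (entries_mat ds es E) = map_image (entries_mat es fs E')"
proof -
  have c: "dim_col (entries_mat ds es E) = length es" "dim_row (entries_mat ds es E) = length ds"
    "dim_col (entries_mat es fs E') = length fs" by (simp_all add: entries_mat_def)
  show ?thesis unfolding map_kernel_def map_image_def c
  proof (intro equalityI subsetI)
    fix v assume "v \<in> {v \<in> carrier_vec (length es). entries_mat ds es E *\<^sub>v v = 0\<^sub>v (length ds)}"
    then have v: "v \<in> carrier_vec (length es)" "entries_mat ds es E *\<^sub>v v = 0\<^sub>v (length ds)" by blast+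
    have z: "(\<Sum>j<length es. E i j * v $ j) = 0" if "i < length ds" for i
      using arg_cong[OF v(2), of "\<lambda>x. x $ i"] that unfolding entries_mat_mult[OF v(1)] by simp
    have "\<exists>u. \<forall>i<length es. v $ i = (\<Sum>j<length fs. E' i j * u j)"
    proof (rule exact_from_pieces[OF E, where v = "\<lambda>i. v $ i" and m = "length fs" and E' = E'])
      fix d v' assume a: "v' \<in> free_piece es d" and b: "\<And>i. i < length ds \<Longrightarrow> (\<Sum>j<length es. E i j * v' j) = 0"
      show "\<exists>u. \<forall>i<length es. v' i = (\<Sum>j<length fs. E' i j * u j)" by (rule exact[OF a b])
    qed (rule z)
    then obtain u where u: "\<And>i. i < length es \<Longrightarrow> v $ i = (\<Sum>j<length fs. E' i j * u j)" by blast
    have "v = entries_mat es fs E' *\<^sub>v vec (length fs) u"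
      unfolding entries_mat_mult[OF vec_carrier] using v(1) u by (intro eq_vecI) auto
    then show "v \<in> (\<lambda>v. entries_mat es fs E' *\<^sub>v v) ` carrier_vec (length fs)" by (rule image_eqI) simp
  next
    fix v assume "v \<in> (\<lambda>v. entries_mat es fs E' *\<^sub>v v) ` carrier_vec (length fs)"
    then obtain u where u: "u \<in> carrier_vec (length fs)" "v = entries_mat es fs E' *\<^sub>v u" by (rule imageE)
    have v: "v = vec (length es) (\<lambda>i. \<Sum>j<length fs. E' i j * u $ j)" unfolding u(2) by (rule entries_mat_mult[OF u(1)])
    have vc: "v \<in> carrier_vec (length es)" unfolding v by simp
    have "(\<Sum>j<length es. E i j * v $ j) = 0" if "i < length ds" for i
    proof -
      have "(\<Sum>j<length es. E i j * v $ j) = (\<Sum>j<length es. E i j * (\<Sum>k<length fs. E' j k * u $ k))"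
        by (intro sum.cong refl) (simp add: v)
      then show ?thesis using complex[OF that, of "\<lambda>k. u $ k"] by simp
    qed
    then have "entries_mat ds es E *\<^sub>v v = 0\<^sub>v (length ds)" unfolding entries_mat_mult[OF vc] by (intro eq_vecI) simp_all
    then show "v \<in> {v \<in> carrier_vec (length es). entries_mat ds es E *\<^sub>v v = 0\<^sub>v (length ds)}" using vc by blast
  qed
qed

lemma has_minimal_resolution_length_4:
  assumes gr: "graded_map [0] D1 M1" "graded_map D1 D2 M2" "graded_map D2 D3 M3" "graded_map D3 D4 M4"
    and im: "map_image M1 = {v \<in> carrier_vec 1. v $ 0 \<in> J}"
    and ex: "map_kernel M1 = map_image M2" "map_kernel M2 = map_image M3" "map_kernel M3 = map_image M4"
      "map_kernel M4 = {0\<^sub>v (length D4)}"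
    and mi: "\<forall>v\<in>map_image M1. \<forall>i<length [0::nat]. v $ i \<in> irrelevant_ideal" "\<forall>v\<in>map_image M2. \<forall>i<length D1. v $ i \<in> irrelevant_ideal"
      "\<forall>v\<in>map_image M3. \<forall>i<length D2. v $ i \<in> irrelevant_ideal" "\<forall>v\<in>map_image M4. \<forall>i<length D3. v $ i \<in> irrelevant_ideal"
  shows "has_minimal_resolution J [D1, D2, D3, D4]"
proof -
  define \<phi> where "\<phi> p = (if p = 1 then M1 else if p = 2 then M2 else if p = 3 then M3 else M4)" for p :: nat
  have s: "\<phi> 1 = M1" "\<phi> 2 = M2" "\<phi> 3 = M3" "\<phi> 4 = M4" "\<phi> (1 + 1) = M2" "\<phi> (2 + 1) = M3" "\<phi> (3 + 1) = M4"
    by (simp_all add: \<phi>_def)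
  have f: "([0] # [D1, D2, D3, D4]) ! (1 - 1) = [0]" "([0] # [D1, D2, D3, D4]) ! (2 - 1) = D1"
    "([0] # [D1, D2, D3, D4]) ! (3 - 1) = D2" "([0] # [D1, D2, D3, D4]) ! (4 - 1) = D3"
    "([0] # [D1, D2, D3, D4]) ! 1 = D1" "([0] # [D1, D2, D3, D4]) ! 2 = D2" "([0] # [D1, D2, D3, D4]) ! 3 = D3"
    "([0] # [D1, D2, D3, D4]) ! 4 = D4" by (simp_all add: numeral_eq_Suc One_nat_def)
  have "{1..4::nat} = {1, 2, 3, 4}" "{1..<4::nat} = {1, 2, 3}" by auto
  then have b: "(\<forall>p\<in>{1..4::nat}. P p) \<longleftrightarrow> P 1 \<and> P 2 \<and> P 3 \<and> P 4" "(\<forall>p\<in>{1..<4::nat}. P p) \<longleftrightarrow> P 1 \<and> P 2 \<and> P 3" for P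
    by (simp_all only: ball_simps(7) ball_empty simp_thms)
  have len: "length [D1, D2, D3, D4] = 4" by simp
  show ?thesis unfolding has_minimal_resolution_def Let_def len b
    by (intro conjI exI[of _ \<phi>]; (unfold s f)?) (simp, (rule gr im ex mi)+)
qed

context resolution
begin

definition "entry1 (i :: nat) j = (if j < n then g j else F)"

definition "entry2 i j = (if i < n then if j < n then b j i else if j = n + i then F else 0
  else if j < n then b j n else - g (j - n))"

definition "entry3 i j = (if j = n then w i else if i < n then if i = j then F else 0 else - b j (i - n))"

definition "entry4 i (j :: nat) = (if i < n then - w i else F)"

lemma sum_lessThan_plus_1: "(\<Sum>j<m + 1. f j) = (\<Sum>j<m. f j) + f (m :: nat)"
  for f :: "nat \<Rightarrow> 'a::comm_monoid_add"
  using sum.lessThan_Suc[of f m] by (simp only: Suc_eq_plus1)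

lemma row1: "(\<Sum>j<n + 1. entry1 i j * v j) = \<phi>1 v"
  unfolding sum_lessThan_plus_1 by (simp add: entry1_def \<phi>1_def)

lemma row2:
  assumes "i < n + 1"
  shows "(\<Sum>j<n + n. entry2 i j * v j) = \<phi>2 v i"
proof (cases "i < n")
  case True
  have "(\<Sum>j<n. entry2 i (n + j) * v (n + j)) = (\<Sum>j<n. if i = j then F * v (n + i) else 0)"
    by (intro sum.cong refl) (auto simp: entry2_def True)
  also have "\<dots> = F * v (n + i)" using True by simp
  finally show ?thesis unfolding sum_lessThan_add by (simp add: entry2_def \<phi>2_def True)
next
  case False
  then have "i = n" using assms by simp
  then show ?thesis unfolding sum_lessThan_add by (simp add: entry2_def \<phi>2_def sum_negf)
qed

lemma row3:
  assumes "i < n + n"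
  shows "(\<Sum>j<n + 1. entry3 i j * v j) = \<phi>3 v i"
proof (cases "i < n")
  case True
  have "(\<Sum>j<n. entry3 i j * v j) = (\<Sum>j<n. if i = j then F * v i else 0)"
    by (intro sum.cong refl) (auto simp: entry3_def True)
  also have "\<dots> = F * v i" using True by simp
  finally have s: "(\<Sum>j<n. entry3 i j * v j) = F * v i" .
  show ?thesis unfolding sum_lessThan_plus_1 s using True by (simp add: entry3_def \<phi>3_def \<tau>_def)
next
  case False
  then show ?thesis unfolding sum_lessThan_plus_1 using assms by (simp add: entry3_def \<phi>3_def \<tau>_def sum_negf)
qed

lemma row4: "i < n + 1 \<Longrightarrow> (\<Sum>j<1. entry4 i j * v j) = \<phi>4 (v 0) i"
proof -
  assume "i < n + 1"
  then have "i < n \<or> i = n" by linarith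
  moreover have "{..<1::nat} = {0}" by auto
  ultimately show ?thesis by (auto simp: entry4_def \<phi>4_def)
qed

lemma index1: "i < n + 1 \<Longrightarrow> i < n \<or> i = n"
  by linarith

lemma index2: "j < n + n \<Longrightarrow> j < n \<or> (\<exists>k<n. j = n + k)"
  by (cases "j < n") (auto intro!: exI[of _ "j - n"])

lemma graded1: "graded_entries [0] degs1 entry1"
  unfolding graded_entries_def
proof (intro allI impI)
  fix i j assume "i < length [0::nat]" "j < length degs1"
  then have i: "i = 0" and "j < n \<or> j = n" using index1 by simp_all
  then consider "j < n" | "j = n" by blast
  then show "entry1 i j \<in> gforms (int (degs1 ! j) - int ([0] ! i)) \<and> [0] ! i < degs1 ! j"
    by cases (use g_gforms[of j] F_gforms i in \<open>simp_all add: entry1_def\<close>)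
qed

lemma graded2: "graded_entries degs1 degs2 entry2"
  unfolding graded_entries_def
proof (intro allI impI)
  fix i j assume "i < length degs1" "j < length degs2"
  then have "i < n \<or> i = n" "j < n \<or> (\<exists>k<n. j = n + k)" using index1[of i] index2[of j] by simp_all
  then consider (a) "i < n" "j < n" | (b) k where "i < n" "k < n" "j = n + k" | (c) "i = n" "j < n" | (d) k where "i = n" "k < n" "j = n + k"
    by blast
  then show "entry2 i j \<in> gforms (int (degs2 ! j) - int (degs1 ! i)) \<and> degs1 ! i < degs2 ! j"
  proof cases
    case a
    have "entry2 i j = b j i" "int (degs2 ! j) - int (degs1 ! i) = int 1" "degs1 ! i < degs2 ! j"
      using a by (simp_all add: entry2_def)
    then show ?thesis using b_gforms(1)[OF a(2,1)] by (simp only: gforms_nat simp_thms)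
  next
    case b
    then show ?thesis using F_gforms by (cases "k = i") (simp_all add: entry2_def)
  next
    case c
    have "entry2 i j = b j n" "int (degs2 ! j) - int (degs1 ! i) = int t" "degs1 ! i < degs2 ! j"
      using c t1 by (simp_all add: entry2_def)
    then show ?thesis using b_gforms(2)[OF c(2)] by (simp only: gforms_nat simp_thms)
  next
    case d
    have "entry2 i j = - g k" "int (degs2 ! j) - int (degs1 ! i) = int (t + 1)" "degs1 ! i < degs2 ! j"
      using d by (simp_all add: entry2_def)
    then show ?thesis using gforms_uminus[OF g_gforms[OF d(2)]] by (simp only: simp_thms)
  qed
qed

lemma graded3: "graded_entries degs2 degs3 entry3"
  unfolding graded_entries_def
proof (intro allI impI)
  fix i j assume ij: "i < length degs2" "j < length degs3"
  have w: "w i \<in> gforms (int (2 * t + 3) - int (degs2 ! i))" by (rule free_pieceD(1)[OF w_piece ij(1)])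
  from ij have "j < n \<or> j = n" "i < n \<or> (\<exists>k<n. i = n + k)" using index1[of j] index2[of i] by simp_all
  then consider (a) "i < n" "j < n" | (b) k where "k < n" "i = n + k" "j < n" | (c) "i < n" "j = n" | (d) k where "k < n" "i = n + k" "j = n"
    by blast
  then show "entry3 i j \<in> gforms (int (degs3 ! j) - int (degs2 ! i)) \<and> degs2 ! i < degs3 ! j"
  proof cases
    case a
    then show ?thesis using F_gforms by (cases "i = j") (simp_all add: entry3_def)
  next
    case b
    have "entry3 i j = - b j k" "int (degs3 ! j) - int (degs2 ! i) = int 1" "degs2 ! i < degs3 ! j"
      using b by (simp_all add: entry3_def)
    then show ?thesis using forms_uminus[OF b_gforms(1)[OF b(3,1)]] by (simp only: gforms_nat simp_thms)
  next
    case c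
    have "entry3 i j = w i" "degs3 ! j = 2 * t + 3" "degs2 ! i < 2 * t + 3" using c t1 by (simp_all add: entry3_def)
    then show ?thesis using w by (simp only: simp_thms)
  next
    case d
    have "entry3 i j = w i" "degs3 ! j = 2 * t + 3" "degs2 ! i < 2 * t + 3" using d t1 by (simp_all add: entry3_def)
    then show ?thesis using w by (simp only: simp_thms)
  qed
qed

lemma graded4: "graded_entries degs3 [2 * t + 5] entry4"
  unfolding graded_entries_def
proof (intro allI impI)
  fix i j :: nat assume ij: "i < length degs3" "j < length [2 * t + 5]"
  then have j: "j = 0" by simp
  have "i < n \<or> i = n" using ij(1) index1[of i] by simp
  then consider "i < n" | "i = n" by blast
  then show "entry4 i j \<in> gforms (int ([2 * t + 5] ! j) - int (degs3 ! i)) \<and> degs3 ! i < [2 * t + 5] ! j"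
  proof cases
    case 1
    have w: "w i \<in> gforms (int (2 * t + 3) - int (t + 2))" using free_pieceD(1)[OF w_piece, of i] 1 by simp
    have "entry4 i j = - w i" "int ([2 * t + 5] ! j) - int (degs3 ! i) = int (2 * t + 3) - int (t + 2)" "degs3 ! i < [2 * t + 5] ! j"
      using 1 j by (simp_all add: entry4_def)
    then show ?thesis using gforms_uminus[OF w] by (simp only: simp_thms)
  next
    case 2
    then show ?thesis using F_gforms j by (simp add: entry4_def)
  qed
qed

lemma annihilator_eq_range: "annihilator c = range \<phi>1"
proof (intro equalityI subsetI)
  fix p assume "p \<in> range \<phi>1"
  then show "p \<in> annihilator c" unfolding annihilator_def using \<phi>1_killed by blast
next
  fix p assume p: "p \<in> annihilator c"
  have sub: "V.subspace (range \<phi>1)"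
    using module_hom.subspace_image[OF linear_\<phi>1[unfolded Vector_Spaces.linear_iff_module_hom] W.subspace_UNIV] .
  have hc: "hom_component d p \<in> range \<phi>1" for d
  proof -
    have "hom_component d p \<in> annihilator c"
      using annihilator_homogeneous[OF c_dual] p unfolding homogeneous_ideal_def by blast
    then have k: "act (hom_component d p) c = 0" unfolding annihilator_def mem_Collect_eq .
    show ?thesis
    proof (cases "d \<ge> t + 1")
      case True
      obtain v where "v \<in> free_piece degs1 (int d)" "\<phi>1 v = hom_component d p"
        by (rule \<phi>1_onto[OF True hom_component_in_forms k])
      moreover have "\<phi>1 v \<in> range \<phi>1" by (rule rangeI)
      ultimately show ?thesis by (simp only:)
    next
      case False
      then have "F dvd hom_component d p" by (intro ann_low[OF hom_component_in_forms _ k]) simp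
      then obtain q where "hom_component d p = F * q" by (rule dvdE)
      then have "hom_component d p = q * F" by (simp only: mult.commute)
      then show ?thesis using F_multiple[of q] by (simp only:)
    qed
  qed
  obtain N where N: "\<And>m. m \<ge> N \<Longrightarrow> p = (\<Sum>d<m. hom_component d p)" by (rule mpoly_eq_sum_hom_components) blast
  have "(\<Sum>d<N. hom_component d p) \<in> range \<phi>1" by (rule V.subspace_sum[OF sub]) (rule hc)
  then show "p \<in> range \<phi>1" by (subst N[OF order_refl])
qed

lemma image1: "map_image (entries_mat [0] degs1 entry1) = {v \<in> carrier_vec 1. v $ 0 \<in> annihilator c}"
proof (intro equalityI subsetI)
  have col: "dim_col (entries_mat [0] degs1 entry1) = length degs1" by (simp add: entries_mat_def)
  fix v assume "v \<in> map_image (entries_mat [0] degs1 entry1)"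
  then obtain u where u: "u \<in> carrier_vec (length degs1)" "v = entries_mat [0] degs1 entry1 *\<^sub>v u"
    unfolding map_image_def col by (rule imageE)
  have v: "v = vec (length [0::nat]) (\<lambda>i. \<Sum>j<length degs1. entry1 i j * u $ j)" unfolding u(2) by (rule entries_mat_mult[OF u(1)])
  have "v $ 0 = \<phi>1 (\<lambda>j. u $ j)" unfolding v length_degs1 row1 by simp
  moreover have "v \<in> carrier_vec 1" unfolding v by (simp add: One_nat_def)
  ultimately show "v \<in> {v \<in> carrier_vec 1. v $ 0 \<in> annihilator c}" unfolding annihilator_eq_range by blast
next
  have col: "dim_col (entries_mat [0] degs1 entry1) = length degs1" by (simp add: entries_mat_def)
  fix v assume "v \<in> {v \<in> carrier_vec 1. v $ 0 \<in> annihilator c}"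
  then obtain u where v: "v \<in> carrier_vec 1" "v $ 0 = \<phi>1 u" unfolding annihilator_eq_range by blast
  let ?u = "vec (length degs1) u"
  have "\<phi>1 u = (\<Sum>j<n + 1. entry1 0 j * u j)" by (rule row1[symmetric])
  also have "\<dots> = (\<Sum>j<length degs1. entry1 0 j * ?u $ j)" by (intro sum.cong) simp_all
  finally have "v = vec (length [0::nat]) (\<lambda>i. \<Sum>j<length degs1. entry1 i j * ?u $ j)"
    using v by (intro eq_vecI) (simp_all add: One_nat_def)
  then have "v = entries_mat [0] degs1 entry1 *\<^sub>v ?u" unfolding entries_mat_mult[OF vec_carrier] .
  then show "v \<in> map_image (entries_mat [0] degs1 entry1)" unfolding map_image_def col by (rule image_eqI) simp
qed

lemma exact1: "map_kernel (entries_mat [0] degs1 entry1) = map_image (entries_mat degs1 degs2 entry2)"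
proof (rule kernel_eq_image[OF graded1], goal_cases)
  case (1 i u)
  have "(\<Sum>j<length degs1. entry1 i j * (\<Sum>k<length degs2. entry2 j k * u k)) = (\<Sum>j<n + 1. entry1 i j * \<phi>2 u j)"
    by (intro sum.cong) (simp_all only: length_degs1 length_degs2 lessThan_iff row2)
  then show ?case unfolding row1 \<phi>1_\<phi>2 .
next
  case (2 d v)
  have "\<phi>1 v = 0" using 2(2)[of 0] unfolding length_degs1 row1 by simp
  then have "v \<in> ker1 d" using 2(1) unfolding ker1_def by blast
  then obtain u where u: "v = \<phi>2 u" by (rule \<phi>2_onto)
  show ?case by (rule exI[of _ u], intro allI impI) (simp only: u length_degs1 length_degs2 row2)
qed

lemma exact2: "map_kernel (entries_mat degs1 degs2 entry2) = map_image (entries_mat degs2 degs3 entry3)"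
proof (rule kernel_eq_image[OF graded2], goal_cases)
  case (1 i u)
  have "(\<Sum>j<length degs2. entry2 i j * (\<Sum>k<length degs3. entry3 j k * u k)) = (\<Sum>j<n + n. entry2 i j * \<phi>3 u j)"
    by (intro sum.cong) (simp_all only: length_degs2 length_degs3 lessThan_iff row3)
  also have "\<dots> = \<phi>2 (\<phi>3 u) i" by (rule row2) (use 1 in simp)
  finally show ?case unfolding \<phi>2_\<phi>3 by simp
next
  case (2 d v)
  have "\<phi>2 v i = 0 i" for i
  proof (cases "i < n + 1")
    case True
    then show ?thesis using 2(2)[of i] row2[OF True, of v] by simp
  next
    case False
    then show ?thesis by (simp add: \<phi>2_def)
  qed
  then have "\<phi>2 v = 0" by (rule ext)
  then have "v \<in> ker2 d" using 2(1) unfolding ker2_def by blast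
  then obtain u where u: "v = \<phi>3 u" by (rule \<phi>3_onto)
  show ?case by (rule exI[of _ u], intro allI impI) (simp only: u length_degs2 length_degs3 row3)
qed

lemma exact3: "map_kernel (entries_mat degs2 degs3 entry3) = map_image (entries_mat degs3 [2 * t + 5] entry4)"
proof (rule kernel_eq_image[OF graded3], goal_cases)
  case (1 i u)
  have len: "length [2 * t + 5] = 1" by simp
  have "(\<Sum>j<length degs3. entry3 i j * (\<Sum>k<length [2 * t + 5]. entry4 j k * u k)) = (\<Sum>j<n + 1. entry3 i j * \<phi>4 (u 0) j)"
    by (intro sum.cong) (simp_all only: length_degs3 len lessThan_iff row4)
  also have "\<dots> = \<phi>3 (\<phi>4 (u 0)) i" by (rule row3) (use 1 in simp)
  finally show ?case unfolding \<phi>3_\<phi>4 by simp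
next
  case (2 d v)
  have len: "length [2 * t + 5] = 1" by simp
  have "\<phi>3 v i = 0 i" for i
  proof (cases "i < n + n")
    case True
    then show ?thesis using 2(2)[of i] row3[OF True, of v] by simp
  next
    case False
    then show ?thesis using free_pieceD(2)[OF w_piece, of i] by (simp add: \<phi>3_def \<tau>_def)
  qed
  then have "\<phi>3 v = 0" by (rule ext)
  from \<phi>3_kernel[OF 2(1) this] obtain y where y: "v = \<phi>4 y" by blast
  show ?case by (rule exI[of _ "\<lambda>_. y"], intro allI impI) (simp only: y length_degs3 len row4)
qed

lemma exact4: "map_kernel (entries_mat degs3 [2 * t + 5] entry4) = {0\<^sub>v (length [2 * t + 5])}"
proof -
  have c: "dim_col (entries_mat degs3 [2 * t + 5] entry4) = length [2 * t + 5]"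
    "dim_row (entries_mat degs3 [2 * t + 5] entry4) = length degs3" by (simp_all add: entries_mat_def)
  have len: "length [2 * t + 5] = 1" by simp
  show ?thesis unfolding map_kernel_def c
  proof (intro equalityI subsetI)
    fix v :: "(4, 'k) mpoly vec"
    assume "v \<in> {v \<in> carrier_vec (length [2 * t + 5]). entries_mat degs3 [2 * t + 5] entry4 *\<^sub>v v = 0\<^sub>v (length degs3)}"
    then have v: "v \<in> carrier_vec (length [2 * t + 5])" "entries_mat degs3 [2 * t + 5] entry4 *\<^sub>v v = 0\<^sub>v (length degs3)" by blast+
    have "(\<Sum>j<length [2 * t + 5]. entry4 n j * v $ j) = 0"
      using arg_cong[OF v(2), of "\<lambda>x. x $ n"] unfolding entries_mat_mult[OF v(1)] by simp
    then have "F * v $ 0 = 0" by (simp add: entry4_def)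
    then have "v $ 0 = 0" using F_neq_0 by simp
    then have "v = 0\<^sub>v (length [2 * t + 5])" using v(1) by (intro eq_vecI) auto
    then show "v \<in> {0\<^sub>v (length [2 * t + 5])}" by (simp only: singleton_iff)
  next
    fix v :: "(4, 'k) mpoly vec" assume "v \<in> {0\<^sub>v (length [2 * t + 5])}"
    then have v: "v = 0\<^sub>v (length [2 * t + 5])" by blast
    have "v \<in> carrier_vec (length [2 * t + 5])" unfolding v by simp
    moreover from entries_mat_mult[OF this] have "entries_mat degs3 [2 * t + 5] entry4 *\<^sub>v v = 0\<^sub>v (length degs3)"
      unfolding v by (intro eq_vecI) simp_all
    ultimately show "v \<in> {v \<in> carrier_vec (length [2 * t + 5]). entries_mat degs3 [2 * t + 5] entry4 *\<^sub>v v = 0\<^sub>v (length degs3)}" by blast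
  qed
qed

lemma explicit_resolution: "has_minimal_resolution (annihilator c) [degs1, degs2, degs3, [2 * t + 5]]"
proof -
  have m: "\<forall>v\<in>map_image (entries_mat ds es E). \<forall>i<length ds. v $ i \<in> irrelevant_ideal" if "graded_entries ds es E"
    for ds es and E :: "nat \<Rightarrow> nat \<Rightarrow> (4, 'k) mpoly"
    using entries_mat_minimal[OF that] by blast
  show ?thesis
    by (rule has_minimal_resolution_length_4[OF entries_mat_graded[OF graded1] entries_mat_graded[OF graded2]
      entries_mat_graded[OF graded3] entries_mat_graded[OF graded4] image1 exact1 exact2 exact3 exact4
      m[OF graded1] m[OF graded2] m[OF graded3] m[OF graded4]])
qed

end

lemma (in compressed_functional) minimal_resolution:
  assumes F_prime: "\<And>p q. F dvd p * q \<Longrightarrow> F dvd p \<or> F dvd q"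
  shows "has_minimal_resolution (annihilator c)
    [replicate (2 * t + 3) (t + 1) @ [2], replicate (2 * t + 3) (t + 2) @ replicate (2 * t + 3) (t + 3),
     replicate (2 * t + 3) (t + 4) @ [2 * t + 3], [2 * t + 5]]"
proof -
  obtain g where g: "\<And>i. i < 2 * t + 3 \<Longrightarrow> g i \<in> ann (t + 1)"
    "\<And>p. p \<in> ann (t + 1) \<Longrightarrow> \<exists>u. F dvd p - (\<Sum>i<2 * t + 3. cmul (u i) (g i))"
    "\<And>u i. F dvd (\<Sum>i<2 * t + 3. cmul (u i) (g i)) \<Longrightarrow> i < 2 * t + 3 \<Longrightarrow> u i = 0" by (rule exists_generators) blast
  define n where "n = 2 * t + 3"
  interpret G: generators F t c n g
  proof unfold_locales
    show "n = 2 * t + 3" by (rule n_def)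
    show "g i \<in> ann (t + 1)" if "i < n" for i using g(1) that unfolding n_def .
    show "\<exists>u. F dvd p - (\<Sum>i<n. cmul (u i) (g i))" if "p \<in> ann (t + 1)" for p using g(2)[OF that] unfolding n_def .
    show "u i = 0" if "F dvd (\<Sum>i<n. cmul (u i) (g i))" "i < n" for u i using g(3)[of u i] that unfolding n_def .
  qed
  obtain b where b: "\<And>j. j < n \<Longrightarrow> b j \<in> G.ker1 (int (t + 2))"
    "\<And>v. v \<in> G.ker1 (int (t + 2)) \<Longrightarrow> \<exists>u. v = (\<Sum>j<n. tscale (u j) (b j))"
    "\<And>u j. (\<Sum>j<n. tscale (u j) (b j)) = 0 \<Longrightarrow> j < n \<Longrightarrow> u j = 0" by (rule G.exists_linear_syzygies) blast
  interpret B: linear_syzygies F t c n g b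
  proof unfold_locales
    show "b j \<in> G.ker1 (int (t + 2))" if "j < n" for j by (rule b(1)[OF that])
    show "\<exists>u. v = (\<Sum>j<n. tscale (u j) (b j))" if "v \<in> G.ker1 (int (t + 2))" for v by (rule b(2)[OF that])
    show "u j = 0" if "(\<Sum>j<n. tscale (u j) (b j)) = 0" "j < n" for u j by (rule b(3)[OF that])
  qed
  obtain w i0 where w: "w \<in> B.ker2 (int (2 * t + 3))" "i0 < n" "\<not> F dvd w i0" by (rule B.exists_extra_syzygy)
  interpret R: resolution F t c n g b w i0
  proof unfold_locales
    show "F dvd p \<or> F dvd q" if "F dvd p * q" for p q by (rule F_prime[OF that])
  qed (rule w)+
  show ?thesis using R.explicit_resolution unfolding G.degs1_def B.degs2_def R.degs3_def unfolding n_def .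
qed

section \<open>General quadrics\<close>

text \<open>Nonvanishing means that the coefficient of the square of \<open>x\<^sub>0\<close> is invertible, which allows division with
  remainder, and that the restriction to the first three variables is a smooth conic, which makes the
  quadric prime. The discriminant is the one that is valid in characteristic two as well.\<close>

definition general_quadric_poly :: "(4 monom, 'k::field) mpoly"
  where "general_quadric_poly = (let x = (\<lambda>i j. var (Poly_Mapping.single i 1 + Poly_Mapping.single j 1)) in
    var (Poly_Mapping.single 0 2) *
    ((1 + 1 + 1 + 1) * x 0 0 * x 1 1 * x 2 2 + x 1 2 * x 0 2 * x 0 1 - x 0 0 * x 1 2 * x 1 2
      - x 1 1 * x 0 2 * x 0 2 - x 2 2 * x 0 1 * x 0 1))"

lemma eval_general_quadric_poly:
  "eval_mpoly (Poly_Mapping.lookup F) general_quadric_poly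
    = Poly_Mapping.lookup F (Poly_Mapping.single 0 2) * conic_discriminant F"
proof -
  have four: "1 + 1 + 1 + 1 = (4 :: 'a)" by simp
  show ?thesis
    unfolding general_quadric_poly_def Let_def conic_discriminant_def quad_coeff_def
      ev.hom_mult ev.hom_add ev.hom_minus ev.hom_one eval_var four ..
qed

lemma general_quadric_exists:
  obtains F :: "(4, 'k::field) mpoly" where "F \<in> forms 2" "Poly_Mapping.lookup F (Poly_Mapping.single 0 2) * conic_discriminant F \<noteq> 0"
proof -
  let ?e = "\<lambda>i::4. Poly_Mapping.single i (1::nat)"
  define F :: "(4, 'k) mpoly" where "F = Poly_Mapping.single (?e 0 + ?e 0) 1 + Poly_Mapping.single (?e 1 + ?e 2) 1"
  have two: "Poly_Mapping.single 0 2 = ?e 0 + ?e 0" by (simp add: single_add[symmetric])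
  have q: "quad_coeff F i j = (if i = 0 \<and> j = 0 then 1 else 0) + (if i = 1 \<and> j = 2 \<or> i = 2 \<and> j = 1 then 1 else 0)" for i j
    unfolding quad_coeff_def F_def lookup_add lookup_single when_def add_single_eq_iff by auto
  have ne: "(0::4) \<noteq> 1" "(0::4) \<noteq> 2" "(1::4) \<noteq> 2" "(1::4) \<noteq> 0" "(2::4) \<noteq> 0" "(2::4) \<noteq> 1" by simp_all
  have "conic_discriminant F = -1" unfolding conic_discriminant_def Let_def q by (simp add: ne)
  moreover have "Poly_Mapping.lookup F (Poly_Mapping.single 0 2) = 1"
    using q[of 0 0] unfolding two quad_coeff_def by (simp add: ne)
  moreover have "F \<in> forms 2" unfolding F_def by (intro forms_add single_in_forms) simp_all
  ultimately show ?thesis using that by simp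
qed

context quadric
begin

text \<open>Functionals up to scalars are the points of the parameter space, and the conditions on them are open
  and satisfied by an example.\<close>

lemma general_gorenstein:
  assumes inf: "infinite (UNIV :: 'k set)" and disc: "conic_discriminant F \<noteq> 0" and t: "t \<ge> 1"
  shows "general_gorenstein_quotient (ideal_of {F}) (2 * t + 1) (\<lambda>I.
      relatively_compressed (ideal_of {F}) (2 * t + 1) I \<and> embedding_dim I = 4 \<and>
      has_minimal_resolution I
        [replicate (2 * t + 3) (t + 1) @ [2], replicate (2 * t + 3) (t + 2) @ replicate (2 * t + 3) (t + 3),
         replicate (2 * t + 3) (t + 4) @ [2 * t + 3], [2 * t + 5]])"
proof -
  let ?s = "2 * t + 1"
  obtain c0 where c0: "c0 \<in> dual ?s" "act F c0 = 0" "compressed t c0" "no_second_syzygies t c0"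
    by (rule example_functional[OF inf t])
  obtain P e where P: "P \<in> forms e" "eval_mpoly c0 P \<noteq> 0"
    "\<And>c. eval_mpoly c P \<noteq> 0 \<Longrightarrow> act F c = 0 \<Longrightarrow> compressed t c \<and> no_second_syzygies t c"
    by (rule conditions_open[OF c0(3,4)]) blast
  have ideal_killed: "ideal_of {F} \<subseteq> annihilator c" if "act F c = 0" for c
    using act_dvd[OF _ that] unfolding annihilator_def in_ideal_of_iff[symmetric] by blast
  define V where "V = {H \<in> hyperplanes (ideal_of {F}) ?s. \<exists>c. hyperplane_coords ?s H c \<and> (\<exists>P\<in>{P}. eval_mpoly c P \<noteq> 0)}"
  have "zariski_open_hyperplanes (ideal_of {F}) ?s V"
    unfolding zariski_open_hyperplanes_def V_def using P(1) by (intro exI[of _ "{P}"]) blast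
  moreover have "V \<noteq> {}"
  proof -
    interpret C: compressed_functional F t c0
      by unfold_locales (rule t c0)+
    define H where "H = {p \<in> forms ?s. pair p c0 = 0}"
    have HA: "H = annihilator c0 \<inter> forms ?s" unfolding H_def using annihilator_top[OF c0(1)] by blast
    have "V.subspace H" unfolding HA by (rule V.subspace_inter[OF ideal_k_subspace[OF annihilator_ideal] subspace_forms])
    moreover have "ideal_of {F} \<inter> forms ?s \<subseteq> H" unfolding HA using ideal_killed[OF c0(2)] by blast
    moreover have "k_dim H + 1 = k_dim (forms ?s :: (4, 'k) mpoly set)"
    proof -
      have "c0 \<in> dual (?s + 0)" using c0(1) by simp
      from ann_dim_symmetric[OF this] show ?thesis
        using C.dim_ann_low[of 0] unfolding HA C.annihilator_Int_forms dim_forms by (simp add: rk_values rk_neg)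
    qed
    moreover have "H \<subseteq> forms ?s" unfolding H_def by blast
    ultimately have "H \<in> hyperplanes (ideal_of {F}) ?s" unfolding hyperplanes_def by blast
    moreover have "hyperplane_coords ?s H c0"
      using c0(1) unfolding hyperplane_coords_def H_def pair_def dual_def by blast
    ultimately have "H \<in> V" unfolding V_def using P(2) by blast
    then show ?thesis by blast
  qed
  moreover have "relatively_compressed (ideal_of {F}) ?s (hyperplane_ideal (ideal_of {F}) ?s H) \<and>
      embedding_dim (hyperplane_ideal (ideal_of {F}) ?s H) = 4 \<and>
      has_minimal_resolution (hyperplane_ideal (ideal_of {F}) ?s H)
        [replicate (2 * t + 3) (t + 1) @ [2], replicate (2 * t + 3) (t + 2) @ replicate (2 * t + 3) (t + 3),
         replicate (2 * t + 3) (t + 4) @ [2 * t + 3], [2 * t + 5]]" if "H \<in> V" for H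
  proof -
    obtain c where H: "H \<in> hyperplanes (ideal_of {F}) ?s" and co: "hyperplane_coords ?s H c" and ev: "eval_mpoly c P \<noteq> 0"
      using \<open>H \<in> V\<close> unfolding V_def by blast
    have c: "c \<in> dual ?s" and Heq: "H = {p \<in> forms ?s. pair p c = 0}"
      using co unfolding hyperplane_coords_def dual_def pair_def by blast+
    have s2: "?s = 2 + (2 * t - 1)" "(2 * t - 1) + 2 = ?s" using t by simp_all
    have "c \<in> dual (2 + (2 * t - 1))" using c unfolding s2(1) .
    moreover have "pair (q * F) c = 0" if q: "q \<in> forms (2 * t - 1)" for q
    proof -
      have "q * F \<in> forms ?s" using forms_mult[OF q F2] unfolding s2(2) .
      moreover have "q * F \<in> ideal_of {F}" unfolding in_ideal_of_iff by simp
      ultimately have "q * F \<in> H" using H unfolding hyperplanes_def by blast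
      then show ?thesis unfolding Heq by blast
    qed
    ultimately have Fc: "act F c = 0" using act_eq_0_iff_pair[OF F2] by blast
    interpret C: compressed_functional F t c
      by unfold_locales (rule t c Fc conjunct1[OF P(3)[OF ev Fc]] conjunct2[OF P(3)[OF ev Fc]])+
    have "hyperplane_ideal (ideal_of {F}) ?s H = annihilator c" by (rule hyperplane_ideal_eq[OF c Heq ideal_killed[OF Fc]])
    then show ?thesis
      using C.annihilator_relatively_compressed C.annihilator_embedding_dim C.minimal_resolution[OF prime[OF inf disc]] by simp
  qed
  ultimately show ?thesis unfolding general_gorenstein_quotient_def by (intro exI[of _ V]) blast
qed

end

theorem proposition3p14:
  fixes t :: nat
  assumes "infinite (UNIV :: 'k::field set)"
    and "t \<ge> 2"
  shows "general_form 2 (\<lambda>F :: (4, 'k) mpoly.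
    general_gorenstein_quotient (ideal_of {F}) (2 * t + 1) (\<lambda>I.
      relatively_compressed (ideal_of {F}) (2 * t + 1) I \<and>
      embedding_dim I = 4 \<and>
      has_minimal_resolution I
        [replicate (2 * t + 3) (t + 1) @ [2],
         replicate (2 * t + 3) (t + 2) @ replicate (2 * t + 3) (t + 3),
         replicate (2 * t + 3) (t + 4) @ [2 * t + 3],
         [2 * t + 5]]))"
  unfolding general_form_def
proof (intro exI conjI ballI)
  let ?U = "{F :: (4, 'k) mpoly. F \<in> forms 2 \<and> (\<exists>P\<in>{general_quadric_poly}. eval_mpoly (Poly_Mapping.lookup F) P \<noteq> 0)}"
  show "zariski_open_forms 2 ?U" unfolding zariski_open_forms_def by (rule exI[of _ "{general_quadric_poly}"]) (rule refl)
  obtain F :: "(4, 'k) mpoly" where "F \<in> forms 2" "Poly_Mapping.lookup F (Poly_Mapping.single 0 2) * conic_discriminant F \<noteq> 0"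
    by (rule general_quadric_exists)
  then have "F \<in> ?U" unfolding eval_general_quadric_poly[symmetric] by blast
  then show "?U \<noteq> {}" by blast
  fix F assume "F \<in> ?U"
  then have F: "F \<in> forms 2" "Poly_Mapping.lookup F (Poly_Mapping.single 0 2) * conic_discriminant F \<noteq> 0"
    unfolding eval_general_quadric_poly[symmetric] by blast+
  interpret quadric F by unfold_locales (use F in auto)
  show "general_gorenstein_quotient (ideal_of {F}) (2 * t + 1) (\<lambda>I.
      relatively_compressed (ideal_of {F}) (2 * t + 1) I \<and> embedding_dim I = 4 \<and>
      has_minimal_resolution I
        [replicate (2 * t + 3) (t + 1) @ [2], replicate (2 * t + 3) (t + 2) @ replicate (2 * t + 3) (t + 3),
         replicate (2 * t + 3) (t + 4) @ [2 * t + 3], [2 * t + 5]])"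
    by (rule general_gorenstein[OF assms(1)]) (use F assms(2) in auto)
qed

end
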